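(* Let $(H,\beta)$ be a Hom-Hopf algebra such that $\beta$ and the antipode $S$ are bijective. Then $({}^{H}_{H}\mathfrak{M}^{H}_{H},\otimes_H)$ is a braided monoidal category with a braiding $\widetilde\sigma:M\otimes_HN\to N\otimes_HM$, $$\widetilde\sigma(m\otimes n)=[\beta^{-4}(m_{[-1]1})\cdot\zeta_N^{-3}(n_{(0)})]\cdot S\beta^{-3}(n_{(1)1})\otimes S\beta^{-3}(m_{[-1]2})\cdot[\zeta_M^{-3}(m_{[0]})\cdot\beta^{-4}(n_{(1)2})],$$ and the inverse $$\widetilde\sigma^{-1}(n\otimes m)=[\beta^{-4}(n_{(1)2})\cdot\zeta_M^{-3}(m_{[0]})]\cdot S^{-1}\beta^{-3}(m_{[-1]2})\otimes S^{-1}\beta^{-3}(n_{(1)1})\cdot[\zeta_N^{-3}(n_{(0)})\cdot\beta^{-4}(m_{[-1]1})],$$ for any $m\in M$ and $n\in N$, where $(M,\zeta_M),(N,\zeta_N)$ are four-angle Hopf modules, $m_{[-1]1}\otimes m_{[-1]2}=\Delta(m_{[-1]})$ and $n_{(1)1}\otimes n_{(1)2}=\Delta(n_{(1)})$.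
   Context: All spaces are over a field $\Bbbk$, $\otimes=\otimes_{\Bbbk}$. A Hom-Hopf algebra $(H,\beta)$ is a linear space $H$ with linear maps $\beta:H\to H$, a multiplication, a unit $1_H$, $\Delta(h)=h_1\otimes h_2$, $\varepsilon$, $S:H\to H$ (the antipode) such that: $\beta(ab)=\beta(a)\beta(b)$, $\beta(a)(bc)=(ab)\beta(c)$, $\beta(1_H)=1_H$, $1_Ha=a1_H=\beta(a)$; $\Delta(\beta(h))=\beta(h_1)\otimes\beta(h_2)$, $\beta(h_1)\otimes\Delta(h_2)=\Delta(h_1)\otimes\beta(h_2)$, $\varepsilon\circ\beta=\varepsilon$, $\varepsilon(h_1)h_2=\beta(h)=h_1\varepsilon(h_2)$; $\Delta(hg)=h_1g_1\otimes h_2g_2$, $\Delta(1_H)=1_H\otimes1_H$, $\varepsilon(hg)=\varepsilon(h)\varepsilon(g)$, $\varepsilon(1_H)=1$; $S(h_1)h_2=\varepsilon(h)1_H=h_1S(h_2)$, $S\beta=\beta S$. A left $H$-module is $(M,\zeta_M)$ with $\zeta_M:M\to M$ linear and an action with $\beta(a)\cdot(b\cdot m)=(ab)\cdot\zeta_M(m)$, $\zeta_M(a\cdot m)=\beta(a)\cdot\zeta_M(m)$, $1_H\cdot m=\zeta_M(m)$. A right $H$-module satisfies $(m\cdot a)\cdot\beta(b)=\zeta_M(m)\cdot(ab)$, $\zeta_M(m\cdot a)=\zeta_M(m)\cdot\beta(a)$, $m\cdot1_H=\zeta_M(m)$. An $H$-bimodule is both, with $\beta(a)\cdot(m\cdot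 b)=(a\cdot m)\cdot\beta(b)$. A left $H$-comodule has $\rho^l(m)=m_{[-1]}\otimes m_{[0]}\in H\otimes M$ with $\rho^l(\zeta_M(m))=\beta(m_{[-1]})\otimes\zeta_M(m_{[0]})$, $\varepsilon(m_{[-1]})m_{[0]}=\zeta_M(m)$, $\beta(m_{[-1]})\otimes\rho^l(m_{[0]})=\Delta(m_{[-1]})\otimes\zeta_M(m_{[0]})$. A right $H$-comodule has $\rho^r(m)=m_{(0)}\otimes m_{(1)}\in M\otimes H$ with $\rho^r(\zeta_M(m))=\zeta_M(m_{(0)})\otimes\beta(m_{(1)})$, $m_{(0)}\varepsilon(m_{(1)})=\zeta_M(m)$, $\rho^r(m_{(0)})\otimes\beta(m_{(1)})=\zeta_M(m_{(0)})\otimes\Delta(m_{(1)})$. An $H$-bicomodule is both, with $\beta(m_{[-1]})\otimes m_{[0](0)}\otimes m_{[0](1)}=m_{(0)[-1]}\otimes m_{(0)[0]}\otimes\beta(m_{(1)})$. A four-angle Hopf module is a pair $(M,\zeta_M)$ with $\zeta_M$ bijective which is an $H$-bimodule and an $H$-bicomodule such that $\rho^l(h\cdot m)=h_1m_{[-1]}\otimes h_2\cdot m_{[0]}$, $\rho^r(h\cdot m)=h_1\cdot m_{(0)}\otimes h_2m_{(1)}$, $\rho^l(m\cdot h)=m_{[-1]}h_1\otimes m_{[0]}\cdot h_2$, $\rho^r(m\cdot h)=m_{(0)}\cdot h_1\otimes m_{(1)}h_2$. Morphisms in ${}^{H}_{H}\mathfrak{M}^{H}_{H}$ are linear maps commuting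 with the structure maps $\zeta$ and with all actions and coactions. Monoidal structure: $M\otimes_HN:=\{m\otimes n\in M\otimes N\mid m\cdot h\otimes\zeta_N(n)=\zeta_M(m)\otimes h\cdot n,\ \forall h\in H\}$, with structure map $\zeta_M\otimes\zeta_N$ and $h\cdot(m\otimes n)=h\cdot m\otimes\zeta_N(n)$, $(m\otimes n)\cdot h=\zeta_M(m)\otimes n\cdot h$, $\rho^l(m\otimes n)=\beta^{-1}(m_{[-1]})\beta^{-1}(n_{[-1]})\otimes m_{[0]}\otimes n_{[0]}$, $\rho^r(m\otimes n)=m_{(0)}\otimes n_{(0)}\otimes\beta^{-1}(m_{(1)})\beta^{-1}(n_{(1)})$; unit object $(H,\beta)$ with its multiplication and comultiplication; associativity $(m\otimes n)\otimes p\mapsto m\otimes(n\otimes p)$; unit constraints $M\otimes_HH\to M$, $m\otimes g\mapsto m\varepsilon(g)$, and $H\otimes_HM\to M$, $g\otimes m\mapsto\varepsilon(g)m$. A braiding is a family of natural isomorphisms satisfying the two hexagon axioms.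
   Formalization: M⊗_H N is taken as the quotient of M⊗N by m·h⊗ζ(n)=ζ(m)⊗h·n, not the displayed subspace (zero for H=k[Z], M=N=H), and the unit constraints are m⊗g↦ζ^{-1}(m·g), g⊗m↦ζ^{-1}(g·m), since mε(g), ε(g)m are not well defined on the quotient. *)

theory Defs
  imports "HOL-Algebra.Module" "HOL-Library.FuncSet"
begin

section \<open>Vector spaces and tensor products\<close>

text \<open>
  A vector space over the field \<open>K\<close> is a \<open>module K V\<close> in the sense of HOL-Algebra.  A category of
  vector spaces that is closed under tensor products needs a type of elements containing the formal
  sums of pairs of its own elements.  The type \<open>'b elt\<close> is generated by an arbitrary type \<open>'b\<close> in
  this way; a vector space with carrier in \<open>'b\<close> is transported to \<open>'b elt\<close> along \<^term>\<open>Elt\<close>.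
\<close>

datatype 'b elt = Elt 'b | Formal_Sum "('b elt \<times> 'b elt) list"

primrec summands :: "'b elt \<Rightarrow> ('b elt \<times> 'b elt) list" where
  "summands (Elt b) = []"
| "summands (Formal_Sum xs) = xs"

definition lin_maps ::
  "('k, 'c) ring_scheme \<Rightarrow> ('k, 'v, 'd) module_scheme \<Rightarrow> ('k, 'w, 'e) module_scheme \<Rightarrow> ('v \<Rightarrow> 'w) set"
where
  "lin_maps K V W = {f \<in> carrier V \<rightarrow> carrier W.
     (\<forall>x\<in>carrier V. \<forall>y\<in>carrier V. f (x \<oplus>\<^bsub>V\<^esub> y) = f x \<oplus>\<^bsub>W\<^esub> f y) \<and>
     (\<forall>c\<in>carrier K. \<forall>x\<in>carrier V. f (c \<odot>\<^bsub>V\<^esub> x) = c \<odot>\<^bsub>W\<^esub> f x)}"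

definition bilinear ::
  "('k, 'c) ring_scheme \<Rightarrow> ('k, 'u, 'd) module_scheme \<Rightarrow> ('k, 'v, 'e) module_scheme \<Rightarrow>
   ('k, 'w, 'f) module_scheme \<Rightarrow> ('u \<Rightarrow> 'v \<Rightarrow> 'w) \<Rightarrow> bool"
where
  "bilinear K U V W f \<longleftrightarrow>
     (\<forall>x\<in>carrier U. f x \<in> lin_maps K V W) \<and> (\<forall>y\<in>carrier V. (\<lambda>x. f x y) \<in> lin_maps K U W)"

text \<open>
  The congruence on formal sums of pairs from \<open>U \<times> V\<close> generated by bilinearity over \<open>K\<close> and by the
  identification of the two components of each element of \<open>E\<close>.
\<close>

inductive tensor_cong ::
  "('k, 'c) ring_scheme \<Rightarrow> ('k, 'v, 'd) module_scheme \<Rightarrow> ('k, 'v, 'e) module_scheme \<Rightarrow>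
   (('v \<times> 'v) \<times> ('v \<times> 'v)) set \<Rightarrow> ('v \<times> 'v) list \<Rightarrow> ('v \<times> 'v) list \<Rightarrow> bool"
  for K U V E
where
  refl: "set xs \<subseteq> carrier U \<times> carrier V \<Longrightarrow> tensor_cong K U V E xs xs"
| sym: "tensor_cong K U V E xs ys \<Longrightarrow> tensor_cong K U V E ys xs"
| trans: "tensor_cong K U V E xs ys \<Longrightarrow> tensor_cong K U V E ys zs \<Longrightarrow> tensor_cong K U V E xs zs"
| append: "tensor_cong K U V E xs xs' \<Longrightarrow> tensor_cong K U V E ys ys' \<Longrightarrow>
    tensor_cong K U V E (xs @ ys) (xs' @ ys')"
| commute: "set xs \<subseteq> carrier U \<times> carrier V \<Longrightarrow> set ys \<subseteq> carrier U \<times> carrier V \<Longrightarrow>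
    tensor_cong K U V E (xs @ ys) (ys @ xs)"
| zero: "v \<in> carrier V \<Longrightarrow> tensor_cong K U V E [(\<zero>\<^bsub>U\<^esub>, v)] []"
| add_left: "u \<in> carrier U \<Longrightarrow> u' \<in> carrier U \<Longrightarrow> v \<in> carrier V \<Longrightarrow>
    tensor_cong K U V E [(u \<oplus>\<^bsub>U\<^esub> u', v)] [(u, v), (u', v)]"
| add_right: "u \<in> carrier U \<Longrightarrow> v \<in> carrier V \<Longrightarrow> v' \<in> carrier V \<Longrightarrow>
    tensor_cong K U V E [(u, v \<oplus>\<^bsub>V\<^esub> v')] [(u, v), (u, v')]"
| scalar: "c \<in> carrier K \<Longrightarrow> u \<in> carrier U \<Longrightarrow> v \<in> carrier V \<Longrightarrow>
    tensor_cong K U V E [(c \<odot>\<^bsub>U\<^esub> u, v)] [(u, c \<odot>\<^bsub>V\<^esub> v)]"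
| identify: "(p, q) \<in> E \<Longrightarrow> p \<in> carrier U \<times> carrier V \<Longrightarrow> q \<in> carrier U \<times> carrier V \<Longrightarrow>
    tensor_cong K U V E [p] [q]"

text \<open>A congruence class is represented by a chosen formal sum in it.\<close>

definition tensor_class ::
  "('k, 'c) ring_scheme \<Rightarrow> ('k, 'b elt, 'd) module_scheme \<Rightarrow> ('k, 'b elt, 'e) module_scheme \<Rightarrow>
   (('b elt \<times> 'b elt) \<times> ('b elt \<times> 'b elt)) set \<Rightarrow> ('b elt \<times> 'b elt) list \<Rightarrow> 'b elt"
where
  "tensor_class K U V E xs = Formal_Sum (SOME ys. tensor_cong K U V E xs ys)"

record ('k, 'v) tensor_space = "('k, 'v) module" +
  pure_tensor :: "'v \<Rightarrow> 'v \<Rightarrow> 'v" (infixl \<open>\<boxtimes>\<index>\<close> 70)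

text \<open>
  The quotient of \<open>U \<otimes> V\<close> by the identifications \<open>E\<close>, with \<open>\<boxtimes>\<close> giving the image of a pure tensor.
  (HOL-Algebra modules extend ring records; \<open>mult\<close> and \<open>one\<close> play no role.)
\<close>

definition tensor_quotient ::
  "('k, 'c) ring_scheme \<Rightarrow> ('k, 'b elt, 'd) module_scheme \<Rightarrow> ('k, 'b elt, 'e) module_scheme \<Rightarrow>
   (('b elt \<times> 'b elt) \<times> ('b elt \<times> 'b elt)) set \<Rightarrow> ('k, 'b elt) tensor_space"
where
  "tensor_quotient K U V E =
     \<lparr>carrier = {tensor_class K U V E xs | xs. set xs \<subseteq> carrier U \<times> carrier V},
      mult = undefined,
      one = undefined,
      zero = tensor_class K U V E [],
      add = (\<lambda>s t. tensor_class K U V E (summands s @ summands t)),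
      smult = (\<lambda>c t. tensor_class K U V E (map (\<lambda>(u, v). (c \<odot>\<^bsub>U\<^esub> u, v)) (summands t))),
      pure_tensor = (\<lambda>u v. tensor_class K U V E [(u, v)])\<rparr>"

definition tensor ::
  "('k, 'c) ring_scheme \<Rightarrow> ('k, 'b elt, 'd) module_scheme \<Rightarrow> ('k, 'b elt, 'e) module_scheme \<Rightarrow>
   ('k, 'b elt) tensor_space"
where
  "tensor K U V = tensor_quotient K U V {}"

text \<open>
  Sweedler's convention: \<open>sweedler W t (\<lambda>x y. \<phi> x y)\<close> is the element \<open>\<phi>(t\<^sub>1, t\<^sub>2)\<close> of \<open>W\<close> for
  \<open>t = t\<^sub>1 \<otimes> t\<^sub>2\<close>.  It is evaluated on the chosen representative of \<open>t\<close> and hence meaningful when \<open>\<phi>\<close> is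
  bilinear and respects the identifications defining the tensor space in which \<open>t\<close> lives.
\<close>

definition sweedler :: "('w, 'd) ring_scheme \<Rightarrow> 'b elt \<Rightarrow> ('b elt \<Rightarrow> 'b elt \<Rightarrow> 'w) \<Rightarrow> 'w" where
  "sweedler W t \<phi> = foldr (\<lambda>(x, y) s. \<phi> x y \<oplus>\<^bsub>W\<^esub> s) (summands t) \<zero>\<^bsub>W\<^esub>"


section \<open>Hom-Hopf algebras\<close>

text \<open>Multiplication and unit are the fields \<open>mult\<close> and \<open>one\<close> of the module record.\<close>

record ('k, 'v) hom_hopf = "('k, 'v) module" +
  twist :: "'v \<Rightarrow> 'v"  (\<open>\<beta>\<index>\<close>)
  comult :: "'v \<Rightarrow> 'v"  (\<open>\<Delta>\<index>\<close>)
  counit :: "'v \<Rightarrow> 'k"  (\<open>\<epsilon>\<index>\<close>)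
  antipode :: "'v \<Rightarrow> 'v"  (\<open>\<S>\<index>\<close>)

locale hom_hopf_algebra = K: field K + H: module K H
  for K :: "('k, 'c) ring_scheme" and H :: "('k, 'b elt) hom_hopf" +
  assumes twist_linear: "\<beta>\<^bsub>H\<^esub> \<in> lin_maps K H H"
    and mult_bilinear: "bilinear K H H H (\<lambda>a b. a \<otimes>\<^bsub>H\<^esub> b)"
    and one_closed: "\<one>\<^bsub>H\<^esub> \<in> carrier H"
    and comult_linear: "\<Delta>\<^bsub>H\<^esub> \<in> lin_maps K H (tensor K H H)"
    and counit_closed: "\<epsilon>\<^bsub>H\<^esub> \<in> carrier H \<rightarrow> carrier K"
    and counit_add: "\<lbrakk>a \<in> carrier H; b \<in> carrier H\<rbrakk> \<Longrightarrow> \<epsilon>\<^bsub>H\<^esub> (a \<oplus>\<^bsub>H\<^esub> b) = \<epsilon>\<^bsub>H\<^esub> a \<oplus>\<^bsub>K\<^esub> \<epsilon>\<^bsub>H\<^esub> b"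
    and counit_smult: "\<lbrakk>x \<in> carrier K; a \<in> carrier H\<rbrakk> \<Longrightarrow> \<epsilon>\<^bsub>H\<^esub> (x \<odot>\<^bsub>H\<^esub> a) = x \<otimes>\<^bsub>K\<^esub> \<epsilon>\<^bsub>H\<^esub> a"
    and antipode_linear: "\<S>\<^bsub>H\<^esub> \<in> lin_maps K H H"
    and twist_mult: "\<lbrakk>a \<in> carrier H; b \<in> carrier H\<rbrakk> \<Longrightarrow> \<beta>\<^bsub>H\<^esub> (a \<otimes>\<^bsub>H\<^esub> b) = \<beta>\<^bsub>H\<^esub> a \<otimes>\<^bsub>H\<^esub> \<beta>\<^bsub>H\<^esub> b"
    and hom_assoc: "\<lbrakk>a \<in> carrier H; b \<in> carrier H; c \<in> carrier H\<rbrakk> \<Longrightarrow>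
      \<beta>\<^bsub>H\<^esub> a \<otimes>\<^bsub>H\<^esub> (b \<otimes>\<^bsub>H\<^esub> c) = (a \<otimes>\<^bsub>H\<^esub> b) \<otimes>\<^bsub>H\<^esub> \<beta>\<^bsub>H\<^esub> c"
    and twist_one: "\<beta>\<^bsub>H\<^esub> \<one>\<^bsub>H\<^esub> = \<one>\<^bsub>H\<^esub>"
    and one_mult: "a \<in> carrier H \<Longrightarrow> \<one>\<^bsub>H\<^esub> \<otimes>\<^bsub>H\<^esub> a = \<beta>\<^bsub>H\<^esub> a"
    and mult_one: "a \<in> carrier H \<Longrightarrow> a \<otimes>\<^bsub>H\<^esub> \<one>\<^bsub>H\<^esub> = \<beta>\<^bsub>H\<^esub> a"
    and comult_twist: "h \<in> carrier H \<Longrightarrow> \<Delta>\<^bsub>H\<^esub> (\<beta>\<^bsub>H\<^esub> h) =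
      sweedler (tensor K H H) (\<Delta>\<^bsub>H\<^esub> h) (\<lambda>h1 h2. \<beta>\<^bsub>H\<^esub> h1 \<boxtimes>\<^bsub>tensor K H H\<^esub> \<beta>\<^bsub>H\<^esub> h2)"
    and hom_coassoc: "h \<in> carrier H \<Longrightarrow>
      sweedler (tensor K H (tensor K H H)) (\<Delta>\<^bsub>H\<^esub> h)
        (\<lambda>h1 h2. \<beta>\<^bsub>H\<^esub> h1 \<boxtimes>\<^bsub>tensor K H (tensor K H H)\<^esub> \<Delta>\<^bsub>H\<^esub> h2) =
      sweedler (tensor K H (tensor K H H)) (\<Delta>\<^bsub>H\<^esub> h) (\<lambda>h1 h2.
        sweedler (tensor K H (tensor K H H)) (\<Delta>\<^bsub>H\<^esub> h1) (\<lambda>h11 h12.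
          h11 \<boxtimes>\<^bsub>tensor K H (tensor K H H)\<^esub> (h12 \<boxtimes>\<^bsub>tensor K H H\<^esub> \<beta>\<^bsub>H\<^esub> h2)))"
    and counit_twist: "h \<in> carrier H \<Longrightarrow> \<epsilon>\<^bsub>H\<^esub> (\<beta>\<^bsub>H\<^esub> h) = \<epsilon>\<^bsub>H\<^esub> h"
    and counit_left: "h \<in> carrier H \<Longrightarrow> sweedler H (\<Delta>\<^bsub>H\<^esub> h) (\<lambda>h1 h2. \<epsilon>\<^bsub>H\<^esub> h1 \<odot>\<^bsub>H\<^esub> h2) = \<beta>\<^bsub>H\<^esub> h"
    and counit_right: "h \<in> carrier H \<Longrightarrow> sweedler H (\<Delta>\<^bsub>H\<^esub> h) (\<lambda>h1 h2. \<epsilon>\<^bsub>H\<^esub> h2 \<odot>\<^bsub>H\<^esub> h1) = \<beta>\<^bsub>H\<^esub> h"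
    and comult_mult: "\<lbrakk>h \<in> carrier H; g \<in> carrier H\<rbrakk> \<Longrightarrow> \<Delta>\<^bsub>H\<^esub> (h \<otimes>\<^bsub>H\<^esub> g) =
      sweedler (tensor K H H) (\<Delta>\<^bsub>H\<^esub> h) (\<lambda>h1 h2. sweedler (tensor K H H) (\<Delta>\<^bsub>H\<^esub> g) (\<lambda>g1 g2.
        (h1 \<otimes>\<^bsub>H\<^esub> g1) \<boxtimes>\<^bsub>tensor K H H\<^esub> (h2 \<otimes>\<^bsub>H\<^esub> g2)))"
    and comult_one: "\<Delta>\<^bsub>H\<^esub> \<one>\<^bsub>H\<^esub> = \<one>\<^bsub>H\<^esub> \<boxtimes>\<^bsub>tensor K H H\<^esub> \<one>\<^bsub>H\<^esub>"
    and counit_mult: "\<lbrakk>h \<in> carrier H; g \<in> carrier H\<rbrakk> \<Longrightarrow> \<epsilon>\<^bsub>H\<^esub> (h \<otimes>\<^bsub>H\<^esub> g) = \<epsilon>\<^bsub>H\<^esub> h \<otimes>\<^bsub>K\<^esub> \<epsilon>\<^bsub>H\<^esub> g"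
    and counit_one: "\<epsilon>\<^bsub>H\<^esub> \<one>\<^bsub>H\<^esub> = \<one>\<^bsub>K\<^esub>"
    and antipode_left: "h \<in> carrier H \<Longrightarrow>
      sweedler H (\<Delta>\<^bsub>H\<^esub> h) (\<lambda>h1 h2. \<S>\<^bsub>H\<^esub> h1 \<otimes>\<^bsub>H\<^esub> h2) = \<epsilon>\<^bsub>H\<^esub> h \<odot>\<^bsub>H\<^esub> \<one>\<^bsub>H\<^esub>"
    and antipode_right: "h \<in> carrier H \<Longrightarrow>
      sweedler H (\<Delta>\<^bsub>H\<^esub> h) (\<lambda>h1 h2. h1 \<otimes>\<^bsub>H\<^esub> \<S>\<^bsub>H\<^esub> h2) = \<epsilon>\<^bsub>H\<^esub> h \<odot>\<^bsub>H\<^esub> \<one>\<^bsub>H\<^esub>"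
    and antipode_twist: "h \<in> carrier H \<Longrightarrow> \<S>\<^bsub>H\<^esub> (\<beta>\<^bsub>H\<^esub> h) = \<beta>\<^bsub>H\<^esub> (\<S>\<^bsub>H\<^esub> h)"


section \<open>Modules, comodules and four-angle Hopf modules\<close>

record ('k, 'v) four_angle = "('k, 'v) module" +
  zeta :: "'v \<Rightarrow> 'v"  (\<open>\<zeta>\<index>\<close>)
  lact :: "'v \<Rightarrow> 'v \<Rightarrow> 'v"  (infixr \<open>\<triangleright>\<index>\<close> 70)
  ract :: "'v \<Rightarrow> 'v \<Rightarrow> 'v"  (infixl \<open>\<triangleleft>\<index>\<close> 70)
  lcoact :: "'v \<Rightarrow> 'v"  (\<open>\<rho>\<^sup>l\<index>\<close>)
  rcoact :: "'v \<Rightarrow> 'v"  (\<open>\<rho>\<^sup>r\<index>\<close>)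

locale hom_space = module K M
  for K :: "('k, 'c) ring_scheme" and M :: "('k, 'b elt) four_angle" +
  assumes zeta_linear: "\<zeta>\<^bsub>M\<^esub> \<in> lin_maps K M M"

locale left_hom_module = hom_space K M
  for K :: "('k, 'c) ring_scheme" and H :: "('k, 'b elt) hom_hopf" and M :: "('k, 'b elt) four_angle" +
  assumes lact_bilinear: "bilinear K H M M (\<lambda>h m. h \<triangleright>\<^bsub>M\<^esub> m)"
    and lact_assoc: "\<lbrakk>a \<in> carrier H; b \<in> carrier H; m \<in> carrier M\<rbrakk> \<Longrightarrow>
      \<beta>\<^bsub>H\<^esub> a \<triangleright>\<^bsub>M\<^esub> (b \<triangleright>\<^bsub>M\<^esub> m) = (a \<otimes>\<^bsub>H\<^esub> b) \<triangleright>\<^bsub>M\<^esub> \<zeta>\<^bsub>M\<^esub> m"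
    and zeta_lact: "\<lbrakk>a \<in> carrier H; m \<in> carrier M\<rbrakk> \<Longrightarrow> \<zeta>\<^bsub>M\<^esub> (a \<triangleright>\<^bsub>M\<^esub> m) = \<beta>\<^bsub>H\<^esub> a \<triangleright>\<^bsub>M\<^esub> \<zeta>\<^bsub>M\<^esub> m"
    and one_lact: "m \<in> carrier M \<Longrightarrow> \<one>\<^bsub>H\<^esub> \<triangleright>\<^bsub>M\<^esub> m = \<zeta>\<^bsub>M\<^esub> m"

locale right_hom_module = hom_space K M
  for K :: "('k, 'c) ring_scheme" and H :: "('k, 'b elt) hom_hopf" and M :: "('k, 'b elt) four_angle" +
  assumes ract_bilinear: "bilinear K M H M (\<lambda>m h. m \<triangleleft>\<^bsub>M\<^esub> h)"
    and ract_assoc: "\<lbrakk>m \<in> carrier M; a \<in> carrier H; b \<in> carrier H\<rbrakk> \<Longrightarrow>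
      (m \<triangleleft>\<^bsub>M\<^esub> a) \<triangleleft>\<^bsub>M\<^esub> \<beta>\<^bsub>H\<^esub> b = \<zeta>\<^bsub>M\<^esub> m \<triangleleft>\<^bsub>M\<^esub> (a \<otimes>\<^bsub>H\<^esub> b)"
    and zeta_ract: "\<lbrakk>m \<in> carrier M; a \<in> carrier H\<rbrakk> \<Longrightarrow> \<zeta>\<^bsub>M\<^esub> (m \<triangleleft>\<^bsub>M\<^esub> a) = \<zeta>\<^bsub>M\<^esub> m \<triangleleft>\<^bsub>M\<^esub> \<beta>\<^bsub>H\<^esub> a"
    and ract_one: "m \<in> carrier M \<Longrightarrow> m \<triangleleft>\<^bsub>M\<^esub> \<one>\<^bsub>H\<^esub> = \<zeta>\<^bsub>M\<^esub> m"

locale hom_bimodule = left_hom_module K H M + right_hom_module K H M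
  for K :: "('k, 'c) ring_scheme" and H :: "('k, 'b elt) hom_hopf" and M :: "('k, 'b elt) four_angle" +
  assumes lact_ract: "\<lbrakk>a \<in> carrier H; m \<in> carrier M; b \<in> carrier H\<rbrakk> \<Longrightarrow>
      \<beta>\<^bsub>H\<^esub> a \<triangleright>\<^bsub>M\<^esub> (m \<triangleleft>\<^bsub>M\<^esub> b) = (a \<triangleright>\<^bsub>M\<^esub> m) \<triangleleft>\<^bsub>M\<^esub> \<beta>\<^bsub>H\<^esub> b"

locale left_hom_comodule = hom_space K M
  for K :: "('k, 'c) ring_scheme" and H :: "('k, 'b elt) hom_hopf" and M :: "('k, 'b elt) four_angle" +
  assumes lcoact_linear: "\<rho>\<^sup>l\<^bsub>M\<^esub> \<in> lin_maps K M (tensor K H M)"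
    and lcoact_zeta: "m \<in> carrier M \<Longrightarrow> \<rho>\<^sup>l\<^bsub>M\<^esub> (\<zeta>\<^bsub>M\<^esub> m) =
      sweedler (tensor K H M) (\<rho>\<^sup>l\<^bsub>M\<^esub> m) (\<lambda>a m0. \<beta>\<^bsub>H\<^esub> a \<boxtimes>\<^bsub>tensor K H M\<^esub> \<zeta>\<^bsub>M\<^esub> m0)"
    and lcoact_counit: "m \<in> carrier M \<Longrightarrow> sweedler M (\<rho>\<^sup>l\<^bsub>M\<^esub> m) (\<lambda>a m0. \<epsilon>\<^bsub>H\<^esub> a \<odot>\<^bsub>M\<^esub> m0) = \<zeta>\<^bsub>M\<^esub> m"
    and lcoact_coassoc: "m \<in> carrier M \<Longrightarrow>
      sweedler (tensor K H (tensor K H M)) (\<rho>\<^sup>l\<^bsub>M\<^esub> m)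
        (\<lambda>a m0. \<beta>\<^bsub>H\<^esub> a \<boxtimes>\<^bsub>tensor K H (tensor K H M)\<^esub> \<rho>\<^sup>l\<^bsub>M\<^esub> m0) =
      sweedler (tensor K H (tensor K H M)) (\<rho>\<^sup>l\<^bsub>M\<^esub> m) (\<lambda>a m0.
        sweedler (tensor K H (tensor K H M)) (\<Delta>\<^bsub>H\<^esub> a) (\<lambda>a1 a2.
          a1 \<boxtimes>\<^bsub>tensor K H (tensor K H M)\<^esub> (a2 \<boxtimes>\<^bsub>tensor K H M\<^esub> \<zeta>\<^bsub>M\<^esub> m0)))"

locale right_hom_comodule = hom_space K M
  for K :: "('k, 'c) ring_scheme" and H :: "('k, 'b elt) hom_hopf" and M :: "('k, 'b elt) four_angle" +
  assumes rcoact_linear: "\<rho>\<^sup>r\<^bsub>M\<^esub> \<in> lin_maps K M (tensor K M H)"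
    and rcoact_zeta: "m \<in> carrier M \<Longrightarrow> \<rho>\<^sup>r\<^bsub>M\<^esub> (\<zeta>\<^bsub>M\<^esub> m) =
      sweedler (tensor K M H) (\<rho>\<^sup>r\<^bsub>M\<^esub> m) (\<lambda>m0 a. \<zeta>\<^bsub>M\<^esub> m0 \<boxtimes>\<^bsub>tensor K M H\<^esub> \<beta>\<^bsub>H\<^esub> a)"
    and rcoact_counit: "m \<in> carrier M \<Longrightarrow> sweedler M (\<rho>\<^sup>r\<^bsub>M\<^esub> m) (\<lambda>m0 a. \<epsilon>\<^bsub>H\<^esub> a \<odot>\<^bsub>M\<^esub> m0) = \<zeta>\<^bsub>M\<^esub> m"
    and rcoact_coassoc: "m \<in> carrier M \<Longrightarrow>
      sweedler (tensor K (tensor K M H) H) (\<rho>\<^sup>r\<^bsub>M\<^esub> m)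
        (\<lambda>m0 a. \<rho>\<^sup>r\<^bsub>M\<^esub> m0 \<boxtimes>\<^bsub>tensor K (tensor K M H) H\<^esub> \<beta>\<^bsub>H\<^esub> a) =
      sweedler (tensor K (tensor K M H) H) (\<rho>\<^sup>r\<^bsub>M\<^esub> m) (\<lambda>m0 a.
        sweedler (tensor K (tensor K M H) H) (\<Delta>\<^bsub>H\<^esub> a) (\<lambda>a1 a2.
          (\<zeta>\<^bsub>M\<^esub> m0 \<boxtimes>\<^bsub>tensor K M H\<^esub> a1) \<boxtimes>\<^bsub>tensor K (tensor K M H) H\<^esub> a2))"

locale hom_bicomodule = left_hom_comodule K H M + right_hom_comodule K H M
  for K :: "('k, 'c) ring_scheme" and H :: "('k, 'b elt) hom_hopf" and M :: "('k, 'b elt) four_angle" +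
  assumes lcoact_rcoact: "m \<in> carrier M \<Longrightarrow>
      sweedler (tensor K H (tensor K M H)) (\<rho>\<^sup>l\<^bsub>M\<^esub> m)
        (\<lambda>a m0. \<beta>\<^bsub>H\<^esub> a \<boxtimes>\<^bsub>tensor K H (tensor K M H)\<^esub> \<rho>\<^sup>r\<^bsub>M\<^esub> m0) =
      sweedler (tensor K H (tensor K M H)) (\<rho>\<^sup>r\<^bsub>M\<^esub> m) (\<lambda>m0 b.
        sweedler (tensor K H (tensor K M H)) (\<rho>\<^sup>l\<^bsub>M\<^esub> m0) (\<lambda>a m00.
          a \<boxtimes>\<^bsub>tensor K H (tensor K M H)\<^esub> (m00 \<boxtimes>\<^bsub>tensor K M H\<^esub> \<beta>\<^bsub>H\<^esub> b)))"

locale four_angle_hopf_module = hom_bimodule K H M + hom_bicomodule K H M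
  for K :: "('k, 'c) ring_scheme" and H :: "('k, 'b elt) hom_hopf" and M :: "('k, 'b elt) four_angle" +
  assumes zeta_bij: "bij_betw \<zeta>\<^bsub>M\<^esub> (carrier M) (carrier M)"
    and lcoact_lact: "\<lbrakk>h \<in> carrier H; m \<in> carrier M\<rbrakk> \<Longrightarrow> \<rho>\<^sup>l\<^bsub>M\<^esub> (h \<triangleright>\<^bsub>M\<^esub> m) =
      sweedler (tensor K H M) (\<Delta>\<^bsub>H\<^esub> h) (\<lambda>h1 h2. sweedler (tensor K H M) (\<rho>\<^sup>l\<^bsub>M\<^esub> m) (\<lambda>a m0.
        (h1 \<otimes>\<^bsub>H\<^esub> a) \<boxtimes>\<^bsub>tensor K H M\<^esub> (h2 \<triangleright>\<^bsub>M\<^esub> m0)))"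
    and rcoact_lact: "\<lbrakk>h \<in> carrier H; m \<in> carrier M\<rbrakk> \<Longrightarrow> \<rho>\<^sup>r\<^bsub>M\<^esub> (h \<triangleright>\<^bsub>M\<^esub> m) =
      sweedler (tensor K M H) (\<Delta>\<^bsub>H\<^esub> h) (\<lambda>h1 h2. sweedler (tensor K M H) (\<rho>\<^sup>r\<^bsub>M\<^esub> m) (\<lambda>m0 a.
        (h1 \<triangleright>\<^bsub>M\<^esub> m0) \<boxtimes>\<^bsub>tensor K M H\<^esub> (h2 \<otimes>\<^bsub>H\<^esub> a)))"
    and lcoact_ract: "\<lbrakk>h \<in> carrier H; m \<in> carrier M\<rbrakk> \<Longrightarrow> \<rho>\<^sup>l\<^bsub>M\<^esub> (m \<triangleleft>\<^bsub>M\<^esub> h) =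
      sweedler (tensor K H M) (\<rho>\<^sup>l\<^bsub>M\<^esub> m) (\<lambda>a m0. sweedler (tensor K H M) (\<Delta>\<^bsub>H\<^esub> h) (\<lambda>h1 h2.
        (a \<otimes>\<^bsub>H\<^esub> h1) \<boxtimes>\<^bsub>tensor K H M\<^esub> (m0 \<triangleleft>\<^bsub>M\<^esub> h2)))"
    and rcoact_ract: "\<lbrakk>h \<in> carrier H; m \<in> carrier M\<rbrakk> \<Longrightarrow> \<rho>\<^sup>r\<^bsub>M\<^esub> (m \<triangleleft>\<^bsub>M\<^esub> h) =
      sweedler (tensor K M H) (\<rho>\<^sup>r\<^bsub>M\<^esub> m) (\<lambda>m0 a. sweedler (tensor K M H) (\<Delta>\<^bsub>H\<^esub> h) (\<lambda>h1 h2.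
        (m0 \<triangleleft>\<^bsub>M\<^esub> h1) \<boxtimes>\<^bsub>tensor K M H\<^esub> (a \<otimes>\<^bsub>H\<^esub> h2)))"


section \<open>Braided monoidal categories\<close>

record ('o, 'a) category =
  Obj :: "'o set"
  Hom :: "'o \<Rightarrow> 'o \<Rightarrow> 'a set"
  Comp :: "'a \<Rightarrow> 'a \<Rightarrow> 'a"  (infixr \<open>\<cdot>\<index>\<close> 65)
  Id :: "'o \<Rightarrow> 'a"

record ('o, 'a) monoidal = "('o, 'a) category" +
  Tensor :: "'o \<Rightarrow> 'o \<Rightarrow> 'o"  (infixr \<open>\<otimes>o\<index>\<close> 70)
  Tensor_Hom :: "'a \<Rightarrow> 'a \<Rightarrow> 'a"  (infixr \<open>\<otimes>a\<index>\<close> 70)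
  Unit :: "'o"
  Assoc :: "'o \<Rightarrow> 'o \<Rightarrow> 'o \<Rightarrow> 'a"
  LUnit :: "'o \<Rightarrow> 'a"
  RUnit :: "'o \<Rightarrow> 'a"

record ('o, 'a) braided = "('o, 'a) monoidal" +
  Braid :: "'o \<Rightarrow> 'o \<Rightarrow> 'a"

definition inverse_arrows :: "('o, 'a, 'z) category_scheme \<Rightarrow> 'o \<Rightarrow> 'o \<Rightarrow> 'a \<Rightarrow> 'a \<Rightarrow> bool" where
  "inverse_arrows C A B f g \<longleftrightarrow>
     f \<in> Hom C A B \<and> g \<in> Hom C B A \<and> g \<cdot>\<^bsub>C\<^esub> f = Id C A \<and> f \<cdot>\<^bsub>C\<^esub> g = Id C B"

definition is_iso :: "('o, 'a, 'z) category_scheme \<Rightarrow> 'o \<Rightarrow> 'o \<Rightarrow> 'a \<Rightarrow> bool" where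
  "is_iso C A B f \<longleftrightarrow> (\<exists>g. inverse_arrows C A B f g)"

locale category =
  fixes C :: "('o, 'a, 'z) category_scheme" (structure)
  assumes id_hom: "A \<in> Obj C \<Longrightarrow> Id C A \<in> Hom C A A"
    and comp_hom: "\<lbrakk>A \<in> Obj C; B \<in> Obj C; D \<in> Obj C; f \<in> Hom C A B; g \<in> Hom C B D\<rbrakk> \<Longrightarrow>
      g \<cdot> f \<in> Hom C A D"
    and comp_id: "\<lbrakk>A \<in> Obj C; B \<in> Obj C; f \<in> Hom C A B\<rbrakk> \<Longrightarrow> f \<cdot> Id C A = f"
    and id_comp: "\<lbrakk>A \<in> Obj C; B \<in> Obj C; f \<in> Hom C A B\<rbrakk> \<Longrightarrow> Id C B \<cdot> f = f"
    and comp_assoc: "\<lbrakk>A \<in> Obj C; B \<in> Obj C; D \<in> Obj C; E \<in> Obj C;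
      f \<in> Hom C A B; g \<in> Hom C B D; h \<in> Hom C D E\<rbrakk> \<Longrightarrow> (h \<cdot> g) \<cdot> f = h \<cdot> (g \<cdot> f)"

locale monoidal_category = category C
  for C :: "('o, 'a, 'z) monoidal_scheme" (structure) +
  assumes tensor_obj: "\<lbrakk>A \<in> Obj C; B \<in> Obj C\<rbrakk> \<Longrightarrow> A \<otimes>o B \<in> Obj C"
    and tensor_hom: "\<lbrakk>A \<in> Obj C; A' \<in> Obj C; B \<in> Obj C; B' \<in> Obj C; f \<in> Hom C A A'; g \<in> Hom C B B'\<rbrakk> \<Longrightarrow>
      f \<otimes>a g \<in> Hom C (A \<otimes>o B) (A' \<otimes>o B')"
    and tensor_id: "\<lbrakk>A \<in> Obj C; B \<in> Obj C\<rbrakk> \<Longrightarrow> Id C A \<otimes>a Id C B = Id C (A \<otimes>o B)"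
    and tensor_comp: "\<lbrakk>A \<in> Obj C; A' \<in> Obj C; A'' \<in> Obj C; B \<in> Obj C; B' \<in> Obj C; B'' \<in> Obj C;
      f \<in> Hom C A A'; f' \<in> Hom C A' A''; g \<in> Hom C B B'; g' \<in> Hom C B' B''\<rbrakk> \<Longrightarrow>
      (f' \<cdot> f) \<otimes>a (g' \<cdot> g) = (f' \<otimes>a g') \<cdot> (f \<otimes>a g)"
    and unit_obj: "Unit C \<in> Obj C"
    and assoc_iso: "\<lbrakk>A \<in> Obj C; B \<in> Obj C; D \<in> Obj C\<rbrakk> \<Longrightarrow>
      is_iso C ((A \<otimes>o B) \<otimes>o D) (A \<otimes>o (B \<otimes>o D)) (Assoc C A B D)"
    and assoc_natural: "\<lbrakk>A \<in> Obj C; A' \<in> Obj C; B \<in> Obj C; B' \<in> Obj C; D \<in> Obj C; D' \<in> Obj C;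
      f \<in> Hom C A A'; g \<in> Hom C B B'; h \<in> Hom C D D'\<rbrakk> \<Longrightarrow>
      Assoc C A' B' D' \<cdot> ((f \<otimes>a g) \<otimes>a h) = (f \<otimes>a (g \<otimes>a h)) \<cdot> Assoc C A B D"
    and lunit_iso: "A \<in> Obj C \<Longrightarrow> is_iso C (Unit C \<otimes>o A) A (LUnit C A)"
    and lunit_natural: "\<lbrakk>A \<in> Obj C; A' \<in> Obj C; f \<in> Hom C A A'\<rbrakk> \<Longrightarrow>
      LUnit C A' \<cdot> (Id C (Unit C) \<otimes>a f) = f \<cdot> LUnit C A"
    and runit_iso: "A \<in> Obj C \<Longrightarrow> is_iso C (A \<otimes>o Unit C) A (RUnit C A)"
    and runit_natural: "\<lbrakk>A \<in> Obj C; A' \<in> Obj C; f \<in> Hom C A A'\<rbrakk> \<Longrightarrow>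
      RUnit C A' \<cdot> (f \<otimes>a Id C (Unit C)) = f \<cdot> RUnit C A"
    and pentagon: "\<lbrakk>A \<in> Obj C; B \<in> Obj C; D \<in> Obj C; E \<in> Obj C\<rbrakk> \<Longrightarrow>
      (Id C A \<otimes>a Assoc C B D E) \<cdot> Assoc C A (B \<otimes>o D) E \<cdot> (Assoc C A B D \<otimes>a Id C E) =
      Assoc C A B (D \<otimes>o E) \<cdot> Assoc C (A \<otimes>o B) D E"
    and triangle: "\<lbrakk>A \<in> Obj C; B \<in> Obj C\<rbrakk> \<Longrightarrow>
      (Id C A \<otimes>a LUnit C B) \<cdot> Assoc C A (Unit C) B = RUnit C A \<otimes>a Id C B"

text \<open>
  In the second hexagon \<open>p\<close>, \<open>q\<close>, \<open>r\<close> stand for the (unique) inverses of the associativity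
  constraints.
\<close>

locale braided_monoidal_category = monoidal_category C
  for C :: "('o, 'a, 'z) braided_scheme" (structure) +
  assumes braid_iso: "\<lbrakk>A \<in> Obj C; B \<in> Obj C\<rbrakk> \<Longrightarrow> is_iso C (A \<otimes>o B) (B \<otimes>o A) (Braid C A B)"
    and braid_natural: "\<lbrakk>A \<in> Obj C; A' \<in> Obj C; B \<in> Obj C; B' \<in> Obj C; f \<in> Hom C A A'; g \<in> Hom C B B'\<rbrakk> \<Longrightarrow>
      Braid C A' B' \<cdot> (f \<otimes>a g) = (g \<otimes>a f) \<cdot> Braid C A B"
    and hexagon1: "\<lbrakk>A \<in> Obj C; B \<in> Obj C; D \<in> Obj C\<rbrakk> \<Longrightarrow>
      Assoc C B D A \<cdot> Braid C A (B \<otimes>o D) \<cdot> Assoc C A B D =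
      (Id C B \<otimes>a Braid C A D) \<cdot> Assoc C B A D \<cdot> (Braid C A B \<otimes>a Id C D)"
    and hexagon2: "\<lbrakk>A \<in> Obj C; B \<in> Obj C; D \<in> Obj C;
      inverse_arrows C ((A \<otimes>o B) \<otimes>o D) (A \<otimes>o (B \<otimes>o D)) (Assoc C A B D) p;
      inverse_arrows C ((D \<otimes>o A) \<otimes>o B) (D \<otimes>o (A \<otimes>o B)) (Assoc C D A B) q;
      inverse_arrows C ((A \<otimes>o D) \<otimes>o B) (A \<otimes>o (D \<otimes>o B)) (Assoc C A D B) r\<rbrakk> \<Longrightarrow>
      q \<cdot> Braid C (A \<otimes>o B) D \<cdot> p =
      (Braid C A D \<otimes>a Id C B) \<cdot> r \<cdot> (Id C A \<otimes>a Braid C B D)"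


section \<open>The category of four-angle Hopf modules\<close>

datatype ('k, 'b) hmap =
  Hmap (source: "('k, 'b elt) four_angle") (fn: "'b elt \<Rightarrow> 'b elt") (target: "('k, 'b elt) four_angle")

text \<open>A morphism is a function that is \<^term>\<open>undefined\<close> off the carrier, tagged with source and target.\<close>

definition four_angle_hom ::
  "('k, 'c) ring_scheme \<Rightarrow> ('k, 'b elt) hom_hopf \<Rightarrow> ('k, 'b elt) four_angle \<Rightarrow> ('k, 'b elt) four_angle \<Rightarrow>
   ('k, 'b) hmap set"
where
  "four_angle_hom K H M N = {Hmap M f N | f.
     f \<in> extensional (carrier M) \<and> f \<in> lin_maps K M N \<and>
     (\<forall>m\<in>carrier M. f (\<zeta>\<^bsub>M\<^esub> m) = \<zeta>\<^bsub>N\<^esub> (f m)) \<and>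
     (\<forall>h\<in>carrier H. \<forall>m\<in>carrier M. f (h \<triangleright>\<^bsub>M\<^esub> m) = h \<triangleright>\<^bsub>N\<^esub> f m) \<and>
     (\<forall>m\<in>carrier M. \<forall>h\<in>carrier H. f (m \<triangleleft>\<^bsub>M\<^esub> h) = f m \<triangleleft>\<^bsub>N\<^esub> h) \<and>
     (\<forall>m\<in>carrier M. \<rho>\<^sup>l\<^bsub>N\<^esub> (f m) =
        sweedler (tensor K H N) (\<rho>\<^sup>l\<^bsub>M\<^esub> m) (\<lambda>a m0. a \<boxtimes>\<^bsub>tensor K H N\<^esub> f m0)) \<and>
     (\<forall>m\<in>carrier M. \<rho>\<^sup>r\<^bsub>N\<^esub> (f m) =
        sweedler (tensor K N H) (\<rho>\<^sup>r\<^bsub>M\<^esub> m) (\<lambda>m0 a. f m0 \<boxtimes>\<^bsub>tensor K N H\<^esub> a))}"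

definition comp_hmap :: "('k, 'b) hmap \<Rightarrow> ('k, 'b) hmap \<Rightarrow> ('k, 'b) hmap" where
  "comp_hmap g f = Hmap (source f) (compose (carrier (source f)) (fn g) (fn f)) (target g)"

definition id_hmap :: "('k, 'b elt) four_angle \<Rightarrow> ('k, 'b) hmap" where
  "id_hmap M = Hmap M (\<lambda>m\<in>carrier M. m) M"

text \<open>
  \<open>M \<otimes>\<^sub>H N\<close> is the quotient of \<open>M \<otimes> N\<close> that identifies \<open>m\<cdot>h \<otimes> \<zeta>(n)\<close> with \<open>\<zeta>(m) \<otimes> h\<cdot>n\<close>.  (The subspace
  of \<open>M \<otimes> N\<close> on which these two expressions agree is not meant: for \<open>H = M = N\<close> the group algebra of an
  infinite group it is zero, so that \<open>H\<close> could not be a unit object.)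
\<close>

definition tensorH ::
  "('k, 'c) ring_scheme \<Rightarrow> ('k, 'b elt) hom_hopf \<Rightarrow> ('k, 'b elt) four_angle \<Rightarrow> ('k, 'b elt) four_angle \<Rightarrow>
   ('k, 'b elt) tensor_space"
where
  "tensorH K H M N = tensor_quotient K M N
     {((m \<triangleleft>\<^bsub>M\<^esub> h, \<zeta>\<^bsub>N\<^esub> n), (\<zeta>\<^bsub>M\<^esub> m, h \<triangleright>\<^bsub>N\<^esub> n)) | m h n. m \<in> carrier M \<and> h \<in> carrier H \<and> n \<in> carrier N}"

definition twist_inv :: "('k, 'v) hom_hopf \<Rightarrow> 'v \<Rightarrow> 'v" where
  "twist_inv H = inv_into (carrier H) \<beta>\<^bsub>H\<^esub>"

definition antipode_inv :: "('k, 'v) hom_hopf \<Rightarrow> 'v \<Rightarrow> 'v" where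
  "antipode_inv H = inv_into (carrier H) \<S>\<^bsub>H\<^esub>"

definition zeta_inv :: "('k, 'v) four_angle \<Rightarrow> 'v \<Rightarrow> 'v" where
  "zeta_inv M = inv_into (carrier M) \<zeta>\<^bsub>M\<^esub>"

definition lcoact_tensor ::
  "('k, 'c) ring_scheme \<Rightarrow> ('k, 'b elt) hom_hopf \<Rightarrow> ('k, 'b elt) four_angle \<Rightarrow> ('k, 'b elt) four_angle \<Rightarrow>
   'b elt \<Rightarrow> 'b elt \<Rightarrow> 'b elt"
where
  "lcoact_tensor K H M N m n = (let T = tensorH K H M N; Y = tensor K H T in
     sweedler Y (\<rho>\<^sup>l\<^bsub>M\<^esub> m) (\<lambda>a m0. sweedler Y (\<rho>\<^sup>l\<^bsub>N\<^esub> n) (\<lambda>b n0.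
       (twist_inv H a \<otimes>\<^bsub>H\<^esub> twist_inv H b) \<boxtimes>\<^bsub>Y\<^esub> (m0 \<boxtimes>\<^bsub>T\<^esub> n0))))"

definition rcoact_tensor ::
  "('k, 'c) ring_scheme \<Rightarrow> ('k, 'b elt) hom_hopf \<Rightarrow> ('k, 'b elt) four_angle \<Rightarrow> ('k, 'b elt) four_angle \<Rightarrow>
   'b elt \<Rightarrow> 'b elt \<Rightarrow> 'b elt"
where
  "rcoact_tensor K H M N m n = (let T = tensorH K H M N; Y = tensor K T H in
     sweedler Y (\<rho>\<^sup>r\<^bsub>M\<^esub> m) (\<lambda>m0 a. sweedler Y (\<rho>\<^sup>r\<^bsub>N\<^esub> n) (\<lambda>n0 b.
       (m0 \<boxtimes>\<^bsub>T\<^esub> n0) \<boxtimes>\<^bsub>Y\<^esub> (twist_inv H a \<otimes>\<^bsub>H\<^esub> twist_inv H b))))"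

definition tensor_mod ::
  "('k, 'c) ring_scheme \<Rightarrow> ('k, 'b elt) hom_hopf \<Rightarrow> ('k, 'b elt) four_angle \<Rightarrow> ('k, 'b elt) four_angle \<Rightarrow>
   ('k, 'b elt) four_angle"
where
  "tensor_mod K H M N = (let T = tensorH K H M N in
     \<lparr>carrier = carrier T, mult = mult T, one = one T, zero = zero T, add = add T, smult = smult T,
      zeta = (\<lambda>t. sweedler T t (\<lambda>m n. \<zeta>\<^bsub>M\<^esub> m \<boxtimes>\<^bsub>T\<^esub> \<zeta>\<^bsub>N\<^esub> n)),
      lact = (\<lambda>h t. sweedler T t (\<lambda>m n. (h \<triangleright>\<^bsub>M\<^esub> m) \<boxtimes>\<^bsub>T\<^esub> \<zeta>\<^bsub>N\<^esub> n)),
      ract = (\<lambda>t h. sweedler T t (\<lambda>m n. \<zeta>\<^bsub>M\<^esub> m \<boxtimes>\<^bsub>T\<^esub> (n \<triangleleft>\<^bsub>N\<^esub> h))),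
      lcoact = (\<lambda>t. sweedler (tensor K H T) t (lcoact_tensor K H M N)),
      rcoact = (\<lambda>t. sweedler (tensor K T H) t (rcoact_tensor K H M N))\<rparr>)"

definition tensor_hmap ::
  "('k, 'c) ring_scheme \<Rightarrow> ('k, 'b elt) hom_hopf \<Rightarrow> ('k, 'b) hmap \<Rightarrow> ('k, 'b) hmap \<Rightarrow> ('k, 'b) hmap"
where
  "tensor_hmap K H f g =
     (let R = tensorH K H (source f) (source g); T = tensorH K H (target f) (target g) in
      Hmap (tensor_mod K H (source f) (source g))
        (\<lambda>t\<in>carrier R. sweedler T t (\<lambda>m n. fn f m \<boxtimes>\<^bsub>T\<^esub> fn g n))
        (tensor_mod K H (target f) (target g)))"

definition unit_mod :: "('k, 'b elt) hom_hopf \<Rightarrow> ('k, 'b elt) four_angle" where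
  "unit_mod H =
     \<lparr>carrier = carrier H, mult = mult H, one = one H, zero = zero H, add = add H, smult = smult H,
      zeta = \<beta>\<^bsub>H\<^esub>, lact = mult H, ract = mult H, lcoact = \<Delta>\<^bsub>H\<^esub>, rcoact = \<Delta>\<^bsub>H\<^esub>\<rparr>"

definition assoc_hmap ::
  "('k, 'c) ring_scheme \<Rightarrow> ('k, 'b elt) hom_hopf \<Rightarrow> ('k, 'b elt) four_angle \<Rightarrow> ('k, 'b elt) four_angle \<Rightarrow>
   ('k, 'b elt) four_angle \<Rightarrow> ('k, 'b) hmap"
where
  "assoc_hmap K H M N P =
     (let MN = tensor_mod K H M N; NP = tensor_mod K H N P;
          T = tensorH K H N P; Y = tensorH K H M NP in
      Hmap (tensor_mod K H MN P)
        (\<lambda>t\<in>carrier (tensorH K H MN P).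
           sweedler Y t (\<lambda>s p. sweedler Y s (\<lambda>m n. m \<boxtimes>\<^bsub>Y\<^esub> (n \<boxtimes>\<^bsub>T\<^esub> p))))
        (tensor_mod K H M NP))"

text \<open>
  The unit constraints are the morphisms with \<open>m \<otimes> 1 \<mapsto> m\<close> and \<open>1 \<otimes> m \<mapsto> m\<close>.  On a general pure tensor
  this is \<open>m \<otimes> g \<mapsto> \<zeta>\<^sup>-\<^sup>1(m\<cdot>g)\<close> and \<open>g \<otimes> m \<mapsto> \<zeta>\<^sup>-\<^sup>1(g\<cdot>m)\<close>, since \<open>m \<otimes> g = \<zeta>\<^sup>-\<^sup>1(m\<cdot>g) \<otimes> 1\<close> in \<open>M \<otimes>\<^sub>H H\<close>; the
  expressions \<open>m\<epsilon>(g)\<close> and \<open>\<epsilon>(g)m\<close>, which agree with them for \<open>g = 1\<close>, do not respect the identifications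
  in \<open>M \<otimes>\<^sub>H H\<close> and \<open>H \<otimes>\<^sub>H M\<close>.
\<close>

definition lunit_hmap ::
  "('k, 'c) ring_scheme \<Rightarrow> ('k, 'b elt) hom_hopf \<Rightarrow> ('k, 'b elt) four_angle \<Rightarrow> ('k, 'b) hmap"
where
  "lunit_hmap K H M =
     Hmap (tensor_mod K H (unit_mod H) M)
       (\<lambda>t\<in>carrier (tensorH K H (unit_mod H) M). sweedler M t (\<lambda>g m. zeta_inv M (g \<triangleright>\<^bsub>M\<^esub> m))) M"

definition runit_hmap ::
  "('k, 'c) ring_scheme \<Rightarrow> ('k, 'b elt) hom_hopf \<Rightarrow> ('k, 'b elt) four_angle \<Rightarrow> ('k, 'b) hmap"
where
  "runit_hmap K H M =
     Hmap (tensor_mod K H M (unit_mod H))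
       (\<lambda>t\<in>carrier (tensorH K H M (unit_mod H)). sweedler M t (\<lambda>m g. zeta_inv M (m \<triangleleft>\<^bsub>M\<^esub> g))) M"

definition braid_pure ::
  "('k, 'c) ring_scheme \<Rightarrow> ('k, 'b elt) hom_hopf \<Rightarrow> ('k, 'b elt) four_angle \<Rightarrow> ('k, 'b elt) four_angle \<Rightarrow>
   'b elt \<Rightarrow> 'b elt \<Rightarrow> 'b elt"
where
  "braid_pure K H M N m n = (let T = tensorH K H N M in
     sweedler T (\<rho>\<^sup>l\<^bsub>M\<^esub> m) (\<lambda>a m0. sweedler T (\<Delta>\<^bsub>H\<^esub> a) (\<lambda>a1 a2.
     sweedler T (\<rho>\<^sup>r\<^bsub>N\<^esub> n) (\<lambda>n0 b. sweedler T (\<Delta>\<^bsub>H\<^esub> b) (\<lambda>b1 b2.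
       (((twist_inv H ^^ 4) a1 \<triangleright>\<^bsub>N\<^esub> (zeta_inv N ^^ 3) n0) \<triangleleft>\<^bsub>N\<^esub> \<S>\<^bsub>H\<^esub> ((twist_inv H ^^ 3) b1))
       \<boxtimes>\<^bsub>T\<^esub>
       (\<S>\<^bsub>H\<^esub> ((twist_inv H ^^ 3) a2) \<triangleright>\<^bsub>M\<^esub> ((zeta_inv M ^^ 3) m0 \<triangleleft>\<^bsub>M\<^esub> (twist_inv H ^^ 4) b2)))))))"

definition braid_hmap ::
  "('k, 'c) ring_scheme \<Rightarrow> ('k, 'b elt) hom_hopf \<Rightarrow> ('k, 'b elt) four_angle \<Rightarrow> ('k, 'b elt) four_angle \<Rightarrow>
   ('k, 'b) hmap"
where
  "braid_hmap K H M N =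
     Hmap (tensor_mod K H M N)
       (\<lambda>t\<in>carrier (tensorH K H M N). sweedler (tensorH K H N M) t (braid_pure K H M N))
       (tensor_mod K H N M)"

definition braid_inv_pure ::
  "('k, 'c) ring_scheme \<Rightarrow> ('k, 'b elt) hom_hopf \<Rightarrow> ('k, 'b elt) four_angle \<Rightarrow> ('k, 'b elt) four_angle \<Rightarrow>
   'b elt \<Rightarrow> 'b elt \<Rightarrow> 'b elt"
where
  "braid_inv_pure K H M N n m = (let T = tensorH K H M N in
     sweedler T (\<rho>\<^sup>l\<^bsub>M\<^esub> m) (\<lambda>a m0. sweedler T (\<Delta>\<^bsub>H\<^esub> a) (\<lambda>a1 a2.
     sweedler T (\<rho>\<^sup>r\<^bsub>N\<^esub> n) (\<lambda>n0 b. sweedler T (\<Delta>\<^bsub>H\<^esub> b) (\<lambda>b1 b2.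
       (((twist_inv H ^^ 4) b2 \<triangleright>\<^bsub>M\<^esub> (zeta_inv M ^^ 3) m0) \<triangleleft>\<^bsub>M\<^esub> antipode_inv H ((twist_inv H ^^ 3) a2))
       \<boxtimes>\<^bsub>T\<^esub>
       (antipode_inv H ((twist_inv H ^^ 3) b1) \<triangleright>\<^bsub>N\<^esub> ((zeta_inv N ^^ 3) n0 \<triangleleft>\<^bsub>N\<^esub> (twist_inv H ^^ 4) a1)))))))"

definition braid_inv_hmap ::
  "('k, 'c) ring_scheme \<Rightarrow> ('k, 'b elt) hom_hopf \<Rightarrow> ('k, 'b elt) four_angle \<Rightarrow> ('k, 'b elt) four_angle \<Rightarrow>
   ('k, 'b) hmap"
where
  "braid_inv_hmap K H M N =
     Hmap (tensor_mod K H N M)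
       (\<lambda>t\<in>carrier (tensorH K H N M). sweedler (tensorH K H M N) t (braid_inv_pure K H M N))
       (tensor_mod K H M N)"

definition four_angle_category ::
  "('k, 'c) ring_scheme \<Rightarrow> ('k, 'b elt) hom_hopf \<Rightarrow> (('k, 'b elt) four_angle, ('k, 'b) hmap) braided"
where
  "four_angle_category K H =
     \<lparr>Obj = {M. four_angle_hopf_module K H M},
      Hom = four_angle_hom K H,
      Comp = comp_hmap,
      Id = id_hmap,
      Tensor = tensor_mod K H,
      Tensor_Hom = tensor_hmap K H,
      Unit = unit_mod H,
      Assoc = assoc_hmap K H,
      LUnit = lunit_hmap K H,
      RUnit = runit_hmap K H,
      Braid = braid_hmap K H\<rparr>"

text \<open>
  The maps above are given by their values on pure tensors, evaluated on chosen representatives.  The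
  following states that these values are indeed attained on all pure tensors, i.e. that the structure
  of \<open>M \<otimes>\<^sub>H N\<close> and the constraints are well defined.
\<close>

definition structure_on_pure_tensors :: "('k, 'c) ring_scheme \<Rightarrow> ('k, 'b elt) hom_hopf \<Rightarrow> bool" where
  "structure_on_pure_tensors K H \<longleftrightarrow>
     (\<forall>M N m n h. four_angle_hopf_module K H M \<longrightarrow> four_angle_hopf_module K H N \<longrightarrow>
        m \<in> carrier M \<longrightarrow> n \<in> carrier N \<longrightarrow> h \<in> carrier H \<longrightarrow>
        (let T = tensorH K H M N; MN = tensor_mod K H M N in
           \<zeta>\<^bsub>MN\<^esub> (m \<boxtimes>\<^bsub>T\<^esub> n) = \<zeta>\<^bsub>M\<^esub> m \<boxtimes>\<^bsub>T\<^esub> \<zeta>\<^bsub>N\<^esub> n \<and>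
           h \<triangleright>\<^bsub>MN\<^esub> (m \<boxtimes>\<^bsub>T\<^esub> n) = (h \<triangleright>\<^bsub>M\<^esub> m) \<boxtimes>\<^bsub>T\<^esub> \<zeta>\<^bsub>N\<^esub> n \<and>
           (m \<boxtimes>\<^bsub>T\<^esub> n) \<triangleleft>\<^bsub>MN\<^esub> h = \<zeta>\<^bsub>M\<^esub> m \<boxtimes>\<^bsub>T\<^esub> (n \<triangleleft>\<^bsub>N\<^esub> h) \<and>
           \<rho>\<^sup>l\<^bsub>MN\<^esub> (m \<boxtimes>\<^bsub>T\<^esub> n) = lcoact_tensor K H M N m n \<and>
           \<rho>\<^sup>r\<^bsub>MN\<^esub> (m \<boxtimes>\<^bsub>T\<^esub> n) = rcoact_tensor K H M N m n)) \<and>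
     (\<forall>M M' N N' f g m n. four_angle_hopf_module K H M \<longrightarrow> four_angle_hopf_module K H M' \<longrightarrow>
        four_angle_hopf_module K H N \<longrightarrow> four_angle_hopf_module K H N' \<longrightarrow>
        f \<in> four_angle_hom K H M M' \<longrightarrow> g \<in> four_angle_hom K H N N' \<longrightarrow>
        m \<in> carrier M \<longrightarrow> n \<in> carrier N \<longrightarrow>
        fn (tensor_hmap K H f g) (m \<boxtimes>\<^bsub>tensorH K H M N\<^esub> n) = fn f m \<boxtimes>\<^bsub>tensorH K H M' N'\<^esub> fn g n) \<and>
     (\<forall>M N P m n p. four_angle_hopf_module K H M \<longrightarrow> four_angle_hopf_module K H N \<longrightarrow>
        four_angle_hopf_module K H P \<longrightarrow> m \<in> carrier M \<longrightarrow> n \<in> carrier N \<longrightarrow> p \<in> carrier P \<longrightarrow>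
        fn (assoc_hmap K H M N P)
          ((m \<boxtimes>\<^bsub>tensorH K H M N\<^esub> n) \<boxtimes>\<^bsub>tensorH K H (tensor_mod K H M N) P\<^esub> p) =
        m \<boxtimes>\<^bsub>tensorH K H M (tensor_mod K H N P)\<^esub> (n \<boxtimes>\<^bsub>tensorH K H N P\<^esub> p)) \<and>
     (\<forall>M m g. four_angle_hopf_module K H M \<longrightarrow> m \<in> carrier M \<longrightarrow> g \<in> carrier H \<longrightarrow>
        fn (lunit_hmap K H M) (g \<boxtimes>\<^bsub>tensorH K H (unit_mod H) M\<^esub> m) = zeta_inv M (g \<triangleright>\<^bsub>M\<^esub> m) \<and>
        fn (runit_hmap K H M) (m \<boxtimes>\<^bsub>tensorH K H M (unit_mod H)\<^esub> g) = zeta_inv M (m \<triangleleft>\<^bsub>M\<^esub> g))"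

end

theory Submission
  imports Defs
begin

text \<open>
  As \<open>\<beta>\<close> and the maps \<open>\<zeta>\<close> are bijective, everything can be untwisted: \<open>\<beta>\<^sup>-\<^sup>1(ab)\<close> and \<open>\<Delta>\<beta>\<^sup>-\<^sup>1\<close> make \<open>H\<close> an
  ordinary Hopf algebra, \<open>\<zeta>\<^sup>-\<^sup>1(h\<cdot>m)\<close>, \<open>\<zeta>\<^sup>-\<^sup>1(m\<cdot>h)\<close> and \<open>\<rho>\<zeta>\<^sup>-\<^sup>1\<close> make \<open>M\<close> an ordinary Hopf bimodule, and \<open>M \<otimes>\<^sub>H N\<close>
  does not change.  In these terms the braiding is
  \<open>m \<otimes> n \<mapsto> m\<^sub>[\<^sub>-\<^sub>1\<^sub>]\<cdot>(E\<^sub>r(n\<^sub>(\<^sub>0\<^sub>)) \<otimes> E\<^sub>l(m\<^sub>[\<^sub>0\<^sub>]))\<cdot>n\<^sub>(\<^sub>1\<^sub>)\<close> for the maps \<open>E\<^sub>l(m) = S(m\<^sub>[\<^sub>-\<^sub>1\<^sub>])\<cdot>m\<^sub>[\<^sub>0\<^sub>]\<close> and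
  \<open>E\<^sub>r(n) = n\<^sub>(\<^sub>0\<^sub>)\<cdot>S(n\<^sub>(\<^sub>1\<^sub>))\<close> onto the left and the right coinvariants.  It is a bimodule map with
  \<open>m \<otimes> n \<mapsto> n \<otimes> m\<close> for left coinvariant \<open>m\<close> and right coinvariant \<open>n\<close>.  Such \<open>m \<otimes> n\<close> generate the bimodule
  \<open>M \<otimes>\<^sub>H N\<close>, so that colinearity, naturality, invertibility and the hexagons need only be checked on them.
\<close>

section \<open>Tensor products\<close>

text \<open>Every structure map is a Sweedler sum over an arbitrarily chosen representative, so it
  can be handled only through the universal property of the tensor space. Each exchange or
  regrouping of sums therefore carries linearity obligations, and the rules below are shaped so that
  simplification discharges them. Generation by coinvariants is half of the fundamental theorem of
  Hopf modules: m is a sum of h.e with e left coinvariant, n a sum of e.k with e right coinvariant,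
  and h and k then stand at the outer ends of the tensor. The inverse braiding starts from N
  \<otimes> M, where right coinvariants must generate N as a left module and left coinvariants M as
  a right module. The projections for this are built from the inverse antipode. Colinearity does not
  follow from the flip formula alone. It needs the braiding on components of the coaction of a
  coinvariant, and these are coinvariant only in the sense of the whole sum. The bicomodule axiom
  bridges that gap.\<close>

lemma lin_mapsI:
  assumes "\<And>x. x \<in> carrier V \<Longrightarrow> f x \<in> carrier W"
    and "\<And>x y. x \<in> carrier V \<Longrightarrow> y \<in> carrier V \<Longrightarrow> f (x \<oplus>\<^bsub>V\<^esub> y) = f x \<oplus>\<^bsub>W\<^esub> f y"
    and "\<And>c x. c \<in> carrier K \<Longrightarrow> x \<in> carrier V \<Longrightarrow> f (c \<odot>\<^bsub>V\<^esub> x) = c \<odot>\<^bsub>W\<^esub> f x"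
  shows "f \<in> lin_maps K V W"
  using assms by (auto simp: lin_maps_def)

lemma lin_maps_closed: "f \<in> lin_maps K V W \<Longrightarrow> x \<in> carrier V \<Longrightarrow> f x \<in> carrier W"
  and lin_maps_add: "f \<in> lin_maps K V W \<Longrightarrow> x \<in> carrier V \<Longrightarrow> y \<in> carrier V \<Longrightarrow> f (x \<oplus>\<^bsub>V\<^esub> y) = f x \<oplus>\<^bsub>W\<^esub> f y"
  and lin_maps_smult: "f \<in> lin_maps K V W \<Longrightarrow> c \<in> carrier K \<Longrightarrow> x \<in> carrier V \<Longrightarrow> f (c \<odot>\<^bsub>V\<^esub> x) = c \<odot>\<^bsub>W\<^esub> f x"
  by (auto simp: lin_maps_def)

lemma lin_maps_zero:
  assumes "module K V" "module K W" "f \<in> lin_maps K V W"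
  shows "f \<zero>\<^bsub>V\<^esub> = \<zero>\<^bsub>W\<^esub>"
proof -
  interpret V: module K V by fact
  interpret W: module K W by fact
  have "f (\<zero>\<^bsub>K\<^esub> \<odot>\<^bsub>V\<^esub> \<zero>\<^bsub>V\<^esub>) = \<zero>\<^bsub>K\<^esub> \<odot>\<^bsub>W\<^esub> f \<zero>\<^bsub>V\<^esub>"
    using assms(3) by (rule lin_maps_smult) simp_all
  then show ?thesis
    using lin_maps_closed[OF assms(3), of "\<zero>\<^bsub>V\<^esub>"] by simp
qed

lemma bilinearI:
  assumes "\<And>x. x \<in> carrier U \<Longrightarrow> f x \<in> lin_maps K V W"
    and "\<And>y. y \<in> carrier V \<Longrightarrow> (\<lambda>x. f x y) \<in> lin_maps K U W"
  shows "bilinear K U V W f"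
  using assms by (auto simp: bilinear_def)

lemma bilinear_right: "bilinear K U V W f \<Longrightarrow> x \<in> carrier U \<Longrightarrow> f x \<in> lin_maps K V W"
  and bilinear_left: "bilinear K U V W f \<Longrightarrow> y \<in> carrier V \<Longrightarrow> (\<lambda>x. f x y) \<in> lin_maps K U W"
  by (auto simp: bilinear_def)

lemma bilinear_closed:
  "bilinear K U V W f \<Longrightarrow> x \<in> carrier U \<Longrightarrow> y \<in> carrier V \<Longrightarrow> f x y \<in> carrier W"
  by (meson bilinear_right lin_maps_closed)

text \<open>The fold inside \<open>sweedler\<close> for an arbitrary list, so that it can also be
  computed on formal sums other than the chosen representative.\<close>

definition list_sum :: "('w, 'f) ring_scheme \<Rightarrow> ('a \<Rightarrow> 'b \<Rightarrow> 'w) \<Rightarrow> ('a \<times> 'b) list \<Rightarrow> 'w" where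
  "list_sum W \<phi> xs = foldr (\<lambda>(x, y) s. \<phi> x y \<oplus>\<^bsub>W\<^esub> s) xs \<zero>\<^bsub>W\<^esub>"

lemma list_sum_Nil [simp]: "list_sum W \<phi> [] = \<zero>\<^bsub>W\<^esub>"
  and list_sum_Cons [simp]: "list_sum W \<phi> ((x, y) # xs) = \<phi> x y \<oplus>\<^bsub>W\<^esub> list_sum W \<phi> xs"
  by (simp_all add: list_sum_def)

lemma list_sum_cong:
  assumes "\<And>x y. (x, y) \<in> set xs \<Longrightarrow> \<phi> x y = \<psi> x y"
  shows "list_sum W \<phi> xs = list_sum W \<psi> xs"
  using assms by (induction xs) auto

lemma list_sum_closed:
  assumes "abelian_group W" "\<And>x y. (x, y) \<in> set xs \<Longrightarrow> \<phi> x y \<in> carrier W"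
  shows "list_sum W \<phi> xs \<in> carrier W"
proof -
  interpret W: abelian_group W by fact
  show ?thesis using assms(2) by (induction xs) auto
qed

lemma list_sum_append:
  assumes "abelian_group W" "\<And>x y. (x, y) \<in> set xs \<union> set ys \<Longrightarrow> \<phi> x y \<in> carrier W"
  shows "list_sum W \<phi> (xs @ ys) = list_sum W \<phi> xs \<oplus>\<^bsub>W\<^esub> list_sum W \<phi> ys"
proof -
  interpret W: abelian_group W by fact
  show ?thesis using assms(2)
    by (induction xs) (auto simp: list_sum_closed[OF assms(1)] W.a_assoc)
qed

lemma list_sum_add:
  assumes "abelian_group W" "\<And>x y. (x, y) \<in> set xs \<Longrightarrow> \<phi> x y \<in> carrier W"
    "\<And>x y. (x, y) \<in> set xs \<Longrightarrow> \<psi> x y \<in> carrier W"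
  shows "list_sum W (\<lambda>x y. \<phi> x y \<oplus>\<^bsub>W\<^esub> \<psi> x y) xs = list_sum W \<phi> xs \<oplus>\<^bsub>W\<^esub> list_sum W \<psi> xs"
proof -
  interpret W: abelian_group W by fact
  show ?thesis using assms(2,3)
  proof (induction xs)
    case (Cons p xs)
    moreover obtain x y where "p = (x, y)" by force
    ultimately show ?case
      by (simp add: list_sum_closed[OF assms(1)] W.a_ac)
  qed simp
qed

lemma list_sum_lin:
  assumes "module K V" "module K W" "f \<in> lin_maps K V W" "\<And>x y. (x, y) \<in> set xs \<Longrightarrow> \<phi> x y \<in> carrier V"
  shows "f (list_sum V \<phi> xs) = list_sum W (\<lambda>x y. f (\<phi> x y)) xs"
proof -
  interpret V: module K V by fact
  show ?thesis using assms(4)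
    by (induction xs)
      (auto simp: lin_maps_zero[OF assms(1-3)] lin_maps_add[OF assms(3)]
        list_sum_closed[OF V.abelian_group_axioms])
qed

text \<open>A scalar multiple is formed by scaling the left components of a representative. For this
  to respect the congruence, \<open>E\<close> has to be stable under the same scaling.\<close>

locale tensor_setting = U: module K U + V: module K V
  for K :: "('k, 'c) ring_scheme" and U :: "('k, 'b elt, 'd) module_scheme" and V :: "('k, 'b elt, 'e) module_scheme" +
  fixes E :: "(('b elt \<times> 'b elt) \<times> ('b elt \<times> 'b elt)) set"
  assumes scale_identify: "\<lbrakk>c \<in> carrier K; ((u, v), (u', v')) \<in> E; u \<in> carrier U; v \<in> carrier V;
    u' \<in> carrier U; v' \<in> carrier V\<rbrakk> \<Longrightarrow> ((c \<odot>\<^bsub>U\<^esub> u, v), (c \<odot>\<^bsub>U\<^esub> u', v')) \<in> E"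
begin

abbreviation formal :: "('b elt \<times> 'b elt) list \<Rightarrow> bool" where
  "formal xs \<equiv> set xs \<subseteq> carrier U \<times> carrier V"

abbreviation cong_rel (infix "\<approx>" 50) where
  "xs \<approx> ys \<equiv> tensor_cong K U V E xs ys"

abbreviation cls where "cls \<equiv> tensor_class K U V E"

abbreviation T where "T \<equiv> tensor_quotient K U V E"

abbreviation scale where "scale c \<equiv> map (\<lambda>(u, v). (c \<odot>\<^bsub>U\<^esub> u, v))"

section \<open>Formal sums modulo the congruence form a module\<close>

lemma cong_formal: "xs \<approx> ys \<Longrightarrow> formal xs \<and> formal ys"
  by (induction rule: tensor_cong.induct) auto

lemma summands_cls: "formal xs \<Longrightarrow> xs \<approx> summands (cls xs)"
  unfolding tensor_class_def summands.simps
  by (rule someI, rule tensor_cong.refl)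

text \<open>The choice operator sees only the predicate it is applied to, and congruent lists define
  the same predicate.\<close>

lemma cls_eqI: "xs \<approx> ys \<Longrightarrow> cls xs = cls ys"
proof -
  assume "xs \<approx> ys"
  then have "tensor_cong K U V E xs = tensor_cong K U V E ys"
    by (intro ext) (meson tensor_cong.sym tensor_cong.trans)
  then show ?thesis by (simp add: tensor_class_def)
qed

lemma carrier_cls: "formal xs \<Longrightarrow> cls xs \<in> carrier T"
  by (auto simp: tensor_quotient_def)

lemma carrierE:
  assumes "t \<in> carrier T" obtains xs where "formal xs" "t = cls xs"
  using assms by (auto simp: tensor_quotient_def)

lemma formal_summands: "t \<in> carrier T \<Longrightarrow> formal (summands t)"
  by (metis carrierE cong_formal summands_cls)

lemma cls_summands: "t \<in> carrier T \<Longrightarrow> cls (summands t) = t"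
  by (metis carrierE cls_eqI summands_cls)

lemma formal_scale: "c \<in> carrier K \<Longrightarrow> formal xs \<Longrightarrow> formal (scale c xs)"
  by auto

lemma cong_scale: "xs \<approx> ys \<Longrightarrow> c \<in> carrier K \<Longrightarrow> scale c xs \<approx> scale c ys"
proof (induction rule: tensor_cong.induct)
  case (refl xs)
  then show ?case by (intro tensor_cong.refl) auto
next
  case (commute xs ys)
  then show ?case by (auto intro!: tensor_cong.commute simp: subset_iff)
next
  case (scalar d u v)
  then have "[(d \<odot>\<^bsub>U\<^esub> (c \<odot>\<^bsub>U\<^esub> u), v)] \<approx> [(c \<odot>\<^bsub>U\<^esub> u, d \<odot>\<^bsub>V\<^esub> v)]"
    by (intro tensor_cong.scalar) auto
  \<comment> \<open>The scalars c and d trade places by commutativity of the ground ring.\<close>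
  moreover have "d \<odot>\<^bsub>U\<^esub> (c \<odot>\<^bsub>U\<^esub> u) = c \<odot>\<^bsub>U\<^esub> (d \<odot>\<^bsub>U\<^esub> u)"
    using scalar by (metis U.smult_assoc1 U.R.m_comm)
  ultimately show ?case by simp
next
  case (identify p q)
  then show ?case by (auto intro!: tensor_cong.identify scale_identify)
qed (auto simp: U.smult_r_distr intro: tensor_cong.intros)

lemma add_cls: "formal xs \<Longrightarrow> formal ys \<Longrightarrow> cls xs \<oplus>\<^bsub>T\<^esub> cls ys = cls (xs @ ys)"
  by (simp add: tensor_quotient_def)
    (metis cls_eqI tensor_cong.append summands_cls)

lemma smult_cls: "c \<in> carrier K \<Longrightarrow> formal xs \<Longrightarrow> c \<odot>\<^bsub>T\<^esub> cls xs = cls (scale c xs)"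
  by (simp add: tensor_quotient_def)
    (metis cls_eqI cong_scale summands_cls)

lemma zero_cls: "\<zero>\<^bsub>T\<^esub> = cls []"
  and pure_cls: "u \<boxtimes>\<^bsub>T\<^esub> v = cls [(u, v)]"
  by (simp_all add: tensor_quotient_def)

text \<open>The terms 0 \<otimes> v disappear one at a time. With \<open>scale_add\<close> this
  provides additive inverses.\<close>

lemma scale_zero: "formal xs \<Longrightarrow> scale \<zero>\<^bsub>K\<^esub> xs \<approx> []"
proof (induction xs)
  case Nil
  show ?case by (simp add: tensor_cong.refl)
next
  case (Cons p xs)
  obtain u v where p: "p = (u, v)" by force
  have "[(\<zero>\<^bsub>U\<^esub>, v)] @ scale \<zero>\<^bsub>K\<^esub> xs \<approx> [] @ []"
    using Cons by (intro tensor_cong.append tensor_cong.zero) (auto simp: p)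
  then show ?case using Cons by (simp add: p)
qed

lemma scale_add:
  "c \<in> carrier K \<Longrightarrow> d \<in> carrier K \<Longrightarrow> formal xs \<Longrightarrow> scale (c \<oplus>\<^bsub>K\<^esub> d) xs \<approx> scale c xs @ scale d xs"
proof (induction xs)
  case Nil
  show ?case by (simp add: tensor_cong.refl)
next
  case (Cons p xs)
  obtain u v where p: "p = (u, v)" by force
  have uv: "u \<in> carrier U" "v \<in> carrier V" "formal xs" using Cons by (auto simp: p)
  have "[((c \<oplus>\<^bsub>K\<^esub> d) \<odot>\<^bsub>U\<^esub> u, v)] \<approx> [(c \<odot>\<^bsub>U\<^esub> u, v), (d \<odot>\<^bsub>U\<^esub> u, v)]"
    using Cons uv by (simp add: U.smult_l_distr tensor_cong.add_left)
  then have "[((c \<oplus>\<^bsub>K\<^esub> d) \<odot>\<^bsub>U\<^esub> u, v)] @ scale (c \<oplus>\<^bsub>K\<^esub> d) xs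
      \<approx> [(c \<odot>\<^bsub>U\<^esub> u, v), (d \<odot>\<^bsub>U\<^esub> u, v)] @ (scale c xs @ scale d xs)"
    using Cons uv by (intro tensor_cong.append) auto
  also have "[(c \<odot>\<^bsub>U\<^esub> u, v), (d \<odot>\<^bsub>U\<^esub> u, v)] @ (scale c xs @ scale d xs)
     = [(c \<odot>\<^bsub>U\<^esub> u, v)] @ ([(d \<odot>\<^bsub>U\<^esub> u, v)] @ scale c xs) @ scale d xs" by simp
  finally have 1: "[((c \<oplus>\<^bsub>K\<^esub> d) \<odot>\<^bsub>U\<^esub> u, v)] @ scale (c \<oplus>\<^bsub>K\<^esub> d) xs \<approx> \<dots>" .
  have "\<dots> \<approx> [(c \<odot>\<^bsub>U\<^esub> u, v)] @ (scale c xs @ [(d \<odot>\<^bsub>U\<^esub> u, v)]) @ scale d xs"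
    using Cons.prems uv formal_scale
    by (intro tensor_cong.append tensor_cong.commute tensor_cong.refl) auto
  with 1 have "[((c \<oplus>\<^bsub>K\<^esub> d) \<odot>\<^bsub>U\<^esub> u, v)] @ scale (c \<oplus>\<^bsub>K\<^esub> d) xs \<approx> \<dots>" by (rule tensor_cong.trans)
  then show ?case by (simp add: p)
qed

lemma scale_one: "formal xs \<Longrightarrow> scale \<one>\<^bsub>K\<^esub> xs = xs"
  by (induction xs) auto

lemma scale_scale: "c \<in> carrier K \<Longrightarrow> d \<in> carrier K \<Longrightarrow> formal xs \<Longrightarrow> scale (c \<otimes>\<^bsub>K\<^esub> d) xs = scale c (scale d xs)"
  by (induction xs) (auto simp: U.smult_assoc1)

lemma module_T: "module K T"
proof (rule moduleI)
  show "cring K" by unfold_locales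
  show "abelian_group T"
  proof (rule abelian_groupI)
    fix x y assume "x \<in> carrier T" "y \<in> carrier T"
    then show "x \<oplus>\<^bsub>T\<^esub> y \<in> carrier T"
      by (auto elim!: carrierE simp: add_cls subset_iff intro!: carrier_cls)
  next
    show "\<zero>\<^bsub>T\<^esub> \<in> carrier T" by (simp add: zero_cls carrier_cls)
  next
    fix x y z assume "x \<in> carrier T" "y \<in> carrier T" "z \<in> carrier T"
    then show "x \<oplus>\<^bsub>T\<^esub> y \<oplus>\<^bsub>T\<^esub> z = x \<oplus>\<^bsub>T\<^esub> (y \<oplus>\<^bsub>T\<^esub> z)"
      by (auto elim!: carrierE simp: add_cls)
  next
    fix x y assume "x \<in> carrier T" "y \<in> carrier T"
    then show "x \<oplus>\<^bsub>T\<^esub> y = y \<oplus>\<^bsub>T\<^esub> x"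
      by (auto elim!: carrierE simp: add_cls intro!: cls_eqI tensor_cong.commute)
  next
    fix x assume "x \<in> carrier T"
    then show "\<zero>\<^bsub>T\<^esub> \<oplus>\<^bsub>T\<^esub> x = x" by (auto elim!: carrierE simp: add_cls zero_cls)
  next
    fix x assume "x \<in> carrier T"
    then obtain xs where xs: "formal xs" "x = cls xs" by (rule carrierE)
    \<comment> \<open>The additive inverse is the multiple by -1: scaling by -1 + 1 = 0 collapses
      the formal sum.\<close>
    have m: "\<ominus>\<^bsub>K\<^esub> \<one>\<^bsub>K\<^esub> \<in> carrier K" by simp
    have "scale (\<ominus>\<^bsub>K\<^esub> \<one>\<^bsub>K\<^esub>) xs @ scale \<one>\<^bsub>K\<^esub> xs \<approx> scale (\<ominus>\<^bsub>K\<^esub> \<one>\<^bsub>K\<^esub> \<oplus>\<^bsub>K\<^esub> \<one>\<^bsub>K\<^esub>) xs"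
      by (rule tensor_cong.sym, rule scale_add) (use xs in auto)
    also have "\<ominus>\<^bsub>K\<^esub> \<one>\<^bsub>K\<^esub> \<oplus>\<^bsub>K\<^esub> \<one>\<^bsub>K\<^esub> = \<zero>\<^bsub>K\<^esub>" by (simp add: U.R.l_neg)
    finally have "scale (\<ominus>\<^bsub>K\<^esub> \<one>\<^bsub>K\<^esub>) xs @ xs \<approx> []"
      using scale_zero[OF xs(1)] scale_one[OF xs(1)] by (metis tensor_cong.trans)
    then have "cls (scale (\<ominus>\<^bsub>K\<^esub> \<one>\<^bsub>K\<^esub>) xs) \<oplus>\<^bsub>T\<^esub> x = \<zero>\<^bsub>T\<^esub>"
      using xs by (simp only: xs(2) add_cls[OF formal_scale[OF m xs(1)] xs(1)] zero_cls cls_eqI)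
    then show "\<exists>y\<in>carrier T. y \<oplus>\<^bsub>T\<^esub> x = \<zero>\<^bsub>T\<^esub>"
      using carrier_cls[OF formal_scale[OF m xs(1)]] by blast
  qed
next
  fix a x assume "a \<in> carrier K" "x \<in> carrier T"
  then show "a \<odot>\<^bsub>T\<^esub> x \<in> carrier T"
    by (metis carrierE smult_cls carrier_cls formal_scale)
next
  fix a b x assume ab: "a \<in> carrier K" "b \<in> carrier K" and "x \<in> carrier T"
  then obtain xs where xs: "formal xs" "x = cls xs" by (metis carrierE)
  then show "(a \<oplus>\<^bsub>K\<^esub> b) \<odot>\<^bsub>T\<^esub> x = a \<odot>\<^bsub>T\<^esub> x \<oplus>\<^bsub>T\<^esub> b \<odot>\<^bsub>T\<^esub> x"
    using ab by (simp only: smult_cls add_cls formal_scale U.R.add.m_closed) (rule cls_eqI[OF scale_add])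
next
  fix a x y assume a: "a \<in> carrier K" and "x \<in> carrier T" "y \<in> carrier T"
  then obtain xs ys where xs: "formal xs" "x = cls xs" "formal ys" "y = cls ys" by (metis carrierE)
  then have "formal (xs @ ys)" by auto
  then show "a \<odot>\<^bsub>T\<^esub> (x \<oplus>\<^bsub>T\<^esub> y) = a \<odot>\<^bsub>T\<^esub> x \<oplus>\<^bsub>T\<^esub> a \<odot>\<^bsub>T\<^esub> y"
    using a xs by (simp only: smult_cls add_cls formal_scale map_append)
next
  fix a b x assume ab: "a \<in> carrier K" "b \<in> carrier K" and "x \<in> carrier T"
  then obtain xs where xs: "formal xs" "x = cls xs" by (metis carrierE)
  then show "(a \<otimes>\<^bsub>K\<^esub> b) \<odot>\<^bsub>T\<^esub> x = a \<odot>\<^bsub>T\<^esub> (b \<odot>\<^bsub>T\<^esub> x)"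
    using ab by (simp only: smult_cls formal_scale U.R.m_closed scale_scale)
next
  fix x assume "x \<in> carrier T"
  then obtain xs where xs: "formal xs" "x = cls xs" by (metis carrierE)
  then show "\<one>\<^bsub>K\<^esub> \<odot>\<^bsub>T\<^esub> x = x" by (simp only: smult_cls U.R.one_closed scale_one)
qed

sublocale T: module K T by (rule module_T)

section \<open>Pure tensors and the universal property\<close>

lemma pure_closed: "u \<in> carrier U \<Longrightarrow> v \<in> carrier V \<Longrightarrow> u \<boxtimes>\<^bsub>T\<^esub> v \<in> carrier T"
  by (simp add: pure_cls carrier_cls)

lemma pure_bilinear: "bilinear K U V T (\<lambda>u v. u \<boxtimes>\<^bsub>T\<^esub> v)"
proof (intro bilinearI lin_mapsI)
  fix u u' v assume *: "u \<in> carrier U" "u' \<in> carrier U" "v \<in> carrier V"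
  then have "cls [(u \<oplus>\<^bsub>U\<^esub> u', v)] = cls ([(u, v)] @ [(u', v)])"
    by (intro cls_eqI) (simp add: tensor_cong.add_left)
  also have "\<dots> = cls [(u, v)] \<oplus>\<^bsub>T\<^esub> cls [(u', v)]" by (rule add_cls[symmetric]) (use * in auto)
  finally show "(u \<oplus>\<^bsub>U\<^esub> u') \<boxtimes>\<^bsub>T\<^esub> v = u \<boxtimes>\<^bsub>T\<^esub> v \<oplus>\<^bsub>T\<^esub> u' \<boxtimes>\<^bsub>T\<^esub> v" by (simp only: pure_cls)
next
  fix u v v' assume *: "u \<in> carrier U" "v \<in> carrier V" "v' \<in> carrier V"
  then have "cls [(u, v \<oplus>\<^bsub>V\<^esub> v')] = cls ([(u, v)] @ [(u, v')])"
    by (intro cls_eqI) (simp add: tensor_cong.add_right)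
  also have "\<dots> = cls [(u, v)] \<oplus>\<^bsub>T\<^esub> cls [(u, v')]" by (rule add_cls[symmetric]) (use * in auto)
  finally show "u \<boxtimes>\<^bsub>T\<^esub> (v \<oplus>\<^bsub>V\<^esub> v') = u \<boxtimes>\<^bsub>T\<^esub> v \<oplus>\<^bsub>T\<^esub> u \<boxtimes>\<^bsub>T\<^esub> v'" by (simp only: pure_cls)
next
  fix c u v assume *: "c \<in> carrier K" "u \<in> carrier U" "v \<in> carrier V"
  then show "(c \<odot>\<^bsub>U\<^esub> u) \<boxtimes>\<^bsub>T\<^esub> v = c \<odot>\<^bsub>T\<^esub> (u \<boxtimes>\<^bsub>T\<^esub> v)"
    by (simp add: pure_cls smult_cls)
  moreover have "(c \<odot>\<^bsub>U\<^esub> u) \<boxtimes>\<^bsub>T\<^esub> v = u \<boxtimes>\<^bsub>T\<^esub> (c \<odot>\<^bsub>V\<^esub> v)"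
    using * by (simp add: pure_cls cls_eqI tensor_cong.scalar)
  ultimately show "u \<boxtimes>\<^bsub>T\<^esub> (c \<odot>\<^bsub>V\<^esub> v) = c \<odot>\<^bsub>T\<^esub> (u \<boxtimes>\<^bsub>T\<^esub> v)" by simp
qed (auto intro: pure_closed)

lemma pure_identify:
  "((u, v), (u', v')) \<in> E \<Longrightarrow> u \<in> carrier U \<Longrightarrow> v \<in> carrier V \<Longrightarrow> u' \<in> carrier U \<Longrightarrow> v' \<in> carrier V \<Longrightarrow>
   u \<boxtimes>\<^bsub>T\<^esub> v = u' \<boxtimes>\<^bsub>T\<^esub> v'"
  by (simp add: pure_cls cls_eqI tensor_cong.identify)

lemma cls_list_sum: "formal xs \<Longrightarrow> cls xs = list_sum T (\<lambda>u v. u \<boxtimes>\<^bsub>T\<^esub> v) xs"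
proof (induction xs)
  case (Cons p xs)
  obtain u v where p: "p = (u, v)" by force
  have "cls ([(u, v)] @ xs) = cls [(u, v)] \<oplus>\<^bsub>T\<^esub> cls xs"
    by (rule add_cls[symmetric]) (use Cons p in auto)
  then show ?case using Cons by (simp add: p pure_cls)
qed (simp add: zero_cls)

lemma sum_pure: "t \<in> carrier T \<Longrightarrow> list_sum T (\<lambda>u v. u \<boxtimes>\<^bsub>T\<^esub> v) (summands t) = t"
  by (metis cls_list_sum cls_summands formal_summands)

text \<open>Restricted to pairs with components in the carriers, because these are the only ones
  that \<open>identify\<close> uses.\<close>

definition balanced :: "('b elt \<Rightarrow> 'b elt \<Rightarrow> 'w) \<Rightarrow> bool" where
  "balanced \<phi> \<longleftrightarrow> (\<forall>u v u' v'. ((u, v), (u', v')) \<in> E \<longrightarrow> u \<in> carrier U \<longrightarrow> v \<in> carrier V \<longrightarrow>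
     u' \<in> carrier U \<longrightarrow> v' \<in> carrier V \<longrightarrow> \<phi> u v = \<phi> u' v')"

context
  fixes W :: "('k, 'w, 'f) module_scheme" and \<phi>
  assumes W: "module K W" and bil: "bilinear K U V W \<phi>" and resp: "balanced \<phi>"
begin

interpretation W: module K W by (rule W)

lemma list_sum_formal_closed: "formal xs \<Longrightarrow> list_sum W \<phi> xs \<in> carrier W"
  by (intro list_sum_closed W.abelian_group_axioms bilinear_closed[OF bil]) auto

text \<open>Each generating step of the congruence preserves the sum: rearrangements because W is
  commutative, the steps of linearity because \<phi> is bilinear, identifications because \<phi> is
  balanced. This is what makes Sweedler notation meaningful.\<close>

lemma list_sum_balanced: "xs \<approx> ys \<Longrightarrow> list_sum W \<phi> xs = list_sum W \<phi> ys"
proof (induction rule: tensor_cong.induct)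
  case (append xs xs' ys ys')
  then show ?case
    using cong_formal[OF append(1)] cong_formal[OF append(2)] bilinear_closed[OF bil]
    by (subst (1 2) list_sum_append[OF W.abelian_group_axioms]) auto
next
  case (commute xs ys)
  then show ?case
    using bilinear_closed[OF bil] list_sum_formal_closed
    by (subst (1 2) list_sum_append[OF W.abelian_group_axioms]) (auto intro: W.a_comm)
next
  case (zero v)
  then show ?case
    using lin_maps_zero[OF U.module_axioms W bilinear_left[OF bil]] by simp
next
  case (add_left u u' v)
  then show ?case
    using lin_maps_add[OF bilinear_left[OF bil], of v u u'] bilinear_closed[OF bil] by simp
next
  case (add_right u v v')
  then show ?case
    using lin_maps_add[OF bilinear_right[OF bil], of u v v'] bilinear_closed[OF bil] by simp
next
  case (scalar c u v)
  then show ?case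
    using lin_maps_smult[OF bilinear_left[OF bil], of v c u] lin_maps_smult[OF bilinear_right[OF bil], of u c v]
      bilinear_closed[OF bil] by simp
next
  case (identify p q)
  then show ?case using resp unfolding balanced_def
    by (cases p; cases q) auto
qed auto

text \<open>The chosen representative is congruent to \<open>xs\<close>, hence may be replaced by
  it.\<close>

lemma sweedler_list_sum: "formal xs \<Longrightarrow> sweedler W (cls xs) \<phi> = list_sum W \<phi> xs"
  unfolding sweedler_def list_sum_def[symmetric]
  by (metis list_sum_balanced summands_cls)

lemma sweedler_pure: "u \<in> carrier U \<Longrightarrow> v \<in> carrier V \<Longrightarrow> sweedler W (u \<boxtimes>\<^bsub>T\<^esub> v) \<phi> = \<phi> u v"
  by (simp add: pure_cls sweedler_list_sum bilinear_closed[OF bil])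

lemma sweedler_linear: "(\<lambda>t. sweedler W t \<phi>) \<in> lin_maps K T W"
proof (intro lin_mapsI)
  fix x assume "x \<in> carrier T"
  then show "sweedler W x \<phi> \<in> carrier W"
    by (metis carrierE sweedler_list_sum list_sum_formal_closed)
next
  fix x y assume "x \<in> carrier T" "y \<in> carrier T"
  then obtain xs ys where xs: "formal xs" "x = cls xs" "formal ys" "y = cls ys" by (metis carrierE)
  moreover from xs have "formal (xs @ ys)" by auto
  ultimately show "sweedler W (x \<oplus>\<^bsub>T\<^esub> y) \<phi> = sweedler W x \<phi> \<oplus>\<^bsub>W\<^esub> sweedler W y \<phi>"
    using bilinear_closed[OF bil]
    by (simp only: add_cls sweedler_list_sum, intro list_sum_append[OF W.abelian_group_axioms]) auto
next
  fix c x assume c: "c \<in> carrier K" and "x \<in> carrier T"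
  then obtain xs where xs: "formal xs" "x = cls xs" by (metis carrierE)
  have "list_sum W \<phi> (scale c xs) = c \<odot>\<^bsub>W\<^esub> list_sum W \<phi> xs"
    using xs(1)
  proof (induction xs)
    case (Cons p xs)
    obtain u v where p: "p = (u, v)" by force
    then show ?case using c Cons lin_maps_smult[OF bilinear_left[OF bil], of v c u]
      by (simp add: W.smult_r_distr list_sum_formal_closed bilinear_closed[OF bil])
  qed (simp add: c)
  then show "sweedler W (c \<odot>\<^bsub>T\<^esub> x) \<phi> = c \<odot>\<^bsub>W\<^esub> sweedler W x \<phi>"
    using xs c by (simp only: smult_cls sweedler_list_sum formal_scale)
qed

end

end

section \<open>Plain tensor products and their dependence on the factors\<close>

lemma tensor_setting_empty: "module K U \<Longrightarrow> module K V \<Longrightarrow> tensor_setting K U V {}"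
  by (simp add: tensor_setting_def tensor_setting_axioms_def)

lemma balanced_empty: "module K U \<Longrightarrow> module K V \<Longrightarrow> tensor_setting.balanced U V {} \<phi>"
  by (simp add: tensor_setting.balanced_def[OF tensor_setting_empty])

text \<open>Prepares \<open>tensor_quotient_cong\<close>: records that share a module structure,
  such as \<open>H\<close> and \<open>unit_mod H\<close>, have literally equal tensor
  spaces.\<close>

lemma tensor_cong_cong:
  assumes "carrier U = carrier U'" "zero U = zero U'" "add U = add U'" "smult U = smult U'"
    and "carrier V = carrier V'" "add V = add V'" "smult V = smult V'"
  shows "tensor_cong K U V E xs ys \<Longrightarrow> tensor_cong K U' V' E xs ys"
proof (induction rule: tensor_cong.induct)
  case (sym xs ys)
  then show ?case by (blast intro: tensor_cong.sym)
next
  case (trans xs ys zs)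
  then show ?case by (blast intro: tensor_cong.trans)
next
  case (zero v)
  then have "tensor_cong K U' V' E [(\<zero>\<^bsub>U'\<^esub>, v)] []"
    using assms by (intro tensor_cong.zero) simp
  then show ?case using assms by simp
qed (use assms in \<open>auto intro: tensor_cong.refl tensor_cong.append tensor_cong.commute
    tensor_cong.add_left tensor_cong.add_right
    tensor_cong.scalar tensor_cong.identify\<close>)

lemma tensor_quotient_cong:
  assumes "carrier U = carrier U'" "zero U = zero U'" "add U = add U'" "smult U = smult U'"
    and "carrier V = carrier V'" "add V = add V'" "smult V = smult V'"
  shows "tensor_quotient K U V E = tensor_quotient K U' V' E"
proof -
  have "tensor_cong K U V E xs ys \<longleftrightarrow> tensor_cong K U' V' E xs ys" for xs ys
    using tensor_cong_cong[of U U' V V' K E xs ys] tensor_cong_cong[of U' U V' V K E xs ys] assms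
    by metis
  then have "tensor_cong K U V E = tensor_cong K U' V' E" by blast
  then have "tensor_class K U V E = tensor_class K U' V' E"
    by (simp add: tensor_class_def fun_eq_iff)
  then show ?thesis by (simp add: tensor_quotient_def assms)
qed


section \<open>Sums over Sweedler components\<close>

text \<open>
  Discarding the summands outside \<open>U \<times> V\<close>, of which an element of \<open>U \<otimes> V\<close> has none, makes the
  congruence rule unconditional.
\<close>

definition tsum ::
  "('b elt, 'd) partial_object_scheme \<Rightarrow> ('b elt, 'e) partial_object_scheme \<Rightarrow> ('w, 'f) ring_scheme \<Rightarrow>
   'b elt \<Rightarrow> ('b elt \<Rightarrow> 'b elt \<Rightarrow> 'w) \<Rightarrow> 'w"
where
  "tsum U V W t \<phi> =
     list_sum W \<phi> (filter (\<lambda>(x, y). x \<in> carrier U \<and> y \<in> carrier V) (summands t))"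

lemma tsum_cong:
  assumes "\<And>a b. a \<in> carrier U \<Longrightarrow> b \<in> carrier V \<Longrightarrow> \<phi> a b = \<psi> a b"
  shows "tsum U V W t \<phi> = tsum U V W t \<psi>"
  unfolding tsum_def by (rule list_sum_cong) (use assms in auto)

text \<open>As a congruence rule it lets the simplifier work under a Sweedler sum knowing that the
  components lie in the carriers. Almost all side conditions further on are met this way.\<close>

lemma tsum_cong_simp [cong]:
  assumes "U = U'" "V = V'" "W = W'" "s = t"
    and "\<And>a b. a \<in> carrier U' \<Longrightarrow> b \<in> carrier V' \<Longrightarrow> \<phi> a b = \<psi> a b"
  shows "tsum U V W s \<phi> = tsum U' V' W' t \<psi>"
  unfolding assms(1-4) by (rule tsum_cong) (rule assms(5))

text \<open>Splits bilinearity into linearity in each slot, which the \<open>lin_\<close> rules then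
  establish along the structure of the term.\<close>

lemma bilinear_iff [simp]:
  "bilinear K U V W f \<longleftrightarrow>
     (\<forall>x\<in>carrier U. f x \<in> lin_maps K V W) \<and> (\<forall>y\<in>carrier V. (\<lambda>x. f x y) \<in> lin_maps K U W)"
  by (simp add: bilinear_def)

locale scalars = cring K for K :: "('k, 'c) ring_scheme"
begin

abbreviation "md V \<equiv> module K V"
abbreviation "LIN V W \<equiv> lin_maps K V W"
abbreviation "bil U V W \<phi> \<equiv> bilinear K U V W \<phi>"
abbreviation "tp U V u v \<equiv> u \<boxtimes>\<^bsub>tensor K U V\<^esub> v"

section \<open>Linearity, exchange and flattening of Sweedler sums\<close>

lemma md_abelian: "md W \<Longrightarrow> abelian_group W"
  by (rule module.axioms)

lemma md_add_closed [simp]: "md W \<Longrightarrow> x \<in> carrier W \<Longrightarrow> y \<in> carrier W \<Longrightarrow> x \<oplus>\<^bsub>W\<^esub> y \<in> carrier W"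
  by (simp add: md_abelian abelian_group.axioms abelian_monoid.a_closed)

lemma md_smult_closed [simp]: "md W \<Longrightarrow> c \<in> carrier K \<Longrightarrow> x \<in> carrier W \<Longrightarrow> c \<odot>\<^bsub>W\<^esub> x \<in> carrier W"
  by (rule module.smult_closed)

lemma tsum_closed [simp]:
  assumes "md W" "\<And>a b. a \<in> carrier U \<Longrightarrow> b \<in> carrier V \<Longrightarrow> \<phi> a b \<in> carrier W"
  shows "tsum U V W t \<phi> \<in> carrier W"
  unfolding tsum_def by (rule list_sum_closed[OF md_abelian[OF assms(1)]]) (use assms in auto)

lemma tsum_push:
  assumes "f \<in> LIN X W" "md X" "md W" "\<And>a b. a \<in> carrier U \<Longrightarrow> b \<in> carrier V \<Longrightarrow> \<phi> a b \<in> carrier X"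
  shows "f (tsum U V X t \<phi>) = tsum U V W t (\<lambda>a b. f (\<phi> a b))"
  unfolding tsum_def by (rule list_sum_lin) (use assms in auto)

lemma tsum_add:
  assumes "md W" "\<And>a b. a \<in> carrier U \<Longrightarrow> b \<in> carrier V \<Longrightarrow> \<phi> a b \<in> carrier W"
    "\<And>a b. a \<in> carrier U \<Longrightarrow> b \<in> carrier V \<Longrightarrow> \<psi> a b \<in> carrier W"
  shows "tsum U V W t (\<lambda>a b. \<phi> a b \<oplus>\<^bsub>W\<^esub> \<psi> a b) = tsum U V W t \<phi> \<oplus>\<^bsub>W\<^esub> tsum U V W t \<psi>"
  unfolding tsum_def by (rule list_sum_add) (use assms in \<open>auto intro: md_abelian\<close>)

lemma lin_id [simp]: "(\<lambda>x. x) \<in> LIN V V"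
  by (rule lin_mapsI) simp_all

lemma lin_comp: "f \<in> LIN V W \<Longrightarrow> g \<in> LIN X V \<Longrightarrow> (\<lambda>x. f (g x)) \<in> LIN X W"
  by (rule lin_mapsI) (simp_all add: lin_maps_closed lin_maps_add lin_maps_smult)

text \<open>Linearity concerns values on the carrier only, so f may be replaced by a map that agrees
  with it there. The structure maps agree with their \<open>tsum\<close> forms in exactly this
  sense.\<close>

lemma lin_comp_cong:
  assumes "f \<in> LIN V W" "g \<in> LIN X V" "\<And>v. v \<in> carrier V \<Longrightarrow> f v = f' v" "md X"
  shows "(\<lambda>x. f' (g x)) \<in> LIN X W"
proof -
  interpret X: module K X by fact
  have "f' (g x) = f (g x)" if "x \<in> carrier X" for x
    using assms that by (simp add: lin_maps_closed)
  with lin_comp[OF assms(1,2)] show ?thesis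
    by (simp add: lin_maps_def Pi_iff)
qed

lemma lin_smult [simp]:
  assumes "md W" "c \<in> carrier K" "f \<in> LIN V W"
  shows "(\<lambda>x. c \<odot>\<^bsub>W\<^esub> f x) \<in> LIN V W"
proof -
  interpret W: module K W by fact
  show ?thesis
  proof (rule lin_mapsI)
    fix d x assume d: "d \<in> carrier K" "x \<in> carrier V"
    then show "c \<odot>\<^bsub>W\<^esub> f (d \<odot>\<^bsub>V\<^esub> x) = d \<odot>\<^bsub>W\<^esub> (c \<odot>\<^bsub>W\<^esub> f x)"
      using assms lin_maps_closed[OF assms(3), of x]
      by (simp add: lin_maps_smult W.smult_assoc1[symmetric] m_comm)
  qed (use assms lin_maps_closed[OF assms(3)] in \<open>simp_all add: lin_maps_add W.smult_r_distr\<close>)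
qed

lemma lin_smult_eta [simp]: "md W \<Longrightarrow> c \<in> carrier K \<Longrightarrow> (\<odot>\<^bsub>W\<^esub>) c \<in> LIN W W"
  using lin_smult[of W c "\<lambda>x. x"] by simp

lemma lin_tsum [simp]:
  assumes "md X" "md W" "\<And>a b. a \<in> carrier U \<Longrightarrow> b \<in> carrier V \<Longrightarrow> (\<lambda>x. F x a b) \<in> LIN X W"
  shows "(\<lambda>x. tsum U V W t (F x)) \<in> LIN X W"
proof (rule lin_mapsI)
  have cl: "F x a b \<in> carrier W" if "x \<in> carrier X" "a \<in> carrier U" "b \<in> carrier V" for x a b
    using lin_maps_closed[OF assms(3)[OF that(2,3)] that(1)] .
  show "tsum U V W t (F x) \<in> carrier W" if "x \<in> carrier X" for x
    by (simp add: assms cl that)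
  show "tsum U V W t (F (x \<oplus>\<^bsub>X\<^esub> y)) = tsum U V W t (F x) \<oplus>\<^bsub>W\<^esub> tsum U V W t (F y)"
    if "x \<in> carrier X" "y \<in> carrier X" for x y
    using that by (subst tsum_add[symmetric]) (auto simp: assms cl lin_maps_add[OF assms(3)] intro!: tsum_cong)
  show "tsum U V W t (F (c \<odot>\<^bsub>X\<^esub> x)) = c \<odot>\<^bsub>W\<^esub> tsum U V W t (F x)"
    if "c \<in> carrier K" "x \<in> carrier X" for c x
    using that tsum_push[of "(\<odot>\<^bsub>W\<^esub>) c" W W U V "F x" t]
    by (auto simp: assms cl lin_maps_smult[OF assms(3)] intro!: tsum_cong)
qed

text \<open>Two independent finite sums may be exchanged; the induction runs over the outer
  list.\<close>

lemma tsum_swap: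
  assumes "md W" "\<And>a b c d. a \<in> carrier U \<Longrightarrow> b \<in> carrier V \<Longrightarrow> c \<in> carrier U' \<Longrightarrow> d \<in> carrier V' \<Longrightarrow>
    \<phi> a b c d \<in> carrier W"
  shows "tsum U V W s (\<lambda>a b. tsum U' V' W t (\<phi> a b)) = tsum U' V' W t (\<lambda>c d. tsum U V W s (\<lambda>a b. \<phi> a b c d))"
proof -
  interpret W: module K W by fact
  have "list_sum W (\<lambda>a b. tsum U' V' W t (\<phi> a b)) xs
      = tsum U' V' W t (\<lambda>c d. list_sum W (\<lambda>a b. \<phi> a b c d) xs)"
    if "set xs \<subseteq> carrier U \<times> carrier V" for xs
    using that
  proof (induction xs)
    case Nil
    \<comment> \<open>A sum of zeros vanishes because the scalar 0 can be pulled out of it.\<close>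
    have "tsum U' V' W t (\<lambda>c d. \<zero>\<^bsub>K\<^esub> \<odot>\<^bsub>W\<^esub> \<zero>\<^bsub>W\<^esub>) = \<zero>\<^bsub>K\<^esub> \<odot>\<^bsub>W\<^esub> tsum U' V' W t (\<lambda>c d. \<zero>\<^bsub>W\<^esub>)"
      by (subst tsum_push[symmetric, of "(\<odot>\<^bsub>W\<^esub>) \<zero>\<^bsub>K\<^esub>" W W]) (simp_all add: assms(1))
    then show ?case by (simp add: assms(1))
  next
    case (Cons p xs)
    obtain a b where p: "p = (a, b)" by force
    have cl: "list_sum W (\<lambda>a b. \<phi> a b c d) xs \<in> carrier W" if "c \<in> carrier U'" "d \<in> carrier V'" for c d
      by (rule list_sum_closed[OF W.abelian_group_axioms]) (use that Cons.prems assms(2) in auto)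
    show ?case
      using Cons cl by (simp add: p assms tsum_add)
  qed
  from this[of "filter (\<lambda>(x, y). x \<in> carrier U \<and> y \<in> carrier V) (summands s)"]
  show ?thesis by (subst (1 4) tsum_def) auto
qed

lemma md_tensor [simp]: "md U \<Longrightarrow> md V \<Longrightarrow> md (tensor K U V)"
  unfolding tensor_def by (intro tensor_setting.module_T tensor_setting_empty)

lemma tp_bilinear: "md U \<Longrightarrow> md V \<Longrightarrow> bil U V (tensor K U V) (tp U V)"
  unfolding tensor_def by (intro tensor_setting.pure_bilinear tensor_setting_empty)

lemma bil_right: "bil U V W \<phi> \<Longrightarrow> u \<in> carrier U \<Longrightarrow> g \<in> LIN X V \<Longrightarrow> (\<lambda>x. \<phi> u (g x)) \<in> LIN X W"
  by (rule lin_comp) auto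

lemma bil_left: "bil U V W \<phi> \<Longrightarrow> v \<in> carrier V \<Longrightarrow> g \<in> LIN X U \<Longrightarrow> (\<lambda>x. \<phi> (g x) v) \<in> LIN X W"
  by (rule lin_comp[of "\<lambda>u. \<phi> u v" U]) auto

lemma tp_closed [simp]: "md U \<Longrightarrow> md V \<Longrightarrow> u \<in> carrier U \<Longrightarrow> v \<in> carrier V \<Longrightarrow> tp U V u v \<in> carrier (tensor K U V)"
  using bilinear_closed[OF tp_bilinear] .

lemma lin_tp [simp]:
  "md U \<Longrightarrow> md V \<Longrightarrow> u \<in> carrier U \<Longrightarrow> tp U V u \<in> LIN V (tensor K U V)"
  "md U \<Longrightarrow> md V \<Longrightarrow> u \<in> carrier U \<Longrightarrow> g \<in> LIN X V \<Longrightarrow> (\<lambda>x. tp U V u (g x)) \<in> LIN X (tensor K U V)"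
  "md U \<Longrightarrow> md V \<Longrightarrow> v \<in> carrier V \<Longrightarrow> f \<in> LIN X U \<Longrightarrow> (\<lambda>x. tp U V (f x) v) \<in> LIN X (tensor K U V)"
  by (rule bilinear_right[OF tp_bilinear] bil_right[OF tp_bilinear] bil_left[OF tp_bilinear]; assumption)+

lemma sweedler_tsum:
  "md U \<Longrightarrow> md V \<Longrightarrow> t \<in> carrier (tensor K U V) \<Longrightarrow> sweedler W t \<phi> = tsum U V W t \<phi>"
  using tensor_setting.formal_summands[OF tensor_setting_empty, of K U V t]
  unfolding sweedler_def tsum_def list_sum_def[symmetric] tensor_def
  by (subst filter_True) auto

lemma tsum_self:
  assumes "md U" "md V" "t \<in> carrier (tensor K U V)"
  shows "tsum U V (tensor K U V) t (tp U V) = t"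
  using assms tensor_setting.sum_pure[OF tensor_setting_empty, of K U V t]
  unfolding sweedler_tsum[OF assms, symmetric] sweedler_def list_sum_def[symmetric] tensor_def
  by simp

lemma tsum_tp [simp]:
  assumes "md U" "md V" "md W" "bil U V W \<phi>" "u \<in> carrier U" "v \<in> carrier V"
  shows "tsum U V W (tp U V u v) \<phi> = \<phi> u v"
  using tensor_setting.sweedler_pure[OF tensor_setting_empty[OF assms(1,2)] assms(3,4) balanced_empty[OF assms(1,2)] assms(5,6)] assms
  by (subst sweedler_tsum[symmetric]) (auto simp: tensor_def[symmetric])

lemma lin_tsum_arg [simp]:
  assumes "md U" "md V" "md W" "md X" "bil U V W \<phi>" "g \<in> LIN X (tensor K U V)"
  shows "(\<lambda>x. tsum U V W (g x) \<phi>) \<in> LIN X W"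
proof -
  have "(\<lambda>t. sweedler W t \<phi>) \<in> LIN (tensor K U V) W"
    using tensor_setting.sweedler_linear[OF tensor_setting_empty[OF assms(1,2)] assms(3,5) balanced_empty[OF assms(1,2)]]
    by (simp add: tensor_def)
  then show ?thesis
    by (rule lin_comp_cong[OF _ assms(6)]) (simp_all add: sweedler_tsum assms del: bilinear_iff)
qed

text \<open>Evaluating a bilinear map on a tensor that is itself a Sweedler sum gives a nested sum.
  This turns an equation in a tensor space into one for all multilinear maps.\<close>

lemma tsum_tsum [simp]:
  assumes "md U" "md V" "md W" "bil U V W \<phi>"
    "\<And>a b. a \<in> carrier A \<Longrightarrow> b \<in> carrier B \<Longrightarrow> \<psi> a b \<in> carrier (tensor K U V)"
  shows "tsum U V W (tsum A B (tensor K U V) s \<psi>) \<phi> = tsum A B W s (\<lambda>a b. tsum U V W (\<psi> a b) \<phi>)"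
  by (rule tsum_push[of "\<lambda>t. tsum U V W t \<phi>"]) (use assms in auto)

lemma tp_tsum [simp]:
  assumes "md U" "md V"
  shows "u \<in> carrier U \<Longrightarrow> (\<And>a b. a \<in> carrier A \<Longrightarrow> b \<in> carrier B \<Longrightarrow> \<psi> a b \<in> carrier V) \<Longrightarrow>
      tp U V u (tsum A B V s \<psi>) = tsum A B (tensor K U V) s (\<lambda>a b. tp U V u (\<psi> a b))"
    and "v \<in> carrier V \<Longrightarrow> (\<And>a b. a \<in> carrier A \<Longrightarrow> b \<in> carrier B \<Longrightarrow> \<chi> a b \<in> carrier U) \<Longrightarrow>
      tp U V (tsum A B U s \<chi>) v = tsum A B (tensor K U V) s (\<lambda>a b. tp U V (\<chi> a b) v)"
  using assms by (auto intro: tsum_push[of "tp U V u"] tsum_push[of "\<lambda>u. tp U V u v"])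

text \<open>Puts the scalar that belongs to the inner Sweedler sum outermost, which is the shape in
  which the counit laws match.\<close>

lemma smult_smult_swap:
  assumes "md W" "c \<in> carrier K" "d \<in> carrier K" "w \<in> carrier W"
  shows "(c \<otimes>\<^bsub>K\<^esub> d) \<odot>\<^bsub>W\<^esub> w = d \<odot>\<^bsub>W\<^esub> (c \<odot>\<^bsub>W\<^esub> w)"
  using assms by (simp add: module.smult_assoc1[symmetric] m_comm)

end

section \<open>Untwisting a Hom-Hopf algebra\<close>

locale bijective_hom_hopf = hom_hopf_algebra K H for K :: "('k, 'c) ring_scheme" and H :: "('k, 'b elt) hom_hopf" +
  assumes bij_twist: "bij_betw \<beta>\<^bsub>H\<^esub> (carrier H) (carrier H)"
    and bij_antipode: "bij_betw \<S>\<^bsub>H\<^esub> (carrier H) (carrier H)"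

sublocale bijective_hom_hopf \<subseteq> scalars K
  by unfold_locales

lemma (in scalars) lin_inv_into:
  assumes "f \<in> LIN V V" "bij_betw f (carrier V) (carrier V)" "md V"
  shows "inv_into (carrier V) f \<in> LIN V V"
proof -
  have inj: "inj_on f (carrier V)" and cl: "\<And>x. x \<in> carrier V \<Longrightarrow> inv_into (carrier V) f x \<in> carrier V"
    and f: "\<And>x. x \<in> carrier V \<Longrightarrow> f (inv_into (carrier V) f x) = x"
    using assms(2) by (auto simp: bij_betw_def inv_into_into f_inv_into_f)
  show ?thesis
  proof (rule lin_mapsI)
    fix x y assume "x \<in> carrier V" "y \<in> carrier V"
    then show "inv_into (carrier V) f (x \<oplus>\<^bsub>V\<^esub> y) = inv_into (carrier V) f x \<oplus>\<^bsub>V\<^esub> inv_into (carrier V) f y"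
      using assms by (intro inv_into_f_eq inj) (simp_all add: cl f lin_maps_add)
  next
    fix c x assume "c \<in> carrier K" "x \<in> carrier V"
    then show "inv_into (carrier V) f (c \<odot>\<^bsub>V\<^esub> x) = c \<odot>\<^bsub>V\<^esub> inv_into (carrier V) f x"
      using assms by (intro inv_into_f_eq inj) (simp_all add: cl f lin_maps_smult)
  qed (rule cl)
qed

context bijective_hom_hopf
begin

abbreviation "\<beta>' \<equiv> \<beta>\<^bsub>H\<^esub>"
abbreviation "\<beta>i \<equiv> twist_inv H"
abbreviation "S \<equiv> \<S>\<^bsub>H\<^esub>"
abbreviation "Si \<equiv> antipode_inv H"
abbreviation "eps \<equiv> \<epsilon>\<^bsub>H\<^esub>"
abbreviation "unt \<equiv> \<one>\<^bsub>H\<^esub>"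

definition mul (infixl "\<star>" 75) where "a \<star> b = \<beta>i (a \<otimes>\<^bsub>H\<^esub> b)"
definition com ("\<delta>") where "\<delta> h = \<Delta>\<^bsub>H\<^esub> (\<beta>i h)"

abbreviation "DS W h \<phi> \<equiv> tsum H H W (\<delta> h) \<phi>"

section \<open>The untwisted product\<close>

lemma md_H [simp]: "md H" ..

lemma linear_H [simp]: "\<beta>' \<in> LIN H H" "\<beta>i \<in> LIN H H" "S \<in> LIN H H" "Si \<in> LIN H H"
  unfolding twist_inv_def antipode_inv_def
  by (intro twist_linear antipode_linear lin_inv_into bij_twist bij_antipode md_H)+

lemma lin_H [simp]:
  "f \<in> LIN V H \<Longrightarrow> (\<lambda>x. \<beta>' (f x)) \<in> LIN V H" "f \<in> LIN V H \<Longrightarrow> (\<lambda>x. \<beta>i (f x)) \<in> LIN V H"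
  "f \<in> LIN V H \<Longrightarrow> (\<lambda>x. S (f x)) \<in> LIN V H" "f \<in> LIN V H \<Longrightarrow> (\<lambda>x. Si (f x)) \<in> LIN V H"
  by (rule lin_comp[OF linear_H(1)] lin_comp[OF linear_H(2)] lin_comp[OF linear_H(3)] lin_comp[OF linear_H(4)]; assumption)+

lemma closed_H [simp]:
  assumes "a \<in> carrier H"
  shows "\<beta>' a \<in> carrier H" "\<beta>i a \<in> carrier H" "S a \<in> carrier H" "Si a \<in> carrier H" "eps a \<in> carrier K"
  by (rule lin_maps_closed[OF linear_H(1) assms] lin_maps_closed[OF linear_H(2) assms]
    lin_maps_closed[OF linear_H(3) assms] lin_maps_closed[OF linear_H(4) assms]
    funcset_mem[OF counit_closed assms])+

lemma unt_closed [simp]: "unt \<in> carrier H" by (rule one_closed)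

lemma twist_inverse [simp]:
  assumes "a \<in> carrier H"
  shows "\<beta>' (\<beta>i a) = a" "\<beta>i (\<beta>' a) = a" "S (Si a) = a" "Si (S a) = a"
  using bij_twist bij_antipode assms
  by (simp_all add: twist_inv_def antipode_inv_def bij_betw_inv_into_left bij_betw_inv_into_right)

lemma otimes_closed [simp]: "a \<in> carrier H \<Longrightarrow> b \<in> carrier H \<Longrightarrow> a \<otimes>\<^bsub>H\<^esub> b \<in> carrier H"
  using bilinear_closed[OF mult_bilinear] .

lemma mul_bilinear: "bil H H H (\<star>)"
  unfolding mul_def
  by (intro bilinearI lin_comp[OF linear_H(2)] bilinear_right[OF mult_bilinear] bilinear_left[OF mult_bilinear])

lemma mul_closed [simp]: "a \<in> carrier H \<Longrightarrow> b \<in> carrier H \<Longrightarrow> a \<star> b \<in> carrier H"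
  by (simp add: mul_def)

lemma lin_mul [simp]:
  "a \<in> carrier H \<Longrightarrow> (\<star>) a \<in> LIN H H"
  "a \<in> carrier H \<Longrightarrow> g \<in> LIN X H \<Longrightarrow> (\<lambda>x. a \<star> g x) \<in> LIN X H"
  "b \<in> carrier H \<Longrightarrow> f \<in> LIN X H \<Longrightarrow> (\<lambda>x. f x \<star> b) \<in> LIN X H"
  by (rule bilinear_right[OF mul_bilinear] bil_right[OF mul_bilinear] bil_left[OF mul_bilinear]; assumption)+

lemma otimes_mul: "a \<in> carrier H \<Longrightarrow> b \<in> carrier H \<Longrightarrow> a \<otimes>\<^bsub>H\<^esub> b = \<beta>' (a \<star> b)"
  by (simp add: mul_def)

lemma twist_mul [simp]: "a \<in> carrier H \<Longrightarrow> b \<in> carrier H \<Longrightarrow> \<beta>' (a \<star> b) = \<beta>' a \<star> \<beta>' b"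
  by (simp add: mul_def twist_mult[symmetric])

lemma twist_inv_mul [simp]: "a \<in> carrier H \<Longrightarrow> b \<in> carrier H \<Longrightarrow> \<beta>i (a \<star> b) = \<beta>i a \<star> \<beta>i b"
  by (metis twist_mul closed_H(2) mul_closed twist_inverse(1,2))

lemma mul_assoc: 
  assumes "a \<in> carrier H" "b \<in> carrier H" "c \<in> carrier H"
  shows "a \<star> b \<star> c = a \<star> (b \<star> c)"
  \<comment> \<open>In Hom-associativity every factor passes through two twists on either side, so
    arguments with two inverse twists leave none.\<close>
  using hom_assoc[of "\<beta>i (\<beta>i a)" "\<beta>i (\<beta>i b)" "\<beta>i (\<beta>i c)"] assms by (simp add: otimes_mul)

lemma twist_unt [simp]: "\<beta>' unt = unt" "\<beta>i unt = unt"
  using twist_one twist_inverse(2)[of unt] by auto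

lemma mul_unt [simp]: "a \<in> carrier H \<Longrightarrow> unt \<star> a = a" "a \<in> carrier H \<Longrightarrow> a \<star> unt = a"
  by (simp_all add: mul_def one_mult mult_one)

lemma counit_mul [simp]: "a \<in> carrier H \<Longrightarrow> b \<in> carrier H \<Longrightarrow> eps (a \<star> b) = eps a \<otimes>\<^bsub>K\<^esub> eps b"
  using counit_twist[of "\<beta>i (a \<otimes>\<^bsub>H\<^esub> b)"] by (simp add: mul_def counit_mult)

lemma counit_twists [simp]: "a \<in> carrier H \<Longrightarrow> eps (\<beta>' a) = eps a" "a \<in> carrier H \<Longrightarrow> eps (\<beta>i a) = eps a"
  "eps unt = \<one>\<^bsub>K\<^esub>"
  using counit_twist[of a] counit_twist[of "\<beta>i a"] by (auto simp: counit_one)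

lemma lin_counit [simp]:
  assumes "md W" "w \<in> carrier W" "f \<in> LIN V H"
  shows "(\<lambda>x. eps (f x) \<odot>\<^bsub>W\<^esub> w) \<in> LIN V W"
proof -
  interpret W: module K W by fact
  have f: "f x \<in> carrier H" if "x \<in> carrier V" for x
    using lin_maps_closed[OF assms(3) that] .
  show ?thesis
  proof (rule lin_mapsI)
    show "eps (f x) \<odot>\<^bsub>W\<^esub> w \<in> carrier W" if "x \<in> carrier V" for x
      using assms(2) f[OF that] by simp
    show "eps (f (x \<oplus>\<^bsub>V\<^esub> y)) \<odot>\<^bsub>W\<^esub> w = eps (f x) \<odot>\<^bsub>W\<^esub> w \<oplus>\<^bsub>W\<^esub> eps (f y) \<odot>\<^bsub>W\<^esub> w"
      if "x \<in> carrier V" "y \<in> carrier V" for x y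
      using assms(2) f[OF that(1)] f[OF that(2)]
      by (simp only: lin_maps_add[OF assms(3) that] counit_add W.smult_l_distr closed_H)
    show "eps (f (c \<odot>\<^bsub>V\<^esub> x)) \<odot>\<^bsub>W\<^esub> w = c \<odot>\<^bsub>W\<^esub> (eps (f x) \<odot>\<^bsub>W\<^esub> w)"
      if "c \<in> carrier K" "x \<in> carrier V" for c x
      using assms(2) f[OF that(2)] that(1)
      by (simp only: lin_maps_smult[OF assms(3) that] counit_smult W.smult_assoc1 closed_H)
  qed
qed

section \<open>The untwisted coproduct and its laws\<close>

lemma com_linear: "\<delta> \<in> LIN H (tensor K H H)"
  unfolding com_def by (rule lin_comp[OF comult_linear linear_H(2)])

lemma lin_com [simp]: "\<delta> \<in> LIN H (tensor K H H)" "f \<in> LIN V H \<Longrightarrow> (\<lambda>x. \<delta> (f x)) \<in> LIN V (tensor K H H)"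
  by (simp_all add: com_linear lin_comp[OF com_linear])

lemma com_closed [simp]: "h \<in> carrier H \<Longrightarrow> \<delta> h \<in> carrier (tensor K H H)"
  using lin_maps_closed[OF com_linear] .

lemma comult_com: "h \<in> carrier H \<Longrightarrow> \<Delta>\<^bsub>H\<^esub> h = \<delta> (\<beta>' h)"
  by (simp add: com_def)

lemma sweedler_comult: "h \<in> carrier H \<Longrightarrow> sweedler W (\<Delta>\<^bsub>H\<^esub> h) \<phi> = DS W (\<beta>' h) \<phi>"
  by (simp add: comult_com sweedler_tsum[of H H])

lemma sweedler_com: "h \<in> carrier H \<Longrightarrow> sweedler W (\<delta> h) \<phi> = DS W h \<phi>"
  by (simp add: sweedler_tsum[of H H])

lemma DS_twist:
  assumes "h \<in> carrier H" "md W" "bil H H W \<phi>"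
  shows "DS W (\<beta>' h) \<phi> = DS W h (\<lambda>a b. \<phi> (\<beta>' a) (\<beta>' b))"
proof -
  have "\<delta> (\<beta>' h) = DS (tensor K H H) h (\<lambda>a b. tp H H (\<beta>' a) (\<beta>' b))"
    using comult_twist[of "\<beta>i h"] assms(1) com_closed[OF assms(1)]
    by (simp add: com_def sweedler_tsum[of H H])
  then show ?thesis using assms by simp
qed

lemma DS_twist_inv:
  assumes "h \<in> carrier H" "md W" "bil H H W \<phi>"
  shows "DS W (\<beta>i h) \<phi> = DS W h (\<lambda>a b. \<phi> (\<beta>i a) (\<beta>i b))"
proof -
  have "DS W (\<beta>' (\<beta>i h)) (\<lambda>a b. \<phi> (\<beta>i a) (\<beta>i b)) = DS W (\<beta>i h) \<phi>"
    using assms by (subst DS_twist) (auto simp del: bilinear_iff intro!: bilinearI bil_left[OF assms(3)] bil_right[OF assms(3)])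
  then show ?thesis using assms(1) by simp
qed

text \<open>An equation in H \<otimes> (H \<otimes> H) becomes usable by applying an arbitrary
  trilinear map to it. In curried form it regroups nested sums without mentioning iterated tensor
  spaces.\<close>

lemma DS_coassoc:
  assumes "h \<in> carrier H" "md W"
    and "\<And>a b. a \<in> carrier H \<Longrightarrow> b \<in> carrier H \<Longrightarrow> \<phi> a b \<in> LIN H W"
    and "\<And>a c. a \<in> carrier H \<Longrightarrow> c \<in> carrier H \<Longrightarrow> (\<lambda>b. \<phi> a b c) \<in> LIN H W"
    and "\<And>b c. b \<in> carrier H \<Longrightarrow> c \<in> carrier H \<Longrightarrow> (\<lambda>a. \<phi> a b c) \<in> LIN H W"
  shows "DS W h (\<lambda>a c. DS W a (\<lambda>a b. \<phi> a b c)) = DS W h (\<lambda>a b. DS W b (\<lambda>b c. \<phi> a b c))"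
proof -
  let ?T = "tensor K H (tensor K H H)"
  \<comment> \<open>The inverse twists cancel the one twist that Hom-coassociativity leaves on each
    leg.\<close>
  let ?\<psi> = "\<lambda>a b c. \<phi> (\<beta>i a) (\<beta>i b) (\<beta>i c)"
  note \<phi> = lin_comp[OF assms(3)] lin_comp[OF assms(4)] lin_comp[OF assms(5)]
  have cl: "\<phi> a b c \<in> carrier W" if "a \<in> carrier H" "b \<in> carrier H" "c \<in> carrier H" for a b c
    using lin_maps_closed[OF assms(3)] that .
  have "DS ?T h (\<lambda>a b. tp H (tensor K H H) (\<beta>' a) (\<delta> (\<beta>' b))) =
    DS ?T h (\<lambda>a c. DS ?T (\<beta>' a) (\<lambda>a b. tp H (tensor K H H) a (tp H H b (\<beta>' c))))"
    using hom_coassoc[of "\<beta>i h"] assms(1) by (simp add: sweedler_com comult_com)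
  then have "tsum H (tensor K H H) W (DS ?T h (\<lambda>a b. tp H (tensor K H H) (\<beta>' a) (\<delta> (\<beta>' b)))) (\<lambda>a s. tsum H H W s (?\<psi> a)) =
    tsum H (tensor K H H) W (DS ?T h (\<lambda>a c. DS ?T (\<beta>' a) (\<lambda>a b. tp H (tensor K H H) a (tp H H b (\<beta>' c))))) (\<lambda>a s. tsum H H W s (?\<psi> a))"
    by simp
  then show ?thesis
    using assms(1,2) by (simp add: DS_twist \<phi> assms(3-5) cl)
qed

lemma DS_counit_left [simp]:
  assumes "h \<in> carrier H" "md W" "f \<in> LIN H W"
  shows "DS W h (\<lambda>a b. eps a \<odot>\<^bsub>W\<^esub> f b) = f h"
proof -
  have "DS H h (\<lambda>a b. eps a \<odot>\<^bsub>H\<^esub> b) = h"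
    using counit_left[of "\<beta>i h"] assms(1) by (simp add: sweedler_comult)
  then have "f h = f (DS H h (\<lambda>a b. eps a \<odot>\<^bsub>H\<^esub> b))" by simp
  also have "\<dots> = DS W h (\<lambda>a b. eps a \<odot>\<^bsub>W\<^esub> f b)"
    using assms by (subst tsum_push[OF assms(3)]) (simp_all add: lin_maps_smult)
  finally show ?thesis by simp
qed

lemma DS_counit_right [simp]:
  assumes "h \<in> carrier H" "md W" "f \<in> LIN H W"
  shows "DS W h (\<lambda>a b. eps b \<odot>\<^bsub>W\<^esub> f a) = f h"
proof -
  have "DS H h (\<lambda>a b. eps b \<odot>\<^bsub>H\<^esub> a) = h"
    using counit_right[of "\<beta>i h"] assms(1) by (simp add: sweedler_comult)
  then have "f h = f (DS H h (\<lambda>a b. eps b \<odot>\<^bsub>H\<^esub> a))" by simp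
  also have "\<dots> = DS W h (\<lambda>a b. eps b \<odot>\<^bsub>W\<^esub> f a)"
    using assms by (subst tsum_push[OF assms(3)]) (simp_all add: lin_maps_smult)
  finally show ?thesis by simp
qed

lemma com_mul:
  assumes "h \<in> carrier H" "g \<in> carrier H"
  shows "\<delta> (h \<star> g) = DS (tensor K H H) h (\<lambda>h1 h2. DS (tensor K H H) g (\<lambda>g1 g2. tp H H (h1 \<star> g1) (h2 \<star> g2)))"
proof -
  have "\<beta>i (h \<star> g) = \<beta>i (\<beta>i h) \<otimes>\<^bsub>H\<^esub> \<beta>i (\<beta>i g)"
    using assms by (simp add: otimes_mul)
  then have "\<delta> (h \<star> g) = \<Delta>\<^bsub>H\<^esub> (\<beta>i (\<beta>i h) \<otimes>\<^bsub>H\<^esub> \<beta>i (\<beta>i g))"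
    by (simp only: com_def)
  also have "\<dots> = DS (tensor K H H) h (\<lambda>h1 h2. DS (tensor K H H) g (\<lambda>g1 g2. tp H H (h1 \<star> g1) (h2 \<star> g2)))"
    using assms by (subst comult_mult) (simp_all add: sweedler_comult DS_twist_inv otimes_mul)
  finally show ?thesis .
qed

lemma DS_mul:
  assumes "h \<in> carrier H" "g \<in> carrier H" "md W" "bil H H W \<phi>"
  shows "DS W (h \<star> g) \<phi> = DS W h (\<lambda>h1 h2. DS W g (\<lambda>g1 g2. \<phi> (h1 \<star> g1) (h2 \<star> g2)))"
  using assms by (simp add: com_mul)

lemma DS_unt [simp]: "md W \<Longrightarrow> bil H H W \<phi> \<Longrightarrow> DS W unt \<phi> = \<phi> unt unt"
  by (simp add: com_def comult_one)

section \<open>The antipode\<close>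

lemma DS_antipode_left:
  assumes "h \<in> carrier H" "md W" "f \<in> LIN H W"
  shows "DS W h (\<lambda>a b. f (S a \<star> b)) = eps h \<odot>\<^bsub>W\<^esub> f unt"
proof -
  have "DS H h (\<lambda>a b. \<beta>' (S a \<star> b)) = eps h \<odot>\<^bsub>H\<^esub> unt"
    using antipode_left[of "\<beta>i h"] assms(1) by (simp add: sweedler_comult otimes_mul)
  then have "\<beta>i (DS H h (\<lambda>a b. \<beta>' (S a \<star> b))) = eps h \<odot>\<^bsub>H\<^esub> unt"
    using assms by (simp add: lin_maps_smult[OF linear_H(2)])
  then have "DS H h (\<lambda>a b. S a \<star> b) = eps h \<odot>\<^bsub>H\<^esub> unt"
    using assms by (subst (asm) tsum_push[OF linear_H(2)]) (simp_all del: twist_mul)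
  \<comment> \<open>The linear map f stands for a surrounding expression, so that the axiom can be
    used deep inside a nested sum.\<close>
  then have "f (DS H h (\<lambda>a b. S a \<star> b)) = eps h \<odot>\<^bsub>W\<^esub> f unt"
    using assms by (simp add: lin_maps_smult[OF assms(3)])
  then show ?thesis
    using assms by (subst (asm) tsum_push[OF assms(3)]) simp_all
qed

lemma DS_antipode_right:
  assumes "h \<in> carrier H" "md W" "f \<in> LIN H W"
  shows "DS W h (\<lambda>a b. f (a \<star> S b)) = eps h \<odot>\<^bsub>W\<^esub> f unt"
proof -
  have "DS H h (\<lambda>a b. \<beta>' (a \<star> S b)) = eps h \<odot>\<^bsub>H\<^esub> unt"
    using antipode_right[of "\<beta>i h"] assms(1) by (simp add: sweedler_comult otimes_mul)
  then have "\<beta>i (DS H h (\<lambda>a b. \<beta>' (a \<star> S b))) = eps h \<odot>\<^bsub>H\<^esub> unt"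
    using assms by (simp add: lin_maps_smult[OF linear_H(2)])
  then have "DS H h (\<lambda>a b. a \<star> S b) = eps h \<odot>\<^bsub>H\<^esub> unt"
    using assms by (subst (asm) tsum_push[OF linear_H(2)]) (simp_all del: twist_mul)
  then have "f (DS H h (\<lambda>a b. a \<star> S b)) = eps h \<odot>\<^bsub>W\<^esub> f unt"
    using assms by (simp add: lin_maps_smult[OF assms(3)])
  then show ?thesis
    using assms by (subst (asm) tsum_push[OF assms(3)]) simp_all
qed

lemma antipode_twists [simp]: "a \<in> carrier H \<Longrightarrow> S (\<beta>' a) = \<beta>' (S a)"
  by (rule antipode_twist)

lemma antipode_unt [simp]: "S unt = unt" "Si unt = unt"
proof -
  have "DS H unt (\<lambda>a b. S a \<star> b) = eps unt \<odot>\<^bsub>H\<^esub> unt"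
    by (rule DS_antipode_left[of unt H "\<lambda>x. x"]) simp_all
  then show "S unt = unt" by simp
  then show "Si unt = unt" by (metis twist_inverse(4) unt_closed)
qed

text \<open>eps(S h) = eps(S h1) eps(h2) = eps(S(h1) h2) = eps(h). The computation runs on multiples
  of \<open>unt\<close>, since Sweedler sums take values in a module; applying \<open>eps\<close>
  recovers the scalars.\<close>

lemma counit_antipode [simp]:
  assumes "h \<in> carrier H" shows "eps (S h) = eps h"
proof -
  have "eps (S h) \<odot>\<^bsub>H\<^esub> unt = DS H h (\<lambda>a b. eps b \<odot>\<^bsub>H\<^esub> (eps (S a) \<odot>\<^bsub>H\<^esub> unt))"
    by (rule DS_counit_right[symmetric]) (simp_all add: assms)
  also have "\<dots> = DS H h (\<lambda>a b. eps (S a \<star> b) \<odot>\<^bsub>H\<^esub> unt)"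
  proof (rule tsum_cong)
    fix a b assume "a \<in> carrier H" "b \<in> carrier H"
    then show "eps b \<odot>\<^bsub>H\<^esub> (eps (S a) \<odot>\<^bsub>H\<^esub> unt) = eps (S a \<star> b) \<odot>\<^bsub>H\<^esub> unt"
      by (subst H.smult_assoc1[symmetric]) (simp_all add: K.m_comm)
  qed
  also have "\<dots> = eps h \<odot>\<^bsub>H\<^esub> (eps unt \<odot>\<^bsub>H\<^esub> unt)"
    by (rule DS_antipode_left[of h H "\<lambda>x. eps x \<odot>\<^bsub>H\<^esub> unt"]) (simp_all add: assms)
  finally have "eps (eps (S h) \<odot>\<^bsub>H\<^esub> unt) = eps (eps h \<odot>\<^bsub>H\<^esub> unt)" by simp
  then show ?thesis
    using assms by (simp only: counit_smult closed_H unt_closed counit_twists K.r_one)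
qed


text \<open>Both sides arise from \<open>S(a\<^sub>1b\<^sub>1)(a\<^sub>2b\<^sub>2)(S(b\<^sub>3)S(a\<^sub>3))\<close>.\<close>

lemma antipode_mul:
  assumes a: "a \<in> carrier H" and b: "b \<in> carrier H"
  shows "S (a \<star> b) = S b \<star> S a"
proof -
  let ?X = "\<lambda>a1 a2 a3 b1 b2 b3. S (a1 \<star> b1) \<star> ((a2 \<star> b2) \<star> (S b3 \<star> S a3))"
  have "S (a \<star> b) = DS H a (\<lambda>a1 a'. eps a' \<odot>\<^bsub>H\<^esub> S (a1 \<star> b))"
    using assms by simp
  also have "\<dots> = DS H a (\<lambda>a1 a'. DS H b (\<lambda>b1 b'. eps b' \<odot>\<^bsub>H\<^esub> (eps a' \<odot>\<^bsub>H\<^esub> S (a1 \<star> b1))))"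
    using assms by (intro tsum_cong) simp
  also have "\<dots> = DS H a (\<lambda>a1 a'. DS H b (\<lambda>b1 b'. DS H a' (\<lambda>a2 a3. DS H b' (\<lambda>b2 b3. ?X a1 a2 a3 b1 b2 b3))))"
  proof (intro tsum_cong)
    fix a1 a' b1 b' assume c: "a1 \<in> carrier H" "a' \<in> carrier H" "b1 \<in> carrier H" "b' \<in> carrier H"
    have "DS H b' (\<lambda>b2 b3. ?X a1 a2 a3 b1 b2 b3) = eps b' \<odot>\<^bsub>H\<^esub> (S (a1 \<star> b1) \<star> (a2 \<star> S a3))"
      if "a2 \<in> carrier H" "a3 \<in> carrier H" for a2 a3
      using c that DS_antipode_right[of b' H "\<lambda>x. S (a1 \<star> b1) \<star> (a2 \<star> (x \<star> S a3))"]
      by (simp add: mul_assoc)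
    moreover have "DS H a' (\<lambda>a2 a3. eps b' \<odot>\<^bsub>H\<^esub> (S (a1 \<star> b1) \<star> (a2 \<star> S a3))) = eps a' \<odot>\<^bsub>H\<^esub> (eps b' \<odot>\<^bsub>H\<^esub> S (a1 \<star> b1))"
      using c DS_antipode_right[of a' H "\<lambda>x. eps b' \<odot>\<^bsub>H\<^esub> (S (a1 \<star> b1) \<star> x)"] by simp
    ultimately have *: "DS H a' (\<lambda>a2 a3. DS H b' (\<lambda>b2 b3. ?X a1 a2 a3 b1 b2 b3)) = eps a' \<odot>\<^bsub>H\<^esub> (eps b' \<odot>\<^bsub>H\<^esub> S (a1 \<star> b1))"
      by (simp cong: tsum_cong)
    have "eps b' \<odot>\<^bsub>H\<^esub> (eps a' \<odot>\<^bsub>H\<^esub> S (a1 \<star> b1)) = eps a' \<odot>\<^bsub>H\<^esub> (eps b' \<odot>\<^bsub>H\<^esub> S (a1 \<star> b1))"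
      using c by (simp only: H.smult_assoc1[symmetric] closed_H mul_closed K.m_comm[of "eps a'"])
    with * show "eps b' \<odot>\<^bsub>H\<^esub> (eps a' \<odot>\<^bsub>H\<^esub> S (a1 \<star> b1)) = DS H a' (\<lambda>a2 a3. DS H b' (\<lambda>b2 b3. ?X a1 a2 a3 b1 b2 b3))"
      by simp
  qed
  \<comment> \<open>The grouping so far joins the last two legs of a and of b, where a3 and b3
    cancel a2 and b2. The coproducts are now regrouped so that the first two legs are joined; their
    products form the coproduct of \<open>a' \<star> b'\<close>.\<close>
  also have "\<dots> = DS H b (\<lambda>b1 b'. DS H a (\<lambda>a1 a'. DS H a' (\<lambda>a2 a3. DS H b' (\<lambda>b2 b3. ?X a1 a2 a3 b1 b2 b3))))"
    using assms by (intro tsum_swap) simp_all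
  also have "\<dots> = DS H b (\<lambda>b1 b'. DS H a (\<lambda>a' a3. DS H a' (\<lambda>a1 a2. DS H b' (\<lambda>b2 b3. ?X a1 a2 a3 b1 b2 b3))))"
    using assms by (intro tsum_cong DS_coassoc[symmetric]) simp_all
  also have "\<dots> = DS H a (\<lambda>a' a3. DS H b (\<lambda>b1 b'. DS H a' (\<lambda>a1 a2. DS H b' (\<lambda>b2 b3. ?X a1 a2 a3 b1 b2 b3))))"
    using assms by (intro tsum_swap) simp_all
  also have "\<dots> = DS H a (\<lambda>a' a3. DS H b (\<lambda>b1 b'. DS H b' (\<lambda>b2 b3. DS H a' (\<lambda>a1 a2. ?X a1 a2 a3 b1 b2 b3))))"
    using assms by (intro tsum_cong tsum_swap) simp_all
  also have "\<dots> = DS H a (\<lambda>a' a3. DS H b (\<lambda>b' b3. DS H b' (\<lambda>b1 b2. DS H a' (\<lambda>a1 a2. ?X a1 a2 a3 b1 b2 b3))))"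
    using assms by (intro tsum_cong DS_coassoc[symmetric]) simp_all
  also have "\<dots> = DS H a (\<lambda>a' a3. DS H b (\<lambda>b' b3. eps (a' \<star> b') \<odot>\<^bsub>H\<^esub> (S b3 \<star> S a3)))"
  proof (intro tsum_cong)
    fix a' a3 b' b3 assume c: "a' \<in> carrier H" "a3 \<in> carrier H" "b' \<in> carrier H" "b3 \<in> carrier H"
    have "DS H b' (\<lambda>b1 b2. DS H a' (\<lambda>a1 a2. ?X a1 a2 a3 b1 b2 b3)) = DS H a' (\<lambda>a1 a2. DS H b' (\<lambda>b1 b2. ?X a1 a2 a3 b1 b2 b3))"
      using c by (intro tsum_swap) simp_all
    also have "\<dots> = DS H (a' \<star> b') (\<lambda>u v. S u \<star> (v \<star> (S b3 \<star> S a3)))"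
      using c by (simp add: DS_mul)
    also have "\<dots> = eps (a' \<star> b') \<odot>\<^bsub>H\<^esub> (S b3 \<star> S a3)"
      using c DS_antipode_left[of "a' \<star> b'" H "\<lambda>x. x \<star> (S b3 \<star> S a3)"] by (simp add: mul_assoc)
    finally show "DS H b' (\<lambda>b1 b2. DS H a' (\<lambda>a1 a2. ?X a1 a2 a3 b1 b2 b3)) = eps (a' \<star> b') \<odot>\<^bsub>H\<^esub> (S b3 \<star> S a3)" .
  qed
  also have "\<dots> = DS H a (\<lambda>a' a3. eps a' \<odot>\<^bsub>H\<^esub> (DS H b (\<lambda>b' b3. eps b' \<odot>\<^bsub>H\<^esub> (S b3 \<star> S a3))))"
    using assms by (intro tsum_cong) (simp add: tsum_push[of "(\<odot>\<^bsub>H\<^esub>) (eps _)" H H] H.smult_assoc1 del: DS_counit_left)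
  also have "\<dots> = S b \<star> S a" using assms by simp
  finally show ?thesis .
qed

text \<open>Both sides arise from \<open>\<phi>(S(h\<^sub>1)\<^sub>1 h\<^sub>2 S(h\<^sub>5), S(h\<^sub>1)\<^sub>2 h\<^sub>3 S(h\<^sub>4))\<close>.\<close>

lemma DS_antipode:
  assumes h: "h \<in> carrier H" and W: "md W" and \<phi>: "bil H H W \<phi>"
  shows "DS W (S h) \<phi> = DS W h (\<lambda>a b. \<phi> (S b) (S a))"
proof -
  note [simp] = W bil_left[OF \<phi>] bil_right[OF \<phi>] bilinear_closed[OF \<phi>] \<phi>[unfolded bilinear_iff]
  let ?X = "\<lambda>u v p q c d. \<phi> (u \<star> (p \<star> S d)) (v \<star> (q \<star> S c))"
  \<comment> \<open>The four legs of z, in the order p, q, c, d, cancel from the inside out: q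
    against S c, then p against S d.\<close>
  have 1: "DS W z (\<lambda>g y. DS W y (\<lambda>c d. DS W g (\<lambda>p q. ?X u v p q c d))) = eps z \<odot>\<^bsub>W\<^esub> \<phi> u v"
    if "z \<in> carrier H" "u \<in> carrier H" "v \<in> carrier H" for z u v
  proof -
    have "DS W z (\<lambda>g y. DS W y (\<lambda>c d. DS W g (\<lambda>p q. ?X u v p q c d))) =
      DS W z (\<lambda>g y. DS W g (\<lambda>p q. DS W y (\<lambda>c d. ?X u v p q c d)))"
      using that by (intro tsum_cong tsum_swap) simp_all
    also have "\<dots> = DS W z (\<lambda>p x. DS W x (\<lambda>q y. DS W y (\<lambda>c d. ?X u v p q c d)))"
      using that by (intro DS_coassoc) simp_all
    also have "\<dots> = DS W z (\<lambda>p x. DS W x (\<lambda>t d. DS W t (\<lambda>q c. ?X u v p q c d)))"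
      using that by (intro tsum_cong DS_coassoc[symmetric]) simp_all
    also have "\<dots> = DS W z (\<lambda>p x. DS W x (\<lambda>t d. eps t \<odot>\<^bsub>W\<^esub> \<phi> (u \<star> (p \<star> S d)) v))"
    proof (intro tsum_cong)
      fix p x t d assume "p \<in> carrier H" "x \<in> carrier H" "t \<in> carrier H" "d \<in> carrier H"
      then show "DS W t (\<lambda>q c. ?X u v p q c d) = eps t \<odot>\<^bsub>W\<^esub> \<phi> (u \<star> (p \<star> S d)) v"
        using that DS_antipode_right[of t W "\<lambda>x. \<phi> (u \<star> (p \<star> S d)) (v \<star> x)"] by simp
    qed
    also have "\<dots> = DS W z (\<lambda>p x. \<phi> (u \<star> (p \<star> S x)) v)"
      using that by (intro tsum_cong) simp
    also have "\<dots> = eps z \<odot>\<^bsub>W\<^esub> \<phi> u v"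
      using that DS_antipode_right[of z W "\<lambda>x. \<phi> (u \<star> x) v"] by simp
    finally show ?thesis .
  qed
  have "DS W (S h) \<phi> = DS W h (\<lambda>x z. eps z \<odot>\<^bsub>W\<^esub> DS W (S x) \<phi>)"
    using h by simp
  also have "\<dots> = DS W h (\<lambda>x z. DS W (S x) (\<lambda>u v. eps z \<odot>\<^bsub>W\<^esub> \<phi> u v))"
    by (intro tsum_cong tsum_push[of "(\<odot>\<^bsub>W\<^esub>) (eps _)" W W]) simp_all
  also have "\<dots> = DS W h (\<lambda>x z. DS W (S x) (\<lambda>u v. DS W z (\<lambda>g y. DS W y (\<lambda>c d. DS W g (\<lambda>p q. ?X u v p q c d)))))"
    by (intro tsum_cong 1[symmetric])
  also have "\<dots> = DS W h (\<lambda>x z. DS W z (\<lambda>g y. DS W (S x) (\<lambda>u v. DS W y (\<lambda>c d. DS W g (\<lambda>p q. ?X u v p q c d)))))"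
    by (intro tsum_cong tsum_swap) simp_all
  also have "\<dots> = DS W h (\<lambda>t y. DS W t (\<lambda>x g. DS W (S x) (\<lambda>u v. DS W y (\<lambda>c d. DS W g (\<lambda>p q. ?X u v p q c d)))))"
    using h by (intro DS_coassoc[symmetric]) simp_all
  also have "\<dots> = DS W h (\<lambda>t y. DS W t (\<lambda>x g. DS W y (\<lambda>c d. DS W (S x) (\<lambda>u v. DS W g (\<lambda>p q. ?X u v p q c d)))))"
    by (intro tsum_cong tsum_swap) simp_all
  also have "\<dots> = DS W h (\<lambda>t y. DS W y (\<lambda>c d. DS W t (\<lambda>x g. DS W (S x) (\<lambda>u v. DS W g (\<lambda>p q. ?X u v p q c d)))))"
    by (intro tsum_cong tsum_swap) simp_all
  also have "\<dots> = DS W h (\<lambda>t y. DS W y (\<lambda>c d. eps t \<odot>\<^bsub>W\<^esub> \<phi> (S d) (S c)))"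
  proof (intro tsum_cong)
    fix t y c d assume c: "t \<in> carrier H" "y \<in> carrier H" "c \<in> carrier H" "d \<in> carrier H"
    \<comment> \<open>Multiplicativity merges the coproducts of S x and g into that of
      \<open>S x \<star> g\<close>, which the antipode axiom for t removes.\<close>
    have "DS W t (\<lambda>x g. DS W (S x) (\<lambda>u v. DS W g (\<lambda>p q. ?X u v p q c d))) = DS W t (\<lambda>x g. DS W (S x \<star> g) (\<lambda>u v. \<phi> (u \<star> S d) (v \<star> S c)))"
      using c by (intro tsum_cong) (simp add: DS_mul mul_assoc)
    also have "\<dots> = eps t \<odot>\<^bsub>W\<^esub> \<phi> (S d) (S c)"
      using c DS_antipode_left[of t W "\<lambda>x. DS W x (\<lambda>u v. \<phi> (u \<star> S d) (v \<star> S c))"] by simp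
    finally show "DS W t (\<lambda>x g. DS W (S x) (\<lambda>u v. DS W g (\<lambda>p q. ?X u v p q c d))) = eps t \<odot>\<^bsub>W\<^esub> \<phi> (S d) (S c)" .
  qed
  also have "\<dots> = DS W h (\<lambda>t y. eps t \<odot>\<^bsub>W\<^esub> DS W y (\<lambda>c d. \<phi> (S d) (S c)))"
    by (intro tsum_cong tsum_push[of "(\<odot>\<^bsub>W\<^esub>) (eps _)" W W, symmetric]) simp_all
  also have "\<dots> = DS W h (\<lambda>c d. \<phi> (S d) (S c))"
    using h by simp
  finally show ?thesis .
qed

section \<open>The inverse antipode\<close>

lemma antipode_inv_twist [simp]: "a \<in> carrier H \<Longrightarrow> Si (\<beta>' a) = \<beta>' (Si a)"
  by (metis antipode_twists closed_H(1,4) twist_inverse(3,4))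

lemma antipode_twist_inv [simp]: "a \<in> carrier H \<Longrightarrow> S (\<beta>i a) = \<beta>i (S a)"
  by (metis antipode_twists closed_H(2,3) twist_inverse(1,2))

lemma antipode_inv_twist_inv [simp]: "a \<in> carrier H \<Longrightarrow> Si (\<beta>i a) = \<beta>i (Si a)"
  by (metis antipode_inv_twist closed_H(2,4) twist_inverse(1,2))

lemma antipode_inv_mul:
  assumes "a \<in> carrier H" "b \<in> carrier H"
  shows "Si (a \<star> b) = Si b \<star> Si a"
  using assms by (metis antipode_mul closed_H(4) mul_closed twist_inverse(3,4))

lemma counit_antipode_inv [simp]: "h \<in> carrier H \<Longrightarrow> eps (Si h) = eps h"
  by (metis counit_antipode closed_H(4) twist_inverse(3))

lemma DS_antipode_inv:
  assumes h: "h \<in> carrier H" and W: "md W" and \<phi>: "bil H H W \<phi>"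
  shows "DS W (Si h) \<phi> = DS W h (\<lambda>a b. \<phi> (Si b) (Si a))"
proof -
  note [simp] = W bil_left[OF \<phi>] bil_right[OF \<phi>] bilinear_closed[OF \<phi>] \<phi>[unfolded bilinear_iff]
  have "DS W (S (Si h)) (\<lambda>a b. \<phi> (Si b) (Si a)) = DS W (Si h) \<phi>"
    using h by (subst DS_antipode) simp_all
  then show ?thesis using h by simp
qed

text \<open>For h = S g the legs are reversed by \<open>DS_antipode\<close>, so S^-1(h2) h1 becomes
  g1 S(g2). In other words, the inverse antipode is the antipode of the co-opposite Hopf
  algebra.\<close>

lemma DS_antipode_inv_left:
  assumes "h \<in> carrier H" "md W" "f \<in> LIN H W"
  shows "DS W h (\<lambda>a b. f (Si b \<star> a)) = eps h \<odot>\<^bsub>W\<^esub> f unt"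
proof -
  note [simp] = lin_comp[OF assms(3)] assms(3)
  have "DS W h (\<lambda>a b. f (Si b \<star> a)) = DS W (S (Si h)) (\<lambda>a b. f (Si b \<star> a))"
    using assms by simp
  also have "\<dots> = DS W (Si h) (\<lambda>a b. f (a \<star> S b))"
    using assms by (subst DS_antipode) simp_all
  also have "\<dots> = eps h \<odot>\<^bsub>W\<^esub> f unt"
    using assms by (subst DS_antipode_right) simp_all
  finally show ?thesis .
qed

lemma DS_antipode_inv_right:
  assumes "h \<in> carrier H" "md W" "f \<in> LIN H W"
  shows "DS W h (\<lambda>a b. f (b \<star> Si a)) = eps h \<odot>\<^bsub>W\<^esub> f unt"
proof -
  note [simp] = lin_comp[OF assms(3)] assms(3)
  have "DS W h (\<lambda>a b. f (b \<star> Si a)) = DS W (S (Si h)) (\<lambda>a b. f (b \<star> Si a))"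
    using assms by simp
  also have "\<dots> = DS W (Si h) (\<lambda>a b. f (S a \<star> b))"
    using assms by (subst DS_antipode) simp_all
  also have "\<dots> = eps h \<odot>\<^bsub>W\<^esub> f unt"
    using assms by (subst DS_antipode_left) simp_all
  finally show ?thesis .
qed

section \<open>Untwisting four-angle Hopf modules\<close>

abbreviation "obj M \<equiv> four_angle_hopf_module K H M"
abbreviation "\<zeta>i M \<equiv> zeta_inv M"

definition lac where "lac M h m = \<zeta>i M (h \<triangleright>\<^bsub>M\<^esub> m)"
definition rac where "rac M m h = \<zeta>i M (m \<triangleleft>\<^bsub>M\<^esub> h)"
definition lco where "lco M m = \<rho>\<^sup>l\<^bsub>M\<^esub> (\<zeta>i M m)"
definition rco where "rco M m = \<rho>\<^sup>r\<^bsub>M\<^esub> (\<zeta>i M m)"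

abbreviation "LS M W m \<phi> \<equiv> tsum H M W (lco M m) \<phi>"
abbreviation "RS M W m \<phi> \<equiv> tsum M H W (rco M m) \<phi>"

section \<open>Untwisted actions and coactions\<close>

lemma md_obj [simp]: "obj M \<Longrightarrow> md M"
  by (simp add: four_angle_hopf_module_def hom_bimodule_def left_hom_module_def hom_space_def)

context
  fixes M assumes M: "obj M"
begin

interpretation M: four_angle_hopf_module K H M by (rule M)

lemma zeta_linear [simp]: "\<zeta>\<^bsub>M\<^esub> \<in> LIN M M" "\<zeta>i M \<in> LIN M M"
  using lin_inv_into[OF M.zeta_linear M.zeta_bij md_obj[OF M]] M.zeta_linear
  by (simp_all add: zeta_inv_def)

lemma lin_zeta [simp]:
  "f \<in> LIN V M \<Longrightarrow> (\<lambda>x. \<zeta>\<^bsub>M\<^esub> (f x)) \<in> LIN V M"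
  "f \<in> LIN V M \<Longrightarrow> (\<lambda>x. \<zeta>i M (f x)) \<in> LIN V M"
  by (rule lin_comp[OF zeta_linear(1)] lin_comp[OF zeta_linear(2)]; assumption)+

lemma zeta_closed [simp]:
  assumes "m \<in> carrier M" shows "\<zeta>\<^bsub>M\<^esub> m \<in> carrier M" "\<zeta>i M m \<in> carrier M"
  using lin_maps_closed[OF zeta_linear(1) assms] lin_maps_closed[OF zeta_linear(2) assms] .

lemma zeta_inverse [simp]:
  assumes "m \<in> carrier M" shows "\<zeta>\<^bsub>M\<^esub> (\<zeta>i M m) = m" "\<zeta>i M (\<zeta>\<^bsub>M\<^esub> m) = m"
  using M.zeta_bij assms
  by (simp_all add: zeta_inv_def bij_betw_inv_into_left bij_betw_inv_into_right)

lemma lact_closed: "h \<in> carrier H \<Longrightarrow> m \<in> carrier M \<Longrightarrow> h \<triangleright>\<^bsub>M\<^esub> m \<in> carrier M"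
  using bilinear_closed[OF M.lact_bilinear] .

lemma ract_closed: "h \<in> carrier H \<Longrightarrow> m \<in> carrier M \<Longrightarrow> m \<triangleleft>\<^bsub>M\<^esub> h \<in> carrier M"
  using bilinear_closed[OF M.ract_bilinear] .

lemma lac_bilinear: "bil H M M (lac M)"
  unfolding lac_def
  by (intro bilinearI lin_comp[OF zeta_linear(2)] bilinear_right[OF M.lact_bilinear] bilinear_left[OF M.lact_bilinear])

lemma rac_bilinear: "bil M H M (rac M)"
  unfolding rac_def
  by (intro bilinearI lin_comp[OF zeta_linear(2)] bilinear_right[OF M.ract_bilinear] bilinear_left[OF M.ract_bilinear])

lemma lac_closed [simp]: "h \<in> carrier H \<Longrightarrow> m \<in> carrier M \<Longrightarrow> lac M h m \<in> carrier M"
  using bilinear_closed[OF lac_bilinear] .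

lemma rac_closed [simp]: "m \<in> carrier M \<Longrightarrow> h \<in> carrier H \<Longrightarrow> rac M m h \<in> carrier M"
  using bilinear_closed[OF rac_bilinear] .

lemma lin_lac [simp]:
  "h \<in> carrier H \<Longrightarrow> lac M h \<in> LIN M M"
  "h \<in> carrier H \<Longrightarrow> g \<in> LIN X M \<Longrightarrow> (\<lambda>x. lac M h (g x)) \<in> LIN X M"
  "m \<in> carrier M \<Longrightarrow> f \<in> LIN X H \<Longrightarrow> (\<lambda>x. lac M (f x) m) \<in> LIN X M"
  by (rule bilinear_right[OF lac_bilinear] bil_right[OF lac_bilinear] bil_left[OF lac_bilinear]; assumption)+

lemma lin_rac [simp]:
  "m \<in> carrier M \<Longrightarrow> rac M m \<in> LIN H M"
  "m \<in> carrier M \<Longrightarrow> g \<in> LIN X H \<Longrightarrow> (\<lambda>x. rac M m (g x)) \<in> LIN X M"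
  "h \<in> carrier H \<Longrightarrow> f \<in> LIN X M \<Longrightarrow> (\<lambda>x. rac M (f x) h) \<in> LIN X M"
  by (rule bilinear_right[OF rac_bilinear] bil_right[OF rac_bilinear] bil_left[OF rac_bilinear]; assumption)+

lemma lact_lac: "h \<in> carrier H \<Longrightarrow> m \<in> carrier M \<Longrightarrow> h \<triangleright>\<^bsub>M\<^esub> m = \<zeta>\<^bsub>M\<^esub> (lac M h m)"
  by (simp add: lac_def lact_closed)

lemma ract_rac: "h \<in> carrier H \<Longrightarrow> m \<in> carrier M \<Longrightarrow> m \<triangleleft>\<^bsub>M\<^esub> h = \<zeta>\<^bsub>M\<^esub> (rac M m h)"
  by (simp add: rac_def ract_closed)

lemma zeta_lac [simp]: "h \<in> carrier H \<Longrightarrow> m \<in> carrier M \<Longrightarrow> \<zeta>\<^bsub>M\<^esub> (lac M h m) = lac M (\<beta>' h) (\<zeta>\<^bsub>M\<^esub> m)"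
  by (simp add: lac_def lact_closed M.zeta_lact[symmetric])

lemma zeta_rac [simp]: "h \<in> carrier H \<Longrightarrow> m \<in> carrier M \<Longrightarrow> \<zeta>\<^bsub>M\<^esub> (rac M m h) = rac M (\<zeta>\<^bsub>M\<^esub> m) (\<beta>' h)"
  by (simp add: rac_def ract_closed M.zeta_ract[symmetric])

lemma zeta_inv_lac [simp]: "h \<in> carrier H \<Longrightarrow> m \<in> carrier M \<Longrightarrow> \<zeta>i M (lac M h m) = lac M (\<beta>i h) (\<zeta>i M m)"
  using zeta_lac[of "\<beta>i h" "\<zeta>i M m"] zeta_inverse(2)[of "lac M (\<beta>i h) (\<zeta>i M m)"] by simp

lemma zeta_inv_rac [simp]: "h \<in> carrier H \<Longrightarrow> m \<in> carrier M \<Longrightarrow> \<zeta>i M (rac M m h) = rac M (\<zeta>i M m) (\<beta>i h)"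
  using zeta_rac[of "\<beta>i h" "\<zeta>i M m"] zeta_inverse(2)[of "rac M (\<zeta>i M m) (\<beta>i h)"] by simp

lemma lac_unt [simp]: "m \<in> carrier M \<Longrightarrow> lac M unt m = m"
  by (simp add: lac_def M.one_lact)

lemma rac_unt [simp]: "m \<in> carrier M \<Longrightarrow> rac M m unt = m"
  by (simp add: rac_def M.ract_one)

lemma lac_mul: "a \<in> carrier H \<Longrightarrow> b \<in> carrier H \<Longrightarrow> m \<in> carrier M \<Longrightarrow> lac M (a \<star> b) m = lac M a (lac M b m)"
  using arg_cong[OF M.lact_assoc[of "\<beta>i (\<beta>i a)" "\<beta>i (\<beta>i b)" "\<zeta>i M (\<zeta>i M m)"], of "\<lambda>x. x"]
  by (simp add: lact_lac otimes_mul)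

lemma rac_mul: "a \<in> carrier H \<Longrightarrow> b \<in> carrier H \<Longrightarrow> m \<in> carrier M \<Longrightarrow> rac M m (a \<star> b) = rac M (rac M m a) b"
  using M.ract_assoc[of "\<zeta>i M (\<zeta>i M m)" "\<beta>i (\<beta>i a)" "\<beta>i (\<beta>i b)"]
  by (simp add: ract_rac otimes_mul)

lemma lac_rac: "a \<in> carrier H \<Longrightarrow> b \<in> carrier H \<Longrightarrow> m \<in> carrier M \<Longrightarrow> lac M a (rac M m b) = rac M (lac M a m) b"
  using M.lact_ract[of "\<beta>i (\<beta>i a)" "\<zeta>i M (\<zeta>i M m)" "\<beta>i (\<beta>i b)"]
  by (simp add: ract_rac lact_lac)

lemma lco_linear [simp]: "lco M \<in> LIN M (tensor K H M)" "f \<in> LIN V M \<Longrightarrow> (\<lambda>x. lco M (f x)) \<in> LIN V (tensor K H M)"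
proof -
  show "lco M \<in> LIN M (tensor K H M)"
    unfolding lco_def by (rule lin_comp[OF M.lcoact_linear zeta_linear(2)])
  then show "f \<in> LIN V M \<Longrightarrow> (\<lambda>x. lco M (f x)) \<in> LIN V (tensor K H M)" by (rule lin_comp)
qed

lemma rco_linear [simp]: "rco M \<in> LIN M (tensor K M H)" "f \<in> LIN V M \<Longrightarrow> (\<lambda>x. rco M (f x)) \<in> LIN V (tensor K M H)"
proof -
  show "rco M \<in> LIN M (tensor K M H)"
    unfolding rco_def by (rule lin_comp[OF M.rcoact_linear zeta_linear(2)])
  then show "f \<in> LIN V M \<Longrightarrow> (\<lambda>x. rco M (f x)) \<in> LIN V (tensor K M H)" by (rule lin_comp)
qed

lemma lco_closed [simp]: "m \<in> carrier M \<Longrightarrow> lco M m \<in> carrier (tensor K H M)"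
  using lin_maps_closed[OF lco_linear(1)] .

lemma rco_closed [simp]: "m \<in> carrier M \<Longrightarrow> rco M m \<in> carrier (tensor K M H)"
  using lin_maps_closed[OF rco_linear(1)] .

lemma lcoact_lco: "m \<in> carrier M \<Longrightarrow> \<rho>\<^sup>l\<^bsub>M\<^esub> m = lco M (\<zeta>\<^bsub>M\<^esub> m)"
  by (simp add: lco_def)

lemma rcoact_rco: "m \<in> carrier M \<Longrightarrow> \<rho>\<^sup>r\<^bsub>M\<^esub> m = rco M (\<zeta>\<^bsub>M\<^esub> m)"
  by (simp add: rco_def)

lemma sweedler_lco: "m \<in> carrier M \<Longrightarrow> sweedler W (lco M m) \<phi> = LS M W m \<phi>"
  using md_obj[OF M] by (simp add: sweedler_tsum[of H M])

lemma sweedler_rco: "m \<in> carrier M \<Longrightarrow> sweedler W (rco M m) \<phi> = RS M W m \<phi>"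
  using md_obj[OF M] by (simp add: sweedler_tsum[of M H])

section \<open>Comodule laws for Sweedler sums\<close>

lemma LS_zeta:
  assumes "m \<in> carrier M" "md W" "bil H M W \<phi>"
  shows "LS M W (\<zeta>\<^bsub>M\<^esub> m) \<phi> = LS M W m (\<lambda>a x. \<phi> (\<beta>' a) (\<zeta>\<^bsub>M\<^esub> x))"
proof -
  have "lco M (\<zeta>\<^bsub>M\<^esub> m) = LS M (tensor K H M) m (\<lambda>a x. tp H M (\<beta>' a) (\<zeta>\<^bsub>M\<^esub> x))"
    using M.lcoact_zeta[of "\<zeta>i M m"] assms(1) by (simp add: lcoact_lco sweedler_lco)
  then show ?thesis using assms md_obj[OF M] by simp
qed

lemma RS_zeta:
  assumes "m \<in> carrier M" "md W" "bil M H W \<phi>"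
  shows "RS M W (\<zeta>\<^bsub>M\<^esub> m) \<phi> = RS M W m (\<lambda>x a. \<phi> (\<zeta>\<^bsub>M\<^esub> x) (\<beta>' a))"
proof -
  have "rco M (\<zeta>\<^bsub>M\<^esub> m) = RS M (tensor K M H) m (\<lambda>x a. tp M H (\<zeta>\<^bsub>M\<^esub> x) (\<beta>' a))"
    using M.rcoact_zeta[of "\<zeta>i M m"] assms(1) by (simp add: rcoact_rco sweedler_rco)
  then show ?thesis using assms md_obj[OF M] by simp
qed

lemma LS_zeta_inv:
  assumes "m \<in> carrier M" "md W" "bil H M W \<phi>"
  shows "LS M W (\<zeta>i M m) \<phi> = LS M W m (\<lambda>a x. \<phi> (\<beta>i a) (\<zeta>i M x))"
proof -
  have "LS M W (\<zeta>\<^bsub>M\<^esub> (\<zeta>i M m)) (\<lambda>a b. \<phi> (\<beta>i a) (\<zeta>i M b)) = LS M W (\<zeta>i M m) \<phi>"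
    using assms by (subst LS_zeta) (auto simp del: bilinear_iff intro!: bilinearI bil_left[OF assms(3)] bil_right[OF assms(3)])
  then show ?thesis using assms(1) by simp
qed

lemma RS_zeta_inv:
  assumes "m \<in> carrier M" "md W" "bil M H W \<phi>"
  shows "RS M W (\<zeta>i M m) \<phi> = RS M W m (\<lambda>x a. \<phi> (\<zeta>i M x) (\<beta>i a))"
proof -
  have "RS M W (\<zeta>\<^bsub>M\<^esub> (\<zeta>i M m)) (\<lambda>a b. \<phi> (\<zeta>i M a) (\<beta>i b)) = RS M W (\<zeta>i M m) \<phi>"
    using assms by (subst RS_zeta) (auto simp del: bilinear_iff intro!: bilinearI bil_left[OF assms(3)] bil_right[OF assms(3)])
  then show ?thesis using assms(1) by simp
qed

lemma LS_counit [simp]: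
  assumes "m \<in> carrier M" "md W" "f \<in> LIN M W"
  shows "LS M W m (\<lambda>a x. eps a \<odot>\<^bsub>W\<^esub> f x) = f m"
proof -
  have "LS M M m (\<lambda>a x. eps a \<odot>\<^bsub>M\<^esub> x) = m"
    using M.lcoact_counit[of "\<zeta>i M m"] assms(1) by (simp add: lcoact_lco sweedler_lco)
  then have "f m = f (LS M M m (\<lambda>a x. eps a \<odot>\<^bsub>M\<^esub> x))" by simp
  also have "\<dots> = LS M W m (\<lambda>a x. eps a \<odot>\<^bsub>W\<^esub> f x)"
    using assms md_obj[OF M] by (subst tsum_push[OF assms(3)]) (simp_all add: lin_maps_smult[OF assms(3)])
  finally show ?thesis by simp
qed

lemma RS_counit [simp]:
  assumes "m \<in> carrier M" "md W" "f \<in> LIN M W"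
  shows "RS M W m (\<lambda>x a. eps a \<odot>\<^bsub>W\<^esub> f x) = f m"
proof -
  have "RS M M m (\<lambda>x a. eps a \<odot>\<^bsub>M\<^esub> x) = m"
    using M.rcoact_counit[of "\<zeta>i M m"] assms(1) by (simp add: rcoact_rco sweedler_rco)
  then have "f m = f (RS M M m (\<lambda>x a. eps a \<odot>\<^bsub>M\<^esub> x))" by simp
  also have "\<dots> = RS M W m (\<lambda>x a. eps a \<odot>\<^bsub>W\<^esub> f x)"
    using assms md_obj[OF M] by (subst tsum_push[OF assms(3)]) (simp_all add: lin_maps_smult[OF assms(3)])
  finally show ?thesis by simp
qed

lemma LS_coassoc:
  assumes "m \<in> carrier M" "md W"
    and "\<And>a b. a \<in> carrier H \<Longrightarrow> b \<in> carrier H \<Longrightarrow> \<phi> a b \<in> LIN M W"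
    and "\<And>a c. a \<in> carrier H \<Longrightarrow> c \<in> carrier M \<Longrightarrow> (\<lambda>b. \<phi> a b c) \<in> LIN H W"
    and "\<And>b c. b \<in> carrier H \<Longrightarrow> c \<in> carrier M \<Longrightarrow> (\<lambda>a. \<phi> a b c) \<in> LIN H W"
  shows "LS M W m (\<lambda>a x. DS W a (\<lambda>a b. \<phi> a b x)) = LS M W m (\<lambda>a x. LS M W x (\<lambda>b y. \<phi> a b y))"
proof -
  let ?T = "tensor K H (tensor K H M)"
  let ?\<psi> = "\<lambda>a b c. \<phi> (\<beta>i a) (\<beta>i b) (\<zeta>i M c)"
  note \<phi> = lin_comp[OF assms(3)] lin_comp[OF assms(4)] lin_comp[OF assms(5)]
  note [simp] = md_obj[OF M]
  have cl: "\<phi> a b c \<in> carrier W" if "a \<in> carrier H" "b \<in> carrier H" "c \<in> carrier M" for a b c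
    using lin_maps_closed[OF assms(3)] that .
  have "LS M ?T m (\<lambda>a b. tp H (tensor K H M) (\<beta>' a) (lco M (\<zeta>\<^bsub>M\<^esub> b))) =
    LS M ?T m (\<lambda>a c. DS ?T (\<beta>' a) (\<lambda>a b. tp H (tensor K H M) a (tp H M b (\<zeta>\<^bsub>M\<^esub> c))))"
    using M.lcoact_coassoc[of "\<zeta>i M m"] assms(1) by (simp add: sweedler_lco sweedler_com comult_com lcoact_lco)
  then have "tsum H (tensor K H M) W (LS M ?T m (\<lambda>a b. tp H (tensor K H M) (\<beta>' a) (lco M (\<zeta>\<^bsub>M\<^esub> b)))) (\<lambda>a s. tsum H M W s (?\<psi> a)) =
    tsum H (tensor K H M) W (LS M ?T m (\<lambda>a c. DS ?T (\<beta>' a) (\<lambda>a b. tp H (tensor K H M) a (tp H M b (\<zeta>\<^bsub>M\<^esub> c))))) (\<lambda>a s. tsum H M W s (?\<psi> a))"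
    by simp
  then show ?thesis
    using assms(1,2) by (simp add: DS_twist LS_zeta \<phi> assms(3-5) cl)
qed

lemma RS_coassoc:
  assumes "m \<in> carrier M" "md W"
    and "\<And>a b. a \<in> carrier M \<Longrightarrow> b \<in> carrier H \<Longrightarrow> \<phi> a b \<in> LIN H W"
    and "\<And>a c. a \<in> carrier M \<Longrightarrow> c \<in> carrier H \<Longrightarrow> (\<lambda>b. \<phi> a b c) \<in> LIN H W"
    and "\<And>b c. b \<in> carrier H \<Longrightarrow> c \<in> carrier H \<Longrightarrow> (\<lambda>a. \<phi> a b c) \<in> LIN M W"
  shows "RS M W m (\<lambda>x a. DS W a (\<lambda>a b. \<phi> x a b)) = RS M W m (\<lambda>x b. RS M W x (\<lambda>y a. \<phi> y a b))"
proof -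
  let ?T = "tensor K (tensor K M H) H"
  let ?\<psi> = "\<lambda>a b c. \<phi> (\<zeta>i M a) (\<beta>i b) (\<beta>i c)"
  note \<phi> = lin_comp[OF assms(3)] lin_comp[OF assms(4)] lin_comp[OF assms(5)]
  note [simp] = md_obj[OF M]
  have cl: "\<phi> a b c \<in> carrier W" if "a \<in> carrier M" "b \<in> carrier H" "c \<in> carrier H" for a b c
    using lin_maps_closed[OF assms(3)] that .
  have "RS M ?T m (\<lambda>x b. tp (tensor K M H) H (rco M (\<zeta>\<^bsub>M\<^esub> x)) (\<beta>' b)) =
    RS M ?T m (\<lambda>x c. DS ?T (\<beta>' c) (\<lambda>a b. tp (tensor K M H) H (tp M H (\<zeta>\<^bsub>M\<^esub> x) a) b))"
    using M.rcoact_coassoc[of "\<zeta>i M m"] assms(1) by (simp add: sweedler_rco sweedler_com comult_com rcoact_rco)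
  then have "tsum (tensor K M H) H W (RS M ?T m (\<lambda>x b. tp (tensor K M H) H (rco M (\<zeta>\<^bsub>M\<^esub> x)) (\<beta>' b))) (\<lambda>s c. tsum M H W s (\<lambda>a b. ?\<psi> a b c)) =
    tsum (tensor K M H) H W (RS M ?T m (\<lambda>x c. DS ?T (\<beta>' c) (\<lambda>a b. tp (tensor K M H) H (tp M H (\<zeta>\<^bsub>M\<^esub> x) a) b))) (\<lambda>s c. tsum M H W s (\<lambda>a b. ?\<psi> a b c))"
    by simp
  then show ?thesis
    using assms(1,2) by (simp add: DS_twist RS_zeta \<phi> assms(3-5) cl)
qed

lemma LS_RS:
  assumes "m \<in> carrier M" "md W"
    and "\<And>a b. a \<in> carrier H \<Longrightarrow> b \<in> carrier M \<Longrightarrow> \<phi> a b \<in> LIN H W"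
    and "\<And>a c. a \<in> carrier H \<Longrightarrow> c \<in> carrier H \<Longrightarrow> (\<lambda>b. \<phi> a b c) \<in> LIN M W"
    and "\<And>b c. b \<in> carrier M \<Longrightarrow> c \<in> carrier H \<Longrightarrow> (\<lambda>a. \<phi> a b c) \<in> LIN H W"
  shows "LS M W m (\<lambda>a x. RS M W x (\<lambda>y b. \<phi> a y b)) = RS M W m (\<lambda>x b. LS M W x (\<lambda>a y. \<phi> a y b))"
proof -
  let ?T = "tensor K H (tensor K M H)"
  \<comment> \<open>On both sides of the bicomodule axiom each of the three legs carries exactly one
    twist, which is removed here.\<close>
  let ?\<psi> = "\<lambda>a b c. \<phi> (\<beta>i a) (\<zeta>i M b) (\<beta>i c)"
  note \<phi> = lin_comp[OF assms(3)] lin_comp[OF assms(4)] lin_comp[OF assms(5)]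
  note [simp] = md_obj[OF M]
  have cl: "\<phi> a b c \<in> carrier W" if "a \<in> carrier H" "b \<in> carrier M" "c \<in> carrier H" for a b c
    using lin_maps_closed[OF assms(3)] that .
  have "LS M ?T m (\<lambda>a x. tp H (tensor K M H) (\<beta>' a) (rco M (\<zeta>\<^bsub>M\<^esub> x))) =
    RS M ?T m (\<lambda>x b. LS M ?T (\<zeta>\<^bsub>M\<^esub> x) (\<lambda>a y. tp H (tensor K M H) a (tp M H y (\<beta>' b))))"
    using M.lcoact_rcoact[of "\<zeta>i M m"] assms(1) by (simp add: sweedler_rco sweedler_lco rcoact_rco lcoact_lco)
  then have "tsum H (tensor K M H) W (LS M ?T m (\<lambda>a x. tp H (tensor K M H) (\<beta>' a) (rco M (\<zeta>\<^bsub>M\<^esub> x)))) (\<lambda>a s. tsum M H W s (?\<psi> a)) =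
    tsum H (tensor K M H) W (RS M ?T m (\<lambda>x b. LS M ?T (\<zeta>\<^bsub>M\<^esub> x) (\<lambda>a y. tp H (tensor K M H) a (tp M H y (\<beta>' b))))) (\<lambda>a s. tsum M H W s (?\<psi> a))"
    by simp
  then show ?thesis
    using assms(1,2) by (simp add: LS_zeta RS_zeta \<phi> assms(3-5) cl)
qed

section \<open>Coactions of h.m and m.h\<close>

lemma lco_lac:
  assumes "h \<in> carrier H" "m \<in> carrier M"
  shows "lco M (lac M h m) = DS (tensor K H M) h (\<lambda>h1 h2. LS M (tensor K H M) m (\<lambda>a x. tp H M (h1 \<star> a) (lac M h2 x)))"
proof -
  note [simp] = md_obj[OF M]
  \<comment> \<open>One inverse twist comes from \<open>lco\<close>, the other from rewriting the
    untwisted action as the given one.\<close>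
  have "lco M (lac M h m) = \<rho>\<^sup>l\<^bsub>M\<^esub> (\<beta>i (\<beta>i h) \<triangleright>\<^bsub>M\<^esub> \<zeta>i M (\<zeta>i M m))"
    using assms by (simp add: lco_def lact_lac)
  also have "\<dots> = DS (tensor K H M) h (\<lambda>h1 h2. LS M (tensor K H M) m (\<lambda>a x. tp H M (h1 \<star> a) (lac M h2 x)))"
    using assms by (subst M.lcoact_lact)
      (simp_all add: comult_com sweedler_com lcoact_lco sweedler_lco DS_twist_inv LS_zeta_inv otimes_mul lact_lac)
  finally show ?thesis .
qed

lemma LS_lac:
  assumes "h \<in> carrier H" "m \<in> carrier M" "md W" "bil H M W \<phi>"
  shows "LS M W (lac M h m) \<phi> = DS W h (\<lambda>h1 h2. LS M W m (\<lambda>a x. \<phi> (h1 \<star> a) (lac M h2 x)))"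
  using assms md_obj[OF M] by (simp add: lco_lac)

lemma rco_lac:
  assumes "h \<in> carrier H" "m \<in> carrier M"
  shows "rco M (lac M h m) = DS (tensor K M H) h (\<lambda>h1 h2. RS M (tensor K M H) m (\<lambda>x a. tp M H (lac M h1 x) (h2 \<star> a)))"
proof -
  note [simp] = md_obj[OF M]
  have "rco M (lac M h m) = \<rho>\<^sup>r\<^bsub>M\<^esub> (\<beta>i (\<beta>i h) \<triangleright>\<^bsub>M\<^esub> \<zeta>i M (\<zeta>i M m))"
    using assms by (simp add: rco_def lact_lac)
  also have "\<dots> = DS (tensor K M H) h (\<lambda>h1 h2. RS M (tensor K M H) m (\<lambda>x a. tp M H (lac M h1 x) (h2 \<star> a)))"
    using assms by (subst M.rcoact_lact)
      (simp_all add: comult_com sweedler_com rcoact_rco sweedler_rco DS_twist_inv RS_zeta_inv otimes_mul lact_lac)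
  finally show ?thesis .
qed

lemma RS_lac:
  assumes "h \<in> carrier H" "m \<in> carrier M" "md W" "bil M H W \<phi>"
  shows "RS M W (lac M h m) \<phi> = DS W h (\<lambda>h1 h2. RS M W m (\<lambda>x a. \<phi> (lac M h1 x) (h2 \<star> a)))"
  using assms md_obj[OF M] by (simp add: rco_lac)

lemma lco_rac:
  assumes "h \<in> carrier H" "m \<in> carrier M"
  shows "lco M (rac M m h) = LS M (tensor K H M) m (\<lambda>a x. DS (tensor K H M) h (\<lambda>h1 h2. tp H M (a \<star> h1) (rac M x h2)))"
proof -
  note [simp] = md_obj[OF M]
  have "lco M (rac M m h) = \<rho>\<^sup>l\<^bsub>M\<^esub> (\<zeta>i M (\<zeta>i M m) \<triangleleft>\<^bsub>M\<^esub> \<beta>i (\<beta>i h))"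
    using assms by (simp add: lco_def ract_rac)
  also have "\<dots> = LS M (tensor K H M) m (\<lambda>a x. DS (tensor K H M) h (\<lambda>h1 h2. tp H M (a \<star> h1) (rac M x h2)))"
    using assms by (subst M.lcoact_ract)
      (simp_all add: comult_com sweedler_com lcoact_lco sweedler_lco DS_twist_inv LS_zeta_inv otimes_mul ract_rac)
  finally show ?thesis .
qed

lemma LS_rac:
  assumes "h \<in> carrier H" "m \<in> carrier M" "md W" "bil H M W \<phi>"
  shows "LS M W (rac M m h) \<phi> = LS M W m (\<lambda>a x. DS W h (\<lambda>h1 h2. \<phi> (a \<star> h1) (rac M x h2)))"
  using assms md_obj[OF M] by (simp add: lco_rac)

lemma rco_rac:
  assumes "h \<in> carrier H" "m \<in> carrier M"
  shows "rco M (rac M m h) = RS M (tensor K M H) m (\<lambda>x a. DS (tensor K M H) h (\<lambda>h1 h2. tp M H (rac M x h1) (a \<star> h2)))"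
proof -
  note [simp] = md_obj[OF M]
  have "rco M (rac M m h) = \<rho>\<^sup>r\<^bsub>M\<^esub> (\<zeta>i M (\<zeta>i M m) \<triangleleft>\<^bsub>M\<^esub> \<beta>i (\<beta>i h))"
    using assms by (simp add: rco_def ract_rac)
  also have "\<dots> = RS M (tensor K M H) m (\<lambda>x a. DS (tensor K M H) h (\<lambda>h1 h2. tp M H (rac M x h1) (a \<star> h2)))"
    using assms by (subst M.rcoact_ract)
      (simp_all add: comult_com sweedler_com rcoact_rco sweedler_rco DS_twist_inv RS_zeta_inv otimes_mul ract_rac)
  finally show ?thesis .
qed

lemma RS_rac:
  assumes "h \<in> carrier H" "m \<in> carrier M" "md W" "bil M H W \<phi>"
  shows "RS M W (rac M m h) \<phi> = RS M W m (\<lambda>x a. DS W h (\<lambda>h1 h2. \<phi> (rac M x h1) (a \<star> h2)))"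
  using assms md_obj[OF M] by (simp add: rco_rac)

end

section \<open>The tensor product of four-angle Hopf modules\<close>

abbreviation tmod (infixr "\<bullet>" 80) where "M \<bullet> N \<equiv> tensor_mod K H M N"
abbreviation pt where "pt M N m n \<equiv> m \<boxtimes>\<^bsub>tensorH K H M N\<^esub> n"

abbreviation identH where
  "identH M N \<equiv> {((m \<triangleleft>\<^bsub>M\<^esub> h, \<zeta>\<^bsub>N\<^esub> n), (\<zeta>\<^bsub>M\<^esub> m, h \<triangleright>\<^bsub>N\<^esub> n)) | m h n. m \<in> carrier M \<and> h \<in> carrier H \<and> n \<in> carrier N}"

text \<open>Middle linearity over the untwisted algebra. Taken at \<zeta> m, \<beta> h and \<zeta> n
  it says that \<phi> respects \<open>identH M N\<close>.\<close>

definition bal where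
  "bal M N \<phi> \<longleftrightarrow> (\<forall>m\<in>carrier M. \<forall>h\<in>carrier H. \<forall>n\<in>carrier N. \<phi> (rac M m h) n = \<phi> m (lac N h n))"

section \<open>The quotient space of a tensor product over H\<close>

lemma tensor_mod_module_fields:
  "carrier (tensorH K H M N) = carrier (M \<bullet> N)" "add (tensorH K H M N) = add (M \<bullet> N)"
  "zero (tensorH K H M N) = zero (M \<bullet> N)" "smult (tensorH K H M N) = smult (M \<bullet> N)"
  by (simp_all add: tensor_mod_def Let_def)

lemma sweedler_tensorH: "sweedler (tensorH K H M N) = sweedler (M \<bullet> N)"
  by (simp add: sweedler_def fun_eq_iff tensor_mod_module_fields)

text \<open>The structure maps are defined through the record \<open>tensorH K H M N\<close>, while
  the axioms for objects speak of \<open>M \<bullet> N\<close>. The two share their module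
  structure.\<close>

lemma tensor_tensorH:
  "tensor K U (tensorH K H M N) = tensor K U (M \<bullet> N)" "tensor K (tensorH K H M N) U = tensor K (M \<bullet> N) U"
  unfolding tensor_def by (rule tensor_quotient_cong; simp add: tensor_mod_module_fields)+

context
  fixes M N assumes M [simp]: "obj M" and N [simp]: "obj N"
begin

text \<open>Scaling m in an identification scales both left components, since the right action and
  \<zeta> are linear in m.\<close>

lemma setting: "tensor_setting K M N (identH M N)"
proof (rule tensor_setting.intro[OF md_obj[OF M] md_obj[OF N] tensor_setting_axioms.intro])
  fix c u v u' v' assume c: "c \<in> carrier K" and "((u, v), (u', v')) \<in> identH M N"
  then obtain m h n where eq: "u = m \<triangleleft>\<^bsub>M\<^esub> h" "v = \<zeta>\<^bsub>N\<^esub> n" "u' = \<zeta>\<^bsub>M\<^esub> m" "v' = h \<triangleright>\<^bsub>N\<^esub> n"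
    and mhn: "m \<in> carrier M" "h \<in> carrier H" "n \<in> carrier N" by blast
  have "c \<odot>\<^bsub>M\<^esub> (m \<triangleleft>\<^bsub>M\<^esub> h) = (c \<odot>\<^bsub>M\<^esub> m) \<triangleleft>\<^bsub>M\<^esub> h"
    using c mhn lin_maps_smult[of "\<lambda>m. rac M m h" K M M c m] lin_maps_smult[of "\<zeta>\<^bsub>M\<^esub>" K M M c "rac M m h"]
    by (simp add: ract_rac del: zeta_rac)
  moreover have "c \<odot>\<^bsub>M\<^esub> \<zeta>\<^bsub>M\<^esub> m = \<zeta>\<^bsub>M\<^esub> (c \<odot>\<^bsub>M\<^esub> m)"
    using c mhn lin_maps_smult[of "\<zeta>\<^bsub>M\<^esub>" K M M c m] by simp
  moreover have "c \<odot>\<^bsub>M\<^esub> m \<in> carrier M" using c mhn by simp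
  ultimately show "((c \<odot>\<^bsub>M\<^esub> u, v), (c \<odot>\<^bsub>M\<^esub> u', v')) \<in> identH M N"
    unfolding eq using mhn(2,3) by blast
qed

lemma md_tmod [simp]: "md (M \<bullet> N)"
proof -
  interpret T: module K "tensorH K H M N"
    using tensor_setting.module_T[OF setting] by (simp add: tensorH_def)
  note [simp] = tensor_mod_module_fields[symmetric]
  show ?thesis
  proof (rule moduleI)
    show "abelian_group (M \<bullet> N)"
    proof (rule abelian_groupI)
      fix x assume "x \<in> carrier (M \<bullet> N)"
      then show "\<exists>y\<in>carrier (M \<bullet> N). y \<oplus>\<^bsub>M \<bullet> N\<^esub> x = \<zero>\<^bsub>M \<bullet> N\<^esub>"
        by (intro bexI[of _ "\<ominus>\<^bsub>tensorH K H M N\<^esub> x"]) (simp_all add: T.l_neg)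
    qed (simp_all add: T.a_ac)
  qed (simp_all add: T.smult_l_distr T.smult_r_distr T.smult_assoc1 K.is_cring)
qed

lemma lin_tensorH: "lin_maps K V (tensorH K H M N) = lin_maps K V (M \<bullet> N)" "lin_maps K (tensorH K H M N) V = lin_maps K (M \<bullet> N) V"
  by (simp_all add: lin_maps_def tensor_mod_module_fields)

lemma pt_bilinear: "bil M N (M \<bullet> N) (pt M N)"
  using tensor_setting.pure_bilinear[OF setting] by (simp add: tensorH_def[symmetric] lin_tensorH)

lemma pt_closed [simp]: "m \<in> carrier M \<Longrightarrow> n \<in> carrier N \<Longrightarrow> pt M N m n \<in> carrier (M \<bullet> N)"
  using bilinear_closed[OF pt_bilinear] .

lemma lin_pt [simp]:
  "m \<in> carrier M \<Longrightarrow> pt M N m \<in> LIN N (M \<bullet> N)"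
  "m \<in> carrier M \<Longrightarrow> g \<in> LIN V N \<Longrightarrow> (\<lambda>x. pt M N m (g x)) \<in> LIN V (M \<bullet> N)"
  "n \<in> carrier N \<Longrightarrow> f \<in> LIN V M \<Longrightarrow> (\<lambda>x. pt M N (f x) n) \<in> LIN V (M \<bullet> N)"
  by (rule bilinear_right[OF pt_bilinear] bil_right[OF pt_bilinear] bil_left[OF pt_bilinear]; assumption)+

lemma pt_balanced:
  assumes "m \<in> carrier M" "h \<in> carrier H" "n \<in> carrier N"
  shows "pt M N (rac M m h) n = pt M N m (lac N h n)"
proof -
  \<comment> \<open>At these arguments the twisted identification reads as the untwisted one for m,
    h and n.\<close>
  let ?m = "\<zeta>i M m" and ?h = "\<beta>i h" and ?n = "\<zeta>i N n"
  have "pt M N (?m \<triangleleft>\<^bsub>M\<^esub> ?h) (\<zeta>\<^bsub>N\<^esub> ?n) = pt M N (\<zeta>\<^bsub>M\<^esub> ?m) (?h \<triangleright>\<^bsub>N\<^esub> ?n)"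
    unfolding tensorH_def
  proof (rule tensor_setting.pure_identify[OF setting])
    show "((?m \<triangleleft>\<^bsub>M\<^esub> ?h, \<zeta>\<^bsub>N\<^esub> ?n), (\<zeta>\<^bsub>M\<^esub> ?m, ?h \<triangleright>\<^bsub>N\<^esub> ?n)) \<in> identH M N"
      using zeta_closed(2)[OF M assms(1)] closed_H(2)[OF assms(2)] zeta_closed(2)[OF N assms(3)] by blast
  qed (use assms in \<open>simp_all add: lact_closed ract_closed\<close>)
  then show ?thesis using assms by (simp add: lact_lac ract_rac)
qed

lemma balanced_bal: "bal M N \<phi> \<Longrightarrow> tensor_setting.balanced M N (identH M N) \<phi>"
proof -
  assume \<phi>: "bal M N \<phi>"
  have "\<phi> (m \<triangleleft>\<^bsub>M\<^esub> h) (\<zeta>\<^bsub>N\<^esub> n) = \<phi> (\<zeta>\<^bsub>M\<^esub> m) (h \<triangleright>\<^bsub>N\<^esub> n)" if "m \<in> carrier M" "h \<in> carrier H" "n \<in> carrier N" for m h n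
    using \<phi> that by (simp add: bal_def lact_lac ract_rac)
  then show ?thesis unfolding tensor_setting.balanced_def[OF setting] by blast
qed

lemma sweedler_tmod:
  "t \<in> carrier (M \<bullet> N) \<Longrightarrow> sweedler W t \<phi> = tsum M N W t \<phi>"
  using tensor_setting.formal_summands[OF setting, of t]
  unfolding sweedler_def tsum_def list_sum_def[symmetric] tensorH_def[symmetric] tensor_mod_module_fields
  by (subst filter_True) auto

lemma tsum_tmod_self:
  assumes "t \<in> carrier (M \<bullet> N)"
  shows "tsum M N (M \<bullet> N) t (pt M N) = t"
  using assms tensor_setting.sum_pure[OF setting, of t]
  unfolding sweedler_tmod[OF assms, symmetric] sweedler_def list_sum_def tensorH_def[symmetric] tensor_mod_module_fields
  by simp

lemma tsum_pt [simp]: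
  assumes "md W" "bil M N W \<phi>" "bal M N \<phi>" "m \<in> carrier M" "n \<in> carrier N"
  shows "tsum M N W (pt M N m n) \<phi> = \<phi> m n"
  using tensor_setting.sweedler_pure[OF setting assms(1,2) balanced_bal[OF assms(3)] assms(4,5)] assms
  by (subst sweedler_tmod[symmetric]) (simp_all add: tensorH_def[symmetric])

lemma lin_tsum_tmod [simp]:
  assumes "md W" "md X" "bil M N W \<phi>" "bal M N \<phi>" "g \<in> LIN X (M \<bullet> N)"
  shows "(\<lambda>x. tsum M N W (g x) \<phi>) \<in> LIN X W"
proof -
  have "(\<lambda>t. sweedler W t \<phi>) \<in> LIN (M \<bullet> N) W"
    using tensor_setting.sweedler_linear[OF setting assms(1,3) balanced_bal[OF assms(4)]]
    by (simp add: tensorH_def[symmetric] lin_tensorH)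
  then show ?thesis
    by (rule lin_comp_cong[OF _ assms(5)]) (simp_all add: sweedler_tmod assms(2))
qed

lemma tmod_eq:
  assumes "t \<in> carrier (M \<bullet> N)" "f \<in> LIN (M \<bullet> N) W" "g \<in> LIN (M \<bullet> N) W" "md W"
    and "\<And>m n. m \<in> carrier M \<Longrightarrow> n \<in> carrier N \<Longrightarrow> f (pt M N m n) = g (pt M N m n)"
  shows "f t = g t"
proof -
  have "f (tsum M N (M \<bullet> N) t (pt M N)) = g (tsum M N (M \<bullet> N) t (pt M N))"
    using assms(2-4) by (subst (1 2) tsum_push[where X = "M \<bullet> N"]) (auto intro!: tsum_cong assms(5))
  then show ?thesis by (simp add: tsum_tmod_self assms(1))
qed

section \<open>Structure maps and their values on pure tensors\<close>

lemma zeta_tmod: "t \<in> carrier (M \<bullet> N) \<Longrightarrow> \<zeta>\<^bsub>M \<bullet> N\<^esub> t = tsum M N (M \<bullet> N) t (\<lambda>m n. pt M N (\<zeta>\<^bsub>M\<^esub> m) (\<zeta>\<^bsub>N\<^esub> n))"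
  by (subst tensor_mod_def) (simp add: Let_def sweedler_tensorH sweedler_tmod)

lemma lact_tmod: "t \<in> carrier (M \<bullet> N) \<Longrightarrow> h \<triangleright>\<^bsub>M \<bullet> N\<^esub> t = tsum M N (M \<bullet> N) t (\<lambda>m n. pt M N (h \<triangleright>\<^bsub>M\<^esub> m) (\<zeta>\<^bsub>N\<^esub> n))"
  by (subst tensor_mod_def) (simp add: Let_def sweedler_tensorH sweedler_tmod)

lemma ract_tmod: "t \<in> carrier (M \<bullet> N) \<Longrightarrow> t \<triangleleft>\<^bsub>M \<bullet> N\<^esub> h = tsum M N (M \<bullet> N) t (\<lambda>m n. pt M N (\<zeta>\<^bsub>M\<^esub> m) (n \<triangleleft>\<^bsub>N\<^esub> h))"
  by (subst tensor_mod_def) (simp add: Let_def sweedler_tensorH sweedler_tmod)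

lemma lcoact_tensor_eq:
  assumes "m \<in> carrier M" "n \<in> carrier N"
  shows "lcoact_tensor K H M N m n =
    LS M (tensor K H (M \<bullet> N)) (\<zeta>\<^bsub>M\<^esub> m) (\<lambda>a x. LS N (tensor K H (M \<bullet> N)) (\<zeta>\<^bsub>N\<^esub> n) (\<lambda>b y. tp H (M \<bullet> N) (a \<star> b) (pt M N x y)))"
  using assms by (simp add: lcoact_tensor_def Let_def tensor_tensorH lcoact_lco sweedler_lco otimes_mul)

lemma rcoact_tensor_eq:
  assumes "m \<in> carrier M" "n \<in> carrier N"
  shows "rcoact_tensor K H M N m n =
    RS M (tensor K (M \<bullet> N) H) (\<zeta>\<^bsub>M\<^esub> m) (\<lambda>x a. RS N (tensor K (M \<bullet> N) H) (\<zeta>\<^bsub>N\<^esub> n) (\<lambda>y b. tp (M \<bullet> N) H (pt M N x y) (a \<star> b)))"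
  using assms by (simp add: rcoact_tensor_def Let_def tensor_tensorH rcoact_rco sweedler_rco otimes_mul)

lemma lcoact_tmod: "t \<in> carrier (M \<bullet> N) \<Longrightarrow> \<rho>\<^sup>l\<^bsub>M \<bullet> N\<^esub> t = tsum M N (tensor K H (M \<bullet> N)) t (\<lambda>m n.
    LS M (tensor K H (M \<bullet> N)) (\<zeta>\<^bsub>M\<^esub> m) (\<lambda>a x. LS N (tensor K H (M \<bullet> N)) (\<zeta>\<^bsub>N\<^esub> n) (\<lambda>b y. tp H (M \<bullet> N) (a \<star> b) (pt M N x y))))"
  by (subst tensor_mod_def) (simp add: Let_def tensor_tensorH sweedler_tmod lcoact_tensor_eq)

lemma rcoact_tmod: "t \<in> carrier (M \<bullet> N) \<Longrightarrow> \<rho>\<^sup>r\<^bsub>M \<bullet> N\<^esub> t = tsum M N (tensor K (M \<bullet> N) H) t (\<lambda>m n.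
    RS M (tensor K (M \<bullet> N) H) (\<zeta>\<^bsub>M\<^esub> m) (\<lambda>x a. RS N (tensor K (M \<bullet> N) H) (\<zeta>\<^bsub>N\<^esub> n) (\<lambda>y b. tp (M \<bullet> N) H (pt M N x y) (a \<star> b))))"
  by (subst tensor_mod_def) (simp add: Let_def tensor_tensorH sweedler_tmod rcoact_tensor_eq)

lemma bal_zeta_pt [simp]: "bal M N (\<lambda>m n. pt M N (\<zeta>\<^bsub>M\<^esub> m) (\<zeta>\<^bsub>N\<^esub> n))"
  by (simp add: bal_def pt_balanced)

text \<open>Both sides have the algebra leg a h1 b, and x.h2 \<otimes> y = x \<otimes> h2.y holds in
  the quotient. The map \<phi> is left arbitrary so that the result serves for every later
  evaluation of the coaction.\<close>

lemma bal_lcoact [simp]: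
  assumes "md W" "bil H (M \<bullet> N) W \<phi>"
  shows "bal M N (\<lambda>m n. LS M W m (\<lambda>a x. LS N W n (\<lambda>b y. \<phi> (a \<star> b) (pt M N x y))))"
proof -
  note [simp] = assms bil_left[OF assms(2)] bil_right[OF assms(2)] bilinear_closed[OF assms(2)]
  have "LS M W (rac M m h) (\<lambda>a x. LS N W n (\<lambda>b y. \<phi> (a \<star> b) (pt M N x y))) =
    LS M W m (\<lambda>a x. LS N W (lac N h n) (\<lambda>b y. \<phi> (a \<star> b) (pt M N x y)))"
    if "m \<in> carrier M" "h \<in> carrier H" "n \<in> carrier N" for m h n
    using that by (simp add: LS_rac LS_lac pt_balanced mul_assoc)
  then show ?thesis by (simp add: bal_def)
qed

lemma bal_rcoact [simp]:
  assumes "md W" "bil (M \<bullet> N) H W \<phi>"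
  shows "bal M N (\<lambda>m n. RS M W m (\<lambda>x a. RS N W n (\<lambda>y b. \<phi> (pt M N x y) (a \<star> b))))"
proof -
  note [simp] = assms bil_left[OF assms(2)] bil_right[OF assms(2)] bilinear_closed[OF assms(2)]
  have "RS M W (rac M m h) (\<lambda>x a. RS N W n (\<lambda>y b. \<phi> (pt M N x y) (a \<star> b))) =
    RS M W m (\<lambda>x a. RS N W (lac N h n) (\<lambda>y b. \<phi> (pt M N x y) (a \<star> b)))"
    if "m \<in> carrier M" "h \<in> carrier H" "n \<in> carrier N" for m h n
    using that by (simp add: RS_rac RS_lac pt_balanced mul_assoc)
  then show ?thesis by (simp add: bal_def)
qed

lemma zeta_pt [simp]: "m \<in> carrier M \<Longrightarrow> n \<in> carrier N \<Longrightarrow> \<zeta>\<^bsub>M \<bullet> N\<^esub> (pt M N m n) = pt M N (\<zeta>\<^bsub>M\<^esub> m) (\<zeta>\<^bsub>N\<^esub> n)"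
  by (simp add: zeta_tmod)

lemma zeta_tmod_linear: "\<zeta>\<^bsub>M \<bullet> N\<^esub> \<in> LIN (M \<bullet> N) (M \<bullet> N)"
proof -
  have "(\<lambda>t. tsum M N (M \<bullet> N) t (\<lambda>m n. pt M N (\<zeta>\<^bsub>M\<^esub> m) (\<zeta>\<^bsub>N\<^esub> n))) \<in> LIN (M \<bullet> N) (M \<bullet> N)" by simp
  from lin_comp_cong[OF this lin_id _ md_tmod, of "\<zeta>\<^bsub>M \<bullet> N\<^esub>"] show ?thesis by (simp add: zeta_tmod)
qed

lemma zeta_tmod_bij: "bij_betw \<zeta>\<^bsub>M \<bullet> N\<^esub> (carrier (M \<bullet> N)) (carrier (M \<bullet> N))"
proof (rule bij_betw_byWitness)
  let ?g = "\<lambda>t. tsum M N (M \<bullet> N) t (\<lambda>m n. pt M N (\<zeta>i M m) (\<zeta>i N n))"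
  have [simp]: "bal M N (\<lambda>m n. pt M N (\<zeta>i M m) (\<zeta>i N n))"
    by (simp add: bal_def pt_balanced)
  have g: "?g \<in> LIN (M \<bullet> N) (M \<bullet> N)" by simp
  have gp: "?g (pt M N m n) = pt M N (\<zeta>i M m) (\<zeta>i N n)" if "m \<in> carrier M" "n \<in> carrier N" for m n
    using that by simp
  show "\<forall>t\<in>carrier (M \<bullet> N). ?g (\<zeta>\<^bsub>M \<bullet> N\<^esub> t) = t"
  proof
    fix t assume "t \<in> carrier (M \<bullet> N)"
    then show "?g (\<zeta>\<^bsub>M \<bullet> N\<^esub> t) = t"
      by (rule tmod_eq[where W = "M \<bullet> N"]) (simp_all add: lin_comp[OF g] zeta_tmod_linear gp)
  qed
  show "\<forall>t\<in>carrier (M \<bullet> N). \<zeta>\<^bsub>M \<bullet> N\<^esub> (?g t) = t"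
  proof
    fix t assume "t \<in> carrier (M \<bullet> N)"
    then show "\<zeta>\<^bsub>M \<bullet> N\<^esub> (?g t) = t"
      by (rule tmod_eq[where W = "M \<bullet> N"]) (simp_all add: lin_comp[OF zeta_tmod_linear] g gp)
  qed
  show "\<zeta>\<^bsub>M \<bullet> N\<^esub> ` carrier (M \<bullet> N) \<subseteq> carrier (M \<bullet> N)" "?g ` carrier (M \<bullet> N) \<subseteq> carrier (M \<bullet> N)"
    using lin_maps_closed[OF zeta_tmod_linear] lin_maps_closed[OF g] by blast+
qed

lemma lact_pt: "h \<in> carrier H \<Longrightarrow> m \<in> carrier M \<Longrightarrow> n \<in> carrier N \<Longrightarrow> h \<triangleright>\<^bsub>M \<bullet> N\<^esub> pt M N m n = pt M N (\<zeta>\<^bsub>M\<^esub> (lac M h m)) (\<zeta>\<^bsub>N\<^esub> n)"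
  by (simp add: lact_tmod lact_lac del: zeta_lac) (simp add: bal_def pt_balanced lac_rac)

lemma ract_pt: "h \<in> carrier H \<Longrightarrow> m \<in> carrier M \<Longrightarrow> n \<in> carrier N \<Longrightarrow> pt M N m n \<triangleleft>\<^bsub>M \<bullet> N\<^esub> h = pt M N (\<zeta>\<^bsub>M\<^esub> m) (\<zeta>\<^bsub>N\<^esub> (rac N n h))"
  by (simp add: ract_tmod ract_rac del: zeta_rac) (simp add: bal_def pt_balanced lac_rac)

lemma lact_tmod_bilinear: "bil H (M \<bullet> N) (M \<bullet> N) (\<lambda>h t. h \<triangleright>\<^bsub>M \<bullet> N\<^esub> t)"
proof (rule bilinearI)
  fix h assume h: "h \<in> carrier H"
  have "(\<lambda>t. tsum M N (M \<bullet> N) t (\<lambda>m n. pt M N (h \<triangleright>\<^bsub>M\<^esub> m) (\<zeta>\<^bsub>N\<^esub> n))) \<in> LIN (M \<bullet> N) (M \<bullet> N)"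
    using h by (simp add: lact_lac bal_def pt_balanced lac_rac)
  from lin_comp_cong[OF this lin_id _ md_tmod] show "(\<lambda>t. h \<triangleright>\<^bsub>M \<bullet> N\<^esub> t) \<in> LIN (M \<bullet> N) (M \<bullet> N)"
    by (simp add: lact_tmod)
next
  fix t assume t: "t \<in> carrier (M \<bullet> N)"
  have "(\<lambda>h. tsum M N (M \<bullet> N) t (\<lambda>m n. pt M N (\<zeta>\<^bsub>M\<^esub> (lac M h m)) (\<zeta>\<^bsub>N\<^esub> n))) \<in> LIN H (M \<bullet> N)"
    by (rule lin_tsum) (simp_all del: zeta_lac)
  from lin_comp_cong[OF this lin_id _ md_H] show "(\<lambda>h. h \<triangleright>\<^bsub>M \<bullet> N\<^esub> t) \<in> LIN H (M \<bullet> N)"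
    using t by (simp add: lact_tmod lact_lac)
qed

lemma ract_tmod_bilinear: "bil (M \<bullet> N) H (M \<bullet> N) (\<lambda>t h. t \<triangleleft>\<^bsub>M \<bullet> N\<^esub> h)"
proof (rule bilinearI)
  fix h assume h: "h \<in> carrier H"
  have "(\<lambda>t. tsum M N (M \<bullet> N) t (\<lambda>m n. pt M N (\<zeta>\<^bsub>M\<^esub> m) (n \<triangleleft>\<^bsub>N\<^esub> h))) \<in> LIN (M \<bullet> N) (M \<bullet> N)"
    using h by (simp add: ract_rac bal_def pt_balanced lac_rac)
  from lin_comp_cong[OF this lin_id _ md_tmod] show "(\<lambda>t. t \<triangleleft>\<^bsub>M \<bullet> N\<^esub> h) \<in> LIN (M \<bullet> N) (M \<bullet> N)"
    by (simp add: ract_tmod)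
next
  fix t assume t: "t \<in> carrier (M \<bullet> N)"
  have "(\<lambda>h. tsum M N (M \<bullet> N) t (\<lambda>m n. pt M N (\<zeta>\<^bsub>M\<^esub> m) (\<zeta>\<^bsub>N\<^esub> (rac N n h)))) \<in> LIN H (M \<bullet> N)"
    by (rule lin_tsum) (simp_all del: zeta_rac)
  from lin_comp_cong[OF this lin_id _ md_H] show "(\<lambda>h. t \<triangleleft>\<^bsub>M \<bullet> N\<^esub> h) \<in> LIN H (M \<bullet> N)"
    using t by (simp add: ract_tmod ract_rac)
qed

lemma lin_lact_tmod [simp]:
  "h \<in> carrier H \<Longrightarrow> g \<in> LIN X (M \<bullet> N) \<Longrightarrow> (\<lambda>x. h \<triangleright>\<^bsub>M \<bullet> N\<^esub> g x) \<in> LIN X (M \<bullet> N)"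
  "t \<in> carrier (M \<bullet> N) \<Longrightarrow> f \<in> LIN X H \<Longrightarrow> (\<lambda>x. f x \<triangleright>\<^bsub>M \<bullet> N\<^esub> t) \<in> LIN X (M \<bullet> N)"
  "h \<in> carrier H \<Longrightarrow> g \<in> LIN X (M \<bullet> N) \<Longrightarrow> (\<lambda>x. g x \<triangleleft>\<^bsub>M \<bullet> N\<^esub> h) \<in> LIN X (M \<bullet> N)"
  "t \<in> carrier (M \<bullet> N) \<Longrightarrow> f \<in> LIN X H \<Longrightarrow> (\<lambda>x. t \<triangleleft>\<^bsub>M \<bullet> N\<^esub> f x) \<in> LIN X (M \<bullet> N)"
  by (rule bil_right[OF lact_tmod_bilinear] bil_left[OF lact_tmod_bilinear]
    bil_right[OF ract_tmod_bilinear] bil_left[OF ract_tmod_bilinear]; assumption)+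

lemma bal_zeta: "bal M N \<phi> \<Longrightarrow> bal M N (\<lambda>m n. \<phi> (\<zeta>\<^bsub>M\<^esub> m) (\<zeta>\<^bsub>N\<^esub> n))"
  by (simp add: bal_def)

lemma bal_coact_zeta [simp]:
  "bal M N (\<lambda>m n. LS M (tensor K H (M \<bullet> N)) (\<zeta>\<^bsub>M\<^esub> m) (\<lambda>a x. LS N (tensor K H (M \<bullet> N)) (\<zeta>\<^bsub>N\<^esub> n)
    (\<lambda>b y. tp H (M \<bullet> N) (a \<star> b) (pt M N x y))))"
  "bal M N (\<lambda>m n. RS M (tensor K (M \<bullet> N) H) (\<zeta>\<^bsub>M\<^esub> m) (\<lambda>x a. RS N (tensor K (M \<bullet> N) H) (\<zeta>\<^bsub>N\<^esub> n)
    (\<lambda>y b. tp (M \<bullet> N) H (pt M N x y) (a \<star> b))))"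
  by (rule bal_zeta[OF bal_lcoact] bal_zeta[OF bal_rcoact]; simp)+

lemma lcoact_pt: "m \<in> carrier M \<Longrightarrow> n \<in> carrier N \<Longrightarrow> \<rho>\<^sup>l\<^bsub>M \<bullet> N\<^esub> (pt M N m n) =
    LS M (tensor K H (M \<bullet> N)) (\<zeta>\<^bsub>M\<^esub> m) (\<lambda>a x. LS N (tensor K H (M \<bullet> N)) (\<zeta>\<^bsub>N\<^esub> n) (\<lambda>b y. tp H (M \<bullet> N) (a \<star> b) (pt M N x y)))"
  by (simp add: lcoact_tmod)

lemma rcoact_pt: "m \<in> carrier M \<Longrightarrow> n \<in> carrier N \<Longrightarrow> \<rho>\<^sup>r\<^bsub>M \<bullet> N\<^esub> (pt M N m n) =
    RS M (tensor K (M \<bullet> N) H) (\<zeta>\<^bsub>M\<^esub> m) (\<lambda>x a. RS N (tensor K (M \<bullet> N) H) (\<zeta>\<^bsub>N\<^esub> n) (\<lambda>y b. tp (M \<bullet> N) H (pt M N x y) (a \<star> b)))"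
  by (simp add: rcoact_tmod)

lemma lcoact_tmod_linear: "\<rho>\<^sup>l\<^bsub>M \<bullet> N\<^esub> \<in> LIN (M \<bullet> N) (tensor K H (M \<bullet> N))"
proof -
  have "(\<lambda>t. tsum M N (tensor K H (M \<bullet> N)) t (\<lambda>m n. LS M (tensor K H (M \<bullet> N)) (\<zeta>\<^bsub>M\<^esub> m) (\<lambda>a x. LS N (tensor K H (M \<bullet> N)) (\<zeta>\<^bsub>N\<^esub> n)
    (\<lambda>b y. tp H (M \<bullet> N) (a \<star> b) (pt M N x y))))) \<in> LIN (M \<bullet> N) (tensor K H (M \<bullet> N))" by simp
  from lin_comp_cong[OF this lin_id _ md_tmod, of "\<rho>\<^sup>l\<^bsub>M \<bullet> N\<^esub>"] show ?thesis by (simp add: lcoact_tmod)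
qed

lemma rcoact_tmod_linear: "\<rho>\<^sup>r\<^bsub>M \<bullet> N\<^esub> \<in> LIN (M \<bullet> N) (tensor K (M \<bullet> N) H)"
proof -
  have "(\<lambda>t. tsum M N (tensor K (M \<bullet> N) H) t (\<lambda>m n. RS M (tensor K (M \<bullet> N) H) (\<zeta>\<^bsub>M\<^esub> m) (\<lambda>x a. RS N (tensor K (M \<bullet> N) H) (\<zeta>\<^bsub>N\<^esub> n)
    (\<lambda>y b. tp (M \<bullet> N) H (pt M N x y) (a \<star> b))))) \<in> LIN (M \<bullet> N) (tensor K (M \<bullet> N) H)" by simp
  from lin_comp_cong[OF this lin_id _ md_tmod, of "\<rho>\<^sup>r\<^bsub>M \<bullet> N\<^esub>"] show ?thesis by (simp add: rcoact_tmod)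
qed

lemma lin_coact_tmod [simp]:
  "\<rho>\<^sup>l\<^bsub>M \<bullet> N\<^esub> \<in> LIN (M \<bullet> N) (tensor K H (M \<bullet> N))" "\<rho>\<^sup>r\<^bsub>M \<bullet> N\<^esub> \<in> LIN (M \<bullet> N) (tensor K (M \<bullet> N) H)"
  "\<zeta>\<^bsub>M \<bullet> N\<^esub> \<in> LIN (M \<bullet> N) (M \<bullet> N)"
  "f \<in> LIN X (M \<bullet> N) \<Longrightarrow> (\<lambda>x. \<rho>\<^sup>l\<^bsub>M \<bullet> N\<^esub> (f x)) \<in> LIN X (tensor K H (M \<bullet> N))"
  "f \<in> LIN X (M \<bullet> N) \<Longrightarrow> (\<lambda>x. \<rho>\<^sup>r\<^bsub>M \<bullet> N\<^esub> (f x)) \<in> LIN X (tensor K (M \<bullet> N) H)"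
  "f \<in> LIN X (M \<bullet> N) \<Longrightarrow> (\<lambda>x. \<zeta>\<^bsub>M \<bullet> N\<^esub> (f x)) \<in> LIN X (M \<bullet> N)"
  using lcoact_tmod_linear rcoact_tmod_linear zeta_tmod_linear by (auto intro: lin_comp)

lemma closed_tmod [simp]:
  assumes "t \<in> carrier (M \<bullet> N)"
  shows "\<rho>\<^sup>l\<^bsub>M \<bullet> N\<^esub> t \<in> carrier (tensor K H (M \<bullet> N))" "\<rho>\<^sup>r\<^bsub>M \<bullet> N\<^esub> t \<in> carrier (tensor K (M \<bullet> N) H)"
    "\<zeta>\<^bsub>M \<bullet> N\<^esub> t \<in> carrier (M \<bullet> N)" "h \<in> carrier H \<Longrightarrow> h \<triangleright>\<^bsub>M \<bullet> N\<^esub> t \<in> carrier (M \<bullet> N)"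
    "h \<in> carrier H \<Longrightarrow> t \<triangleleft>\<^bsub>M \<bullet> N\<^esub> h \<in> carrier (M \<bullet> N)"
  using assms lin_maps_closed[OF lin_coact_tmod(1)] lin_maps_closed[OF lin_coact_tmod(2)] lin_maps_closed[OF lin_coact_tmod(3)]
    bilinear_closed[OF lact_tmod_bilinear] bilinear_closed[OF ract_tmod_bilinear]
  by blast+

section \<open>The axioms of a four-angle Hopf module\<close>

lemma hom_bimodule_tmod: "hom_bimodule K H (M \<bullet> N)"
proof (intro hom_bimodule.intro left_hom_module.intro right_hom_module.intro hom_space.intro
    hom_bimodule_axioms.intro left_hom_module_axioms.intro right_hom_module_axioms.intro hom_space_axioms.intro)
  \<comment> \<open>Every axiom is an equality of linear maps in t, so pure tensors suffice.\<close>
  note t = tmod_eq[where W = "M \<bullet> N"]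
  note s = lact_pt ract_pt lac_rac lact_lac ract_rac lac_mul rac_mul otimes_mul pt_balanced
  {
    fix t assume *: "t \<in> carrier (M \<bullet> N)"
    show "unt \<triangleright>\<^bsub>M \<bullet> N\<^esub> t = \<zeta>\<^bsub>M \<bullet> N\<^esub> t" "t \<triangleleft>\<^bsub>M \<bullet> N\<^esub> unt = \<zeta>\<^bsub>M \<bullet> N\<^esub> t"
      using * by (rule_tac t, simp_all add: s)+
  next
    fix a t assume *: "a \<in> carrier H" "t \<in> carrier (M \<bullet> N)"
    show "\<zeta>\<^bsub>M \<bullet> N\<^esub> (a \<triangleright>\<^bsub>M \<bullet> N\<^esub> t) = \<beta>' a \<triangleright>\<^bsub>M \<bullet> N\<^esub> \<zeta>\<^bsub>M \<bullet> N\<^esub> t"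
      using * by (rule_tac t, simp_all add: s)
    show "\<zeta>\<^bsub>M \<bullet> N\<^esub> (t \<triangleleft>\<^bsub>M \<bullet> N\<^esub> a) = \<zeta>\<^bsub>M \<bullet> N\<^esub> t \<triangleleft>\<^bsub>M \<bullet> N\<^esub> \<beta>' a"
      using * by (rule_tac t, simp_all add: s)
  }
  fix a b t assume *: "a \<in> carrier H" "b \<in> carrier H" "t \<in> carrier (M \<bullet> N)"
  show "\<beta>' a \<triangleright>\<^bsub>M \<bullet> N\<^esub> (b \<triangleright>\<^bsub>M \<bullet> N\<^esub> t) = (a \<otimes>\<^bsub>H\<^esub> b) \<triangleright>\<^bsub>M \<bullet> N\<^esub> \<zeta>\<^bsub>M \<bullet> N\<^esub> t"
    using * by (rule_tac t) (simp_all add: s)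
  show "(t \<triangleleft>\<^bsub>M \<bullet> N\<^esub> a) \<triangleleft>\<^bsub>M \<bullet> N\<^esub> \<beta>' b = \<zeta>\<^bsub>M \<bullet> N\<^esub> t \<triangleleft>\<^bsub>M \<bullet> N\<^esub> (a \<otimes>\<^bsub>H\<^esub> b)"
    using * by (rule_tac t) (simp_all add: s)
  show "\<beta>' a \<triangleright>\<^bsub>M \<bullet> N\<^esub> (t \<triangleleft>\<^bsub>M \<bullet> N\<^esub> b) = (a \<triangleright>\<^bsub>M \<bullet> N\<^esub> t) \<triangleleft>\<^bsub>M \<bullet> N\<^esub> \<beta>' b"
    using * by (rule_tac t) (simp_all add: s)
qed (use lact_tmod_bilinear ract_tmod_bilinear in simp_all)

lemma sweedler_coact:
  "t \<in> carrier (tensor K H (M \<bullet> N)) \<Longrightarrow> sweedler W t \<phi> = tsum H (M \<bullet> N) W t \<phi>"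
  "t \<in> carrier (tensor K (M \<bullet> N) H) \<Longrightarrow> sweedler W t \<phi> = tsum (M \<bullet> N) H W t \<phi>"
  by (rule sweedler_tsum; simp)+

text \<open>With t bound by a quantifier, the maps f and g are determined by unification with the
  goal.\<close>

lemma tmod_ext:
  assumes "f \<in> LIN (M \<bullet> N) W" "g \<in> LIN (M \<bullet> N) W" "md W"
    and "\<And>m n. m \<in> carrier M \<Longrightarrow> n \<in> carrier N \<Longrightarrow> f (pt M N m n) = g (pt M N m n)"
  shows "\<forall>t\<in>carrier (M \<bullet> N). f t = g t"
  using tmod_eq[OF _ assms] by blast

lemma hom_bicomodule_tmod: "hom_bicomodule K H (M \<bullet> N)"
proof (intro hom_bicomodule.intro left_hom_comodule.intro right_hom_comodule.intro hom_space.intro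
    hom_bicomodule_axioms.intro left_hom_comodule_axioms.intro right_hom_comodule_axioms.intro hom_space_axioms.intro)
  let ?X = "M \<bullet> N"
  let ?LX = "tensor K H ?X" and ?XR = "tensor K ?X H"
  note s = lcoact_pt rcoact_pt LS_zeta RS_zeta DS_twist DS_mul
  have "\<forall>t\<in>carrier ?X. \<rho>\<^sup>l\<^bsub>?X\<^esub> (\<zeta>\<^bsub>?X\<^esub> t) = tsum H ?X ?LX (\<rho>\<^sup>l\<^bsub>?X\<^esub> t) (\<lambda>a m0. tp H ?X (\<beta>' a) (\<zeta>\<^bsub>?X\<^esub> m0))"
    by (rule tmod_ext[where W = "?LX"]) (simp_all add: s)
  then show "\<And>t. t \<in> carrier ?X \<Longrightarrow> \<rho>\<^sup>l\<^bsub>?X\<^esub> (\<zeta>\<^bsub>?X\<^esub> t) = sweedler ?LX (\<rho>\<^sup>l\<^bsub>?X\<^esub> t) (\<lambda>a m0. tp H ?X (\<beta>' a) (\<zeta>\<^bsub>?X\<^esub> m0))"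
    by (simp add: sweedler_coact)
  have "\<forall>t\<in>carrier ?X. \<rho>\<^sup>r\<^bsub>?X\<^esub> (\<zeta>\<^bsub>?X\<^esub> t) = tsum ?X H ?XR (\<rho>\<^sup>r\<^bsub>?X\<^esub> t) (\<lambda>m0 a. tp ?X H (\<zeta>\<^bsub>?X\<^esub> m0) (\<beta>' a))"
    by (rule tmod_ext[where W = "?XR"]) (simp_all add: s)
  then show "\<And>t. t \<in> carrier ?X \<Longrightarrow> \<rho>\<^sup>r\<^bsub>?X\<^esub> (\<zeta>\<^bsub>?X\<^esub> t) = sweedler ?XR (\<rho>\<^sup>r\<^bsub>?X\<^esub> t) (\<lambda>m0 a. tp ?X H (\<zeta>\<^bsub>?X\<^esub> m0) (\<beta>' a))"
    by (simp add: sweedler_coact)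
  have "\<forall>t\<in>carrier ?X. tsum H ?X ?X (\<rho>\<^sup>l\<^bsub>?X\<^esub> t) (\<lambda>a m0. eps a \<odot>\<^bsub>?X\<^esub> m0) = \<zeta>\<^bsub>?X\<^esub> t"
    apply (rule tmod_ext[where W = "?X"]) apply (simp_all add: s)
    by (simp add: smult_smult_swap)
  then show "\<And>t. t \<in> carrier ?X \<Longrightarrow> sweedler ?X (\<rho>\<^sup>l\<^bsub>?X\<^esub> t) (\<lambda>a m0. eps a \<odot>\<^bsub>?X\<^esub> m0) = \<zeta>\<^bsub>?X\<^esub> t"
    by (simp add: sweedler_coact)
  have "\<forall>t\<in>carrier ?X. tsum ?X H ?X (\<rho>\<^sup>r\<^bsub>?X\<^esub> t) (\<lambda>m0 a. eps a \<odot>\<^bsub>?X\<^esub> m0) = \<zeta>\<^bsub>?X\<^esub> t"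
    apply (rule tmod_ext[where W = "?X"]) apply (simp_all add: s)
    by (simp add: smult_smult_swap)
  then show "\<And>t. t \<in> carrier ?X \<Longrightarrow> sweedler ?X (\<rho>\<^sup>r\<^bsub>?X\<^esub> t) (\<lambda>m0 a. eps a \<odot>\<^bsub>?X\<^esub> m0) = \<zeta>\<^bsub>?X\<^esub> t"
    by (simp add: sweedler_coact)
  let ?T = "tensor K H ?LX"
  have "\<forall>t\<in>carrier ?X. tsum H ?X ?T (\<rho>\<^sup>l\<^bsub>?X\<^esub> t) (\<lambda>a m0. tp H ?LX (\<beta>' a) (\<rho>\<^sup>l\<^bsub>?X\<^esub> m0)) =
      tsum H ?X ?T (\<rho>\<^sup>l\<^bsub>?X\<^esub> t) (\<lambda>a m0. DS ?T (\<beta>' a) (\<lambda>a1 a2. tp H ?LX a1 (tp H ?X a2 (\<zeta>\<^bsub>?X\<^esub> m0))))"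
    apply (rule tmod_ext[where W = "?T"]) apply (simp_all add: s)
  proof -
    fix m n assume [simp]: "m \<in> carrier M" "n \<in> carrier N"
    \<comment> \<open>The form that remains once all twists have been moved inwards; each leg has
      collected two of them.\<close>
    let ?F = "\<lambda>a a' x b b' y. tp H ?LX (\<beta>' (\<beta>' a) \<star> \<beta>' (\<beta>' b)) (tp H ?X (\<beta>' (\<beta>' a') \<star> \<beta>' (\<beta>' b'))
      (pt M N (\<zeta>\<^bsub>M\<^esub> (\<zeta>\<^bsub>M\<^esub> x)) (\<zeta>\<^bsub>N\<^esub> (\<zeta>\<^bsub>N\<^esub> y))))"
    \<comment> \<open>The sums for M and N are independent. Exchanging them brings the two coactions
      of each module together, and coassociativity applies to N and M separately.\<close>
    have "LS M ?T m (\<lambda>a x. LS N ?T n (\<lambda>b y. LS M ?T x (\<lambda>a' x'. LS N ?T y (\<lambda>b' y'. ?F a a' x' b b' y')))) =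
      LS M ?T m (\<lambda>a x. LS M ?T x (\<lambda>a' x'. LS N ?T n (\<lambda>b y. LS N ?T y (\<lambda>b' y'. ?F a a' x' b b' y'))))"
      by (intro tsum_cong tsum_swap) simp_all
    also have "\<dots> = LS M ?T m (\<lambda>a x. LS M ?T x (\<lambda>a' x'. LS N ?T n (\<lambda>b y. DS ?T b (\<lambda>b b'. ?F a a' x' b b' y))))"
      by (intro tsum_cong LS_coassoc[symmetric]) simp_all
    also have "\<dots> = LS M ?T m (\<lambda>a x. DS ?T a (\<lambda>a a'. LS N ?T n (\<lambda>b y. DS ?T b (\<lambda>b b'. ?F a a' x b b' y))))"
      by (intro LS_coassoc[symmetric]) simp_all
    also have "\<dots> = LS M ?T m (\<lambda>a x. LS N ?T n (\<lambda>b y. DS ?T a (\<lambda>a a'. DS ?T b (\<lambda>b b'. ?F a a' x b b' y))))"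
      by (intro tsum_cong tsum_swap) simp_all
    finally show "LS M ?T m (\<lambda>a x. LS N ?T n (\<lambda>b y. LS M ?T x (\<lambda>a' x'. LS N ?T y (\<lambda>b' y'. ?F a a' x' b b' y')))) = \<dots>" .
  qed
  then show "\<And>t. t \<in> carrier ?X \<Longrightarrow> sweedler ?T (\<rho>\<^sup>l\<^bsub>?X\<^esub> t) (\<lambda>a m0. tp H ?LX (\<beta>' a) (\<rho>\<^sup>l\<^bsub>?X\<^esub> m0)) =
      sweedler ?T (\<rho>\<^sup>l\<^bsub>?X\<^esub> t) (\<lambda>a m0. sweedler ?T (\<Delta>\<^bsub>H\<^esub> a) (\<lambda>a1 a2. tp H ?LX a1 (tp H ?X a2 (\<zeta>\<^bsub>?X\<^esub> m0))))"
    by (simp add: sweedler_coact sweedler_comult)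
  let ?T = "tensor K ?XR H"
  have "\<forall>t\<in>carrier ?X. tsum ?X H ?T (\<rho>\<^sup>r\<^bsub>?X\<^esub> t) (\<lambda>m0 a. tp ?XR H (\<rho>\<^sup>r\<^bsub>?X\<^esub> m0) (\<beta>' a)) =
      tsum ?X H ?T (\<rho>\<^sup>r\<^bsub>?X\<^esub> t) (\<lambda>m0 a. DS ?T (\<beta>' a) (\<lambda>a1 a2. tp ?XR H (tp ?X H (\<zeta>\<^bsub>?X\<^esub> m0) a1) a2))"
    apply (rule tmod_ext[where W = "?T"]) apply (simp_all add: s)
  proof -
    fix m n assume [simp]: "m \<in> carrier M" "n \<in> carrier N"
    let ?F = "\<lambda>x a a' y b b'. tp ?XR H (tp ?X H (pt M N (\<zeta>\<^bsub>M\<^esub> (\<zeta>\<^bsub>M\<^esub> x)) (\<zeta>\<^bsub>N\<^esub> (\<zeta>\<^bsub>N\<^esub> y))) (\<beta>' (\<beta>' a) \<star> \<beta>' (\<beta>' b)))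
      (\<beta>' (\<beta>' a') \<star> \<beta>' (\<beta>' b'))"
    have "RS M ?T m (\<lambda>x a'. RS N ?T n (\<lambda>y b'. RS M ?T x (\<lambda>x' a. RS N ?T y (\<lambda>y' b. ?F x' a a' y' b b')))) =
      RS M ?T m (\<lambda>x a'. RS M ?T x (\<lambda>x' a. RS N ?T n (\<lambda>y b'. RS N ?T y (\<lambda>y' b. ?F x' a a' y' b b'))))"
      by (intro tsum_cong tsum_swap) simp_all
    also have "\<dots> = RS M ?T m (\<lambda>x a'. RS M ?T x (\<lambda>x' a. RS N ?T n (\<lambda>y b. DS ?T b (\<lambda>b b'. ?F x' a a' y b b'))))"
      by (intro tsum_cong RS_coassoc[symmetric]) simp_all
    also have "\<dots> = RS M ?T m (\<lambda>x a. DS ?T a (\<lambda>a a'. RS N ?T n (\<lambda>y b. DS ?T b (\<lambda>b b'. ?F x a a' y b b'))))"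
      by (intro RS_coassoc[symmetric]) simp_all
    also have "\<dots> = RS M ?T m (\<lambda>x a. RS N ?T n (\<lambda>y b. DS ?T a (\<lambda>a a'. DS ?T b (\<lambda>b b'. ?F x a a' y b b'))))"
      by (intro tsum_cong tsum_swap) simp_all
    finally show "RS M ?T m (\<lambda>x a'. RS N ?T n (\<lambda>y b'. RS M ?T x (\<lambda>x' a. RS N ?T y (\<lambda>y' b. ?F x' a a' y' b b')))) = \<dots>" .
  qed
  then show "\<And>t. t \<in> carrier ?X \<Longrightarrow> sweedler ?T (\<rho>\<^sup>r\<^bsub>?X\<^esub> t) (\<lambda>m0 a. tp ?XR H (\<rho>\<^sup>r\<^bsub>?X\<^esub> m0) (\<beta>' a)) =
      sweedler ?T (\<rho>\<^sup>r\<^bsub>?X\<^esub> t) (\<lambda>m0 a. sweedler ?T (\<Delta>\<^bsub>H\<^esub> a) (\<lambda>a1 a2. tp ?XR H (tp ?X H (\<zeta>\<^bsub>?X\<^esub> m0) a1) a2))"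
    by (simp add: sweedler_coact sweedler_comult)
  let ?T = "tensor K H ?XR"
  have "\<forall>t\<in>carrier ?X. tsum H ?X ?T (\<rho>\<^sup>l\<^bsub>?X\<^esub> t) (\<lambda>a m0. tp H ?XR (\<beta>' a) (\<rho>\<^sup>r\<^bsub>?X\<^esub> m0)) =
      tsum ?X H ?T (\<rho>\<^sup>r\<^bsub>?X\<^esub> t) (\<lambda>m0 b. tsum H ?X ?T (\<rho>\<^sup>l\<^bsub>?X\<^esub> m0) (\<lambda>a m00. tp H ?XR a (tp ?X H m00 (\<beta>' b))))"
    apply (rule tmod_ext[where W = "?T"]) apply (simp_all add: s)
  proof -
    fix m n assume [simp]: "m \<in> carrier M" "n \<in> carrier N"
    let ?F = "\<lambda>a x a' b y b'. tp H ?XR (\<beta>' (\<beta>' a) \<star> \<beta>' (\<beta>' b)) (tp ?X H (pt M N (\<zeta>\<^bsub>M\<^esub> (\<zeta>\<^bsub>M\<^esub> x)) (\<zeta>\<^bsub>N\<^esub> (\<zeta>\<^bsub>N\<^esub> y)))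
      (\<beta>' (\<beta>' a') \<star> \<beta>' (\<beta>' b')))"
    \<comment> \<open>As for coassociativity: exchange the sums, then commute left and right
      coaction in each factor on its own.\<close>
    have "LS M ?T m (\<lambda>a x. LS N ?T n (\<lambda>b y. RS M ?T x (\<lambda>x' a'. RS N ?T y (\<lambda>y' b'. ?F a x' a' b y' b')))) =
      LS M ?T m (\<lambda>a x. RS M ?T x (\<lambda>x' a'. LS N ?T n (\<lambda>b y. RS N ?T y (\<lambda>y' b'. ?F a x' a' b y' b'))))"
      by (intro tsum_cong tsum_swap) simp_all
    also have "\<dots> = LS M ?T m (\<lambda>a x. RS M ?T x (\<lambda>x' a'. RS N ?T n (\<lambda>y b'. LS N ?T y (\<lambda>b y'. ?F a x' a' b y' b'))))"
      by (intro tsum_cong LS_RS) simp_all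
    also have "\<dots> = RS M ?T m (\<lambda>x a'. LS M ?T x (\<lambda>a x'. RS N ?T n (\<lambda>y b'. LS N ?T y (\<lambda>b y'. ?F a x' a' b y' b'))))"
      by (intro LS_RS) simp_all
    also have "\<dots> = RS M ?T m (\<lambda>x a'. RS N ?T n (\<lambda>y b'. LS M ?T x (\<lambda>a x'. LS N ?T y (\<lambda>b y'. ?F a x' a' b y' b'))))"
      by (intro tsum_cong tsum_swap) simp_all
    finally show "LS M ?T m (\<lambda>a x. LS N ?T n (\<lambda>b y. RS M ?T x (\<lambda>x' a'. RS N ?T y (\<lambda>y' b'. ?F a x' a' b y' b')))) = \<dots>" .
  qed
  then show "\<And>t. t \<in> carrier ?X \<Longrightarrow> sweedler ?T (\<rho>\<^sup>l\<^bsub>?X\<^esub> t) (\<lambda>a m0. tp H ?XR (\<beta>' a) (\<rho>\<^sup>r\<^bsub>?X\<^esub> m0)) =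
      sweedler ?T (\<rho>\<^sup>r\<^bsub>?X\<^esub> t) (\<lambda>m0 b. sweedler ?T (\<rho>\<^sup>l\<^bsub>?X\<^esub> m0) (\<lambda>a m00. tp H ?XR a (tp ?X H m00 (\<beta>' b))))"
    by (simp add: sweedler_coact)
qed simp_all

text \<open>From the left h acts on M alone, from the right on N alone. So each compatibility is
  that of a single factor together with associativity of the product.\<close>

lemma obj_tmod [simp]: "obj (M \<bullet> N)"
proof (intro four_angle_hopf_module.intro four_angle_hopf_module_axioms.intro hom_bimodule_tmod hom_bicomodule_tmod zeta_tmod_bij)
  let ?X = "M \<bullet> N"
  let ?LX = "tensor K H ?X" and ?XR = "tensor K ?X H"
  note s = lcoact_pt rcoact_pt LS_zeta RS_zeta DS_twist DS_mul lact_pt ract_pt otimes_mul LS_lac LS_rac RS_lac RS_rac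
  fix h t assume h [simp]: "h \<in> carrier H" and t: "t \<in> carrier ?X"
  have "\<forall>t\<in>carrier ?X. \<rho>\<^sup>l\<^bsub>?X\<^esub> (h \<triangleright>\<^bsub>?X\<^esub> t) = DS ?LX (\<beta>' h) (\<lambda>h1 h2. tsum H ?X ?LX (\<rho>\<^sup>l\<^bsub>?X\<^esub> t) (\<lambda>a m0.
        tp H ?X (h1 \<otimes>\<^bsub>H\<^esub> a) (h2 \<triangleright>\<^bsub>?X\<^esub> m0)))"
    by (rule tmod_ext[where W = ?LX]) (simp_all add: s mul_assoc)
  then show "\<rho>\<^sup>l\<^bsub>?X\<^esub> (h \<triangleright>\<^bsub>?X\<^esub> t) = sweedler ?LX (\<Delta>\<^bsub>H\<^esub> h) (\<lambda>h1 h2. sweedler ?LX (\<rho>\<^sup>l\<^bsub>?X\<^esub> t) (\<lambda>a m0.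
        tp H ?X (h1 \<otimes>\<^bsub>H\<^esub> a) (h2 \<triangleright>\<^bsub>?X\<^esub> m0)))"
    using t by (simp add: sweedler_comult sweedler_coact)
  have "\<forall>t\<in>carrier ?X. \<rho>\<^sup>r\<^bsub>?X\<^esub> (h \<triangleright>\<^bsub>?X\<^esub> t) = DS ?XR (\<beta>' h) (\<lambda>h1 h2. tsum ?X H ?XR (\<rho>\<^sup>r\<^bsub>?X\<^esub> t) (\<lambda>m0 a.
        tp ?X H (h1 \<triangleright>\<^bsub>?X\<^esub> m0) (h2 \<otimes>\<^bsub>H\<^esub> a)))"
    by (rule tmod_ext[where W = ?XR]) (simp_all add: s mul_assoc)
  then show "\<rho>\<^sup>r\<^bsub>?X\<^esub> (h \<triangleright>\<^bsub>?X\<^esub> t) = sweedler ?XR (\<Delta>\<^bsub>H\<^esub> h) (\<lambda>h1 h2. sweedler ?XR (\<rho>\<^sup>r\<^bsub>?X\<^esub> t) (\<lambda>m0 a.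
        tp ?X H (h1 \<triangleright>\<^bsub>?X\<^esub> m0) (h2 \<otimes>\<^bsub>H\<^esub> a)))"
    using t by (simp add: sweedler_comult sweedler_coact)
  have "\<forall>t\<in>carrier ?X. \<rho>\<^sup>l\<^bsub>?X\<^esub> (t \<triangleleft>\<^bsub>?X\<^esub> h) = tsum H ?X ?LX (\<rho>\<^sup>l\<^bsub>?X\<^esub> t) (\<lambda>a m0. DS ?LX (\<beta>' h) (\<lambda>h1 h2. 
        tp H ?X (a \<otimes>\<^bsub>H\<^esub> h1) (m0 \<triangleleft>\<^bsub>?X\<^esub> h2)))"
    by (rule tmod_ext[where W = ?LX]) (simp_all add: s mul_assoc)
  then show "\<rho>\<^sup>l\<^bsub>?X\<^esub> (t \<triangleleft>\<^bsub>?X\<^esub> h) = sweedler ?LX (\<rho>\<^sup>l\<^bsub>?X\<^esub> t) (\<lambda>a m0. sweedler ?LX (\<Delta>\<^bsub>H\<^esub> h) (\<lambda>h1 h2. 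
        tp H ?X (a \<otimes>\<^bsub>H\<^esub> h1) (m0 \<triangleleft>\<^bsub>?X\<^esub> h2)))"
    using t by (simp add: sweedler_comult sweedler_coact)
  have "\<forall>t\<in>carrier ?X. \<rho>\<^sup>r\<^bsub>?X\<^esub> (t \<triangleleft>\<^bsub>?X\<^esub> h) = tsum ?X H ?XR (\<rho>\<^sup>r\<^bsub>?X\<^esub> t) (\<lambda>m0 a. DS ?XR (\<beta>' h) (\<lambda>h1 h2. 
        tp ?X H (m0 \<triangleleft>\<^bsub>?X\<^esub> h1) (a \<otimes>\<^bsub>H\<^esub> h2)))"
    by (rule tmod_ext[where W = ?XR]) (simp_all add: s mul_assoc)
  then show "\<rho>\<^sup>r\<^bsub>?X\<^esub> (t \<triangleleft>\<^bsub>?X\<^esub> h) = sweedler ?XR (\<rho>\<^sup>r\<^bsub>?X\<^esub> t) (\<lambda>m0 a. sweedler ?XR (\<Delta>\<^bsub>H\<^esub> h) (\<lambda>h1 h2. 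
        tp ?X H (m0 \<triangleleft>\<^bsub>?X\<^esub> h1) (a \<otimes>\<^bsub>H\<^esub> h2)))"
    using t by (simp add: sweedler_comult sweedler_coact)
qed

end

section \<open>Untwisted structure of the tensor product\<close>

context
  fixes M N assumes M [simp]: "obj M" and N [simp]: "obj N"
begin

lemma zeta_inv_pt [simp]:
  assumes "m \<in> carrier M" "n \<in> carrier N"
  shows "\<zeta>i (M \<bullet> N) (pt M N m n) = pt M N (\<zeta>i M m) (\<zeta>i N n)"
proof -
  have "\<zeta>i (M \<bullet> N) (\<zeta>\<^bsub>M \<bullet> N\<^esub> (pt M N (\<zeta>i M m) (\<zeta>i N n))) = pt M N (\<zeta>i M m) (\<zeta>i N n)"
    by (rule zeta_inverse(2)) (use assms in simp_all)
  then show ?thesis using assms by simp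
qed

lemma lac_pt [simp]:
  "h \<in> carrier H \<Longrightarrow> m \<in> carrier M \<Longrightarrow> n \<in> carrier N \<Longrightarrow> lac (M \<bullet> N) h (pt M N m n) = pt M N (lac M h m) n"
  by (subst lac_def) (simp add: lact_pt)

lemma rac_pt [simp]:
  "h \<in> carrier H \<Longrightarrow> m \<in> carrier M \<Longrightarrow> n \<in> carrier N \<Longrightarrow> rac (M \<bullet> N) (pt M N m n) h = pt M N m (rac N n h)"
  by (subst rac_def) (simp add: ract_pt)

lemma lco_pt:
  "m \<in> carrier M \<Longrightarrow> n \<in> carrier N \<Longrightarrow> lco (M \<bullet> N) (pt M N m n) =
    LS M (tensor K H (M \<bullet> N)) m (\<lambda>a x. LS N (tensor K H (M \<bullet> N)) n (\<lambda>b y. tp H (M \<bullet> N) (a \<star> b) (pt M N x y)))"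
  by (subst lco_def) (simp add: lcoact_pt)

lemma rco_pt:
  "m \<in> carrier M \<Longrightarrow> n \<in> carrier N \<Longrightarrow> rco (M \<bullet> N) (pt M N m n) =
    RS M (tensor K (M \<bullet> N) H) m (\<lambda>x a. RS N (tensor K (M \<bullet> N) H) n (\<lambda>y b. tp (M \<bullet> N) H (pt M N x y) (a \<star> b)))"
  by (subst rco_def) (simp add: rcoact_pt)

lemma LS_pt:
  assumes "m \<in> carrier M" "n \<in> carrier N" "md W" "bil H (M \<bullet> N) W \<phi>"
  shows "LS (M \<bullet> N) W (pt M N m n) \<phi> = LS M W m (\<lambda>a x. LS N W n (\<lambda>b y. \<phi> (a \<star> b) (pt M N x y)))"
  using assms by (simp add: lco_pt)

lemma RS_pt:
  assumes "m \<in> carrier M" "n \<in> carrier N" "md W" "bil (M \<bullet> N) H W \<phi>"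
  shows "RS (M \<bullet> N) W (pt M N m n) \<phi> = RS M W m (\<lambda>x a. RS N W n (\<lambda>y b. \<phi> (pt M N x y) (a \<star> b)))"
  using assms by (simp add: rco_pt)

lemma pt_tsum [simp]:
  "m \<in> carrier M \<Longrightarrow> (\<And>a b. a \<in> carrier A \<Longrightarrow> b \<in> carrier B \<Longrightarrow> \<psi> a b \<in> carrier N) \<Longrightarrow>
    pt M N m (tsum A B N s \<psi>) = tsum A B (M \<bullet> N) s (\<lambda>a b. pt M N m (\<psi> a b))"
  "n \<in> carrier N \<Longrightarrow> (\<And>a b. a \<in> carrier A \<Longrightarrow> b \<in> carrier B \<Longrightarrow> \<chi> a b \<in> carrier M) \<Longrightarrow>
    pt M N (tsum A B M s \<chi>) n = tsum A B (M \<bullet> N) s (\<lambda>a b. pt M N (\<chi> a b) n)"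
  by (auto intro: tsum_push[of "pt M N m"] tsum_push[of "\<lambda>m. pt M N m n"])

end

lemma lac_tsum [simp]:
  assumes "obj M" "h \<in> carrier H" "\<And>a b. a \<in> carrier A \<Longrightarrow> b \<in> carrier B \<Longrightarrow> \<psi> a b \<in> carrier M"
  shows "lac M h (tsum A B M s \<psi>) = tsum A B M s (\<lambda>a b. lac M h (\<psi> a b))"
  using assms by (intro tsum_push[of "lac M h"]) simp_all

lemma rac_tsum [simp]:
  assumes "obj M" "h \<in> carrier H" "\<And>a b. a \<in> carrier A \<Longrightarrow> b \<in> carrier B \<Longrightarrow> \<psi> a b \<in> carrier M"
  shows "rac M (tsum A B M s \<psi>) h = tsum A B M s (\<lambda>a b. rac M (\<psi> a b) h)"
  using assms by (intro tsum_push[of "\<lambda>m. rac M m h"]) simp_all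

section \<open>The unit object\<close>

abbreviation "U \<equiv> unit_mod H"

lemma unit_fields [simp]:
  "carrier U = carrier H" "add U = add H" "zero U = zero H" "smult U = smult H" "\<zeta>\<^bsub>U\<^esub> = \<beta>'"
  "\<rho>\<^sup>l\<^bsub>U\<^esub> = \<Delta>\<^bsub>H\<^esub>" "\<rho>\<^sup>r\<^bsub>U\<^esub> = \<Delta>\<^bsub>H\<^esub>" "a \<triangleright>\<^bsub>U\<^esub> b = a \<otimes>\<^bsub>H\<^esub> b" "a \<triangleleft>\<^bsub>U\<^esub> b = a \<otimes>\<^bsub>H\<^esub> b"
  by (simp_all add: unit_mod_def)

lemma lin_unit [simp]: "lin_maps K V U = lin_maps K V H" "lin_maps K U V = lin_maps K H V"
  by (simp_all add: lin_maps_def)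

lemma tensor_unit [simp]: "tensor K V U = tensor K V H" "tensor K U V = tensor K H V"
  unfolding tensor_def by (rule tensor_quotient_cong; simp)+

lemma list_sum_unit: "list_sum U = list_sum H"
  by (simp add: list_sum_def fun_eq_iff)

lemma tsum_unit [simp]: "tsum U V W t \<phi> = tsum H V W t \<phi>" "tsum V U W t \<phi> = tsum V H W t \<phi>" "tsum V W U t \<phi> = tsum V W H t \<phi>"
  by (simp_all add: tsum_def list_sum_unit)

lemma sweedler_unit [simp]: "sweedler U = sweedler H"
  by (simp add: sweedler_def fun_eq_iff)

lemma md_unit [simp]: "md U"
proof (rule moduleI)
  show "abelian_group U"
  proof (rule abelian_groupI)
    fix x assume "x \<in> carrier U"
    then show "\<exists>y\<in>carrier U. y \<oplus>\<^bsub>U\<^esub> x = \<zero>\<^bsub>U\<^esub>"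
      by (intro bexI[of _ "\<ominus>\<^bsub>H\<^esub> x"]) (simp_all add: H.l_neg)
  qed (simp_all add: H.a_ac)
qed (simp_all add: H.smult_l_distr H.smult_r_distr H.smult_assoc1 K.is_cring)

text \<open>A right comodule needs the law in (H \<otimes> H) \<otimes> H, whereas
  Hom-coassociativity is given in H \<otimes> (H \<otimes> H). The multilinear form
  \<open>DS_coassoc\<close> does not depend on the bracketing and carries it over.\<close>

lemma comult_coassoc_right:
  assumes "m \<in> carrier H"
  shows "sweedler (tensor K (tensor K H H) H) (\<Delta>\<^bsub>H\<^esub> m) (\<lambda>m0 a. tp (tensor K H H) H (\<Delta>\<^bsub>H\<^esub> m0) (\<beta>' a)) =
    sweedler (tensor K (tensor K H H) H) (\<Delta>\<^bsub>H\<^esub> m) (\<lambda>m0 a.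
      sweedler (tensor K (tensor K H H) H) (\<Delta>\<^bsub>H\<^esub> a) (\<lambda>a1 a2. tp (tensor K H H) H (tp H H (\<beta>' m0) a1) a2))"
proof -
  let ?T = "tensor K (tensor K H H) H"
  let ?F = "\<lambda>a b c. tp (tensor K H H) H (tp H H (\<beta>' (\<beta>' a)) (\<beta>' (\<beta>' b))) (\<beta>' (\<beta>' c))"
  \<comment> \<open>The tensor is expanded into pure tensors so that the twists appear on its
    legs.\<close>
  have "\<delta> (\<beta>' (\<beta>' a)) = DS (tensor K H H) a (\<lambda>a b. tp H H (\<beta>' (\<beta>' a)) (\<beta>' (\<beta>' b)))" if "a \<in> carrier H" for a
    using that tsum_self[of H H "\<delta> (\<beta>' (\<beta>' a))"] by (simp add: DS_twist)
  then have "sweedler ?T (\<Delta>\<^bsub>H\<^esub> m) (\<lambda>m0 a. tp (tensor K H H) H (\<Delta>\<^bsub>H\<^esub> m0) (\<beta>' a)) = DS ?T m (\<lambda>x c. DS ?T x (\<lambda>a b. ?F a b c))"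
    using assms by (simp add: sweedler_com comult_com DS_twist)
  also have "\<dots> = DS ?T m (\<lambda>a x. DS ?T x (\<lambda>b c. ?F a b c))"
    using assms by (intro DS_coassoc) simp_all
  also have "\<dots> = sweedler ?T (\<Delta>\<^bsub>H\<^esub> m) (\<lambda>m0 a.
      sweedler ?T (\<Delta>\<^bsub>H\<^esub> a) (\<lambda>a1 a2. tp (tensor K H H) H (tp H H (\<beta>' m0) a1) a2))"
    using assms by (simp add: sweedler_com comult_com DS_twist)
  finally show ?thesis .
qed

lemma obj_unit [simp]: "obj U"
  by (intro four_angle_hopf_module.intro four_angle_hopf_module_axioms.intro
    hom_bimodule.intro left_hom_module.intro right_hom_module.intro hom_space.intro
    hom_bimodule_axioms.intro left_hom_module_axioms.intro right_hom_module_axioms.intro hom_space_axioms.intro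
    hom_bicomodule.intro left_hom_comodule.intro right_hom_comodule.intro
    hom_bicomodule_axioms.intro left_hom_comodule_axioms.intro right_hom_comodule_axioms.intro)
  (use mult_bilinear comult_linear in \<open>simp_all add: bij_twist hom_assoc twist_mult one_mult mult_one comult_twist
    hom_coassoc comult_coassoc_right counit_left counit_right comult_mult\<close>)

lemma zeta_inv_unit [simp]: "\<zeta>i U = \<beta>i"
  by (simp add: zeta_inv_def twist_inv_def)

lemma lac_unit [simp]: "lac U a b = a \<star> b"
  and rac_unit [simp]: "rac U a b = a \<star> b"
  and lco_unit [simp]: "lco U = \<delta>"
  and rco_unit [simp]: "rco U = \<delta>"
  by (simp_all add: lac_def rac_def lco_def rco_def com_def mul_def fun_eq_iff)


section \<open>Morphisms\<close>

text \<open>Plain functions, neither extensional nor tagged with source and target, so that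
  composites are ordinary terms. \<open>hom_eq_morphism\<close> gives the relation to the
  arrows.\<close>

definition morphism where
  "morphism M N f \<longleftrightarrow> f \<in> LIN M N \<and> (\<forall>m\<in>carrier M. f (\<zeta>\<^bsub>M\<^esub> m) = \<zeta>\<^bsub>N\<^esub> (f m)) \<and>
     (\<forall>h\<in>carrier H. \<forall>m\<in>carrier M. f (lac M h m) = lac N h (f m)) \<and>
     (\<forall>h\<in>carrier H. \<forall>m\<in>carrier M. f (rac M m h) = rac N (f m) h) \<and>
     (\<forall>m\<in>carrier M. lco N (f m) = LS M (tensor K H N) m (\<lambda>a x. tp H N a (f x))) \<and>
     (\<forall>m\<in>carrier M. rco N (f m) = RS M (tensor K N H) m (\<lambda>x a. tp N H (f x) a))"

lemma morphismI:
  assumes "f \<in> LIN M N" "\<And>m. m \<in> carrier M \<Longrightarrow> f (\<zeta>\<^bsub>M\<^esub> m) = \<zeta>\<^bsub>N\<^esub> (f m)"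
    "\<And>h m. h \<in> carrier H \<Longrightarrow> m \<in> carrier M \<Longrightarrow> f (lac M h m) = lac N h (f m)"
    "\<And>h m. h \<in> carrier H \<Longrightarrow> m \<in> carrier M \<Longrightarrow> f (rac M m h) = rac N (f m) h"
    "\<And>m. m \<in> carrier M \<Longrightarrow> lco N (f m) = LS M (tensor K H N) m (\<lambda>a x. tp H N a (f x))"
    "\<And>m. m \<in> carrier M \<Longrightarrow> rco N (f m) = RS M (tensor K N H) m (\<lambda>x a. tp N H (f x) a)"
  shows "morphism M N f"
  using assms by (simp add: morphism_def)

lemma morphism_linear: "morphism M N f \<Longrightarrow> f \<in> LIN M N"
  by (simp add: morphism_def)

lemma morphism_closed: "morphism M N f \<Longrightarrow> m \<in> carrier M \<Longrightarrow> f m \<in> carrier N"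
  by (rule lin_maps_closed[OF morphism_linear])

lemma morphism_zeta: "morphism M N f \<Longrightarrow> m \<in> carrier M \<Longrightarrow> f (\<zeta>\<^bsub>M\<^esub> m) = \<zeta>\<^bsub>N\<^esub> (f m)"
  and morphism_lac: "morphism M N f \<Longrightarrow> h \<in> carrier H \<Longrightarrow> m \<in> carrier M \<Longrightarrow> f (lac M h m) = lac N h (f m)"
  and morphism_rac: "morphism M N f \<Longrightarrow> h \<in> carrier H \<Longrightarrow> m \<in> carrier M \<Longrightarrow> f (rac M m h) = rac N (f m) h"
  and morphism_lco: "morphism M N f \<Longrightarrow> m \<in> carrier M \<Longrightarrow> lco N (f m) = LS M (tensor K H N) m (\<lambda>a x. tp H N a (f x))"
  and morphism_rco: "morphism M N f \<Longrightarrow> m \<in> carrier M \<Longrightarrow> rco N (f m) = RS M (tensor K N H) m (\<lambda>x a. tp N H (f x) a)"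
  by (simp_all add: morphism_def)

lemma morphism_LS:
  assumes "morphism M N f" "obj M" "obj N" "m \<in> carrier M" "md W" "bil H N W \<phi>"
  shows "LS N W (f m) \<phi> = LS M W m (\<lambda>a x. \<phi> a (f x))"
  using assms by (simp add: morphism_lco morphism_closed[OF assms(1)])

lemma morphism_RS:
  assumes "morphism M N f" "obj M" "obj N" "m \<in> carrier M" "md W" "bil N H W \<phi>"
  shows "RS N W (f m) \<phi> = RS M W m (\<lambda>x a. \<phi> (f x) a)"
  using assms by (simp add: morphism_rco morphism_closed[OF assms(1)])

lemma morphism_id: "obj M \<Longrightarrow> morphism M M (\<lambda>m. m)"
  by (rule morphismI) (simp_all add: tsum_self)

lemma morphism_comp:
  assumes "morphism M N f" "morphism N P g" and [simp]: "obj M" "obj N" "obj P"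
  shows "morphism M P (\<lambda>m. g (f m))"
proof (rule morphismI)
  note [simp] = morphism_closed[OF assms(1)] morphism_closed[OF assms(2)] morphism_linear[OF assms(1)] lin_comp[OF morphism_linear[OF assms(2)]] morphism_linear[OF assms(2)]
  show "(\<lambda>m. g (f m)) \<in> LIN M P" by simp
  fix m assume m: "m \<in> carrier M"
  show "lco P (g (f m)) = LS M (tensor K H P) m (\<lambda>a x. tp H P a (g (f x)))"
    using m by (simp add: morphism_lco[OF assms(2)] morphism_LS[OF assms(1)])
  show "rco P (g (f m)) = RS M (tensor K P H) m (\<lambda>x a. tp P H (g (f x)) a)"
    using m by (simp add: morphism_rco[OF assms(2)] morphism_RS[OF assms(1)])
qed (simp_all add: morphism_zeta[OF assms(1)] morphism_zeta[OF assms(2)] morphism_lac[OF assms(1)] morphism_lac[OF assms(2)]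
   morphism_rac[OF assms(1)] morphism_rac[OF assms(2)] morphism_closed[OF assms(1)])

text \<open>Any identity for g at n follows from n = f (g n) by cancelling g after f. For the
  coactions this takes place under the sum, in the legs of the coaction of f (g n). Isomorphisms can
  thus be given by explicit inverse functions.\<close>

lemma morphism_inverse:
  assumes f: "morphism M N f" and [simp]: "obj M" "obj N"
    and g: "\<And>n. n \<in> carrier N \<Longrightarrow> g n \<in> carrier M"
    and gf: "\<And>m. m \<in> carrier M \<Longrightarrow> g (f m) = m" and fg: "\<And>n. n \<in> carrier N \<Longrightarrow> f (g n) = n"
  shows "morphism N M g"
proof -
  have g_eq: "g n = m" if "n \<in> carrier N" "m \<in> carrier M" "n = f m" for n m using that gf by simp
  have lin: "g \<in> LIN N M"
  proof (rule lin_mapsI)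
    fix x y assume "x \<in> carrier N" "y \<in> carrier N"
    then show "g (x \<oplus>\<^bsub>N\<^esub> y) = g x \<oplus>\<^bsub>M\<^esub> g y"
      by (intro g_eq) (simp_all add: g fg lin_maps_add[OF morphism_linear[OF f]])
  next
    fix c x assume "c \<in> carrier K" "x \<in> carrier N"
    then show "g (c \<odot>\<^bsub>N\<^esub> x) = c \<odot>\<^bsub>M\<^esub> g x"
      by (intro g_eq) (simp_all add: g fg lin_maps_smult[OF morphism_linear[OF f]])
  qed (rule g)
  show ?thesis
  proof (rule morphismI)
    fix n assume n: "n \<in> carrier N"
    show "g (\<zeta>\<^bsub>N\<^esub> n) = \<zeta>\<^bsub>M\<^esub> (g n)"
      using n by (intro g_eq) (simp_all add: g fg morphism_zeta[OF f])
    show "g (lac N h n) = lac M h (g n)" "g (rac N n h) = rac M (g n) h" if "h \<in> carrier H" for h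
      using n that by (intro g_eq; simp add: g fg morphism_lac[OF f] morphism_rac[OF f])+
    have "LS N (tensor K H M) (f (g n)) (\<lambda>a x. tp H M a (g x)) = LS M (tensor K H M) (g n) (\<lambda>a x. tp H M a (g (f x)))"
      using n by (subst morphism_LS[OF f]) (simp_all add: g lin lin_comp[OF lin])
    then show "lco M (g n) = LS N (tensor K H M) n (\<lambda>a x. tp H M a (g x))"
      using n by (simp add: fg gf g tsum_self)
    have "RS N (tensor K M H) (f (g n)) (\<lambda>x a. tp M H (g x) a) = RS M (tensor K M H) (g n) (\<lambda>x a. tp M H (g (f x)) a)"
      using n by (subst morphism_RS[OF f]) (simp_all add: g lin lin_comp[OF lin])
    then show "rco M (g n) = RS N (tensor K M H) n (\<lambda>x a. tp M H (g x) a)"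
      using n by (simp add: fg gf g tsum_self)
  qed (rule lin)
qed

lemma morphism_cong:
  assumes "morphism M N f" "\<And>m. m \<in> carrier M \<Longrightarrow> f m = g m" and [simp]: "obj M" "obj N"
  shows "morphism M N g"
proof -
  have g: "g m = f m" if "m \<in> carrier M" for m using that assms(2) by simp
  have "g \<in> LIN M N"
    using lin_comp_cong[OF morphism_linear[OF assms(1)] lin_id assms(2)] by simp
  then show ?thesis
    by (intro morphismI) (simp_all add: g morphism_zeta[OF assms(1)] morphism_lac[OF assms(1)] morphism_rac[OF assms(1)]
      morphism_lco[OF assms(1)] morphism_rco[OF assms(1)])
qed

section \<open>Morphisms as arrows\<close>

definition arr where "arr M f N = Hmap M (restrict f (carrier M)) N"

lemma arr_eqI: "(\<And>m. m \<in> carrier M \<Longrightarrow> f m = g m) \<Longrightarrow> arr M f N = arr M g N"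
  by (auto simp: arr_def)

lemma fn_arr [simp]: "m \<in> carrier M \<Longrightarrow> fn (arr M f N) m = f m"
  by (simp_all add: arr_def)

lemma comp_arr:
  "(\<And>m. m \<in> carrier M \<Longrightarrow> f m \<in> carrier N) \<Longrightarrow> comp_hmap (arr N g P) (arr M f N) = arr M (\<lambda>m. g (f m)) P"
  by (auto simp: comp_hmap_def arr_def compose_def)

lemma id_arr: "id_hmap M = arr M (\<lambda>m. m) M"
  by (simp add: id_hmap_def arr_def)

text \<open>For maps that commute with \<zeta>, twisted and untwisted conditions translate into each
  other. For other maps both sides are false, hence the case distinction.\<close>

lemma hom_iff_morphism:
  assumes [simp]: "obj M" "obj N" and f: "f \<in> LIN M N"
  shows "((\<forall>m\<in>carrier M. f (\<zeta>\<^bsub>M\<^esub> m) = \<zeta>\<^bsub>N\<^esub> (f m)) \<and>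
     (\<forall>h\<in>carrier H. \<forall>m\<in>carrier M. f (h \<triangleright>\<^bsub>M\<^esub> m) = h \<triangleright>\<^bsub>N\<^esub> f m) \<and>
     (\<forall>m\<in>carrier M. \<forall>h\<in>carrier H. f (m \<triangleleft>\<^bsub>M\<^esub> h) = f m \<triangleleft>\<^bsub>N\<^esub> h) \<and>
     (\<forall>m\<in>carrier M. \<rho>\<^sup>l\<^bsub>N\<^esub> (f m) = sweedler (tensor K H N) (\<rho>\<^sup>l\<^bsub>M\<^esub> m) (\<lambda>a m0. tp H N a (f m0))) \<and>
     (\<forall>m\<in>carrier M. \<rho>\<^sup>r\<^bsub>N\<^esub> (f m) = sweedler (tensor K N H) (\<rho>\<^sup>r\<^bsub>M\<^esub> m) (\<lambda>m0 a. tp N H (f m0) a))) \<longleftrightarrow> morphism M N f"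
    (is "?zeta \<and> ?rest \<longleftrightarrow> _")
proof (cases ?zeta)
  case True
  note [simp] = lin_maps_closed[OF f]
  have zi: "f (\<zeta>i M m) = \<zeta>i N (f m)" if "m \<in> carrier M" for m
    using that True zeta_inverse(2)[of N "f (\<zeta>i M m)"] by (metis assms(1,2) lin_maps_closed[OF f] zeta_closed(2) zeta_inverse(1))
  \<comment> \<open>The untwisted coactions contain \<zeta>^-1, which permutes the carrier and may
    therefore be substituted under the quantifier.\<close>
  have ball_zeta: "(\<forall>m\<in>carrier M. P m) \<longleftrightarrow> (\<forall>m\<in>carrier M. P (\<zeta>i M m))" for P
    by (metis assms(1) zeta_closed zeta_inverse(2))
  have inj: "\<zeta>\<^bsub>N\<^esub> x = \<zeta>\<^bsub>N\<^esub> y \<longleftrightarrow> x = y" if "x \<in> carrier N" "y \<in> carrier N" for x y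
    using that by (metis assms(2) zeta_inverse(2))
  have "(\<forall>h\<in>carrier H. \<forall>m\<in>carrier M. f (h \<triangleright>\<^bsub>M\<^esub> m) = h \<triangleright>\<^bsub>N\<^esub> f m) \<longleftrightarrow>
    (\<forall>h\<in>carrier H. \<forall>m\<in>carrier M. f (lac M h m) = lac N h (f m))"
    using True by (simp add: lact_lac inj del: zeta_lac)
  moreover have "(\<forall>m\<in>carrier M. \<forall>h\<in>carrier H. f (m \<triangleleft>\<^bsub>M\<^esub> h) = f m \<triangleleft>\<^bsub>N\<^esub> h) \<longleftrightarrow>
    (\<forall>h\<in>carrier H. \<forall>m\<in>carrier M. f (rac M m h) = rac N (f m) h)"
    using True by (auto simp add: ract_rac inj simp del: zeta_rac)
  moreover have "(\<forall>m\<in>carrier M. \<rho>\<^sup>l\<^bsub>N\<^esub> (f m) = sweedler (tensor K H N) (\<rho>\<^sup>l\<^bsub>M\<^esub> m) (\<lambda>a m0. tp H N a (f m0))) \<longleftrightarrow>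
    (\<forall>m\<in>carrier M. lco N (f m) = LS M (tensor K H N) m (\<lambda>a x. tp H N a (f x)))"
    by (subst ball_zeta) (simp add: zi lcoact_lco sweedler_lco)
  moreover have "(\<forall>m\<in>carrier M. \<rho>\<^sup>r\<^bsub>N\<^esub> (f m) = sweedler (tensor K N H) (\<rho>\<^sup>r\<^bsub>M\<^esub> m) (\<lambda>m0 a. tp N H (f m0) a)) \<longleftrightarrow>
    (\<forall>m\<in>carrier M. rco N (f m) = RS M (tensor K N H) m (\<lambda>x a. tp N H (f x) a))"
    by (subst ball_zeta) (simp add: zi rcoact_rco sweedler_rco)
  ultimately show ?thesis using True f by (simp only: morphism_def simp_thms)
next
  case False
  then show ?thesis unfolding morphism_def by blast
qed

lemma hom_eq_morphism:
  assumes "obj M" "obj N"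
  shows "four_angle_hom K H M N = {arr M f N | f. morphism M N f}"
proof (intro equalityI subsetI)
  fix F assume "F \<in> four_angle_hom K H M N"
  then obtain f where F: "F = Hmap M f N" "f \<in> extensional (carrier M)" "f \<in> LIN M N"
    and "(\<forall>m\<in>carrier M. f (\<zeta>\<^bsub>M\<^esub> m) = \<zeta>\<^bsub>N\<^esub> (f m)) \<and>
     (\<forall>h\<in>carrier H. \<forall>m\<in>carrier M. f (h \<triangleright>\<^bsub>M\<^esub> m) = h \<triangleright>\<^bsub>N\<^esub> f m) \<and>
     (\<forall>m\<in>carrier M. \<forall>h\<in>carrier H. f (m \<triangleleft>\<^bsub>M\<^esub> h) = f m \<triangleleft>\<^bsub>N\<^esub> h) \<and>
     (\<forall>m\<in>carrier M. \<rho>\<^sup>l\<^bsub>N\<^esub> (f m) = sweedler (tensor K H N) (\<rho>\<^sup>l\<^bsub>M\<^esub> m) (\<lambda>a m0. tp H N a (f m0))) \<and>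
     (\<forall>m\<in>carrier M. \<rho>\<^sup>r\<^bsub>N\<^esub> (f m) = sweedler (tensor K N H) (\<rho>\<^sup>r\<^bsub>M\<^esub> m) (\<lambda>m0 a. tp N H (f m0) a))"
    unfolding four_angle_hom_def by blast
  then have "morphism M N f" using hom_iff_morphism[OF assms] by blast
  then show "F \<in> {arr M f N | f. morphism M N f}" using F by (auto simp: arr_def extensional_restrict intro!: exI[of _ f])
next
  fix F assume "F \<in> {arr M f N | f. morphism M N f}"
  then obtain f where F: "F = arr M f N" "morphism M N f" by blast
  have r: "morphism M N (restrict f (carrier M))"
    by (rule morphism_cong[OF F(2)]) (simp_all add: assms)
  show "F \<in> four_angle_hom K H M N"
    unfolding four_angle_hom_def F(1) arr_def mem_Collect_eq
    using hom_iff_morphism[OF assms morphism_linear[OF r]] r morphism_linear[OF r] by blast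
qed

section \<open>Tensor products of morphisms\<close>

definition tensor_fun where
  "tensor_fun M N M' N' f g t = tsum M N (M' \<bullet> N') t (\<lambda>m n. pt M' N' (f m) (g n))"

context
  fixes M N M' N' f g
  assumes [simp]: "obj M" "obj N" "obj M'" "obj N'" and f: "morphism M M' f" and g: "morphism N N' g"
begin

lemma bal_tensor_fun: "bal M N (\<lambda>m n. pt M' N' (f m) (g n))"
  by (simp add: bal_def morphism_rac[OF f] morphism_lac[OF g] pt_balanced morphism_closed[OF f] morphism_closed[OF g])

lemma tensor_fun_linear: "tensor_fun M N M' N' f g \<in> LIN (M \<bullet> N) (M' \<bullet> N')"
  unfolding tensor_fun_def
  by (rule lin_tsum_tmod) (simp_all add: bal_tensor_fun morphism_closed[OF f] morphism_closed[OF g] morphism_linear[OF f] morphism_linear[OF g])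

lemma tensor_fun_pt:
  "m \<in> carrier M \<Longrightarrow> n \<in> carrier N \<Longrightarrow> tensor_fun M N M' N' f g (pt M N m n) = pt M' N' (f m) (g n)"
  unfolding tensor_fun_def
  by (rule tsum_pt) (simp_all add: bal_tensor_fun morphism_closed[OF f] morphism_closed[OF g] morphism_linear[OF f] morphism_linear[OF g])

lemma morphism_tensor_fun: "morphism (M \<bullet> N) (M' \<bullet> N') (tensor_fun M N M' N' f g)" (is "morphism ?X ?Y ?F")
proof -
  note [simp] = tensor_fun_pt tensor_fun_linear lin_comp[OF tensor_fun_linear] morphism_closed[OF f] morphism_closed[OF g]
    lin_maps_closed[OF tensor_fun_linear] morphism_linear[OF f] morphism_linear[OF g] morphism_zeta[OF f] morphism_zeta[OF g]
    morphism_lac[OF f] morphism_lac[OF g] morphism_rac[OF f] morphism_rac[OF g]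
  have 1: "\<forall>t\<in>carrier ?X. ?F (\<zeta>\<^bsub>?X\<^esub> t) = \<zeta>\<^bsub>?Y\<^esub> (?F t)"
    by (rule tmod_ext[where W = ?Y]) simp_all
  have 2: "\<forall>t\<in>carrier ?X. ?F (lac ?X h t) = lac ?Y h (?F t)" if "h \<in> carrier H" for h
    by (rule tmod_ext[where W = ?Y]) (simp_all add: that)
  have 3: "\<forall>t\<in>carrier ?X. ?F (rac ?X t h) = rac ?Y (?F t) h" if "h \<in> carrier H" for h
    by (rule tmod_ext[where W = ?Y]) (simp_all add: that)
  have 4: "\<forall>t\<in>carrier ?X. lco ?Y (?F t) = LS ?X (tensor K H ?Y) t (\<lambda>a x. tp H ?Y a (?F x))"
    by (rule tmod_ext[where W = "tensor K H ?Y"]) (simp_all add: lco_pt LS_pt morphism_LS[OF f] morphism_LS[OF g])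
  have 5: "\<forall>t\<in>carrier ?X. rco ?Y (?F t) = RS ?X (tensor K ?Y H) t (\<lambda>x a. tp ?Y H (?F x) a)"
    by (rule tmod_ext[where W = "tensor K ?Y H"]) (simp_all add: rco_pt RS_pt morphism_RS[OF f] morphism_RS[OF g])
  show ?thesis by (rule morphismI) (simp_all add: 1[rule_format] 2[rule_format] 3[rule_format] 4[rule_format] 5[rule_format])
qed

lemma tensor_arr: "tensor_hmap K H (arr M f M') (arr N g N') = arr (M \<bullet> N) (tensor_fun M N M' N' f g) (M' \<bullet> N')"
  by (simp add: tensor_hmap_def Let_def arr_def tensor_fun_def tensor_mod_module_fields sweedler_tensorH sweedler_tmod[of M N]
    cong: restrict_cong)

end

section \<open>The associativity constraint\<close>

lemma tmod_ext3:
  assumes [simp]: "obj M" "obj N" "obj P" and W: "md W"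
    and f: "f \<in> LIN ((M \<bullet> N) \<bullet> P) W" and g: "g \<in> LIN ((M \<bullet> N) \<bullet> P) W"
    and eq: "\<And>m n p. m \<in> carrier M \<Longrightarrow> n \<in> carrier N \<Longrightarrow> p \<in> carrier P \<Longrightarrow>
      f (pt (M \<bullet> N) P (pt M N m n) p) = g (pt (M \<bullet> N) P (pt M N m n) p)"
  shows "\<forall>t\<in>carrier ((M \<bullet> N) \<bullet> P). f t = g t"
proof (rule tmod_ext[OF _ _ f g W])
  fix s p assume s: "s \<in> carrier (M \<bullet> N)" and p: "p \<in> carrier P"
  have "\<forall>s\<in>carrier (M \<bullet> N). f (pt (M \<bullet> N) P s p) = g (pt (M \<bullet> N) P s p)"
    by (rule tmod_ext[where W = W]) (simp_all add: lin_comp[OF f] lin_comp[OF g] W p eq)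
  then show "f (pt (M \<bullet> N) P s p) = g (pt (M \<bullet> N) P s p)" using s by blast
qed simp_all

lemma tmod_ext3':
  assumes [simp]: "obj M" "obj N" "obj P" and W: "md W"
    and f: "f \<in> LIN (M \<bullet> N \<bullet> P) W" and g: "g \<in> LIN (M \<bullet> N \<bullet> P) W"
    and eq: "\<And>m n p. m \<in> carrier M \<Longrightarrow> n \<in> carrier N \<Longrightarrow> p \<in> carrier P \<Longrightarrow>
      f (pt M (N \<bullet> P) m (pt N P n p)) = g (pt M (N \<bullet> P) m (pt N P n p))"
  shows "\<forall>t\<in>carrier (M \<bullet> N \<bullet> P). f t = g t"
proof (rule tmod_ext[OF _ _ f g W])
  fix m s assume m: "m \<in> carrier M" and s: "s \<in> carrier (N \<bullet> P)"
  have "\<forall>s\<in>carrier (N \<bullet> P). f (pt M (N \<bullet> P) m s) = g (pt M (N \<bullet> P) m s)"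
    by (rule tmod_ext[where W = W]) (simp_all add: lin_comp[OF f] lin_comp[OF g] W m eq)
  then show "f (pt M (N \<bullet> P) m s) = g (pt M (N \<bullet> P) m s)" using s by blast
qed simp_all

definition assoc_fun where
  "assoc_fun M N P t = tsum (M \<bullet> N) P (M \<bullet> N \<bullet> P) t
     (\<lambda>s p. tsum M N (M \<bullet> N \<bullet> P) s (\<lambda>m n. pt M (N \<bullet> P) m (pt N P n p)))"

definition assoc_inv where
  "assoc_inv M N P t = tsum M (N \<bullet> P) ((M \<bullet> N) \<bullet> P) t
     (\<lambda>m s. tsum N P ((M \<bullet> N) \<bullet> P) s (\<lambda>n p. pt (M \<bullet> N) P (pt M N m n) p))"

context
  fixes M N P
  assumes [simp]: "obj M" "obj N" "obj P"
begin

abbreviation (input) "L3 \<equiv> (M \<bullet> N) \<bullet> P"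
abbreviation (input) "R3 \<equiv> M \<bullet> N \<bullet> P"

lemma bal_assoc [simp]:
  "p \<in> carrier P \<Longrightarrow> bal M N (\<lambda>m n. pt M (N \<bullet> P) m (pt N P n p))"
  "m \<in> carrier M \<Longrightarrow> bal N P (\<lambda>n p. pt (M \<bullet> N) P (pt M N m n) p)"
  \<comment> \<open>Read backwards, \<open>rac_pt\<close> exhibits m \<otimes> n.h as (m \<otimes>
    n).h, to which the relation of the outer tensor product applies.\<close>
  by (simp_all add: bal_def pt_balanced flip: rac_pt)

text \<open>One argument ranges over a tensor product, so balancedness is itself an equality of
  linear maps there and is tested on pure tensors.\<close>

lemma bal_assoc2 [simp]:
  "bal (M \<bullet> N) P (\<lambda>s p. tsum M N R3 s (\<lambda>m n. pt M (N \<bullet> P) m (pt N P n p)))"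
  "bal M (N \<bullet> P) (\<lambda>m s. tsum N P L3 s (\<lambda>n p. pt (M \<bullet> N) P (pt M N m n) p))"
proof -
  have "\<forall>s\<in>carrier (M \<bullet> N). tsum M N R3 (rac (M \<bullet> N) s h) (\<lambda>m n. pt M (N \<bullet> P) m (pt N P n p)) =
    tsum M N R3 s (\<lambda>m n. pt M (N \<bullet> P) m (pt N P n (lac P h p)))" if "h \<in> carrier H" "p \<in> carrier P" for h p
    by (rule tmod_ext[where W = R3]) (simp_all add: that pt_balanced)
  then show "bal (M \<bullet> N) P (\<lambda>s p. tsum M N R3 s (\<lambda>m n. pt M (N \<bullet> P) m (pt N P n p)))"
    by (simp add: bal_def)
  have "\<forall>s\<in>carrier (N \<bullet> P). tsum N P L3 s (\<lambda>n p. pt (M \<bullet> N) P (pt M N (rac M m h) n) p) =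
    tsum N P L3 (lac (N \<bullet> P) h s) (\<lambda>n p. pt (M \<bullet> N) P (pt M N m n) p)" if "h \<in> carrier H" "m \<in> carrier M" for h m
  proof -
    have [simp]: "bal N P (\<lambda>n p. pt (M \<bullet> N) P (pt M N m (lac N h n)) p)"
      using that by (simp add: bal_def lac_rac pt_balanced flip: rac_pt)
    show ?thesis by (rule tmod_ext[where W = L3]) (simp_all add: that pt_balanced)
  qed
  then show "bal M (N \<bullet> P) (\<lambda>m s. tsum N P L3 s (\<lambda>n p. pt (M \<bullet> N) P (pt M N m n) p))"
    by (simp add: bal_def)
qed

lemma assoc_linear: "assoc_fun M N P \<in> LIN L3 R3" "assoc_inv M N P \<in> LIN R3 L3"
  unfolding assoc_fun_def assoc_inv_def by simp_all

lemma assoc_pt [simp]: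
  assumes "m \<in> carrier M" "n \<in> carrier N" "p \<in> carrier P"
  shows "assoc_fun M N P (pt (M \<bullet> N) P (pt M N m n) p) = pt M (N \<bullet> P) m (pt N P n p)"
    "assoc_inv M N P (pt M (N \<bullet> P) m (pt N P n p)) = pt (M \<bullet> N) P (pt M N m n) p"
  unfolding assoc_fun_def assoc_inv_def using assms by simp_all

lemma assoc_inverse:
  "t \<in> carrier L3 \<Longrightarrow> assoc_inv M N P (assoc_fun M N P t) = t"
  "t \<in> carrier R3 \<Longrightarrow> assoc_fun M N P (assoc_inv M N P t) = t"
proof -
  have "\<forall>t\<in>carrier L3. assoc_inv M N P (assoc_fun M N P t) = t"
    by (rule tmod_ext3[where W = L3]) (simp_all add: lin_comp[OF assoc_linear(2)] assoc_linear)
  then show "t \<in> carrier L3 \<Longrightarrow> assoc_inv M N P (assoc_fun M N P t) = t" by blast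
  have "\<forall>t\<in>carrier R3. assoc_fun M N P (assoc_inv M N P t) = t"
    by (rule tmod_ext3'[where W = R3]) (simp_all add: lin_comp[OF assoc_linear(1)] assoc_linear)
  then show "t \<in> carrier R3 \<Longrightarrow> assoc_fun M N P (assoc_inv M N P t) = t" by blast
qed

lemma morphism_assoc: "morphism L3 R3 (assoc_fun M N P)" (is "morphism _ _ ?F")
proof -
  note [simp] = assoc_linear lin_comp[OF assoc_linear(1)] lin_maps_closed[OF assoc_linear(1)]
  have 1: "\<forall>t\<in>carrier L3. ?F (\<zeta>\<^bsub>L3\<^esub> t) = \<zeta>\<^bsub>R3\<^esub> (?F t)"
    by (rule tmod_ext3[where W = R3]) simp_all
  have 2: "\<forall>t\<in>carrier L3. ?F (lac L3 h t) = lac R3 h (?F t)" if "h \<in> carrier H" for h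
    by (rule tmod_ext3[where W = R3]) (simp_all add: that)
  have 3: "\<forall>t\<in>carrier L3. ?F (rac L3 t h) = rac R3 (?F t) h" if "h \<in> carrier H" for h
    by (rule tmod_ext3[where W = R3]) (simp_all add: that)
  have 4: "\<forall>t\<in>carrier L3. lco R3 (?F t) = LS L3 (tensor K H R3) t (\<lambda>a x. tp H R3 a (?F x))"
    by (rule tmod_ext3[where W = "tensor K H R3"]) (simp_all add: lco_pt LS_pt mul_assoc)
  have 5: "\<forall>t\<in>carrier L3. rco R3 (?F t) = RS L3 (tensor K R3 H) t (\<lambda>x a. tp R3 H (?F x) a)"
    by (rule tmod_ext3[where W = "tensor K R3 H"]) (simp_all add: rco_pt RS_pt mul_assoc)
  show ?thesis by (rule morphismI) (simp_all add: 1[rule_format] 2[rule_format] 3[rule_format] 4[rule_format] 5[rule_format])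
qed

lemma assoc_arr: "assoc_hmap K H M N P = arr L3 (assoc_fun M N P) R3"
  by (simp add: assoc_hmap_def Let_def arr_def assoc_fun_def tensor_mod_module_fields sweedler_tensorH
    sweedler_tmod[of "M \<bullet> N" P] sweedler_tmod[of M N] cong: restrict_cong)

end

section \<open>The unit constraints\<close>

definition lunit_fun where "lunit_fun M t = tsum H M M t (lac M)"
definition runit_fun where "runit_fun M t = tsum M H M t (rac M)"

context
  fixes M assumes [simp]: "obj M"
begin

lemma bal_unit: "bal U M (lac M)" "bal M U (rac M)"
  by (simp_all add: bal_def lac_mul rac_mul)

lemma unit_linear: "lunit_fun M \<in> LIN (U \<bullet> M) M" "runit_fun M \<in> LIN (M \<bullet> U) M"
proof -
  have "(\<lambda>t. tsum U M M t (lac M)) \<in> LIN (U \<bullet> M) M" by (rule lin_tsum_tmod) (simp_all add: bal_unit)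
  then show "lunit_fun M \<in> LIN (U \<bullet> M) M" by (simp only: lunit_fun_def[abs_def] tsum_unit)
  have "(\<lambda>t. tsum M U M t (rac M)) \<in> LIN (M \<bullet> U) M" by (rule lin_tsum_tmod) (simp_all add: bal_unit)
  then show "runit_fun M \<in> LIN (M \<bullet> U) M" by (simp only: runit_fun_def[abs_def] tsum_unit)
qed

lemma unit_pt [simp]:
  assumes "m \<in> carrier M" "h \<in> carrier H"
  shows "lunit_fun M (pt U M h m) = lac M h m" "runit_fun M (pt M U m h) = rac M m h"
proof -
  have "tsum U M M (pt U M h m) (lac M) = lac M h m" by (rule tsum_pt) (simp_all add: bal_unit assms)
  then show "lunit_fun M (pt U M h m) = lac M h m" by (simp only: lunit_fun_def tsum_unit)
  have "tsum M U M (pt M U m h) (rac M) = rac M m h" by (rule tsum_pt) (simp_all add: bal_unit assms)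
  then show "runit_fun M (pt M U m h) = rac M m h" by (simp only: runit_fun_def tsum_unit)
qed

lemma unit_inverse:
  "t \<in> carrier (U \<bullet> M) \<Longrightarrow> pt U M unt (lunit_fun M t) = t"
  "t \<in> carrier (M \<bullet> U) \<Longrightarrow> pt M U (runit_fun M t) unt = t"
proof -
  have l: "pt U M unt (lac M h m) = pt U M h m" if "h \<in> carrier H" "m \<in> carrier M" for h m
    using pt_balanced[of U M unt h m] that by simp
  have "\<forall>t\<in>carrier (U \<bullet> M). pt U M unt (lunit_fun M t) = t"
    by (rule tmod_ext[where W = "U \<bullet> M"]) (simp_all add: unit_linear l)
  then show "t \<in> carrier (U \<bullet> M) \<Longrightarrow> pt U M unt (lunit_fun M t) = t" by blast
  have r: "pt M U (rac M m h) unt = pt M U m h" if "h \<in> carrier H" "m \<in> carrier M" for h m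
    using pt_balanced[of M U m h unt] that by simp
  have "\<forall>t\<in>carrier (M \<bullet> U). pt M U (runit_fun M t) unt = t"
    by (rule tmod_ext[where W = "M \<bullet> U"]) (simp_all add: unit_linear r)
  then show "t \<in> carrier (M \<bullet> U) \<Longrightarrow> pt M U (runit_fun M t) unt = t" by blast
qed

text \<open>Since the coactions of \<open>U\<close> are the coproduct, colinearity amounts to the
  compatibility of the left action on M with its coactions.\<close>

lemma morphism_lunit: "morphism (U \<bullet> M) M (lunit_fun M)" (is "morphism ?X _ ?F")
proof -
  note [simp] = unit_linear lin_comp[OF unit_linear(1)] lin_maps_closed[OF unit_linear(1)]
  have 1: "\<forall>t\<in>carrier ?X. ?F (\<zeta>\<^bsub>?X\<^esub> t) = \<zeta>\<^bsub>M\<^esub> (?F t)"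
    by (rule tmod_ext[where W = M]) simp_all
  have 2: "\<forall>t\<in>carrier ?X. ?F (lac ?X h t) = lac M h (?F t)" if "h \<in> carrier H" for h
    by (rule tmod_ext[where W = M]) (simp_all add: that lac_mul)
  have 3: "\<forall>t\<in>carrier ?X. ?F (rac ?X t h) = rac M (?F t) h" if "h \<in> carrier H" for h
    by (rule tmod_ext[where W = M]) (simp_all add: that lac_rac)
  have 4: "\<forall>t\<in>carrier ?X. lco M (?F t) = LS ?X (tensor K H M) t (\<lambda>a x. tp H M a (?F x))"
    by (rule tmod_ext[where W = "tensor K H M"]) (simp_all add: lco_lac LS_pt)
  have 5: "\<forall>t\<in>carrier ?X. rco M (?F t) = RS ?X (tensor K M H) t (\<lambda>x a. tp M H (?F x) a)"
    by (rule tmod_ext[where W = "tensor K M H"]) (simp_all add: rco_lac RS_pt)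
  show ?thesis by (rule morphismI) (simp_all add: 1[rule_format] 2[rule_format] 3[rule_format] 4[rule_format] 5[rule_format])
qed

lemma morphism_runit: "morphism (M \<bullet> U) M (runit_fun M)" (is "morphism ?X _ ?F")
proof -
  note [simp] = unit_linear lin_comp[OF unit_linear(2)] lin_maps_closed[OF unit_linear(2)]
  have 1: "\<forall>t\<in>carrier ?X. ?F (\<zeta>\<^bsub>?X\<^esub> t) = \<zeta>\<^bsub>M\<^esub> (?F t)"
    by (rule tmod_ext[where W = M]) simp_all
  have 2: "\<forall>t\<in>carrier ?X. ?F (lac ?X h t) = lac M h (?F t)" if "h \<in> carrier H" for h
    by (rule tmod_ext[where W = M]) (simp_all add: that lac_rac)
  have 3: "\<forall>t\<in>carrier ?X. ?F (rac ?X t h) = rac M (?F t) h" if "h \<in> carrier H" for h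
    by (rule tmod_ext[where W = M]) (simp_all add: that rac_mul)
  have 4: "\<forall>t\<in>carrier ?X. lco M (?F t) = LS ?X (tensor K H M) t (\<lambda>a x. tp H M a (?F x))"
    by (rule tmod_ext[where W = "tensor K H M"]) (simp_all add: lco_rac LS_pt)
  have 5: "\<forall>t\<in>carrier ?X. rco M (?F t) = RS ?X (tensor K M H) t (\<lambda>x a. tp M H (?F x) a)"
    by (rule tmod_ext[where W = "tensor K M H"]) (simp_all add: rco_rac RS_pt)
  show ?thesis by (rule morphismI) (simp_all add: 1[rule_format] 2[rule_format] 3[rule_format] 4[rule_format] 5[rule_format])
qed

lemma unit_arr: "lunit_hmap K H M = arr (U \<bullet> M) (lunit_fun M) M" "runit_hmap K H M = arr (M \<bullet> U) (runit_fun M) M"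
  by (simp_all add: lunit_hmap_def runit_hmap_def arr_def lunit_fun_def runit_fun_def tensor_mod_module_fields
    sweedler_tmod[of U M] sweedler_tmod[of M U] lac_def[of M, symmetric] rac_def[of M, symmetric] cong: restrict_cong)

end

section \<open>Coinvariants\<close>

text \<open>
  \<open>El\<close> and \<open>Fr\<close> map onto the left coinvariants \<open>LC\<close>, \<open>Er\<close> and \<open>Fl\<close> onto the right coinvariants \<open>RC\<close>; the
  letter \<open>l\<close> or \<open>r\<close> is the side on which the antipode or its inverse acts.
\<close>

definition El where "El M m = LS M M m (\<lambda>a x. lac M (S a) x)"
definition Er where "Er M m = RS M M m (\<lambda>x a. rac M x (S a))"
definition Fr where "Fr M m = LS M M m (\<lambda>a x. rac M x (Si a))"
definition Fl where "Fl M m = RS M M m (\<lambda>x a. lac M (Si a) x)"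

definition LC where "LC M = {m \<in> carrier M. lco M m = tp H M unt m}"
definition RC where "RC M = {m \<in> carrier M. rco M m = tp M H m unt}"

context
  fixes M assumes M [simp]: "obj M"
begin

lemma lac_smult [simp]:
  "c \<in> carrier K \<Longrightarrow> h \<in> carrier H \<Longrightarrow> m \<in> carrier M \<Longrightarrow> lac M h (c \<odot>\<^bsub>M\<^esub> m) = c \<odot>\<^bsub>M\<^esub> lac M h m"
  "c \<in> carrier K \<Longrightarrow> h \<in> carrier H \<Longrightarrow> m \<in> carrier M \<Longrightarrow> rac M (c \<odot>\<^bsub>M\<^esub> m) h = c \<odot>\<^bsub>M\<^esub> rac M m h"
  using lin_maps_smult[of "lac M h" K M M c m] lin_maps_smult[of "\<lambda>m. rac M m h" K M M c m] by simp_all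

lemma LC_closed [simp]: "m \<in> LC M \<Longrightarrow> m \<in> carrier M"
  and RC_closed [simp]: "m \<in> RC M \<Longrightarrow> m \<in> carrier M"
  by (simp_all only: LC_def RC_def mem_Collect_eq)

lemma LC_coact: "m \<in> LC M \<Longrightarrow> lco M m = tp H M unt m"
  and RC_coact: "m \<in> RC M \<Longrightarrow> rco M m = tp M H m unt"
  by (simp_all only: LC_def RC_def mem_Collect_eq)

lemma LC_I: "m \<in> carrier M \<Longrightarrow> lco M m = tp H M unt m \<Longrightarrow> m \<in> LC M"
  and RC_I: "m \<in> carrier M \<Longrightarrow> rco M m = tp M H m unt \<Longrightarrow> m \<in> RC M"
  by (simp_all only: LC_def RC_def mem_Collect_eq simp_thms)

lemma LC_LS: "m \<in> LC M \<Longrightarrow> md W \<Longrightarrow> bil H M W \<phi> \<Longrightarrow> LS M W m \<phi> = \<phi> unt m"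
  by (simp add: LC_coact)

lemma RC_RS: "m \<in> RC M \<Longrightarrow> md W \<Longrightarrow> bil M H W \<phi> \<Longrightarrow> RS M W m \<phi> = \<phi> m unt"
  by (simp add: RC_coact)

lemma E_closed [simp]:
  assumes "m \<in> carrier M"
  shows "El M m \<in> carrier M" "Er M m \<in> carrier M" "Fr M m \<in> carrier M" "Fl M m \<in> carrier M"
  using assms by (simp_all add: El_def Er_def Fr_def Fl_def)

lemma E_linear [simp]: "El M \<in> LIN M M" "Er M \<in> LIN M M" "Fr M \<in> LIN M M" "Fl M \<in> LIN M M"
  unfolding El_def Er_def Fr_def Fl_def by simp_all

lemma lin_E [simp]:
  assumes "f \<in> LIN V M"
  shows "(\<lambda>x. El M (f x)) \<in> LIN V M" "(\<lambda>x. Er M (f x)) \<in> LIN V M" "(\<lambda>x. Fr M (f x)) \<in> LIN V M" "(\<lambda>x. Fl M (f x)) \<in> LIN V M"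
  using assms by (auto intro: lin_comp[OF E_linear(1)] lin_comp[OF E_linear(2)] lin_comp[OF E_linear(3)] lin_comp[OF E_linear(4)])

text \<open>The antipode reverses legs, so the coaction of S(a).x becomes S(a2) a3 \<otimes> S(a1).y
  after coassociativity, and the adjacent legs a2 and a3 cancel.\<close>

lemma El_LC: "m \<in> carrier M \<Longrightarrow> El M m \<in> LC M"
proof -
  assume m [simp]: "m \<in> carrier M"
  let ?T = "tensor K H M"
  have "lco M (El M m) = LS M ?T m (\<lambda>a x. lco M (lac M (S a) x))"
    unfolding El_def by (rule tsum_push) simp_all
  also have "\<dots> = LS M ?T m (\<lambda>a x. DS ?T a (\<lambda>a1 a2. LS M ?T x (\<lambda>b y. tp H M (S a2 \<star> b) (lac M (S a1) y))))"
    by (simp add: lco_lac DS_antipode)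
  also have "\<dots> = LS M ?T m (\<lambda>a x. LS M ?T x (\<lambda>b y. DS ?T a (\<lambda>a1 a2. tp H M (S a2 \<star> b) (lac M (S a1) y))))"
    by (intro tsum_cong tsum_swap) simp_all
  also have "\<dots> = LS M ?T m (\<lambda>a y. DS ?T a (\<lambda>a b. DS ?T a (\<lambda>a1 a2. tp H M (S a2 \<star> b) (lac M (S a1) y))))"
    by (intro LS_coassoc[symmetric]) simp_all
  also have "\<dots> = LS M ?T m (\<lambda>a y. DS ?T a (\<lambda>a1 c. DS ?T c (\<lambda>a2 b. tp H M (S a2 \<star> b) (lac M (S a1) y))))"
    by (intro tsum_cong DS_coassoc) simp_all
  also have "\<dots> = LS M ?T m (\<lambda>a y. DS ?T a (\<lambda>a1 c. eps c \<odot>\<^bsub>?T\<^esub> tp H M unt (lac M (S a1) y)))"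
    by (intro tsum_cong DS_antipode_left[where f = "\<lambda>x. tp H M x (lac M (S _) _)"]) simp_all
  also have "\<dots> = tp H M unt (El M m)"
    by (simp add: El_def)
  finally show ?thesis by (intro LC_I) simp_all
qed

lemma Er_RC: "m \<in> carrier M \<Longrightarrow> Er M m \<in> RC M"
proof -
  assume m [simp]: "m \<in> carrier M"
  let ?T = "tensor K M H"
  have "rco M (Er M m) = RS M ?T m (\<lambda>x a. rco M (rac M x (S a)))"
    unfolding Er_def by (rule tsum_push) simp_all
  also have "\<dots> = RS M ?T m (\<lambda>x a. RS M ?T x (\<lambda>y b. DS ?T a (\<lambda>a1 a2. tp M H (rac M y (S a2)) (b \<star> S a1))))"
    by (simp add: rco_rac DS_antipode)
  also have "\<dots> = RS M ?T m (\<lambda>y a. DS ?T a (\<lambda>b a. DS ?T a (\<lambda>a1 a2. tp M H (rac M y (S a2)) (b \<star> S a1))))"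
    by (intro RS_coassoc[symmetric]) simp_all
  also have "\<dots> = RS M ?T m (\<lambda>y a. DS ?T a (\<lambda>c a2. DS ?T c (\<lambda>b a1. tp M H (rac M y (S a2)) (b \<star> S a1))))"
    by (intro tsum_cong DS_coassoc[symmetric]) simp_all
  also have "\<dots> = RS M ?T m (\<lambda>y a. DS ?T a (\<lambda>c a2. eps c \<odot>\<^bsub>?T\<^esub> tp M H (rac M y (S a2)) unt))"
    by (intro tsum_cong DS_antipode_right[where f = "\<lambda>x. tp M H (rac M _ (S _)) x"]) simp_all
  also have "\<dots> = tp M H (Er M m) unt"
    by (simp add: Er_def)
  finally show ?thesis by (intro RC_I) simp_all
qed

text \<open>Acting from the right puts the reversed leg behind a3, giving a3 S^-1(a2). In this order
  it is the inverse antipode that cancels.\<close>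

lemma Fr_LC: "m \<in> carrier M \<Longrightarrow> Fr M m \<in> LC M"
proof -
  assume m [simp]: "m \<in> carrier M"
  let ?T = "tensor K H M"
  have "lco M (Fr M m) = LS M ?T m (\<lambda>a x. lco M (rac M x (Si a)))"
    unfolding Fr_def by (rule tsum_push) simp_all
  also have "\<dots> = LS M ?T m (\<lambda>a x. LS M ?T x (\<lambda>b y. DS ?T a (\<lambda>a1 a2. tp H M (b \<star> Si a2) (rac M y (Si a1)))))"
    by (simp add: lco_rac DS_antipode_inv)
  also have "\<dots> = LS M ?T m (\<lambda>a y. DS ?T a (\<lambda>a b. DS ?T a (\<lambda>a1 a2. tp H M (b \<star> Si a2) (rac M y (Si a1)))))"
    by (intro LS_coassoc[symmetric]) simp_all
  also have "\<dots> = LS M ?T m (\<lambda>a y. DS ?T a (\<lambda>a1 c. DS ?T c (\<lambda>a2 b. tp H M (b \<star> Si a2) (rac M y (Si a1)))))"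
    by (intro tsum_cong DS_coassoc) simp_all
  also have "\<dots> = LS M ?T m (\<lambda>a y. DS ?T a (\<lambda>a1 c. eps c \<odot>\<^bsub>?T\<^esub> tp H M unt (rac M y (Si a1))))"
    by (intro tsum_cong DS_antipode_inv_right[where f = "\<lambda>x. tp H M x (rac M _ (Si _))"]) simp_all
  also have "\<dots> = tp H M unt (Fr M m)"
    by (simp add: Fr_def)
  finally show ?thesis by (intro LC_I) simp_all
qed

lemma Fl_RC: "m \<in> carrier M \<Longrightarrow> Fl M m \<in> RC M"
proof -
  assume m [simp]: "m \<in> carrier M"
  let ?T = "tensor K M H"
  have "rco M (Fl M m) = RS M ?T m (\<lambda>x a. rco M (lac M (Si a) x))"
    unfolding Fl_def by (rule tsum_push) simp_all
  also have "\<dots> = RS M ?T m (\<lambda>x a. DS ?T a (\<lambda>a1 a2. RS M ?T x (\<lambda>y b. tp M H (lac M (Si a2) y) (Si a1 \<star> b))))"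
    by (simp add: rco_lac DS_antipode_inv)
  also have "\<dots> = RS M ?T m (\<lambda>x a. RS M ?T x (\<lambda>y b. DS ?T a (\<lambda>a1 a2. tp M H (lac M (Si a2) y) (Si a1 \<star> b))))"
    by (intro tsum_cong tsum_swap) simp_all
  also have "\<dots> = RS M ?T m (\<lambda>y a. DS ?T a (\<lambda>b a. DS ?T a (\<lambda>a1 a2. tp M H (lac M (Si a2) y) (Si a1 \<star> b))))"
    by (intro RS_coassoc[symmetric]) simp_all
  also have "\<dots> = RS M ?T m (\<lambda>y a. DS ?T a (\<lambda>c a2. DS ?T c (\<lambda>b a1. tp M H (lac M (Si a2) y) (Si a1 \<star> b))))"
    by (intro tsum_cong DS_coassoc[symmetric]) simp_all
  also have "\<dots> = RS M ?T m (\<lambda>y a. DS ?T a (\<lambda>c a2. eps c \<odot>\<^bsub>?T\<^esub> tp M H (lac M (Si a2) y) unt))"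
    by (intro tsum_cong DS_antipode_inv_left[where f = "\<lambda>x. tp M H (lac M (Si _) _) x"]) simp_all
  also have "\<dots> = tp M H (Fl M m) unt"
    by (simp add: Fl_def)
  finally show ?thesis by (intro RC_I) simp_all
qed

text \<open>The legs a S(b) of m_[-2] \<otimes> m_[-1] collapse. Hence \<open>LC M\<close> generates
  M as a left module, one half of the fundamental theorem of Hopf modules.\<close>

lemma El_sum:
  assumes [simp]: "m \<in> carrier M" shows "LS M M m (\<lambda>a x. lac M a (El M x)) = m"
proof -
  have "LS M M m (\<lambda>a x. lac M a (El M x)) = LS M M m (\<lambda>a x. LS M M x (\<lambda>b y. lac M (a \<star> S b) y))"
    by (simp add: El_def lac_mul)
  also have "\<dots> = LS M M m (\<lambda>a x. DS M a (\<lambda>a b. lac M (a \<star> S b) x))"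
    by (intro LS_coassoc[symmetric]) simp_all
  also have "\<dots> = LS M M m (\<lambda>a x. eps a \<odot>\<^bsub>M\<^esub> lac M unt x)"
    by (intro tsum_cong DS_antipode_right[where f = "\<lambda>a. lac M a _"]) simp_all
  finally show ?thesis by (simp cong: tsum_cong_simp)
qed

lemma Er_sum:
  assumes [simp]: "m \<in> carrier M" shows "RS M M m (\<lambda>x a. rac M (Er M x) a) = m"
proof -
  have "RS M M m (\<lambda>x a. rac M (Er M x) a) = RS M M m (\<lambda>x a. RS M M x (\<lambda>y b. rac M y (S b \<star> a)))"
    by (simp add: Er_def rac_mul)
  also have "\<dots> = RS M M m (\<lambda>x a. DS M a (\<lambda>b a. rac M x (S b \<star> a)))"
    by (intro RS_coassoc[symmetric]) simp_all
  also have "\<dots> = RS M M m (\<lambda>x a. eps a \<odot>\<^bsub>M\<^esub> rac M x unt)"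
    by (intro tsum_cong DS_antipode_left[where f = "\<lambda>a. rac M _ a"]) simp_all
  finally show ?thesis by simp
qed

text \<open>Here S^-1(a2) a1 collapses, so \<open>LC M\<close> generates M as a right module
  too.\<close>

lemma Fr_sum:
  assumes [simp]: "m \<in> carrier M" shows "LS M M m (\<lambda>a x. rac M (Fr M x) a) = m"
proof -
  have "LS M M m (\<lambda>a x. rac M (Fr M x) a) = LS M M m (\<lambda>a x. LS M M x (\<lambda>b y. rac M y (Si b \<star> a)))"
    by (simp add: Fr_def rac_mul)
  also have "\<dots> = LS M M m (\<lambda>a x. DS M a (\<lambda>a b. rac M x (Si b \<star> a)))"
    by (intro LS_coassoc[symmetric]) simp_all
  also have "\<dots> = LS M M m (\<lambda>a x. eps a \<odot>\<^bsub>M\<^esub> rac M x unt)"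
    by (intro tsum_cong DS_antipode_inv_left[where f = "\<lambda>a. rac M _ a"]) simp_all
  finally show ?thesis by simp
qed

lemma Fl_sum:
  assumes [simp]: "m \<in> carrier M" shows "RS M M m (\<lambda>x a. lac M a (Fl M x)) = m"
proof -
  have "RS M M m (\<lambda>x a. lac M a (Fl M x)) = RS M M m (\<lambda>x a. RS M M x (\<lambda>y b. lac M (a \<star> Si b) y))"
    by (simp add: Fl_def lac_mul)
  also have "\<dots> = RS M M m (\<lambda>x a. DS M a (\<lambda>b a. lac M (a \<star> Si b) x))"
    by (intro RS_coassoc[symmetric]) simp_all
  also have "\<dots> = RS M M m (\<lambda>x a. eps a \<odot>\<^bsub>M\<^esub> lac M unt x)"
    by (intro tsum_cong DS_antipode_inv_right[where f = "\<lambda>a. lac M a _"]) simp_all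
  finally show ?thesis by simp
qed

text \<open>S(h1 a) h2 = S(a) S(h1) h2, and the factor S(h1) h2 reduces to the counit.\<close>

lemma El_lac:
  assumes [simp]: "h \<in> carrier H" "m \<in> carrier M" shows "El M (lac M h m) = eps h \<odot>\<^bsub>M\<^esub> El M m"
proof -
  have "El M (lac M h m) = DS M h (\<lambda>h1 h2. LS M M m (\<lambda>a x. lac M (S a) (lac M (S h1 \<star> h2) x)))"
    by (simp add: El_def LS_lac antipode_mul lac_mul)
  also have "\<dots> = LS M M m (\<lambda>a x. DS M h (\<lambda>h1 h2. lac M (S a) (lac M (S h1 \<star> h2) x)))"
    by (intro tsum_swap) simp_all
  also have "\<dots> = LS M M m (\<lambda>a x. eps h \<odot>\<^bsub>M\<^esub> lac M (S a) (lac M unt x))"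
    by (intro tsum_cong DS_antipode_left[where f = "\<lambda>h. lac M (S _) (lac M h _)"]) simp_all
  also have "\<dots> = eps h \<odot>\<^bsub>M\<^esub> El M m"
    unfolding El_def by (subst tsum_push[of "(\<odot>\<^bsub>M\<^esub>) (eps h)" M M]) simp_all
  finally show ?thesis .
qed

text \<open>\<open>El\<close> turns the right action into the right adjoint action on left
  coinvariants.\<close>

lemma El_rac:
  assumes [simp]: "h \<in> carrier H" "m \<in> carrier M"
  shows "El M (rac M m h) = DS M h (\<lambda>h1 h2. lac M (S h1) (rac M (El M m) h2))"
proof -
  have "El M (rac M m h) = LS M M m (\<lambda>a x. DS M h (\<lambda>h1 h2. lac M (S h1) (rac M (lac M (S a) x) h2)))"
    by (simp add: El_def LS_rac antipode_mul lac_mul lac_rac)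
  also have "\<dots> = DS M h (\<lambda>h1 h2. LS M M m (\<lambda>a x. lac M (S h1) (rac M (lac M (S a) x) h2)))"
    by (intro tsum_swap) simp_all
  finally show ?thesis by (simp add: El_def)
qed

lemma Er_rac:
  assumes [simp]: "h \<in> carrier H" "m \<in> carrier M" shows "Er M (rac M m h) = eps h \<odot>\<^bsub>M\<^esub> Er M m"
proof -
  have "Er M (rac M m h) = RS M M m (\<lambda>x a. DS M h (\<lambda>h1 h2. rac M (rac M x (h1 \<star> S h2)) (S a)))"
    by (simp add: Er_def RS_rac antipode_mul rac_mul)
  also have "\<dots> = RS M M m (\<lambda>x a. eps h \<odot>\<^bsub>M\<^esub> rac M (rac M x unt) (S a))"
    by (intro tsum_cong DS_antipode_right[where f = "\<lambda>h. rac M (rac M _ h) (S _)"]) simp_all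
  also have "\<dots> = eps h \<odot>\<^bsub>M\<^esub> Er M m"
    unfolding Er_def by (subst tsum_push[of "(\<odot>\<^bsub>M\<^esub>) (eps h)" M M]) simp_all
  finally show ?thesis .
qed

text \<open>Dually to \<open>El_rac\<close>, the left action becomes the left adjoint action on
  right coinvariants.\<close>

lemma Er_lac:
  assumes [simp]: "h \<in> carrier H" "m \<in> carrier M"
  shows "Er M (lac M h m) = DS M h (\<lambda>h1 h2. lac M h1 (rac M (Er M m) (S h2)))"
  by (simp add: Er_def RS_lac antipode_mul rac_mul lac_rac)

lemma Fr_rac:
  assumes [simp]: "h \<in> carrier H" "m \<in> carrier M" shows "Fr M (rac M m h) = eps h \<odot>\<^bsub>M\<^esub> Fr M m"
proof -
  have "Fr M (rac M m h) = LS M M m (\<lambda>a x. DS M h (\<lambda>h1 h2. rac M (rac M x (h2 \<star> Si h1)) (Si a)))"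
    by (simp add: Fr_def LS_rac antipode_inv_mul rac_mul)
  also have "\<dots> = LS M M m (\<lambda>a x. eps h \<odot>\<^bsub>M\<^esub> rac M (rac M x unt) (Si a))"
    by (intro tsum_cong DS_antipode_inv_right[where f = "\<lambda>h. rac M (rac M _ h) (Si _)"]) simp_all
  also have "\<dots> = eps h \<odot>\<^bsub>M\<^esub> Fr M m"
    unfolding Fr_def by (subst tsum_push[of "(\<odot>\<^bsub>M\<^esub>) (eps h)" M M]) simp_all
  finally show ?thesis .
qed

lemma Fr_lac:
  assumes [simp]: "h \<in> carrier H" "m \<in> carrier M"
  shows "Fr M (lac M h m) = DS M h (\<lambda>h1 h2. lac M h2 (rac M (Fr M m) (Si h1)))"
  by (simp add: Fr_def LS_lac antipode_inv_mul rac_mul lac_rac)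

lemma Fl_lac:
  assumes [simp]: "h \<in> carrier H" "m \<in> carrier M" shows "Fl M (lac M h m) = eps h \<odot>\<^bsub>M\<^esub> Fl M m"
proof -
  have "Fl M (lac M h m) = DS M h (\<lambda>h1 h2. RS M M m (\<lambda>x a. lac M (Si a) (lac M (Si h2 \<star> h1) x)))"
    by (simp add: Fl_def RS_lac antipode_inv_mul lac_mul)
  also have "\<dots> = RS M M m (\<lambda>x a. DS M h (\<lambda>h1 h2. lac M (Si a) (lac M (Si h2 \<star> h1) x)))"
    by (intro tsum_swap) simp_all
  also have "\<dots> = RS M M m (\<lambda>x a. eps h \<odot>\<^bsub>M\<^esub> lac M (Si a) (lac M unt x))"
    by (intro tsum_cong DS_antipode_inv_left[where f = "\<lambda>h. lac M (Si _) (lac M h _)"]) simp_all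
  also have "\<dots> = eps h \<odot>\<^bsub>M\<^esub> Fl M m"
    unfolding Fl_def by (subst tsum_push[of "(\<odot>\<^bsub>M\<^esub>) (eps h)" M M]) simp_all
  finally show ?thesis .
qed

lemma Fl_rac:
  assumes [simp]: "h \<in> carrier H" "m \<in> carrier M"
  shows "Fl M (rac M m h) = DS M h (\<lambda>h1 h2. lac M (Si h2) (rac M (Fl M m) h1))"
proof -
  have "Fl M (rac M m h) = RS M M m (\<lambda>x a. DS M h (\<lambda>h1 h2. lac M (Si h2) (rac M (lac M (Si a) x) h1)))"
    by (simp add: Fl_def RS_rac antipode_inv_mul lac_mul lac_rac)
  also have "\<dots> = DS M h (\<lambda>h1 h2. RS M M m (\<lambda>x a. lac M (Si h2) (rac M (lac M (Si a) x) h1)))"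
    by (intro tsum_swap) simp_all
  finally show ?thesis by (simp add: Fl_def)
qed

section \<open>Coactions of coinvariants\<close>

lemma E_coinvariant:
  "m \<in> LC M \<Longrightarrow> El M m = m" "m \<in> LC M \<Longrightarrow> Fr M m = m"
  "m \<in> RC M \<Longrightarrow> Er M m = m" "m \<in> RC M \<Longrightarrow> Fl M m = m"
  by (simp_all add: El_def Er_def Fr_def Fl_def LC_LS RC_RS)

text \<open>By the bicomodule axiom the coactions can be exchanged, and then the right one meets n
  itself. So n_[0] behaves as right coinvariant under the sum, although single components of a
  representative need not be.\<close>

lemma RC_LS_RS:
  assumes "n \<in> RC M" "md W"
    and "\<And>a b. a \<in> carrier H \<Longrightarrow> b \<in> carrier M \<Longrightarrow> \<phi> a b \<in> LIN H W"
    and "\<And>a c. a \<in> carrier H \<Longrightarrow> c \<in> carrier H \<Longrightarrow> (\<lambda>b. \<phi> a b c) \<in> LIN M W"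
    and "\<And>b c. b \<in> carrier M \<Longrightarrow> c \<in> carrier H \<Longrightarrow> (\<lambda>a. \<phi> a b c) \<in> LIN H W"
  shows "LS M W n (\<lambda>a x. RS M W x (\<lambda>y b. \<phi> a y b)) = LS M W n (\<lambda>a y. \<phi> a y unt)"
proof -
  have "LS M W n (\<lambda>a x. RS M W x (\<lambda>y b. \<phi> a y b)) = RS M W n (\<lambda>x b. LS M W x (\<lambda>a y. \<phi> a y b))"
    using assms by (intro LS_RS) simp_all
  also have "\<dots> = LS M W n (\<lambda>a y. \<phi> a y unt)"
    using assms(2-5) by (intro RC_RS[OF assms(1)]) simp_all
  finally show ?thesis .
qed

lemma LC_RS_LS:
  assumes "n \<in> LC M" "md W"
    and "\<And>a b. a \<in> carrier H \<Longrightarrow> b \<in> carrier M \<Longrightarrow> \<phi> a b \<in> LIN H W"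
    and "\<And>a c. a \<in> carrier H \<Longrightarrow> c \<in> carrier H \<Longrightarrow> (\<lambda>b. \<phi> a b c) \<in> LIN M W"
    and "\<And>b c. b \<in> carrier M \<Longrightarrow> c \<in> carrier H \<Longrightarrow> (\<lambda>a. \<phi> a b c) \<in> LIN H W"
  shows "RS M W n (\<lambda>x b. LS M W x (\<lambda>a y. \<phi> a y b)) = RS M W n (\<lambda>y b. \<phi> unt y b)"
proof -
  have "RS M W n (\<lambda>x b. LS M W x (\<lambda>a y. \<phi> a y b)) = LS M W n (\<lambda>a x. RS M W x (\<lambda>y b. \<phi> a y b))"
    using assms by (intro LS_RS[symmetric]) simp_all
  also have "\<dots> = RS M W n (\<lambda>y b. \<phi> unt y b)"
    using assms(2-5) by (intro LC_LS[OF assms(1)]) simp_all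
  finally show ?thesis .
qed

text \<open>Allows the braiding to be evaluated as a flip behind \<zeta>, which is how it is seen to
  commute with \<zeta>.\<close>

lemma zeta_LC [simp]: "m \<in> LC M \<Longrightarrow> \<zeta>\<^bsub>M\<^esub> m \<in> LC M"
  and zeta_RC [simp]: "n \<in> RC M \<Longrightarrow> \<zeta>\<^bsub>M\<^esub> n \<in> RC M"
proof -
  assume m: "m \<in> LC M"
  have "LS M (tensor K H M) (\<zeta>\<^bsub>M\<^esub> m) (tp H M) = tp H M unt (\<zeta>\<^bsub>M\<^esub> m)"
    using m by (simp add: LS_zeta LC_LS)
  then show "\<zeta>\<^bsub>M\<^esub> m \<in> LC M" using m by (intro LC_I) (simp_all add: tsum_self)
next
  assume m: "n \<in> RC M"
  have "RS M (tensor K M H) (\<zeta>\<^bsub>M\<^esub> n) (tp M H) = tp M H (\<zeta>\<^bsub>M\<^esub> n) unt"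
    using m by (simp add: RS_zeta RC_RS)
  then show "\<zeta>\<^bsub>M\<^esub> n \<in> RC M" using m by (intro RC_I) (simp_all add: tsum_self)
qed

end

lemma morphism_LC: "morphism M N f \<Longrightarrow> obj M \<Longrightarrow> obj N \<Longrightarrow> m \<in> LC M \<Longrightarrow> f m \<in> LC N"
  and morphism_RC: "morphism M N f \<Longrightarrow> obj M \<Longrightarrow> obj N \<Longrightarrow> n \<in> RC M \<Longrightarrow> f n \<in> RC N"
  by (intro LC_I RC_I; simp add: morphism_closed morphism_lco morphism_rco morphism_linear LC_LS RC_RS)+

section \<open>Generation of the tensor product by coinvariants\<close>

context
  fixes M N assumes M [simp]: "obj M" and N [simp]: "obj N"
begin

lemma pt_smult [simp]:
  "c \<in> carrier K \<Longrightarrow> m \<in> carrier M \<Longrightarrow> n \<in> carrier N \<Longrightarrow> pt M N (c \<odot>\<^bsub>M\<^esub> m) n = c \<odot>\<^bsub>M \<bullet> N\<^esub> pt M N m n"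
  "c \<in> carrier K \<Longrightarrow> m \<in> carrier M \<Longrightarrow> n \<in> carrier N \<Longrightarrow> pt M N m (c \<odot>\<^bsub>N\<^esub> n) = c \<odot>\<^bsub>M \<bullet> N\<^esub> pt M N m n"
  using lin_maps_smult[of "pt M N m" K N "M \<bullet> N" c n] lin_maps_smult[of "\<lambda>m. pt M N m n" K M "M \<bullet> N" c m] by simp_all

lemma pt_LC: "m \<in> LC M \<Longrightarrow> n \<in> LC N \<Longrightarrow> pt M N m n \<in> LC (M \<bullet> N)"
proof -
  assume m: "m \<in> LC M" and n: "n \<in> LC N"
  then have "lco (M \<bullet> N) (pt M N m n) = tp H (M \<bullet> N) unt (pt M N m n)"
    by (simp add: lco_pt LC_LS)
  then show ?thesis using m n by (intro LC_I) simp_all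
qed

lemma pt_RC: "m \<in> RC M \<Longrightarrow> n \<in> RC N \<Longrightarrow> pt M N m n \<in> RC (M \<bullet> N)"
proof -
  assume m: "m \<in> RC M" and n: "n \<in> RC N"
  then have "rco (M \<bullet> N) (pt M N m n) = tp (M \<bullet> N) H (pt M N m n) unt"
    by (simp add: rco_pt RC_RS)
  then show ?thesis using m n by (intro RC_I) simp_all
qed

text \<open>By \<open>El_sum\<close> and \<open>Er_sum\<close> a pure tensor is a sum of a.El(x)
  \<otimes> Er(y).b, and a and b stand at the outer ends, where they are the two actions on the
  tensor product.\<close>

lemma coinvariant_ext:
  assumes f: "f \<in> LIN (M \<bullet> N) W" and g: "g \<in> LIN (M \<bullet> N) W" and W: "md W"
    and eq: "\<And>h m n k. h \<in> carrier H \<Longrightarrow> m \<in> LC M \<Longrightarrow> n \<in> RC N \<Longrightarrow> k \<in> carrier H \<Longrightarrow>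
      f (lac (M \<bullet> N) h (rac (M \<bullet> N) (pt M N m n) k)) = g (lac (M \<bullet> N) h (rac (M \<bullet> N) (pt M N m n) k))"
  shows "\<forall>t\<in>carrier (M \<bullet> N). f t = g t"
proof (rule tmod_ext[OF M N f g W])
  fix m n assume m: "m \<in> carrier M" and n: "n \<in> carrier N"
  let ?X = "M \<bullet> N"
  let ?G = "\<lambda>a x y b. lac ?X a (rac ?X (pt M N (El M x) (Er N y)) b)"
  have "pt M N (LS M M m (\<lambda>a x. lac M a (El M x))) (RS N N n (\<lambda>y b. rac N (Er N y) b)) =
    RS N ?X n (\<lambda>y b. LS M ?X m (\<lambda>a x. ?G a x y b))"
    by simp
  then have *: "pt M N m n = RS N ?X n (\<lambda>y b. LS M ?X m (\<lambda>a x. ?G a x y b))"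
    using m n by (simp only: El_sum[OF M] Er_sum[OF N])
  have push: "F (RS N ?X n (\<lambda>y b. LS M ?X m (\<lambda>a x. ?G a x y b))) = RS N W n (\<lambda>y b. LS M W m (\<lambda>a x. F (?G a x y b)))"
    if "F \<in> LIN ?X W" for F
    by (simp add: tsum_push[OF that] W)
  show "f (pt M N m n) = g (pt M N m n)"
    unfolding * push[OF f] push[OF g] by (intro tsum_cong eq El_LC Er_RC) simp_all
qed

text \<open>The sides are exchanged: right coinvariants generate the left factor by
  \<open>Fl_sum\<close>, left coinvariants the right factor by \<open>Fr_sum\<close>. This is the
  form for the domain of the inverse braiding.\<close>

lemma coinvariant_ext':
  assumes f: "f \<in> LIN (M \<bullet> N) W" and g: "g \<in> LIN (M \<bullet> N) W" and W: "md W"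
    and eq: "\<And>h m n k. h \<in> carrier H \<Longrightarrow> m \<in> RC M \<Longrightarrow> n \<in> LC N \<Longrightarrow> k \<in> carrier H \<Longrightarrow>
      f (lac (M \<bullet> N) h (rac (M \<bullet> N) (pt M N m n) k)) = g (lac (M \<bullet> N) h (rac (M \<bullet> N) (pt M N m n) k))"
  shows "\<forall>t\<in>carrier (M \<bullet> N). f t = g t"
proof (rule tmod_ext[OF M N f g W])
  fix m n assume m: "m \<in> carrier M" and n: "n \<in> carrier N"
  let ?X = "M \<bullet> N"
  let ?G = "\<lambda>a x y b. lac ?X a (rac ?X (pt M N (Fl M x) (Fr N y)) b)"
  have "pt M N (RS M M m (\<lambda>x a. lac M a (Fl M x))) (LS N N n (\<lambda>b y. rac N (Fr N y) b)) =
    LS N ?X n (\<lambda>b y. RS M ?X m (\<lambda>x a. ?G a x y b))"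
    by simp
  then have *: "pt M N m n = LS N ?X n (\<lambda>b y. RS M ?X m (\<lambda>x a. ?G a x y b))"
    using m n by (simp only: Fl_sum[OF M] Fr_sum[OF N])
  have push: "F (LS N ?X n (\<lambda>b y. RS M ?X m (\<lambda>x a. ?G a x y b))) = LS N W n (\<lambda>b y. RS M W m (\<lambda>x a. F (?G a x y b)))"
    if "F \<in> LIN ?X W" for F
    by (simp add: tsum_push[OF that] W)
  show "f (pt M N m n) = g (pt M N m n)"
    unfolding * push[OF f] push[OF g] by (intro tsum_cong eq Fl_RC Fr_LC) simp_all
qed

end

section \<open>The braiding\<close>

definition braid_op where
  "braid_op M N m n = LS M (N \<bullet> M) m (\<lambda>a x. RS N (N \<bullet> M) n (\<lambda>y b. pt N M (lac N a (Er N y)) (rac M (El M x) b)))"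

text \<open>In untwisted terms n_(1).(Fr(m_[0]) \<otimes> Fl(n_(0))).m_[-1].\<close>

definition braid_inv_op where
  "braid_inv_op M N n m = LS M (M \<bullet> N) m (\<lambda>a x. RS N (M \<bullet> N) n (\<lambda>y b. pt M N (lac M b (Fr M x)) (rac N (Fl N y) a)))"

definition braid_fun where "braid_fun M N t = tsum M N (N \<bullet> M) t (braid_op M N)"
definition braid_inv where "braid_inv M N t = tsum N M (M \<bullet> N) t (braid_inv_op M N)"

context
  fixes M N assumes M [simp]: "obj M" and N [simp]: "obj N"
begin

abbreviation (input) "X \<equiv> M \<bullet> N"
abbreviation (input) "Y \<equiv> N \<bullet> M"

section \<open>The braiding as a well-defined bimodule map\<close>

lemma braid_op_bilinear: "bil M N Y (braid_op M N)"
  unfolding braid_op_def by simp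

lemma braid_inv_op_bilinear: "bil N M X (braid_inv_op M N)"
  unfolding braid_inv_op_def by simp

lemma braid_op_closed [simp]: "m \<in> carrier M \<Longrightarrow> n \<in> carrier N \<Longrightarrow> braid_op M N m n \<in> carrier Y"
  and braid_inv_op_closed [simp]: "m \<in> carrier M \<Longrightarrow> n \<in> carrier N \<Longrightarrow> braid_inv_op M N n m \<in> carrier X"
  using bilinear_closed[OF braid_op_bilinear] bilinear_closed[OF braid_inv_op_bilinear] by blast+

text \<open>By \<open>El_rac\<close>, m.h contributes a h1.Er(y) \<otimes> S(h2).El(x).h3 b; by
  \<open>Er_lac\<close>, h.n contributes a.(h1.Er(y).S(h2)) \<otimes> El(x).h3 b. They differ only
  by moving S(h2) across the tensor sign.\<close>

lemma bal_braid_op: "bal M N (braid_op M N)"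
proof -
  have "braid_op M N (rac M m h) n = braid_op M N m (lac N h n)" if [simp]: "m \<in> carrier M" "h \<in> carrier H" "n \<in> carrier N" for m h n
  proof -
    let ?F = "\<lambda>a x y b h1 h2 h3. pt N M (lac N a (lac N h1 (rac N (Er N y) (S h2)))) (rac M (El M x) (h3 \<star> b))"
    have "braid_op M N (rac M m h) n = LS M Y m (\<lambda>a x. DS Y h (\<lambda>h1 g. RS N Y n (\<lambda>y b. DS Y g (\<lambda>h2 h3. ?F a x y b h1 h2 h3))))"
      by (simp add: braid_op_def LS_rac El_rac lac_mul rac_mul lac_rac pt_balanced)
    also have "\<dots> = LS M Y m (\<lambda>a x. RS N Y n (\<lambda>y b. DS Y h (\<lambda>h1 g. DS Y g (\<lambda>h2 h3. ?F a x y b h1 h2 h3))))"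
      by (intro tsum_cong tsum_swap) simp_all
    also have "\<dots> = LS M Y m (\<lambda>a x. RS N Y n (\<lambda>y b. DS Y h (\<lambda>g h3. DS Y g (\<lambda>h1 h2. ?F a x y b h1 h2 h3))))"
      by (intro tsum_cong DS_coassoc[symmetric]) simp_all
    also have "\<dots> = LS M Y m (\<lambda>a x. DS Y h (\<lambda>g h3. RS N Y n (\<lambda>y b. DS Y g (\<lambda>h1 h2. ?F a x y b h1 h2 h3))))"
      by (intro tsum_cong tsum_swap) simp_all
    also have "\<dots> = braid_op M N m (lac N h n)"
      by (simp add: braid_op_def RS_lac Er_lac)
    finally show ?thesis .
  qed
  then show ?thesis by (simp add: bal_def)
qed

text \<open>Now S^-1(h2) is moved across, with h3 to its left on the first factor and h1 to its
  right on the second.\<close>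

lemma bal_braid_inv_op: "bal N M (braid_inv_op M N)"
proof -
  have "braid_inv_op M N (rac N n h) m = braid_inv_op M N n (lac M h m)" if [simp]: "m \<in> carrier M" "h \<in> carrier H" "n \<in> carrier N" for m h n
  proof -
    let ?F = "\<lambda>a x y b h1 h2 h3. pt M N (lac M b (lac M h3 (rac M (Fr M x) (Si h2)))) (rac N (Fl N y) (h1 \<star> a))"
    have "braid_inv_op M N (rac N n h) m = LS M X m (\<lambda>a x. RS N X n (\<lambda>y b. DS X h (\<lambda>g h3. DS X g (\<lambda>h1 h2. ?F a x y b h1 h2 h3))))"
      by (simp add: braid_inv_op_def RS_rac Fl_rac lac_mul rac_mul lac_rac pt_balanced)
    also have "\<dots> = LS M X m (\<lambda>a x. RS N X n (\<lambda>y b. DS X h (\<lambda>h1 g. DS X g (\<lambda>h2 h3. ?F a x y b h1 h2 h3))))"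
      by (intro tsum_cong DS_coassoc) simp_all
    also have "\<dots> = LS M X m (\<lambda>a x. DS X h (\<lambda>h1 g. RS N X n (\<lambda>y b. DS X g (\<lambda>h2 h3. ?F a x y b h1 h2 h3))))"
      by (intro tsum_cong tsum_swap) simp_all
    also have "\<dots> = DS X h (\<lambda>h1 g. LS M X m (\<lambda>a x. RS N X n (\<lambda>y b. DS X g (\<lambda>h2 h3. ?F a x y b h1 h2 h3))))"
      by (intro tsum_swap) simp_all
    also have "\<dots> = braid_inv_op M N n (lac M h m)"
      by (simp add: braid_inv_op_def LS_lac Fr_lac)
    finally show ?thesis .
  qed
  then show ?thesis by (simp add: bal_def)
qed

lemma braid_linear [simp]: "braid_fun M N \<in> LIN X Y" "braid_inv M N \<in> LIN Y X"
  unfolding braid_fun_def braid_inv_def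
  by (rule lin_tsum_tmod; simp add: bal_braid_op bal_braid_inv_op braid_op_bilinear[unfolded bilinear_iff] braid_inv_op_bilinear[unfolded bilinear_iff])+

lemma braid_pt:
  "m \<in> carrier M \<Longrightarrow> n \<in> carrier N \<Longrightarrow> braid_fun M N (pt M N m n) = braid_op M N m n"
  "m \<in> carrier M \<Longrightarrow> n \<in> carrier N \<Longrightarrow> braid_inv M N (pt N M n m) = braid_inv_op M N n m"
  unfolding braid_fun_def braid_inv_def
  by (rule tsum_pt; simp add: bal_braid_op bal_braid_inv_op braid_op_bilinear[unfolded bilinear_iff] braid_inv_op_bilinear[unfolded bilinear_iff])+

lemma lin_braid [simp]:
  "f \<in> LIN V X \<Longrightarrow> (\<lambda>x. braid_fun M N (f x)) \<in> LIN V Y" "g \<in> LIN V Y \<Longrightarrow> (\<lambda>x. braid_inv M N (g x)) \<in> LIN V X"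
  by (rule lin_comp[OF braid_linear(1)] lin_comp[OF braid_linear(2)]; assumption)+

lemma braid_closed [simp]: "t \<in> carrier X \<Longrightarrow> braid_fun M N t \<in> carrier Y" "s \<in> carrier Y \<Longrightarrow> braid_inv M N s \<in> carrier X"
  by (rule lin_maps_closed[OF braid_linear(1)] lin_maps_closed[OF braid_linear(2)]; assumption)+

text \<open>A left factor h of m multiplies the leg a by h1 and leaves eps(h2) by
  \<open>El_lac\<close>, so the counit restores h in front of everything. A right factor of n is
  treated likewise by \<open>Er_rac\<close>.\<close>

lemma braid_bimodule:
  assumes [simp]: "h \<in> carrier H" and t: "t \<in> carrier X"
  shows "braid_fun M N (lac X h t) = lac Y h (braid_fun M N t)" "braid_fun M N (rac X t h) = rac Y (braid_fun M N t) h"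
proof -
  have "braid_op M N (lac M h m) n = lac Y h (braid_op M N m n)" if [simp]: "m \<in> carrier M" "n \<in> carrier N" for m n
  proof -
    let ?F = "\<lambda>a x y b. pt N M (lac N a (Er N y)) (rac M (El M x) b)"
    have "braid_op M N (lac M h m) n = DS Y h (\<lambda>h1 h2. LS M Y m (\<lambda>a x. RS N Y n (\<lambda>y b. eps h2 \<odot>\<^bsub>Y\<^esub> ?F (h1 \<star> a) x y b)))"
      by (simp add: braid_op_def LS_lac El_lac)
    also have "\<dots> = LS M Y m (\<lambda>a x. DS Y h (\<lambda>h1 h2. RS N Y n (\<lambda>y b. eps h2 \<odot>\<^bsub>Y\<^esub> ?F (h1 \<star> a) x y b)))"
      by (intro tsum_swap) simp_all
    also have "\<dots> = LS M Y m (\<lambda>a x. RS N Y n (\<lambda>y b. DS Y h (\<lambda>h1 h2. eps h2 \<odot>\<^bsub>Y\<^esub> ?F (h1 \<star> a) x y b)))"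
      by (intro tsum_cong tsum_swap) simp_all
    also have "\<dots> = LS M Y m (\<lambda>a x. RS N Y n (\<lambda>y b. ?F (h \<star> a) x y b))"
      by (intro tsum_cong DS_counit_right) simp_all
    also have "\<dots> = lac Y h (braid_op M N m n)"
      by (simp add: braid_op_def lac_mul)
    finally show ?thesis .
  qed
  then have "\<forall>t\<in>carrier X. braid_fun M N (lac X h t) = lac Y h (braid_fun M N t)"
    by (intro tmod_ext[where W = Y]) (simp_all add: braid_pt)
  then show "braid_fun M N (lac X h t) = lac Y h (braid_fun M N t)" using t by blast
  have "braid_op M N m (rac N n h) = rac Y (braid_op M N m n) h" if [simp]: "m \<in> carrier M" "n \<in> carrier N" for m n
  proof -
    let ?F = "\<lambda>a x y b. pt N M (lac N a (Er N y)) (rac M (El M x) b)"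
    have "braid_op M N m (rac N n h) = LS M Y m (\<lambda>a x. RS N Y n (\<lambda>y b. DS Y h (\<lambda>h1 h2. eps h1 \<odot>\<^bsub>Y\<^esub> ?F a x y (b \<star> h2))))"
      by (simp add: braid_op_def RS_rac Er_rac del: DS_counit_left)
    also have "\<dots> = LS M Y m (\<lambda>a x. RS N Y n (\<lambda>y b. ?F a x y (b \<star> h)))"
      by (intro tsum_cong DS_counit_left) simp_all
    also have "\<dots> = rac Y (braid_op M N m n) h"
      by (simp add: braid_op_def rac_mul)
    finally show ?thesis .
  qed
  then have "\<forall>t\<in>carrier X. braid_fun M N (rac X t h) = rac Y (braid_fun M N t) h"
    by (intro tmod_ext[where W = Y]) (simp_all add: braid_pt)
  then show "braid_fun M N (rac X t h) = rac Y (braid_fun M N t) h" using t by blast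
qed

lemma braid_inv_bimodule:
  assumes [simp]: "h \<in> carrier H" and t: "t \<in> carrier Y"
  shows "braid_inv M N (lac Y h t) = lac X h (braid_inv M N t)" "braid_inv M N (rac Y t h) = rac X (braid_inv M N t) h"
proof -
  have "braid_inv_op M N (lac N h n) m = lac X h (braid_inv_op M N n m)" if [simp]: "m \<in> carrier M" "n \<in> carrier N" for m n
  proof -
    let ?F = "\<lambda>a x y b. pt M N (lac M b (Fr M x)) (rac N (Fl N y) a)"
    have "braid_inv_op M N (lac N h n) m = LS M X m (\<lambda>a x. DS X h (\<lambda>h1 h2. RS N X n (\<lambda>y b. eps h1 \<odot>\<^bsub>X\<^esub> ?F a x y (h2 \<star> b))))"
      by (simp add: braid_inv_op_def RS_lac Fl_lac)
    also have "\<dots> = LS M X m (\<lambda>a x. RS N X n (\<lambda>y b. DS X h (\<lambda>h1 h2. eps h1 \<odot>\<^bsub>X\<^esub> ?F a x y (h2 \<star> b))))"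
      by (intro tsum_cong tsum_swap) simp_all
    also have "\<dots> = LS M X m (\<lambda>a x. RS N X n (\<lambda>y b. ?F a x y (h \<star> b)))"
      by (intro tsum_cong DS_counit_left) simp_all
    also have "\<dots> = lac X h (braid_inv_op M N n m)"
      by (simp add: braid_inv_op_def lac_mul)
    finally show ?thesis .
  qed
  then have "\<forall>t\<in>carrier Y. braid_inv M N (lac Y h t) = lac X h (braid_inv M N t)"
    by (intro tmod_ext[where W = X]) (simp_all add: braid_pt)
  then show "braid_inv M N (lac Y h t) = lac X h (braid_inv M N t)" using t by blast
  have "braid_inv_op M N n (rac M m h) = rac X (braid_inv_op M N n m) h" if [simp]: "m \<in> carrier M" "n \<in> carrier N" for m n
  proof -
    let ?F = "\<lambda>a x y b. pt M N (lac M b (Fr M x)) (rac N (Fl N y) a)"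
    have "braid_inv_op M N n (rac M m h) = LS M X m (\<lambda>a x. DS X h (\<lambda>h1 h2. RS N X n (\<lambda>y b. eps h2 \<odot>\<^bsub>X\<^esub> ?F (a \<star> h1) x y b)))"
      by (simp add: braid_inv_op_def LS_rac Fr_rac)
    also have "\<dots> = LS M X m (\<lambda>a x. RS N X n (\<lambda>y b. DS X h (\<lambda>h1 h2. eps h2 \<odot>\<^bsub>X\<^esub> ?F (a \<star> h1) x y b)))"
      by (intro tsum_cong tsum_swap) simp_all
    also have "\<dots> = LS M X m (\<lambda>a x. RS N X n (\<lambda>y b. ?F (a \<star> h) x y b))"
      by (intro tsum_cong DS_counit_right) simp_all
    also have "\<dots> = rac X (braid_inv_op M N n m) h"
      by (simp add: braid_inv_op_def rac_mul)
    finally show ?thesis .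
  qed
  then have "\<forall>t\<in>carrier Y. braid_inv M N (rac Y t h) = rac X (braid_inv M N t) h"
    by (intro tmod_ext[where W = X]) (simp_all add: braid_pt)
  then show "braid_inv M N (rac Y t h) = rac X (braid_inv M N t) h" using t by blast
qed

section \<open>The flip on coinvariants, invertibility and colinearity\<close>

lemma braid_coinvariant:
  assumes "m \<in> LC M" "n \<in> RC N"
  shows "braid_op M N m n = pt N M n m" "braid_inv_op M N n m = pt M N m n"
  using assms by (simp_all add: braid_op_def braid_inv_op_def LC_LS RC_RS E_coinvariant)

lemma braid_inverse:
  "t \<in> carrier X \<Longrightarrow> braid_inv M N (braid_fun M N t) = t"
  "t \<in> carrier Y \<Longrightarrow> braid_fun M N (braid_inv M N t) = t"
proof -
  note s = braid_bimodule braid_inv_bimodule braid_pt braid_coinvariant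
  have "\<forall>t\<in>carrier X. braid_inv M N (braid_fun M N t) = t"
    by (rule coinvariant_ext[where W = X]) (simp_all add: s del: lac_pt rac_pt)
  then show "t \<in> carrier X \<Longrightarrow> braid_inv M N (braid_fun M N t) = t" by blast
  have "\<forall>t\<in>carrier Y. braid_fun M N (braid_inv M N t) = t"
    \<comment> \<open>In N \<otimes> M the right coinvariants form the left factor, so the other
      generation statement is needed.\<close>
    by (rule coinvariant_ext'[where W = Y]) (simp_all add: s del: lac_pt rac_pt)
  then show "t \<in> carrier Y \<Longrightarrow> braid_fun M N (braid_inv M N t) = t" by blast
qed

text \<open>Colinearity needs the braiding at n_[0], which is not right coinvariant term by term.
  \<open>RC_LS_RS\<close> treats it as such under the sum, once for the right coaction in
  \<open>braid_op\<close> and once for the one inside \<open>Er\<close>.\<close>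

lemma LS_braid_op:
  assumes m: "m \<in> LC M" and n: "n \<in> RC N" and W [simp]: "md W" and \<phi>: "bil H Y W \<phi>"
  shows "LS N W n (\<lambda>b y. \<phi> b (braid_op M N m y)) = LS N W n (\<lambda>b y. \<phi> b (pt N M y m))"
proof -
  note [simp] = bil_left[OF \<phi>] bil_right[OF \<phi>] bilinear_closed[OF \<phi>] \<phi>[unfolded bilinear_iff] LC_closed[OF M m] RC_closed[OF N n]
  have push: "\<phi> b (tsum A B Y t \<psi>) = tsum A B W t (\<lambda>c d. \<phi> b (\<psi> c d))"
    if "b \<in> carrier H" "\<And>c d. c \<in> carrier A \<Longrightarrow> d \<in> carrier B \<Longrightarrow> \<psi> c d \<in> carrier Y" for b A B t \<psi>
    using that by (intro tsum_push[of "\<phi> b"]) simp_all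
  have "LS N W n (\<lambda>b y. \<phi> b (braid_op M N m y)) = LS N W n (\<lambda>b y. RS N W y (\<lambda>z c. \<phi> b (pt N M (Er N z) (rac M m c))))"
    using m by (simp add: braid_op_def LC_LS E_coinvariant push)
  also have "\<dots> = LS N W n (\<lambda>b z. \<phi> b (pt N M (Er N z) (rac M m unt)))"
    using n by (intro RC_LS_RS) simp_all
  also have "\<dots> = LS N W n (\<lambda>b z. RS N W z (\<lambda>w c. \<phi> b (pt N M (rac N w (S c)) m)))"
    by (simp add: Er_def push)
  also have "\<dots> = LS N W n (\<lambda>b w. \<phi> b (pt N M (rac N w (S unt)) m))"
    using n by (intro RC_LS_RS) simp_all
  finally show ?thesis by simp
qed

lemma RS_braid_op:
  assumes m: "m \<in> LC M" and n: "n \<in> RC N" and W [simp]: "md W" and \<phi>: "bil Y H W \<phi>"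
  shows "RS M W m (\<lambda>x a. \<phi> (braid_op M N x n) a) = RS M W m (\<lambda>x a. \<phi> (pt N M n x) a)"
proof -
  note [simp] = bil_left[OF \<phi>] bil_right[OF \<phi>] bilinear_closed[OF \<phi>] \<phi>[unfolded bilinear_iff] LC_closed[OF M m] RC_closed[OF N n]
  have push: "\<phi> (tsum A B Y t \<psi>) b = tsum A B W t (\<lambda>c d. \<phi> (\<psi> c d) b)"
    if "b \<in> carrier H" "\<And>c d. c \<in> carrier A \<Longrightarrow> d \<in> carrier B \<Longrightarrow> \<psi> c d \<in> carrier Y" for b A B t \<psi>
    using that by (intro tsum_push[of "\<lambda>y. \<phi> y b"]) simp_all
  have "RS M W m (\<lambda>x a. \<phi> (braid_op M N x n) a) = RS M W m (\<lambda>x a. LS M W x (\<lambda>c z. \<phi> (pt N M (lac N c n) (El M z)) a))"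
    using n by (simp add: braid_op_def RC_RS E_coinvariant push)
  also have "\<dots> = RS M W m (\<lambda>z a. \<phi> (pt N M (lac N unt n) (El M z)) a)"
    using m by (intro LC_RS_LS) simp_all
  also have "\<dots> = RS M W m (\<lambda>z a. LS M W z (\<lambda>c w. \<phi> (pt N M n (lac M (S c) w)) a))"
    by (simp add: El_def push)
  also have "\<dots> = RS M W m (\<lambda>w a. \<phi> (pt N M n (lac M (S unt) w)) a)"
    using m by (intro LC_RS_LS) simp_all
  finally show ?thesis by simp
qed

lemma morphism_braid: "morphism X Y (braid_fun M N)"
proof -
  note s = braid_bimodule braid_pt braid_coinvariant
  have 1: "\<forall>t\<in>carrier X. braid_fun M N (\<zeta>\<^bsub>X\<^esub> t) = \<zeta>\<^bsub>Y\<^esub> (braid_fun M N t)"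
    by (rule coinvariant_ext[where W = Y]) (simp_all add: s del: lac_pt rac_pt)
  have 2: "\<forall>t\<in>carrier X. lco Y (braid_fun M N t) = LS X (tensor K H Y) t (\<lambda>a x. tp H Y a (braid_fun M N x))"
  proof (rule coinvariant_ext[where W = "tensor K H Y"])
    let ?T = "tensor K H Y"
    fix h m n k assume [simp]: "h \<in> carrier H" "k \<in> carrier H" and mn [simp]: "m \<in> LC M" "n \<in> RC N"
    \<comment> \<open>As m is left coinvariant, only the left coaction of n contributes a nontrivial
      leg. The sums over h and k belong to the bilinear map to which \<open>LS_braid_op\<close> is
      applied.\<close>
    have "DS ?T h (\<lambda>h1 h2. LS N ?T n (\<lambda>b y. DS ?T k (\<lambda>k1 k2. tp H Y (h1 \<star> (b \<star> k1)) (lac Y h2 (rac Y (braid_op M N m y) k2))))) =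
      DS ?T h (\<lambda>h1 h2. LS N ?T n (\<lambda>b y. DS ?T k (\<lambda>k1 k2. tp H Y (h1 \<star> (b \<star> k1)) (lac Y h2 (rac Y (pt N M y m) k2)))))"
      by (intro tsum_cong LS_braid_op[where \<phi> = "\<lambda>b t. DS ?T k (\<lambda>k1 k2. tp H Y (_ \<star> (b \<star> k1)) (lac Y _ (rac Y t k2)))"]) simp_all
    then show "lco Y (braid_fun M N (lac X h (rac X (pt M N m n) k))) =
      LS X ?T (lac X h (rac X (pt M N m n) k)) (\<lambda>a x. tp H Y a (braid_fun M N x))"
      by (simp add: s lco_lac LS_lac LS_rac LS_pt LC_LS del: lac_pt rac_pt)
  qed simp_all
  have 3: "\<forall>t\<in>carrier X. rco Y (braid_fun M N t) = RS X (tensor K Y H) t (\<lambda>x a. tp Y H (braid_fun M N x) a)"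
  proof (rule coinvariant_ext[where W = "tensor K Y H"])
    let ?T = "tensor K Y H"
    fix h m n k assume [simp]: "h \<in> carrier H" "k \<in> carrier H" and mn [simp]: "m \<in> LC M" "n \<in> RC N"
    have "DS ?T h (\<lambda>h1 h2. RS M ?T m (\<lambda>x a. DS ?T k (\<lambda>k1 k2. tp Y H (lac Y h1 (rac Y (braid_op M N x n) k1)) (h2 \<star> (a \<star> k2))))) =
      DS ?T h (\<lambda>h1 h2. RS M ?T m (\<lambda>x a. DS ?T k (\<lambda>k1 k2. tp Y H (lac Y h1 (rac Y (pt N M n x) k1)) (h2 \<star> (a \<star> k2)))))"
      by (intro tsum_cong RS_braid_op[where \<phi> = "\<lambda>t a. DS ?T k (\<lambda>k1 k2. tp Y H (lac Y _ (rac Y t k1)) (_ \<star> (a \<star> k2)))"]) simp_all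
    then show "rco Y (braid_fun M N (lac X h (rac X (pt M N m n) k))) =
      RS X ?T (lac X h (rac X (pt M N m n) k)) (\<lambda>x a. tp Y H (braid_fun M N x) a)"
      by (simp add: s rco_lac RS_lac RS_rac RS_pt RC_RS del: lac_pt rac_pt)
  qed simp_all
  show ?thesis
    by (rule morphismI) (simp_all add: 1[rule_format] 2[rule_format] 3[rule_format] braid_bimodule)
qed

end

section \<open>Comparison with the twisted formulas\<close>

lemma tsum_tensorH: "tsum V W (tensorH K H M N) t \<phi> = tsum V W (M \<bullet> N) t \<phi>"
  by (simp add: tsum_def list_sum_def tensor_mod_module_fields)

context
  fixes M N assumes M [simp]: "obj M" and N [simp]: "obj N"
begin

text \<open>The exponents count twists. Relative to the untwisted maps a coaction puts \<zeta> on
  its module leg, and a coaction followed by a coproduct puts \<beta>^2 on the algebra legs. Of the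
  two nested actions, arguments of the inner one collect two more twists, the argument of the outer
  one only one. This makes 2 + 2 = 4 for \<open>a1\<close> and \<open>b2\<close>, 1 + 2 = 3 for
  \<open>n0\<close> and \<open>m0\<close>, and 2 + 1 = 3 for \<open>b1\<close> and
  \<open>a2\<close>, so everything cancels.\<close>

lemma braid_pure_eq:
  assumes [simp]: "m \<in> carrier M" "n \<in> carrier N"
  shows "braid_pure K H M N m n = braid_op M N m n"
proof -
  let ?W = "N \<bullet> M"
  let ?F = "\<lambda>a d x y c b. pt N M (rac N (lac N a y) (S c)) (lac M (S d) (rac M x b))"
  have "braid_pure K H M N m n = LS M ?W m (\<lambda>a x. DS ?W a (\<lambda>a d. RS N ?W n (\<lambda>y b. DS ?W b (\<lambda>c b. ?F a d x y c b))))"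
    by (simp add: braid_pure_def Let_def sweedler_tensorH lcoact_lco sweedler_lco rcoact_rco sweedler_rco sweedler_comult
      numeral_eq_Suc tsum_tensorH lact_lac ract_rac LS_zeta RS_zeta DS_twist)
  also have "\<dots> = LS M ?W m (\<lambda>a x. LS M ?W x (\<lambda>d x. RS N ?W n (\<lambda>y b. DS ?W b (\<lambda>c b. ?F a d x y c b))))"
    by (intro LS_coassoc) simp_all
  also have "\<dots> = LS M ?W m (\<lambda>a x. LS M ?W x (\<lambda>d x. RS N ?W n (\<lambda>y b. RS N ?W y (\<lambda>y c. ?F a d x y c b))))"
    by (intro tsum_cong RS_coassoc) simp_all
  also have "\<dots> = LS M ?W m (\<lambda>a x. RS N ?W n (\<lambda>y b. LS M ?W x (\<lambda>d x. RS N ?W y (\<lambda>y c. ?F a d x y c b))))"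
    by (intro tsum_cong tsum_swap) simp_all
  also have "\<dots> = braid_op M N m n"
    by (simp add: braid_op_def El_def Er_def lac_rac)
  finally show ?thesis .
qed

lemma braid_inv_pure_eq:
  assumes [simp]: "m \<in> carrier M" "n \<in> carrier N"
  shows "braid_inv_pure K H M N n m = braid_inv_op M N n m"
proof -
  let ?W = "M \<bullet> N"
  let ?F = "\<lambda>a d x y c b. pt M N (rac M (lac M b x) (Si d)) (lac N (Si c) (rac N y a))"
  have "braid_inv_pure K H M N n m = LS M ?W m (\<lambda>a x. DS ?W a (\<lambda>a d. RS N ?W n (\<lambda>y b. DS ?W b (\<lambda>c b. ?F a d x y c b))))"
    by (simp add: braid_inv_pure_def Let_def sweedler_tensorH lcoact_lco sweedler_lco rcoact_rco sweedler_rco sweedler_comult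
      numeral_eq_Suc tsum_tensorH lact_lac ract_rac LS_zeta RS_zeta DS_twist)
  also have "\<dots> = LS M ?W m (\<lambda>a x. LS M ?W x (\<lambda>d x. RS N ?W n (\<lambda>y b. DS ?W b (\<lambda>c b. ?F a d x y c b))))"
    by (intro LS_coassoc) simp_all
  also have "\<dots> = LS M ?W m (\<lambda>a x. LS M ?W x (\<lambda>d x. RS N ?W n (\<lambda>y b. RS N ?W y (\<lambda>y c. ?F a d x y c b))))"
    by (intro tsum_cong RS_coassoc) simp_all
  also have "\<dots> = LS M ?W m (\<lambda>a x. RS N ?W n (\<lambda>y b. LS M ?W x (\<lambda>d x. RS N ?W y (\<lambda>y c. ?F a d x y c b))))"
    by (intro tsum_cong tsum_swap) simp_all
  also have "\<dots> = LS M ?W m (\<lambda>a x. RS N ?W n (\<lambda>y b. RS N ?W y (\<lambda>y c. LS M ?W x (\<lambda>d x. ?F a d x y c b))))"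
    by (intro tsum_cong tsum_swap) simp_all
  also have "\<dots> = braid_inv_op M N n m"
    by (simp add: braid_inv_op_def Fl_def Fr_def lac_rac)
  finally show ?thesis .
qed

lemma braid_arr:
  "braid_hmap K H M N = arr (M \<bullet> N) (braid_fun M N) (N \<bullet> M)"
  "braid_inv_hmap K H M N = arr (N \<bullet> M) (braid_inv M N) (M \<bullet> N)"
  by (simp_all add: braid_hmap_def braid_inv_hmap_def arr_def braid_fun_def braid_inv_def tensor_mod_module_fields sweedler_tensorH
    sweedler_tmod[of M N] sweedler_tmod[of N M] braid_pure_eq braid_inv_pure_eq cong: restrict_cong)

end

section \<open>Equality of morphisms tested on coinvariants\<close>

lemma LC_ext:
  assumes [simp]: "obj M" and u: "u \<in> LIN M W" and v: "v \<in> LIN M W" and W [simp]: "md W" and x: "x \<in> carrier M"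
    and eq: "\<And>h e. h \<in> carrier H \<Longrightarrow> e \<in> LC M \<Longrightarrow> u (lac M h e) = v (lac M h e)"
  shows "u x = v x"
proof -
  have "u (LS M M x (\<lambda>a x. lac M a (El M x))) = v (LS M M x (\<lambda>a x. lac M a (El M x)))"
    by (simp add: tsum_push[OF u] tsum_push[OF v] eq El_LC)
  then show ?thesis by (simp only: El_sum[OF assms(1) x])
qed

lemma RC_ext:
  assumes [simp]: "obj M" and u: "u \<in> LIN M W" and v: "v \<in> LIN M W" and W [simp]: "md W" and x: "x \<in> carrier M"
    and eq: "\<And>h e. h \<in> carrier H \<Longrightarrow> e \<in> RC M \<Longrightarrow> u (rac M e h) = v (rac M e h)"
  shows "u x = v x"
proof -
  have "u (RS M M x (\<lambda>x a. rac M (Er M x) a)) = v (RS M M x (\<lambda>x a. rac M (Er M x) a))"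
    by (simp add: tsum_push[OF u] tsum_push[OF v] eq Er_RC)
  then show ?thesis by (simp only: Er_sum[OF assms(1) x])
qed

text \<open>Morphisms commute with both actions, so the outer elements h and k of
  \<open>coinvariant_ext\<close> drop out.\<close>

lemma morphism_coinvariant_ext:
  assumes [simp]: "obj A" "obj B" "obj W" and f: "morphism (A \<bullet> B) W f" and g: "morphism (A \<bullet> B) W g"
    and eq: "\<And>a b. a \<in> LC A \<Longrightarrow> b \<in> RC B \<Longrightarrow> f (pt A B a b) = g (pt A B a b)"
    and t: "t \<in> carrier (A \<bullet> B)"
  shows "f t = g t"
proof -
  have "\<forall>t\<in>carrier (A \<bullet> B). f t = g t"
    by (rule coinvariant_ext[where W = W])
      (simp_all add: morphism_linear[OF f] morphism_linear[OF g] morphism_lac[OF f] morphism_lac[OF g] morphism_rac[OF f] morphism_rac[OF g] eq del: lac_pt rac_pt)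
  then show ?thesis using t by blast
qed

text \<open>Writing a as h.a' takes h out to the left. Writing b as b'.c hands c on to the third
  factor, and writing c.d as d'.k takes k out to the right.\<close>

lemma morphism_coinvariant_ext3:
  assumes [simp]: "obj A" "obj B" "obj D" "obj W" and f: "morphism ((A \<bullet> B) \<bullet> D) W f" and g: "morphism ((A \<bullet> B) \<bullet> D) W g"
    and eq: "\<And>a b d. a \<in> LC A \<Longrightarrow> b \<in> RC B \<Longrightarrow> d \<in> RC D \<Longrightarrow> f (pt (A \<bullet> B) D (pt A B a b) d) = g (pt (A \<bullet> B) D (pt A B a b) d)"
    and t: "t \<in> carrier ((A \<bullet> B) \<bullet> D)"
  shows "f t = g t"
proof -
  let ?p = "\<lambda>a b d. pt (A \<bullet> B) D (pt A B a b) d" and ?L = "(A \<bullet> B) \<bullet> D"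
  note [simp] = lin_comp[OF morphism_linear[OF f]] lin_comp[OF morphism_linear[OF g]]
  have "f (?p a b d) = g (?p a b d)" if [simp]: "a \<in> carrier A" "b \<in> carrier B" "d \<in> carrier D" for a b d
  proof (rule LC_ext[where M = A and W = W and x = a and u = "\<lambda>a. f (?p a b d)" and v = "\<lambda>a. g (?p a b d)"])
    fix h a' assume [simp]: "h \<in> carrier H" and a' [simp]: "a' \<in> LC A"
    have "f (lac ?L h (?p a' b d)) = g (lac ?L h (?p a' b d))"
    proof (rule RC_ext[where M = B and W = W and x = b and u = "\<lambda>b. f (lac ?L h (?p a' b d))" and v = "\<lambda>b. g (lac ?L h (?p a' b d))"])
      fix c b' assume [simp]: "c \<in> carrier H" and b' [simp]: "b' \<in> RC B"
      \<comment> \<open>The element c released by b has moved to D, so it is c.d and not d that is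
        expanded in right coinvariants.\<close>
      have "f (lac ?L h (?p a' b' (lac D c d))) = g (lac ?L h (?p a' b' (lac D c d)))"
      proof (rule RC_ext[where M = D and W = W and x = "lac D c d" and u = "\<lambda>d. f (lac ?L h (?p a' b' d))" and v = "\<lambda>d. g (lac ?L h (?p a' b' d))"])
        fix k d' assume [simp]: "k \<in> carrier H" and d' [simp]: "d' \<in> RC D"
        have "f (lac ?L h (rac ?L (?p a' b' d') k)) = g (lac ?L h (rac ?L (?p a' b' d') k))"
          by (simp add: morphism_lac[OF f] morphism_lac[OF g] morphism_rac[OF f] morphism_rac[OF g] eq del: lac_pt rac_pt)
        then show "f (lac ?L h (?p a' b' (rac D d' k))) = g (lac ?L h (?p a' b' (rac D d' k)))" by simp
      qed simp_all
      moreover have "?p a' b' (lac D c d) = ?p a' (rac B b' c) d"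
        by (simp add: pt_balanced[of "A \<bullet> B" D, symmetric])
      ultimately show "f (lac ?L h (?p a' (rac B b' c) d)) = g (lac ?L h (?p a' (rac B b' c) d))"
        by simp
    qed simp_all
    then show "f (?p (lac A h a') b d) = g (?p (lac A h a') b d)" by simp
  qed simp_all
  then have "\<forall>t\<in>carrier ?L. f t = g t"
    by (intro tmod_ext3[where W = W]) (simp_all add: morphism_linear[OF f] morphism_linear[OF g])
  then show ?thesis using t by blast
qed

text \<open>Here the middle factor is left coinvariant and hands its algebra element to the left.
  The two versions fit the two hexagons: the first braids A with B \<otimes> D, which must be right
  coinvariant, the second braids A \<otimes> B, which must be left coinvariant, with D.\<close>

lemma morphism_coinvariant_ext3':
  assumes [simp]: "obj A" "obj B" "obj D" "obj W" and f: "morphism (A \<bullet> B \<bullet> D) W f" and g: "morphism (A \<bullet> B \<bullet> D) W g"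
    and eq: "\<And>a b d. a \<in> LC A \<Longrightarrow> b \<in> LC B \<Longrightarrow> d \<in> RC D \<Longrightarrow> f (pt A (B \<bullet> D) a (pt B D b d)) = g (pt A (B \<bullet> D) a (pt B D b d))"
    and t: "t \<in> carrier (A \<bullet> B \<bullet> D)"
  shows "f t = g t"
proof -
  let ?p = "\<lambda>a b d. pt A (B \<bullet> D) a (pt B D b d)" and ?L = "A \<bullet> B \<bullet> D"
  note [simp] = lin_comp[OF morphism_linear[OF f]] lin_comp[OF morphism_linear[OF g]]
  have "f (?p a b d) = g (?p a b d)" if [simp]: "a \<in> carrier A" "b \<in> carrier B" "d \<in> carrier D" for a b d
  proof (rule RC_ext[where M = D and W = W and x = d and u = "\<lambda>d. f (?p a b d)" and v = "\<lambda>d. g (?p a b d)"])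
    fix k d' assume [simp]: "k \<in> carrier H" and d' [simp]: "d' \<in> RC D"
    have "f (rac ?L (?p a b d') k) = g (rac ?L (?p a b d') k)"
    proof (rule LC_ext[where M = B and W = W and x = b and u = "\<lambda>b. f (rac ?L (?p a b d') k)" and v = "\<lambda>b. g (rac ?L (?p a b d') k)"])
      fix c b' assume [simp]: "c \<in> carrier H" and b' [simp]: "b' \<in> LC B"
      have "f (rac ?L (?p (rac A a c) b' d') k) = g (rac ?L (?p (rac A a c) b' d') k)"
      proof (rule LC_ext[where M = A and W = W and x = "rac A a c" and u = "\<lambda>a. f (rac ?L (?p a b' d') k)" and v = "\<lambda>a. g (rac ?L (?p a b' d') k)"])
        fix h a' assume [simp]: "h \<in> carrier H" and a' [simp]: "a' \<in> LC A"
        have "f (rac ?L (lac ?L h (?p a' b' d')) k) = g (rac ?L (lac ?L h (?p a' b' d')) k)"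
          by (simp add: morphism_lac[OF f] morphism_lac[OF g] morphism_rac[OF f] morphism_rac[OF g] eq del: lac_pt rac_pt)
        then show "f (rac ?L (?p (lac A h a') b' d') k) = g (rac ?L (?p (lac A h a') b' d') k)" by simp
      qed simp_all
      moreover have "?p (rac A a c) b' d' = ?p a (lac B c b') d'"
        by (simp add: pt_balanced[of A "B \<bullet> D"])
      ultimately show "f (rac ?L (?p a (lac B c b') d') k) = g (rac ?L (?p a (lac B c b') d') k)"
        by simp
    qed simp_all
    then show "f (?p a b (rac D d' k)) = g (?p a b (rac D d' k))" by simp
  qed simp_all
  then have "\<forall>t\<in>carrier ?L. f t = g t"
    by (intro tmod_ext3'[where W = W]) (simp_all add: morphism_linear[OF f] morphism_linear[OF g])
  then show ?thesis using t by blast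
qed


section \<open>The braided monoidal category\<close>

abbreviation "Cat \<equiv> four_angle_category K H"

lemma cat_fields [simp]:
  "Obj Cat = {M. obj M}" "Hom Cat = four_angle_hom K H" "Comp Cat = comp_hmap" "Id Cat = id_hmap"
  "Tensor Cat = tensor_mod K H" "Tensor_Hom Cat = tensor_hmap K H" "Unit Cat = U" "Assoc Cat = assoc_hmap K H"
  "LUnit Cat = lunit_hmap K H" "RUnit Cat = runit_hmap K H" "Braid Cat = braid_hmap K H"
  by (simp_all add: four_angle_category_def)

section \<open>Arrows and inverses\<close>

lemma hom_arr: "obj M \<Longrightarrow> obj N \<Longrightarrow> morphism M N f \<Longrightarrow> arr M f N \<in> four_angle_hom K H M N"
  by (auto simp: hom_eq_morphism)

lemma homE:
  assumes "F \<in> four_angle_hom K H M N" "obj M" "obj N"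
  obtains f where "F = arr M f N" "morphism M N f"
  using assms by (auto simp: hom_eq_morphism)

lemma inverse_arrows_arr:
  assumes [simp]: "obj M" "obj N" and f: "morphism M N f"
    and g: "\<And>n. n \<in> carrier N \<Longrightarrow> g n \<in> carrier M"
    and gf: "\<And>m. m \<in> carrier M \<Longrightarrow> g (f m) = m" and fg: "\<And>n. n \<in> carrier N \<Longrightarrow> f (g n) = n"
  shows "inverse_arrows Cat M N (arr M f N) (arr N g M)"
proof -
  have "morphism N M g" using morphism_inverse[OF f _ _ g gf fg] by simp
  then show ?thesis
    by (auto simp: inverse_arrows_def hom_arr f comp_arr g morphism_closed[OF f] id_arr gf fg intro!: arr_eqI)
qed

text \<open>A left inverse equals a right inverse. This identifies the unspecified inverses in the
  second hexagon with explicit functions.\<close>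

lemma inverse_arrows_unique:
  assumes [simp]: "obj M" "obj N" and f: "morphism M N f"
    and g: "\<And>n. n \<in> carrier N \<Longrightarrow> g n \<in> carrier M" and fg: "\<And>n. n \<in> carrier N \<Longrightarrow> f (g n) = n"
    and inv: "inverse_arrows Cat M N (arr M f N) p"
  shows "p = arr N g M"
proof -
  obtain q where p: "p = arr N q M" and q: "morphism N M q"
    using inv by (auto simp: inverse_arrows_def elim: homE)
  have "arr M (\<lambda>m. q (f m)) M = arr M (\<lambda>m. m) M"
    using inv by (simp add: inverse_arrows_def p comp_arr morphism_closed[OF f] id_arr)
  then have "fn (arr M (\<lambda>m. q (f m)) M) m = fn (arr M (\<lambda>m. m) M) m" for m by simp
  then have qf: "q (f m) = m" if "m \<in> carrier M" for m using that by (metis fn_arr)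
  show ?thesis unfolding p
    by (rule arr_eqI) (metis fg g qf)
qed

lemma comp_arr_morphism [simp]:
  assumes "morphism M N f" shows "comp_hmap (arr N g P) (arr M f N) = arr M (\<lambda>m. g (f m)) P"
  by (rule comp_arr) (rule morphism_closed[OF assms])

section \<open>The category and its monoidal structure\<close>

lemma category_four_angle: "category Cat"
proof
  fix A B D E f g h
  assume o: "A \<in> Obj Cat" "B \<in> Obj Cat" "D \<in> Obj Cat" "E \<in> Obj Cat"
    and F: "f \<in> Hom Cat A B" "g \<in> Hom Cat B D" "h \<in> Hom Cat D E"
  from o have [simp]: "obj A" "obj B" "obj D" "obj E" by simp_all
  obtain f' g' h' where f: "f = arr A f' B" "morphism A B f'" and g: "g = arr B g' D" "morphism B D g'" and h: "h = arr D h' E" "morphism D E h'"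
    using F by (auto elim!: homE)
  show "(h \<cdot>\<^bsub>Cat\<^esub> g) \<cdot>\<^bsub>Cat\<^esub> f = h \<cdot>\<^bsub>Cat\<^esub> (g \<cdot>\<^bsub>Cat\<^esub> f)"
    by (simp add: f g h morphism_comp[OF f(2) g(2)])
next
  fix A B D f g
  assume o: "A \<in> Obj Cat" "B \<in> Obj Cat" "D \<in> Obj Cat" and F: "f \<in> Hom Cat A B" "g \<in> Hom Cat B D"
  from o have [simp]: "obj A" "obj B" "obj D" by simp_all
  obtain f' g' where f: "f = arr A f' B" "morphism A B f'" and g: "g = arr B g' D" "morphism B D g'"
    using F by (auto elim!: homE)
  show "g \<cdot>\<^bsub>Cat\<^esub> f \<in> Hom Cat A D"
    by (simp add: f g hom_arr morphism_comp[OF f(2) g(2)])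
next
  fix A assume "A \<in> Obj Cat"
  then show "Id Cat A \<in> Hom Cat A A" by (simp add: id_arr hom_arr morphism_id)
next
  fix A B f assume o: "A \<in> Obj Cat" "B \<in> Obj Cat" and F: "f \<in> Hom Cat A B"
  from o have [simp]: "obj A" "obj B" by simp_all
  obtain f' where f: "f = arr A f' B" "morphism A B f'" using F by (auto elim!: homE)
  show "f \<cdot>\<^bsub>Cat\<^esub> Id Cat A = f" "Id Cat B \<cdot>\<^bsub>Cat\<^esub> f = f"
    by (simp_all add: f id_arr morphism_id)
qed

lemma hom_E:
  assumes "F \<in> Hom Cat M N" "M \<in> Obj Cat" "N \<in> Obj Cat"
  obtains f where "F = arr M f N" "morphism M N f"
  using assms by (auto elim: homE)

lemma tmod_ext4:
  assumes [simp]: "obj A" "obj B" "obj D" "obj E" and W: "md W"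
    and f: "f \<in> LIN (((A \<bullet> B) \<bullet> D) \<bullet> E) W" and g: "g \<in> LIN (((A \<bullet> B) \<bullet> D) \<bullet> E) W"
    and eq: "\<And>a b d e. a \<in> carrier A \<Longrightarrow> b \<in> carrier B \<Longrightarrow> d \<in> carrier D \<Longrightarrow> e \<in> carrier E \<Longrightarrow>
      f (pt ((A \<bullet> B) \<bullet> D) E (pt (A \<bullet> B) D (pt A B a b) d) e) = g (pt ((A \<bullet> B) \<bullet> D) E (pt (A \<bullet> B) D (pt A B a b) d) e)"
  shows "\<forall>t\<in>carrier (((A \<bullet> B) \<bullet> D) \<bullet> E). f t = g t"
proof (rule tmod_ext[OF _ _ f g W])
  fix s e assume s: "s \<in> carrier ((A \<bullet> B) \<bullet> D)" and e: "e \<in> carrier E"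
  have "\<forall>s\<in>carrier ((A \<bullet> B) \<bullet> D). f (pt ((A \<bullet> B) \<bullet> D) E s e) = g (pt ((A \<bullet> B) \<bullet> D) E s e)"
    by (rule tmod_ext3[where W = W]) (simp_all add: lin_comp[OF f] lin_comp[OF g] W e eq)
  then show "f (pt ((A \<bullet> B) \<bullet> D) E s e) = g (pt ((A \<bullet> B) \<bullet> D) E s e)" using s by blast
qed simp_all

text \<open>Naturality and coherence are equalities of linear maps with explicit values on iterated
  pure tensors, so they are compared there.\<close>

lemma monoidal_four_angle: "monoidal_category Cat"
proof (intro monoidal_category.intro monoidal_category_axioms.intro category_four_angle)
  fix A A' B B' f g
  assume o: "A \<in> Obj Cat" "A' \<in> Obj Cat" "B \<in> Obj Cat" "B' \<in> Obj Cat" and F: "f \<in> Hom Cat A A'" "g \<in> Hom Cat B B'"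
  from o have [simp]: "obj A" "obj A'" "obj B" "obj B'" by simp_all
  obtain f' g' where f: "f = arr A f' A'" "morphism A A' f'" and g: "g = arr B g' B'" "morphism B B' g'"
    using F o by (metis hom_E)
  show "Tensor_Hom Cat f g \<in> Hom Cat (Tensor Cat A B) (Tensor Cat A' B')"
    by (simp add: f g tensor_arr hom_arr morphism_tensor_fun)
next
  fix A B assume "A \<in> Obj Cat" "B \<in> Obj Cat"
  then have [simp]: "obj A" "obj B" by simp_all
  have "\<forall>t\<in>carrier (A \<bullet> B). tensor_fun A B A B (\<lambda>m. m) (\<lambda>m. m) t = t"
    by (rule tmod_ext[where W = "A \<bullet> B"]) (simp_all add: tensor_fun_linear tensor_fun_pt morphism_id)
  then show "Tensor_Hom Cat (Id Cat A) (Id Cat B) = Id Cat (Tensor Cat A B)"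
    by (auto simp: id_arr tensor_arr morphism_id intro!: arr_eqI)
next
  fix A A' A'' B B' B'' f f' g g'
  assume o: "A \<in> Obj Cat" "A' \<in> Obj Cat" "A'' \<in> Obj Cat" "B \<in> Obj Cat" "B' \<in> Obj Cat" "B'' \<in> Obj Cat"
    and F: "f \<in> Hom Cat A A'" "f' \<in> Hom Cat A' A''" "g \<in> Hom Cat B B'" "g' \<in> Hom Cat B' B''"
  from o have [simp]: "obj A" "obj A'" "obj A''" "obj B" "obj B'" "obj B''" by simp_all
  obtain u u' v v' where f: "f = arr A u A'" "morphism A A' u" and f': "f' = arr A' u' A''" "morphism A' A'' u'"
    and g: "g = arr B v B'" "morphism B B' v" and g': "g' = arr B' v' B''" "morphism B' B'' v'"
    using F o by (metis hom_E)
  note [simp] = f(2) f'(2) g(2) g'(2) morphism_comp[OF f(2) f'(2)] morphism_comp[OF g(2) g'(2)] morphism_tensor_fun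
    morphism_closed[OF f(2)] morphism_closed[OF g(2)]
  have "\<forall>t\<in>carrier (A \<bullet> B). tensor_fun A B A'' B'' (\<lambda>m. u' (u m)) (\<lambda>m. v' (v m)) t =
      tensor_fun A' B' A'' B'' u' v' (tensor_fun A B A' B' u v t)"
    by (rule tmod_ext[where W = "A'' \<bullet> B''"]) (simp_all add: tensor_fun_linear tensor_fun_pt lin_comp[OF tensor_fun_linear])
  then show "Tensor_Hom Cat (Comp Cat f' f) (Comp Cat g' g) = Comp Cat (Tensor_Hom Cat f' g') (Tensor_Hom Cat f g)"
    by (auto simp: f(1) g(1) f'(1) g'(1) tensor_arr intro!: arr_eqI)
next
  show "Unit Cat \<in> Obj Cat" by simp
next
  fix A B assume "A \<in> Obj Cat" "B \<in> Obj Cat"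
  then show "Tensor Cat A B \<in> Obj Cat" by simp
next
  fix A B D assume "A \<in> Obj Cat" "B \<in> Obj Cat" "D \<in> Obj Cat"
  then have [simp]: "obj A" "obj B" "obj D" by simp_all
  have "inverse_arrows Cat ((A \<bullet> B) \<bullet> D) (A \<bullet> B \<bullet> D) (assoc_hmap K H A B D) (arr (A \<bullet> B \<bullet> D) (assoc_inv A B D) ((A \<bullet> B) \<bullet> D))"
    unfolding assoc_arr[OF \<open>obj A\<close> \<open>obj B\<close> \<open>obj D\<close>]
    by (rule inverse_arrows_arr) (simp_all add: morphism_assoc assoc_inverse lin_maps_closed[OF assoc_linear(2)])
  then show "is_iso Cat (Tensor Cat (Tensor Cat A B) D) (Tensor Cat A (Tensor Cat B D)) (Assoc Cat A B D)"
    by (auto simp: is_iso_def)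
next
  fix A A' B B' D D' f g h
  assume o: "A \<in> Obj Cat" "A' \<in> Obj Cat" "B \<in> Obj Cat" "B' \<in> Obj Cat" "D \<in> Obj Cat" "D' \<in> Obj Cat"
    and F: "f \<in> Hom Cat A A'" "g \<in> Hom Cat B B'" "h \<in> Hom Cat D D'"
  from o have [simp]: "obj A" "obj A'" "obj B" "obj B'" "obj D" "obj D'" by simp_all
  obtain u v w where f: "f = arr A u A'" "morphism A A' u" and g: "g = arr B v B'" "morphism B B' v" and h: "h = arr D w D'" "morphism D D' w"
    using F o by (metis hom_E)
  note [simp] = f(2) g(2) h(2) morphism_tensor_fun morphism_assoc morphism_closed[OF f(2)] morphism_closed[OF g(2)] morphism_closed[OF h(2)]
    tensor_fun_linear tensor_fun_pt lin_comp[OF tensor_fun_linear] lin_comp[OF assoc_linear(1)] assoc_linear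
  have "\<forall>t\<in>carrier ((A \<bullet> B) \<bullet> D). assoc_fun A' B' D' (tensor_fun (A \<bullet> B) D (A' \<bullet> B') D' (tensor_fun A B A' B' u v) w t) =
      tensor_fun A (B \<bullet> D) A' (B' \<bullet> D') u (tensor_fun B D B' D' v w) (assoc_fun A B D t)"
    by (rule tmod_ext3[where W = "A' \<bullet> B' \<bullet> D'"]) simp_all
  then show "Comp Cat (Assoc Cat A' B' D') (Tensor_Hom Cat (Tensor_Hom Cat f g) h) =
      Comp Cat (Tensor_Hom Cat f (Tensor_Hom Cat g h)) (Assoc Cat A B D)"
    by (auto simp: f(1) g(1) h(1) tensor_arr assoc_arr intro!: arr_eqI)
next
  fix A assume "A \<in> Obj Cat"
  then have [simp]: "obj A" by simp
  have "inverse_arrows Cat (U \<bullet> A) A (lunit_hmap K H A) (arr A (pt U A unt) (U \<bullet> A))"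
    unfolding unit_arr[OF \<open>obj A\<close>]
    by (rule inverse_arrows_arr) (simp_all add: morphism_lunit unit_inverse)
  then show "is_iso Cat (Tensor Cat (Unit Cat) A) A (LUnit Cat A)"
    by (auto simp: is_iso_def)
  have "inverse_arrows Cat (A \<bullet> U) A (runit_hmap K H A) (arr A (\<lambda>a. pt A U a unt) (A \<bullet> U))"
    unfolding unit_arr[OF \<open>obj A\<close>]
    by (rule inverse_arrows_arr) (simp_all add: morphism_runit unit_inverse)
  then show "is_iso Cat (Tensor Cat A (Unit Cat)) A (RUnit Cat A)"
    by (auto simp: is_iso_def)
next
  fix A A' f assume o: "A \<in> Obj Cat" "A' \<in> Obj Cat" and F: "f \<in> Hom Cat A A'"
  from o have [simp]: "obj A" "obj A'" by simp_all
  obtain u where f: "f = arr A u A'" "morphism A A' u" using F o by (metis hom_E)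
  note [simp] = f(2) morphism_tensor_fun morphism_closed[OF f(2)] morphism_lunit morphism_runit morphism_id morphism_linear[OF f(2)] lin_comp[OF morphism_linear[OF f(2)]]
    tensor_fun_linear tensor_fun_pt lin_comp[OF unit_linear(1)] lin_comp[OF unit_linear(2)] unit_linear
  have "\<forall>t\<in>carrier (U \<bullet> A). lunit_fun A' (tensor_fun U A U A' (\<lambda>m. m) u t) = u (lunit_fun A t)"
    by (rule tmod_ext[where W = A']) (simp_all add: morphism_lac[OF f(2)])
  then show "Comp Cat (LUnit Cat A') (Tensor_Hom Cat (Id Cat (Unit Cat)) f) = Comp Cat f (LUnit Cat A)"
    by (auto simp: f(1) tensor_arr unit_arr id_arr intro!: arr_eqI)
  have "\<forall>t\<in>carrier (A \<bullet> U). runit_fun A' (tensor_fun A U A' U u (\<lambda>m. m) t) = u (runit_fun A t)"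
    by (rule tmod_ext[where W = A']) (simp_all add: morphism_rac[OF f(2)])
  then show "Comp Cat (RUnit Cat A') (Tensor_Hom Cat f (Id Cat (Unit Cat))) = Comp Cat f (RUnit Cat A)"
    by (auto simp: f(1) tensor_arr unit_arr id_arr intro!: arr_eqI)
next
  fix A B D E assume "A \<in> Obj Cat" "B \<in> Obj Cat" "D \<in> Obj Cat" "E \<in> Obj Cat"
  then have [simp]: "obj A" "obj B" "obj D" "obj E" by simp_all
  note [simp] = morphism_tensor_fun morphism_assoc morphism_id tensor_fun_linear tensor_fun_pt lin_comp[OF tensor_fun_linear]
    lin_comp[OF assoc_linear(1)] assoc_linear lin_maps_closed[OF assoc_linear(1)]
  \<comment> \<open>The rule \<open>comp_arr_morphism\<close> composes with an inner composite only
    once that is known to be a morphism.\<close>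
  have 1: "morphism (((A \<bullet> B) \<bullet> D) \<bullet> E) (A \<bullet> (B \<bullet> D) \<bullet> E)
     (\<lambda>t. assoc_fun A (B \<bullet> D) E (tensor_fun ((A \<bullet> B) \<bullet> D) E (A \<bullet> B \<bullet> D) E (assoc_fun A B D) (\<lambda>m. m) t))"
    by (rule morphism_comp[OF morphism_tensor_fun morphism_assoc]) simp_all
  have "\<forall>t\<in>carrier (((A \<bullet> B) \<bullet> D) \<bullet> E).
      tensor_fun A ((B \<bullet> D) \<bullet> E) A (B \<bullet> D \<bullet> E) (\<lambda>m. m) (assoc_fun B D E)
        (assoc_fun A (B \<bullet> D) E (tensor_fun ((A \<bullet> B) \<bullet> D) E (A \<bullet> B \<bullet> D) E (assoc_fun A B D) (\<lambda>m. m) t)) =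
      assoc_fun A B (D \<bullet> E) (assoc_fun (A \<bullet> B) D E t)"
    by (rule tmod_ext4[where W = "A \<bullet> B \<bullet> D \<bullet> E"]) simp_all
  then show "Comp Cat (Tensor_Hom Cat (Id Cat A) (Assoc Cat B D E))
      (Comp Cat (Assoc Cat A (Tensor Cat B D) E) (Tensor_Hom Cat (Assoc Cat A B D) (Id Cat E))) =
      Comp Cat (Assoc Cat A B (Tensor Cat D E)) (Assoc Cat (Tensor Cat A B) D E)"
    by (auto simp: tensor_arr assoc_arr id_arr 1 intro!: arr_eqI)
next
  fix A B assume "A \<in> Obj Cat" "B \<in> Obj Cat"
  then have [simp]: "obj A" "obj B" by simp_all
  note [simp] = morphism_tensor_fun morphism_assoc morphism_id tensor_fun_linear tensor_fun_pt lin_comp[OF tensor_fun_linear]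
    lin_comp[OF assoc_linear(1)] assoc_linear morphism_lunit morphism_runit
  \<comment> \<open>On pure tensors the triangle is the defining relation a.h \<otimes> b = a
    \<otimes> h.b.\<close>
  have "\<forall>t\<in>carrier ((A \<bullet> U) \<bullet> B). tensor_fun A (U \<bullet> B) A B (\<lambda>m. m) (lunit_fun B) (assoc_fun A U B t) =
      tensor_fun (A \<bullet> U) B A B (runit_fun A) (\<lambda>m. m) t"
    by (rule tmod_ext3[where W = "A \<bullet> B"]) (simp_all add: pt_balanced)
  then show "Comp Cat (Tensor_Hom Cat (Id Cat A) (LUnit Cat B)) (Assoc Cat A (Unit Cat) B) = Tensor_Hom Cat (RUnit Cat A) (Id Cat B)"
    by (auto simp: tensor_arr assoc_arr unit_arr id_arr intro!: arr_eqI)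
qed

section \<open>The braiding axioms\<close>

lemma inverse_arrows_braid:
  assumes [simp]: "obj M" "obj N"
  shows "inverse_arrows Cat (M \<bullet> N) (N \<bullet> M) (braid_hmap K H M N) (braid_inv_hmap K H M N)"
  unfolding braid_arr[OF assms]
  by (rule inverse_arrows_arr) (simp_all add: morphism_braid braid_inverse)

lemma inverse_assoc_unique:
  assumes [simp]: "obj A" "obj B" "obj D"
    and "inverse_arrows Cat ((A \<bullet> B) \<bullet> D) (A \<bullet> B \<bullet> D) (assoc_hmap K H A B D) p"
  shows "p = arr (A \<bullet> B \<bullet> D) (assoc_inv A B D) ((A \<bullet> B) \<bullet> D)"
  by (rule inverse_arrows_unique[OF _ _ morphism_assoc _ _ assms(4)[unfolded assoc_arr[OF assms(1-3)]]])
    (simp_all add: lin_maps_closed[OF assoc_linear(2)] assoc_inverse)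

lemma morphism_assoc_inv:
  assumes [simp]: "obj A" "obj B" "obj D"
  shows "morphism (A \<bullet> B \<bullet> D) ((A \<bullet> B) \<bullet> D) (assoc_inv A B D)"
  by (rule morphism_inverse[OF morphism_assoc]) (simp_all add: lin_maps_closed[OF assoc_linear(2)] assoc_inverse)

text \<open>Morphisms preserve coinvariants, and a tensor product of left (right) coinvariants is
  again left (right) coinvariant. So every braiding in the diagrams meets arguments on which it is
  the flip, and both sides permute the factors in the same way.\<close>

lemma braided_four_angle: "braided_monoidal_category Cat"
proof (intro braided_monoidal_category.intro braided_monoidal_category_axioms.intro monoidal_four_angle)
  fix A B assume "A \<in> Obj Cat" "B \<in> Obj Cat"
  then show "is_iso Cat (Tensor Cat A B) (Tensor Cat B A) (Braid Cat A B)"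
    using inverse_arrows_braid by (auto simp: is_iso_def)
next
  fix A A' B B' f g
  assume o: "A \<in> Obj Cat" "A' \<in> Obj Cat" "B \<in> Obj Cat" "B' \<in> Obj Cat" and F: "f \<in> Hom Cat A A'" "g \<in> Hom Cat B B'"
  from o have [simp]: "obj A" "obj A'" "obj B" "obj B'" by simp_all
  obtain u v where f: "f = arr A u A'" "morphism A A' u" and g: "g = arr B v B'" "morphism B B' v"
    using F o by (metis hom_E)
  note [simp] = f(2) g(2) morphism_closed[OF f(2)] morphism_closed[OF g(2)] tensor_fun_pt morphism_tensor_fun morphism_braid
    morphism_LC[OF f(2)] morphism_RC[OF g(2)] braid_pt braid_coinvariant
  have "braid_fun A' B' (tensor_fun A B A' B' u v t) = tensor_fun B A B' A' v u (braid_fun A B t)"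
    if "t \<in> carrier (A \<bullet> B)" for t
    by (rule morphism_coinvariant_ext[where W = "B' \<bullet> A'", OF _ _ _ morphism_comp[OF morphism_tensor_fun morphism_braid] morphism_comp[OF morphism_braid morphism_tensor_fun] _ that])
      simp_all
  then show "Comp Cat (Braid Cat A' B') (Tensor_Hom Cat f g) = Comp Cat (Tensor_Hom Cat g f) (Braid Cat A B)"
    by (auto simp: f(1) g(1) tensor_arr braid_arr intro!: arr_eqI)
next
  fix A B D assume "A \<in> Obj Cat" "B \<in> Obj Cat" "D \<in> Obj Cat"
  then have [simp]: "obj A" "obj B" "obj D" by simp_all
  note [simp] = tensor_fun_pt morphism_tensor_fun morphism_braid morphism_assoc morphism_id braid_pt braid_coinvariant pt_RC
  have 1: "morphism ((A \<bullet> B) \<bullet> D) ((B \<bullet> D) \<bullet> A) (\<lambda>t. braid_fun A (B \<bullet> D) (assoc_fun A B D t))"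
    by (rule morphism_comp[OF morphism_assoc morphism_braid]) simp_all
  have 2: "morphism ((A \<bullet> B) \<bullet> D) (B \<bullet> A \<bullet> D) (\<lambda>t. assoc_fun B A D (tensor_fun (A \<bullet> B) D (B \<bullet> A) D (braid_fun A B) (\<lambda>m. m) t))"
    by (rule morphism_comp[OF morphism_tensor_fun morphism_assoc]) simp_all
  have "assoc_fun B D A (braid_fun A (B \<bullet> D) (assoc_fun A B D t)) =
      tensor_fun B (A \<bullet> D) B (D \<bullet> A) (\<lambda>m. m) (braid_fun A D)
        (assoc_fun B A D (tensor_fun (A \<bullet> B) D (B \<bullet> A) D (braid_fun A B) (\<lambda>m. m) t))"
    if "t \<in> carrier ((A \<bullet> B) \<bullet> D)" for t
    by (rule morphism_coinvariant_ext3[where W = "B \<bullet> D \<bullet> A", OF _ _ _ _ morphism_comp[OF 1 morphism_assoc] morphism_comp[OF 2 morphism_tensor_fun] _ that])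
      simp_all
  then show "Comp Cat (Assoc Cat B D A) (Comp Cat (Braid Cat A (Tensor Cat B D)) (Assoc Cat A B D)) =
      Comp Cat (Tensor_Hom Cat (Id Cat B) (Braid Cat A D)) (Comp Cat (Assoc Cat B A D) (Tensor_Hom Cat (Braid Cat A B) (Id Cat D)))"
    by (auto simp: tensor_arr assoc_arr braid_arr id_arr 1 2 intro!: arr_eqI)
next
  fix A B D p q r assume "A \<in> Obj Cat" "B \<in> Obj Cat" "D \<in> Obj Cat"
    and inv: "inverse_arrows Cat (Tensor Cat (Tensor Cat A B) D) (Tensor Cat A (Tensor Cat B D)) (Assoc Cat A B D) p"
    "inverse_arrows Cat (Tensor Cat (Tensor Cat D A) B) (Tensor Cat D (Tensor Cat A B)) (Assoc Cat D A B) q"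
    "inverse_arrows Cat (Tensor Cat (Tensor Cat A D) B) (Tensor Cat A (Tensor Cat D B)) (Assoc Cat A D B) r"
  then have [simp]: "obj A" "obj B" "obj D" by simp_all
  have p: "p = arr (A \<bullet> B \<bullet> D) (assoc_inv A B D) ((A \<bullet> B) \<bullet> D)"
    and q: "q = arr (D \<bullet> A \<bullet> B) (assoc_inv D A B) ((D \<bullet> A) \<bullet> B)"
    and r: "r = arr (A \<bullet> D \<bullet> B) (assoc_inv A D B) ((A \<bullet> D) \<bullet> B)"
    using inv by (auto intro: inverse_assoc_unique)
  note [simp] = tensor_fun_pt morphism_tensor_fun morphism_braid morphism_assoc_inv morphism_id braid_pt braid_coinvariant pt_LC
  have 1: "morphism (A \<bullet> B \<bullet> D) (D \<bullet> A \<bullet> B) (\<lambda>t. braid_fun (A \<bullet> B) D (assoc_inv A B D t))"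
    by (rule morphism_comp[OF morphism_assoc_inv morphism_braid]) simp_all
  have 2: "morphism (A \<bullet> B \<bullet> D) ((A \<bullet> D) \<bullet> B) (\<lambda>t. assoc_inv A D B (tensor_fun A (B \<bullet> D) A (D \<bullet> B) (\<lambda>m. m) (braid_fun B D) t))"
    by (rule morphism_comp[OF morphism_tensor_fun morphism_assoc_inv]) simp_all
  have "assoc_inv D A B (braid_fun (A \<bullet> B) D (assoc_inv A B D t)) =
      tensor_fun (A \<bullet> D) B (D \<bullet> A) B (braid_fun A D) (\<lambda>m. m)
        (assoc_inv A D B (tensor_fun A (B \<bullet> D) A (D \<bullet> B) (\<lambda>m. m) (braid_fun B D) t))"
    if "t \<in> carrier (A \<bullet> B \<bullet> D)" for t
    by (rule morphism_coinvariant_ext3'[where W = "(D \<bullet> A) \<bullet> B", OF _ _ _ _ morphism_comp[OF 1 morphism_assoc_inv] morphism_comp[OF 2 morphism_tensor_fun] _ that])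
      simp_all
  then show "Comp Cat q (Comp Cat (Braid Cat (Tensor Cat A B) D) p) =
      Comp Cat (Tensor_Hom Cat (Braid Cat A D) (Id Cat B)) (Comp Cat r (Tensor_Hom Cat (Id Cat A) (Braid Cat B D)))"
    by (auto simp: p q r tensor_arr braid_arr id_arr 1 2 intro!: arr_eqI)
qed

lemma pure_tensor_structure: "structure_on_pure_tensors K H"
  unfolding structure_on_pure_tensors_def Let_def
proof (intro conjI allI impI)
  fix M N m n h
  assume [simp]: "obj M" "obj N" "m \<in> carrier M" "n \<in> carrier N" "h \<in> carrier H"
  show "\<zeta>\<^bsub>M \<bullet> N\<^esub> (pt M N m n) = pt M N (\<zeta>\<^bsub>M\<^esub> m) (\<zeta>\<^bsub>N\<^esub> n)" by simp
  show "h \<triangleright>\<^bsub>M \<bullet> N\<^esub> pt M N m n = pt M N (h \<triangleright>\<^bsub>M\<^esub> m) (\<zeta>\<^bsub>N\<^esub> n)" by (simp add: lact_pt lact_lac)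
  show "pt M N m n \<triangleleft>\<^bsub>M \<bullet> N\<^esub> h = pt M N (\<zeta>\<^bsub>M\<^esub> m) (n \<triangleleft>\<^bsub>N\<^esub> h)" by (simp add: ract_pt ract_rac)
  show "\<rho>\<^sup>l\<^bsub>M \<bullet> N\<^esub> (pt M N m n) = lcoact_tensor K H M N m n" by (simp add: lcoact_pt lcoact_tensor_eq)
  show "\<rho>\<^sup>r\<^bsub>M \<bullet> N\<^esub> (pt M N m n) = rcoact_tensor K H M N m n" by (simp add: rcoact_pt rcoact_tensor_eq)
next
  fix M M' N N' f g m n
  assume [simp]: "obj M" "obj M'" "obj N" "obj N'" and F: "f \<in> four_angle_hom K H M M'" "g \<in> four_angle_hom K H N N'"
    and [simp]: "m \<in> carrier M" "n \<in> carrier N"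
  obtain u v where f: "f = arr M u M'" "morphism M M' u" and g: "g = arr N v N'" "morphism N N' v"
    using F by (auto elim!: homE)
  show "fn (tensor_hmap K H f g) (pt M N m n) = pt M' N' (fn f m) (fn g n)"
    by (simp add: f g tensor_arr tensor_fun_pt)
next
  fix M N P m n p
  assume [simp]: "obj M" "obj N" "obj P" "m \<in> carrier M" "n \<in> carrier N" "p \<in> carrier P"
  show "fn (assoc_hmap K H M N P) (pt (M \<bullet> N) P (pt M N m n) p) = pt M (N \<bullet> P) m (pt N P n p)"
    by (simp add: assoc_arr)
next
  fix M m g
  assume [simp]: "obj M" "m \<in> carrier M" "g \<in> carrier H"
  show "fn (lunit_hmap K H M) (pt U M g m) = \<zeta>i M (g \<triangleright>\<^bsub>M\<^esub> m)" "fn (runit_hmap K H M) (pt M U m g) = \<zeta>i M (m \<triangleleft>\<^bsub>M\<^esub> g)"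
    by (simp_all add: unit_arr) (simp_all add: lac_def rac_def)
qed

end

theorem theorem4p7:
  fixes K :: "('k, 'c) ring_scheme" and H :: "('k, 'b elt) hom_hopf"
  assumes "field K"
    and "hom_hopf_algebra K H"
    and "bij_betw \<beta>\<^bsub>H\<^esub> (carrier H) (carrier H)"
    and "bij_betw \<S>\<^bsub>H\<^esub> (carrier H) (carrier H)"
  shows "braided_monoidal_category (four_angle_category K H) \<and>
    structure_on_pure_tensors K H \<and>
    (\<forall>M N. four_angle_hopf_module K H M \<longrightarrow> four_angle_hopf_module K H N \<longrightarrow>
       inverse_arrows (four_angle_category K H) (tensor_mod K H M N) (tensor_mod K H N M)
         (braid_hmap K H M N) (braid_inv_hmap K H M N) \<and>
       (\<forall>m\<in>carrier M. \<forall>n\<in>carrier N.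
          fn (braid_hmap K H M N) (m \<boxtimes>\<^bsub>tensorH K H M N\<^esub> n) = braid_pure K H M N m n \<and>
          fn (braid_inv_hmap K H M N) (n \<boxtimes>\<^bsub>tensorH K H N M\<^esub> m) = braid_inv_pure K H M N n m))"
proof -
  interpret bijective_hom_hopf K H
    using assms by (intro bijective_hom_hopf.intro bijective_hom_hopf_axioms.intro)
  show ?thesis
    by (intro conjI allI impI ballI braided_four_angle pure_tensor_structure inverse_arrows_braid)
      (simp_all add: braid_arr braid_pt braid_pure_eq braid_inv_pure_eq)
qed

end
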